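(* $\rho(3,6)=\frac{1}{2}\left(1-\frac{1}{r(3,3)}\right)=\frac{5}{12}$; equivalently $RT(n,3,6,o(n))=\frac{5}{12}n^2+o(n^2)$. Moreover, the weak stability property holds for $RT(n,3,6,o(n))$: if $(S_n)$ and $(Z_n)$ are two sequences of graphs such that, for each $n$, both $S_n$ and $Z_n$ have $n$ vertices and are $(K_3,K_6)$-free, $\alpha(S_n)=o(n)$, $\alpha(Z_n)=o(n)$, and $e(S_n)=\frac{5}{12}n^2+o(n^2)$, $e(Z_n)=\frac{5}{12}n^2+o(n^2)$, then $\Delta(S_n,Z_n)=o(n^2)$.
   Context: For integers $p,q\ge 2$, a graph $G$ is $(K_p,K_q)$-free if there is a colouring of the edges of $G$ with two colours (colour 1 and colour 2) containing no $K_p$ all of whose edges have colour 1 and no $K_q$ all of whose edges have colour 2. $\alpha(G)$ is the independence number and $e(G)$ the number of edges. $RT(n,p,q,m)$ is the maximum number of edges in an $n$-vertex $(K_p,K_q)$-free graph $G$ with $\alpha(G)<m$. For $0<\delta<1$, $\rho(p,q,\delta)=\lim_{n\to\infty}RT(n,p,q,\delta n)/n^2$ and $\rho(p,q)=\lim_{\delta\to 0}\rho(p,q,\delta)$ (the Ramsey–Turán density). $r(p,q)$ denotes the classical two-colour Ramsey number (so $r(3,3)=6$). For graphs $S,Z$ on the same number of vertices, $\Delta(S,Z)$ is the minimum number of edges one must delete from and add to $S$ to obtain a graph isomorphic to $Z$. *)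

theory Defs
  imports Complex_Main
begin

definition graph :: "nat \<Rightarrow> nat set set \<Rightarrow> bool" where
  "graph n E \<longleftrightarrow> E \<subseteq> {{a, b} | a b. a \<noteq> b \<and> a < n \<and> b < n}"

definition mono_clique :: "nat \<Rightarrow> nat set set \<Rightarrow> (nat set \<Rightarrow> bool) \<Rightarrow> bool \<Rightarrow> nat \<Rightarrow> nat set \<Rightarrow> bool" where
  "mono_clique n E c col p K \<longleftrightarrow> K \<subseteq> {..<n} \<and> card K = p \<and>
     (\<forall>x\<in>K. \<forall>y\<in>K. x \<noteq> y \<longrightarrow> {x, y} \<in> E \<and> c {x, y} = col)"

definition KK_free :: "nat \<Rightarrow> nat \<Rightarrow> nat \<Rightarrow> nat set set \<Rightarrow> bool" where
  "KK_free p q n E \<longleftrightarrow> (\<exists>c. (\<nexists>K. mono_clique n E c True p K) \<and> (\<nexists>K. mono_clique n E c False q K))"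

definition indep_num :: "nat \<Rightarrow> nat set set \<Rightarrow> nat" where
  "indep_num n E = Max {card I | I. I \<subseteq> {..<n} \<and> (\<forall>x\<in>I. \<forall>y\<in>I. x \<noteq> y \<longrightarrow> {x, y} \<notin> E)}"

text \<open>Maximum number of edges (0 if no admissible graph exists).\<close>
definition RT :: "nat \<Rightarrow> nat \<Rightarrow> nat \<Rightarrow> real \<Rightarrow> nat" where
  "RT n p q m = Sup {card E | E. graph n E \<and> KK_free p q n E \<and> real (indep_num n E) < m}"

definition edit_dist :: "nat \<Rightarrow> nat set set \<Rightarrow> nat set set \<Rightarrow> nat" where
  "edit_dist n S Z = Min {card ((S - (\<lambda>e. \<pi> ` e) ` Z) \<union> ((\<lambda>e. \<pi> ` e) ` Z - S)) | \<pi>.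
      bij_betw \<pi> {..<n} {..<n}}"

end

theory Submission
  imports Defs "HOL-Analysis.Analysis"
begin

text \<open>Let \<open>B\<close> be a maximal union of disjoint large vertex sets spanning no red edge, and \<open>A\<close> its
  complement. Red neighbourhoods span no red edge, so they meet \<open>A\<close> in few vertices, and after
  deleting \<open>o(n\<^sup>2)\<close> edges no red edge meets \<open>A\<close>; on the other hand every large subset of \<open>B\<close> spans
  a blue edge. In a regular partition refining \<open>{A, B}\<close> a cluster in \<open>B\<close> can supply
  two vertices of a blue clique. A Motzkin-Straus argument on the reduced coloured graph shows that
  its Lagrangian is at most \<open>0.8325 < 5/6\<close> unless it contains a core: one \<open>A\<close>-cluster joined in blue to
  five \<open>B\<close>-clusters which carry the red-blue pentagon colouring of \<open>K\<^sub>5\<close>.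

  A core of clusters embeds as 11 vertices: an apex \<open>q\<close> in \<open>A\<close> and five blue edges \<open>u\<^sub>i v\<^sub>i\<close> in \<open>B\<close>. Giving
  weight 2 to \<open>q\<close> and 1 to the other vertices, almost every vertex has weighted degree at most
  \<open>10 = 12 * 5/6\<close> into the core, and equality forces it to be attached to the core like \<open>q\<close> or like one
  of the five pairs. When all degrees are at least about \<open>5n/6\<close>, almost every vertex therefore lies
  in one of six parts, and each part spans \<open>o(n\<^sup>2)\<close> edges. Hence \<open>G\<close> is close to the balanced complete
  6-partite graph, which gives both the upper bound and stability. For the lower bound, sparse
  triangle-free graphs with small independence number are put into the six classes.\<close>

section \<open>Lagrangians\<close>

text \<open>The Lagrangian bound need not be sharp. Any threshold below 5/6 suffices, since a
  density just above it already produces a core, and the exact constant is recovered only from the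
  attachment count. This leaves room for crude case estimates: \<open>\<mu>\<close> below 0.1675
  stands for a Lagrangian above 0.8325, and the tightest case, twelve support clusters outside
  \<open>A\<close>, would break down near 0.1677. The split into \<open>A\<close> and
  \<open>B\<close> makes the two colours manageable: a cluster in \<open>B\<close> can be doubled in
  blue; a cluster in \<open>A\<close> cannot, but it has lost all its red edges. Doubling both ends
  of a pair needs density above one half, because two vertices must have common neighbours; hence
  the pair weights 1 and 1/2. The weight 2 of the apex balances the core. It has one vertex in one
  part of the extremal graph and two in each of the other five, so every part carries weight 2 of
  12, and a vertex of the extremal graph misses exactly the weight of its own part.\<close>

definition quad :: "'a set \<Rightarrow> ('a \<Rightarrow> 'a \<Rightarrow> real) \<Rightarrow> ('a \<Rightarrow> real) \<Rightarrow> real" where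
  "quad I w x = (\<Sum>i\<in>I. \<Sum>j\<in>I. w i j * x i * x j)"

definition lin :: "'a set \<Rightarrow> ('a \<Rightarrow> 'a \<Rightarrow> real) \<Rightarrow> ('a \<Rightarrow> real) \<Rightarrow> 'a \<Rightarrow> real" where
  "lin I w x i = (\<Sum>j\<in>I. w i j * x j)"

definition shift :: "('a \<Rightarrow> real) \<Rightarrow> 'a \<Rightarrow> 'a \<Rightarrow> real \<Rightarrow> 'a \<Rightarrow> real" where
  "shift x i j t = (\<lambda>l. x l + (if l = i then t else 0) - (if l = j then t else 0))"

lemma sum_shift:
  assumes "finite I" "i \<in> I" "j \<in> I"
  shows "sum (shift x i j t) I = sum x I"
  using assms by (simp add: shift_def sum.distrib sum_subtractf sum.delta)

lemma lin_shift:
  assumes "finite I" "i \<in> I" "j \<in> I"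
  shows "lin I w (shift x i j t) l = lin I w x l + t * w l i - t * w l j"
  using assms
  by (simp add: lin_def shift_def algebra_simps sum.distrib sum_subtractf if_distrib[where f="\<lambda>z. _ * z"] sum.delta
     cong: if_cong)

lemma quad_alt: "quad I w x = (\<Sum>i\<in>I. x i * lin I w x i)"
  by (simp add: quad_def lin_def sum_distrib_left mult.assoc mult.left_commute)

lemma quad_shift:
  assumes I: "finite I" "i \<in> I" "j \<in> I" and ij: "i \<noteq> j"
    and sym: "\<And>k l. w k l = w l k" and diag: "\<And>k. w k k = 0"
  shows "quad I w (shift x i j t) = quad I w x + 2 * t * (lin I w x i - lin I w x j) - 2 * t^2 * w i j"
proof -
  have *: "(\<Sum>k\<in>I. x k * w k l) = lin I w x l" for l
    unfolding lin_def by (rule sum.cong) (auto simp: sym[of _ l] mult.commute)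
  have "quad I w (shift x i j t) = (\<Sum>k\<in>I. shift x i j t k * (lin I w x k + t * w k i - t * w k j))"
    by (simp add: quad_alt lin_shift[OF I])
  also have "\<dots> = (\<Sum>k\<in>I. x k * (lin I w x k + t * w k i - t * w k j))
     + t * (lin I w x i + t * w i i - t * w i j) - t * (lin I w x j + t * w j i - t * w j j)"
    using I by (simp add: shift_def ring_distribs sum.distrib sum_subtractf
       if_distrib[where f="\<lambda>z. z * _"] sum.delta cong: if_cong)
  also have "(\<Sum>k\<in>I. x k * (lin I w x k + t * w k i - t * w k j)) =
      quad I w x + t * (\<Sum>k\<in>I. x k * w k i) - t * (\<Sum>k\<in>I. x k * w k j)"
    by (simp add: quad_alt ring_distribs sum.distrib sum_subtractf sum_distrib_left algebra_simps)
  finally show ?thesis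
    unfolding * using diag sym[of j i] by (simp add: algebra_simps power2_eq_square)
qed

text \<open>Symmetrisation: as long as the support contains a nonadjacent pair, all the weight of
  one end can be moved to the end with the larger \<open>lin\<close>; the form is affine along this
  shift, so it does not drop, and the support shrinks. On a clique the form is the square of the sum
  minus the sum of squares, and Cauchy-Schwarz with at most \<open>k\<close> terms finishes.\<close>

lemma motzkin_straus:
  assumes T: "finite T" and sym: "\<And>i j. G i j \<longleftrightarrow> G j i" and irr: "\<And>i. \<not> G i i"
    and nocl: "\<And>C. C \<subseteq> T \<Longrightarrow> (\<And>i j. i \<in> C \<Longrightarrow> j \<in> C \<Longrightarrow> i \<noteq> j \<Longrightarrow> G i j) \<Longrightarrow> card C \<le> k"
    and k: "k > 0"
    and nn: "\<And>i. i \<in> T \<Longrightarrow> x i \<ge> (0::real)"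
  shows "k * quad T (\<lambda>i j. of_bool (G i j)) x \<le> (real k - 1) * (sum x T)^2"
  using nn
proof (induction "card {i\<in>T. x i > 0}" arbitrary: x rule: less_induct)
  case less
  define w where "w = (\<lambda>i j. of_bool (G i j) :: real)"
  define S where "S = {i\<in>T. x i > 0}"
  have fS: "finite S" and ST: "S \<subseteq> T" using T by (auto simp: S_def)
  have zero: "x i = 0" if "i \<in> T - S" for i
    using that less.prems[of i] by (auto simp: S_def)
  have ws: "w a b = w b a" and wd: "w a a = 0" for a b using sym irr by (auto simp: w_def)
  show ?case
  proof (cases "\<forall>i\<in>S. \<forall>j\<in>S. i \<noteq> j \<longrightarrow> G i j")
    case True
    have cS: "card S \<le> k" by (rule nocl) (use True ST in auto)
    have sS: "sum x T = sum x S"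
      by (rule sum.mono_neutral_right) (use T ST zero in auto)
    have "quad T w x = (\<Sum>i\<in>S. \<Sum>j\<in>T. w i j * x i * x j)"
      unfolding quad_def by (rule sum.mono_neutral_right) (use T ST zero in auto)
    also have "\<dots> = (\<Sum>i\<in>S. \<Sum>j\<in>S. w i j * x i * x j)"
      by (rule sum.cong[OF refl], rule sum.mono_neutral_right) (use T ST zero in auto)
    also have "\<dots> = (\<Sum>i\<in>S. (\<Sum>j\<in>S. x i * x j) - x i * x i)"
    proof (rule sum.cong[OF refl])
      fix i assume i: "i \<in> S"
      have "(\<Sum>j\<in>S. w i j * x i * x j) = (\<Sum>j\<in>S. x i * x j - (if j = i then x i * x i else 0))"
        by (rule sum.cong[OF refl]) (use True i irr in \<open>auto simp: w_def\<close>)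
      also have "\<dots> = (\<Sum>j\<in>S. x i * x j) - x i * x i"
        using i fS by (simp add: sum_subtractf sum.delta)
      finally show "(\<Sum>j\<in>S. w i j * x i * x j) = (\<Sum>j\<in>S. x i * x j) - x i * x i" .
    qed
    also have "\<dots> = (sum x S)^2 - (\<Sum>i\<in>S. (x i)^2)"
      by (simp add: sum_subtractf power2_eq_square sum_product)
    finally have q: "quad T w x = (sum x S)^2 - (\<Sum>i\<in>S. (x i)^2)" .
    have "(sum x S)^2 \<le> card S * (\<Sum>i\<in>S. (x i)^2)"
      using Cauchy_Schwarz_ineq_sum[of "\<lambda>_. 1" x S] by simp
    also have "\<dots> \<le> k * (\<Sum>i\<in>S. (x i)^2)"
      by (rule mult_right_mono) (use cS in \<open>auto intro: sum_nonneg\<close>)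
    finally show ?thesis unfolding w_def[symmetric] q sS by (simp add: algebra_simps)
  next
    case False
    have "\<exists>i\<in>S. \<exists>j\<in>S. i \<noteq> j \<and> \<not> G i j \<and> lin T w x i \<ge> lin T w x j"
    proof -
      obtain i j where ij: "i \<in> S" "j \<in> S" "i \<noteq> j" "\<not> G i j" using False by blast
      show ?thesis
      proof (cases "lin T w x i \<ge> lin T w x j")
        case True
        then show ?thesis using ij by blast
      next
        case False
        then have "lin T w x j \<ge> lin T w x i" by simp
        moreover have "\<not> G j i" using ij sym[of i j] by simp
        ultimately show ?thesis using ij(1-3) by (intro bexI[of _ j] bexI[of _ i]) auto
      qed
    qed
    then obtain i j where ij: "i \<in> S" "j \<in> S" "i \<noteq> j" "\<not> G i j" "lin T w x i \<ge> lin T w x j" by auto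
    let ?y = "shift x i j (x j)"
    have iT: "i \<in> T" "j \<in> T" using ij ST by auto
    have ynn: "?y l \<ge> 0" if "l \<in> T" for l using less.prems[OF that] less.prems[OF iT(2)] ij(3)
      by (auto simp: shift_def)
    have sub: "{l\<in>T. ?y l > 0} \<subset> S"
    proof
      show "{l\<in>T. ?y l > 0} \<subseteq> S" using ij by (auto simp: shift_def S_def split: if_splits)
      show "{l\<in>T. ?y l > 0} \<noteq> S" using ij by (auto simp: shift_def)
    qed
    have "k * quad T w ?y \<le> (real k - 1) * (sum ?y T)^2"
      unfolding w_def
      by (rule less.hyps) (use psubset_card_mono[OF fS sub] ynn in \<open>auto simp: S_def\<close>)
    moreover have "quad T w ?y \<ge> quad T w x"
    proof -
      have "w i j = 0" using ij by (simp add: w_def)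
      moreover have "x j * (lin T w x i - lin T w x j) \<ge> 0"
        using ij less.prems[OF iT(2)] by simp
      ultimately show ?thesis by (simp add: quad_shift[OF T iT ij(3) ws wd])
    qed
    moreover have "sum ?y T = sum x T" by (rule sum_shift[OF T iT])
    ultimately show ?thesis unfolding w_def[symmetric]
      by (smt (verit) mult_left_mono of_nat_0_le_iff)
  qed
qed

text \<open>The weights are made to vanish off \<open>I\<close> so that, in the product topology on
  all functions, the simplex is a closed subset of a product of compact intervals and
  singletons.\<close>

lemma compact_simplex:
  assumes "finite I"
  shows "compact {x :: 'a \<Rightarrow> real. (\<forall>i\<in>I. 0 \<le> x i) \<and> (\<forall>i. i \<notin> I \<longrightarrow> x i = 0) \<and> sum x I = 1}"
proof -
  define K where "K = (\<Pi>\<^sub>E i\<in>UNIV. if i \<in> I then {0..1::real} else {0})"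
  have K: "compact K"
  proof -
    have "compactin (product_topology (\<lambda>i. euclidean) UNIV) K"
      unfolding K_def compactin_PiE by auto
    then show ?thesis by (simp add: euclidean_product_topology)
  qed
  have c: "closed {x :: 'a \<Rightarrow> real. sum x I = 1}"
    by (intro closed_Collect_eq continuous_intros) (auto intro: continuous_on_product_coordinates)
  have "{x :: 'a \<Rightarrow> real. (\<forall>i\<in>I. 0 \<le> x i) \<and> (\<forall>i. i \<notin> I \<longrightarrow> x i = 0) \<and> sum x I = 1} = K \<inter> {x. sum x I = 1}"
  proof -
    have "x i \<le> 1" if "\<forall>i\<in>I. 0 \<le> x i" "sum x I = 1" "i \<in> I" for x :: "'a \<Rightarrow> real" and i
      using member_le_sum[of i I x] that assms by auto
    then show ?thesis by (auto simp: K_def PiE_def Pi_def split: if_splits)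
  qed
  then show ?thesis using compact_Int_closed[OF K c] by simp
qed

text \<open>A maximiser with smallest support has no zero-weight pair in its support, since the form is
  affine along the corresponding shift.\<close>
lemma lagrangian_max:
  fixes w :: "'a \<Rightarrow> 'a \<Rightarrow> real"
  assumes I: "finite I" and sym: "\<And>k l. w k l = w l k" and diag: "\<And>k. w k k = 0"
    and x0: "\<And>i. i \<in> I \<Longrightarrow> 0 \<le> x0 i" "sum x0 I = 1"
  obtains S x where "S \<subseteq> I" "\<And>i. i \<in> S \<Longrightarrow> x i > 0" "sum x S = 1"
    "\<And>i j. i \<in> S \<Longrightarrow> j \<in> S \<Longrightarrow> i \<noteq> j \<Longrightarrow> w i j \<noteq> 0"
    "\<And>i. i \<in> S \<Longrightarrow> lin S w x i \<ge> quad I w x0"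
    "\<And>i j. i \<in> S \<Longrightarrow> j \<in> S \<Longrightarrow> lin S w x i = lin S w x j"
proof -
  define D where "D = {x :: 'a \<Rightarrow> real. (\<forall>i\<in>I. 0 \<le> x i) \<and> (\<forall>i. i \<notin> I \<longrightarrow> x i = 0) \<and> sum x I = 1}"
  have cD: "compact D" unfolding D_def by (rule compact_simplex[OF I])
  define x1 where "x1 = (\<lambda>i. if i \<in> I then x0 i else 0)"
  have x1: "x1 \<in> D" using x0 by (auto simp: D_def x1_def)
  have q1: "quad I w x1 = quad I w x0" by (auto simp: quad_def x1_def intro!: sum.cong)
  have "continuous_on D (quad I w)"
    unfolding quad_def by (intro continuous_intros continuous_on_product_then_coordinatewise[OF continuous_on_id])
  then obtain y0 where y0: "y0 \<in> D" "\<And>y. y \<in> D \<Longrightarrow> quad I w y \<le> quad I w y0"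
    using continuous_attains_sup[OF cD] x1 by blast
  define M where "M = {y\<in>D. \<forall>z\<in>D. quad I w z \<le> quad I w y}"
  have "y0 \<in> M" using y0 by (auto simp: M_def)
  then obtain x where x: "x \<in> M" "\<And>y. y \<in> M \<Longrightarrow> card {i\<in>I. x i > 0} \<le> card {i\<in>I. y i > 0}"
    using ex_has_least_nat[of "\<lambda>y. y \<in> M" y0 "\<lambda>y. card {i\<in>I. y i > 0}"] by blast
  define S where "S = {i\<in>I. x i > 0}"
  have SI: "S \<subseteq> I" and fS: "finite S" using I by (auto simp: S_def)
  have xD: "x \<in> D" and xmax: "\<And>z. z \<in> D \<Longrightarrow> quad I w z \<le> quad I w x" using x by (auto simp: M_def)
  have zero: "x i = 0" if "i \<notin> S" for i using that xD by (cases "i \<in> I") (auto simp: S_def D_def order.antisym not_less)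
  have linS: "lin S w x i = lin I w x i" for i
    unfolding lin_def by (rule sum.mono_neutral_left) (use I SI zero in auto)
  have shD: "shift x i j t \<in> D" if "i \<in> S" "j \<in> S" "i \<noteq> j" "- x i \<le> t" "t \<le> x j" for i j t
  proof -
    have "shift x i j t l \<ge> 0" for l using that xD
      by (cases "l \<in> I") (auto simp: shift_def D_def S_def)
    moreover have "sum (shift x i j t) I = 1" using sum_shift[OF I, of i j x t] that SI xD by (auto simp: D_def)
    moreover have "shift x i j t l = 0" if "l \<notin> I" for l using that \<open>i \<in> S\<close> \<open>j \<in> S\<close> SI xD by (auto simp: shift_def D_def)
    ultimately show ?thesis by (auto simp: D_def)
  qed
  have le: "lin I w x i \<le> lin I w x j" if "i \<in> S" "j \<in> S" "i \<noteq> j" for i j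
  proof (rule ccontr)
    assume n: "\<not> ?thesis"
    define d where "d = lin I w x i - lin I w x j"
    have d: "d > 0" using n by (simp add: d_def)
    define c where "c = \<bar>w i j\<bar> + 1"
    have c: "c > 0" "w i j < c" by (auto simp: c_def)
    \<comment> \<open>Small enough for the linear gain \<open>2 * t * d\<close> to beat the
      quadratic term, and at most \<open>x j\<close> so that no weight becomes negative.\<close>
    define t where "t = min (x j) (d / c)"
    have xj: "x j > 0" "x i > 0" using that by (auto simp: S_def)
    have t: "t > 0" "t \<le> x j" "t * c \<le> d" using d c xj by (auto simp: t_def min_def field_simps)
    have "quad I w (shift x i j t) \<le> quad I w x" by (rule xmax, rule shD) (use that t xj in auto)
    then have "2 * t * d - 2 * t^2 * w i j \<le> 0"
      using quad_shift[where w=w, OF I _ _ that(3) sym diag, of x t] that(1,2) subsetD[OF SI] by (simp add: d_def)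
    then have "2 * t * (d - t * w i j) \<le> 0" by (simp add: algebra_simps power2_eq_square)
    then have "d \<le> t * w i j" using t by (simp add: mult_le_0_iff)
    also have "\<dots> < t * c" using t c by simp
    finally show False using t by simp
  qed
  then have eq: "lin I w x i = lin I w x j" if "i \<in> S" "j \<in> S" for i j
    using that by (cases "i = j") (auto intro: order.antisym)
  have cl: "w i j \<noteq> 0" if "i \<in> S" "j \<in> S" "i \<noteq> j" for i j
  proof
    assume w0: "w i j = 0"
    let ?y = "shift x i j (x j)"
    have yD: "?y \<in> D" by (rule shD) (use that in \<open>auto simp: S_def\<close>)
    have "quad I w ?y = quad I w x"
      using quad_shift[where w=w, OF I _ _ that(3) sym diag, of x "x j"] that SI w0 eq[of i j] by auto
    then have "?y \<in> M" using yD xmax by (auto simp: M_def)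
    then have "card S \<le> card {i\<in>I. ?y i > 0}" using x(2) by (auto simp: S_def)
    moreover have "{l\<in>I. ?y l > 0} \<subset> S"
    proof
      show "{l\<in>I. ?y l > 0} \<subseteq> S" using that by (auto simp: shift_def S_def split: if_splits)
      show "{l\<in>I. ?y l > 0} \<noteq> S" using that by (auto simp: shift_def)
    qed
    ultimately show False using psubset_card_mono[OF fS, of "{l\<in>I. ?y l > 0}"] by linarith
  qed
  have sS: "sum x S = 1"
  proof -
    have "sum x S = sum x I" by (rule sum.mono_neutral_left) (use I SI zero in auto)
    then show ?thesis using xD by (auto simp: D_def)
  qed
  have ge: "lin I w x i \<ge> quad I w x0" if "i \<in> S" for i
  proof -
    have "quad I w x = (\<Sum>k\<in>S. x k * lin I w x k)"
      unfolding quad_alt by (rule sum.mono_neutral_right) (use I SI zero in auto)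
    also have "\<dots> = (\<Sum>k\<in>S. x k) * lin I w x i"
      unfolding sum_distrib_right by (rule sum.cong[OF refl]) (simp only: eq[OF _ that])
    finally show ?thesis using xmax[OF x1] q1 sS by simp
  qed
  show ?thesis
  proof (rule that[of S x])
    show "x i > 0" if "i \<in> S" for i using that by (simp add: S_def)
    show "lin S w x i \<ge> quad I w x0" if "i \<in> S" for i using ge[OF that] by (simp add: linS)
    show "lin S w x i = lin S w x j" if "i \<in> S" "j \<in> S" for i j using eq[OF that] by (simp only: linS)
    show "S \<subseteq> I" by (fact SI)
    show "sum x S = 1" by (fact sS)
    show "w i j \<noteq> 0" if "i \<in> S" "j \<in> S" "i \<noteq> j" for i j using that by (fact cl)
  qed
qed

section \<open>The reduced graph\<close>

lemma three_elements:
  assumes "card T \<ge> 3"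
  obtains a b c where "a \<in> T" "b \<in> T" "c \<in> T" "a \<noteq> b" "b \<noteq> c" "a \<noteq> c"
proof -
  obtain K where "K \<subseteq> T" "card K = 3" using assms by (meson obtain_subset_with_card_n)
  then show ?thesis using that by (auto simp: card_3_iff)
qed

lemma ramsey_3_3:
  assumes "card T \<ge> 6" and sym: "\<And>a b. P a b \<longleftrightarrow> P b a"
  obtains a b c where "a \<in> T" "b \<in> T" "c \<in> T" "a \<noteq> b" "b \<noteq> c" "a \<noteq> c"
    "(P a b \<and> P b c \<and> P a c) \<or> (\<not> P a b \<and> \<not> P b c \<and> \<not> P a c)"
proof -
  note goal = that
  have fin: "finite T" using assms by (metis card.infinite not_numeral_le_zero)
  obtain v where v: "v \<in> T" using assms by fastforce
  define N where "N = {u\<in>T - {v}. P v u}"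
  define M where "M = {u\<in>T - {v}. \<not> P v u}"
  have "card N + card M = card (T - {v})"
    unfolding N_def M_def using fin by (subst card_Un_disjoint[symmetric]) (auto intro!: arg_cong[where f=card])
  then have "card N \<ge> 3 \<or> card M \<ge> 3" using assms v fin by auto
  have key: thesis if abc: "a \<noteq> b" "b \<noteq> c" "a \<noteq> c" "a \<in> T - {v}" "b \<in> T - {v}" "c \<in> T - {v}"
    "P v a = Q" "P v b = Q" "P v c = Q" for a b c Q
  proof (cases "P a b \<noteq> Q \<and> P b c \<noteq> Q \<and> P a c \<noteq> Q")
    case True
    then show ?thesis using goal[of a b c] abc(1-6) by (cases Q) auto
  next
    case False
    then consider "P a b = Q" | "P b c = Q" | "P a c = Q" by auto
    then show ?thesis
    proof cases
      case 1 show ?thesis by (rule goal[of v a b]) (use 1 abc v in \<open>cases Q; auto\<close>)+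
    next
      case 2 show ?thesis by (rule goal[of v b c]) (use 2 abc v in \<open>cases Q; auto\<close>)+
    next
      case 3 show ?thesis by (rule goal[of v a c]) (use 3 abc v in \<open>cases Q; auto\<close>)+
    qed
  qed
  from \<open>card N \<ge> 3 \<or> card M \<ge> 3\<close> show ?thesis
  proof
    assume "card N \<ge> 3"
    then obtain a b c where "a \<in> N" "b \<in> N" "c \<in> N" "a \<noteq> b" "b \<noteq> c" "a \<noteq> c" by (rule three_elements)
    then show ?thesis by (intro key[of a b c True]) (auto simp: N_def)
  next
    assume "card M \<ge> 3"
    then obtain a b c where "a \<in> M" "b \<in> M" "c \<in> M" "a \<noteq> b" "b \<noteq> c" "a \<noteq> c" by (rule three_elements)
    then show ?thesis by (intro key[of a b c False]) (auto simp: M_def)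
  qed
qed

text \<open>Three neighbours of one colour at a vertex already force a monochromatic triangle, so
  \<open>a\<close> has two of each colour. The remaining pairs are then determined up to the names
  of \<open>c\<close> and \<open>d\<close>.\<close>

lemma two_coloured_K5_pentagon:
  assumes c: "card T = 5" and sym: "\<And>a b. P a b \<longleftrightarrow> P b a"
    and t1: "\<And>a b c. a \<in> T \<Longrightarrow> b \<in> T \<Longrightarrow> c \<in> T \<Longrightarrow> a \<noteq> b \<Longrightarrow> b \<noteq> c \<Longrightarrow> a \<noteq> c \<Longrightarrow> P a b \<Longrightarrow> P b c \<Longrightarrow> \<not> P a c"
    and t2: "\<And>a b c. a \<in> T \<Longrightarrow> b \<in> T \<Longrightarrow> c \<in> T \<Longrightarrow> a \<noteq> b \<Longrightarrow> b \<noteq> c \<Longrightarrow> a \<noteq> c \<Longrightarrow> \<not> P a b \<Longrightarrow> \<not> P b c \<Longrightarrow> P a c"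
  obtains a b c d e where "T = {a,b,c,d,e}" "distinct [a,b,c,d,e]"
    "P a b" "P b c" "P c d" "P d e" "P e a" "\<not> P a c" "\<not> P b d" "\<not> P c e" "\<not> P d a" "\<not> P e b"
proof -
  have fin: "finite T" using c by (metis card.infinite zero_neq_numeral)
  have symD: "P u v \<Longrightarrow> P v u" for u v using sym[of u v] by simp
  obtain a where a: "a \<in> T" using c by fastforce
  define N where "N = {u\<in>T - {a}. P a u}"
  define M where "M = {u\<in>T - {a}. \<not> P a u}"
  have s: "card N + card M = 4"
  proof -
    have "card N + card M = card (T - {a})"
      unfolding N_def M_def using fin by (subst card_Un_disjoint[symmetric]) (auto intro!: arg_cong[where f=card])
    then show ?thesis using c a fin by simp
  qed
  have "card N \<le> 2"
  proof (rule ccontr)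
    assume "\<not> card N \<le> 2"
    then have "card N \<ge> 3" by simp
    then obtain x y z where k: "x \<in> N" "y \<in> N" "z \<in> N" "x \<noteq> y" "y \<noteq> z" "x \<noteq> z" by (rule three_elements)
    then have "P a x" "P a y" "P a z" "x \<in> T" "y \<in> T" "z \<in> T" "a \<noteq> x" "a \<noteq> y" "a \<noteq> z" by (auto simp: N_def)
    then have "\<not> P x y" "\<not> P y z" "\<not> P x z"
      using t1[OF _ a, of x y] t1[OF _ a, of y z] t1[OF _ a, of x z] k symD by metis+
    then show False using t2[of x y z] k \<open>x \<in> T\<close> \<open>y \<in> T\<close> \<open>z \<in> T\<close> by simp
  qed
  moreover have "card M \<le> 2"
  proof (rule ccontr)
    assume "\<not> card M \<le> 2"
    then have "card M \<ge> 3" by simp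
    then obtain x y z where k: "x \<in> M" "y \<in> M" "z \<in> M" "x \<noteq> y" "y \<noteq> z" "x \<noteq> z" by (rule three_elements)
    then have "\<not> P a x" "\<not> P a y" "\<not> P a z" "x \<in> T" "y \<in> T" "z \<in> T" "a \<noteq> x" "a \<noteq> y" "a \<noteq> z" by (auto simp: M_def)
    then have "P x y" "P y z" "P x z"
      using t2[OF _ a, of x y] t2[OF _ a, of y z] t2[OF _ a, of x z] k symD by metis+
    then show False using t1[of x y z] k \<open>x \<in> T\<close> \<open>y \<in> T\<close> \<open>z \<in> T\<close> by simp
  qed
  ultimately have "card N = 2" "card M = 2" using s by auto
  then obtain b e c d where NM: "N = {b,e}" "b \<noteq> e" "M = {c,d}" "c \<noteq> d" by (meson card_2_iff)
  have T: "T = insert a (N \<union> M)" using a by (auto simp: N_def M_def)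
  have m: "b \<in> T" "c \<in> T" "d \<in> T" "e \<in> T" "P a b" "P a e" "\<not> P a c" "\<not> P a d"
    "a \<noteq> b" "a \<noteq> c" "a \<noteq> d" "a \<noteq> e"
    using NM unfolding N_def M_def by blast+
  have ne: "b \<noteq> c" "b \<noteq> d" "e \<noteq> c" "e \<noteq> d" using m by auto
  have be: "\<not> P b e" using t1[of b a e] m NM a symD by metis
  have cd: "P c d" using t2[of c a d] m NM a symD by metis
  have "P b c \<or> P b d"
  proof (rule ccontr)
    assume n: "\<not> ?thesis"
    then have "P e c" "P e d" using t2[of e b c] t2[of e b d] be m ne NM symD by metis+
    then show False using t1[of c e d] cd m ne NM symD by metis
  qed
  then obtain c' d' where cd': "P b c'" "{c',d'} = {c,d}" "c' \<noteq> d'" using NM by (metis insert_commute)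
  then have cd2: "P c' d'" "\<not> P a c'" "\<not> P a d'" "c' \<in> T" "d' \<in> T" "a \<noteq> c'" "a \<noteq> d'" "b \<noteq> c'" "b \<noteq> d'" "e \<noteq> c'" "e \<noteq> d'"
    using cd symD m ne by (auto simp: doubleton_eq_iff)
  have bd: "\<not> P b d'" using t1[of b c' d'] cd' cd2 m by metis
  have ed: "P e d'" using t2[of e b d'] bd be cd2 m NM symD by metis
  have ec: "\<not> P e c'" using t1[of e c' d'] ed cd2 m cd' by metis
  have T': "T = {a, b, c', d', e}" using T NM cd'(2) by auto
  have dist: "distinct [a, b, c', d', e]" using NM cd' cd2 m by auto
  have s1: "P d' e" "P e a" "\<not> P c' e" "\<not> P d' a" "\<not> P e b" using ed m cd2 ec be symD by blast+
  show ?thesis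
    using that[OF T' dist m(5) cd'(1) cd2(1) s1(1,2) cd2(2) bd s1(3,4,5)] .
qed

text \<open>In the application \<open>I\<close> are the clusters of a regular partition and \<open>A\<close> those on which no
  red edge is incident; every large subset of a cluster outside \<open>A\<close> spans a blue edge. \<open>R\<close> are the
  pairs of positive red density, \<open>F\<close> and \<open>H\<close> the remaining pairs of blue density above one half and
  of positive blue density, \<open>L\<close> the pairs of total density about one half or less. A cluster outside
  \<open>A\<close> may contribute two vertices to a blue clique if the clusters so doubled are joined by \<open>F\<close>.\<close>
locale reduced =
  fixes I A :: "'a set" and R F H L :: "'a \<Rightarrow> 'a \<Rightarrow> bool"
  assumes fin: "finite I"
    and symR: "R a b \<longleftrightarrow> R b a" and symF: "F a b \<longleftrightarrow> F b a" and symH: "H a b \<longleftrightarrow> H b a" and symL: "L a b \<longleftrightarrow> L b a"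
    and irrR: "\<not> R a a" and irrF: "\<not> F a a" and irrH: "\<not> H a a"
    and RF: "\<not> (R a b \<and> F a b)" and RH: "\<not> (R a b \<and> H a b)" and FH: "\<not> (F a b \<and> H a b)"
    and RA: "R a b \<Longrightarrow> a \<notin> A"
    and tri: "a \<in> I \<Longrightarrow> b \<in> I \<Longrightarrow> c \<in> I \<Longrightarrow> R a b \<Longrightarrow> R b c \<Longrightarrow> \<not> R a c"
    and blue_bound: "J \<subseteq> I \<Longrightarrow> D \<subseteq> J \<Longrightarrow> D \<inter> A = {} \<Longrightarrow> (\<And>i j. i \<in> J \<Longrightarrow> j \<in> J \<Longrightarrow> i \<noteq> j \<Longrightarrow> F i j \<or> H i j)
      \<Longrightarrow> (\<And>i j. i \<in> D \<Longrightarrow> j \<in> D \<Longrightarrow> i \<noteq> j \<Longrightarrow> F i j) \<Longrightarrow> card J + card D \<le> 5"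
begin

text \<open>\<open>full\<close> and \<open>half\<close> sort pairs by total density: a
  \<open>half\<close> pair has density at most about one half, either as a sparse red pair or as a
  blue pair whose two ends cannot both be doubled.\<close>

definition full :: "'a \<Rightarrow> 'a \<Rightarrow> bool" where
  "full i j \<longleftrightarrow> (R i j \<and> \<not> L i j) \<or> F i j"

definition half :: "'a \<Rightarrow> 'a \<Rightarrow> bool" where
  "half i j \<longleftrightarrow> (R i j \<and> L i j) \<or> H i j"

definition w :: "'a \<Rightarrow> 'a \<Rightarrow> real" where
  "w i j = (if full i j then 1 else if half i j then 1/2 else 0)"

lemma full_half: "\<not> (full i j \<and> half i j)"
  using RF[of i j] RH[of i j] FH[of i j] by (auto simp: full_def half_def)

lemma full_irr: "\<not> full i i" and half_irr: "\<not> half i i"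
  using irrR irrF irrH by (auto simp: full_def half_def)

lemma full_sym: "full i j \<longleftrightarrow> full j i" and half_sym: "half i j \<longleftrightarrow> half j i"
  using symR[of i j] symF[of i j] symH[of i j] symL[of i j] by (auto simp: full_def half_def)

text \<open>The red pairs have to be \<open>full\<close>: once blue density on them is excluded,
  this pushes the red density above one half, as needed to double both ends.\<close>

definition has_core :: bool where
  "has_core \<longleftrightarrow> (\<exists>q a b c d e. q \<in> I \<inter> A \<and> {a,b,c,d,e} \<subseteq> I - A \<and> distinct [a,b,c,d,e] \<and>
     (\<forall>p\<in>{a,b,c,d,e}. F q p) \<and>
     F a b \<and> F b c \<and> F c d \<and> F d e \<and> F e a \<and> R a c \<and> R b d \<and> R c e \<and> R d a \<and> R e b \<and>
     full a c \<and> full b d \<and> full c e \<and> full d a \<and> full e b)"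

text \<open>Doubling the three clusters would count 3 + 3 = 6 vertices of a blue clique.\<close>

lemma no_F_triangle:
  assumes "a \<in> I - A" "b \<in> I - A" "c \<in> I - A" "F a b" "F b c" shows "\<not> F a c"
proof
  assume ac: "F a c"
  have ne: "a \<noteq> b" "b \<noteq> c" "a \<noteq> c" using assms ac irrF by auto
  have "card {a,b,c} + card {a,b,c} \<le> 5"
    by (rule blue_bound) (use assms ac symF in auto)
  then show False using ne by simp
qed

lemma red_clique_card:
  assumes "T \<subseteq> I" "\<And>i j. i \<in> T \<Longrightarrow> j \<in> T \<Longrightarrow> i \<noteq> j \<Longrightarrow> R i j" shows "card T \<le> 2"
proof (rule ccontr)
  assume "\<not> ?thesis"
  then have "card T \<ge> 3" by simp
  then obtain x y z where "x \<in> T" "y \<in> T" "z \<in> T" "x \<noteq> y" "y \<noteq> z" "x \<noteq> z" by (rule three_elements)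
  then show False using tri[of x y z] assms by blast
qed

text \<open>Split by the number of clusters in \<open>A\<close>. None: Ramsey gives a red triangle
  or an \<open>F\<close> triangle. One: the other five carry the pentagon colouring, which is the
  core. Two or more: pairs meeting \<open>A\<close> are \<open>F\<close>, so an \<open>F\<close>
  pair outside \<open>A\<close> could be doubled next to two clusters of \<open>A\<close>; hence
  \<open>B\<close> is a red clique, has at most two clusters, and at least four clusters of
  \<open>A\<close> remain, too many for \<open>blue_bound\<close>.\<close>

lemma full_K6_core:
  assumes CI: "C \<subseteq> I" and C: "card C \<ge> 6" and cl: "\<And>i j. i \<in> C \<Longrightarrow> j \<in> C \<Longrightarrow> i \<noteq> j \<Longrightarrow> full i j"
  shows has_core
proof -
  obtain C' where C': "C' \<subseteq> C" "card C' = 6" using C by (meson obtain_subset_with_card_n)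
  have fC: "finite C'" using C' by (metis card.infinite zero_neq_numeral)
  have cl': "\<And>i j. i \<in> C' \<Longrightarrow> j \<in> C' \<Longrightarrow> i \<noteq> j \<Longrightarrow> R i j \<or> F i j" and CI': "C' \<subseteq> I"
    using cl C' CI by (auto simp: full_def)
  have clA: "F i j" if "i \<in> C'" "j \<in> C'" "i \<noteq> j" "i \<in> A \<or> j \<in> A" for i j
    using cl'[OF that(1,2,3)] that(4) RA symR by blast
  define B where "B = C' - A"
  have cAB: "card (C' \<inter> A) + card B = 6"
    unfolding B_def using fC C' by (subst card_Un_disjoint[symmetric]) (auto simp: Int_Diff_Un)
  consider "card (C' \<inter> A) = 0" | "card (C' \<inter> A) = 1" | "card (C' \<inter> A) \<ge> 2" by linarith
  then show ?thesis
  proof cases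
    case 1
    then have "C' \<inter> A = {}" using fC by simp
    obtain a b c where "a \<in> C'" "b \<in> C'" "c \<in> C'" "a \<noteq> b" "b \<noteq> c" "a \<noteq> c"
      "(R a b \<and> R b c \<and> R a c) \<or> (\<not> R a b \<and> \<not> R b c \<and> \<not> R a c)"
      using ramsey_3_3[of C' R] C' symR by auto
    then show ?thesis using no_F_triangle[of a b c] tri[of a b c] cl' CI' \<open>C' \<inter> A = {}\<close> by blast
  next
    case 2
    then obtain q where q: "C' \<inter> A = {q}" by (meson card_1_singletonE)
    have "card B = 5" using 2 cAB by simp
    then obtain a b c d e where p: "B = {a,b,c,d,e}" "distinct [a,b,c,d,e]"
      "F a b" "F b c" "F c d" "F d e" "F e a" "\<not> F a c" "\<not> F b d" "\<not> F c e" "\<not> F d a" "\<not> F e b"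
    proof (rule two_coloured_K5_pentagon[of B F])
      show "\<not> F a c" if "a \<in> B" "b \<in> B" "c \<in> B" "F a b" "F b c" for a b c
        using no_F_triangle[of a b c] that CI' by (auto simp: B_def)
      show "F a c" if "a \<in> B" "b \<in> B" "c \<in> B" "a \<noteq> b" "b \<noteq> c" "a \<noteq> c" "\<not> F a b" "\<not> F b c" for a b c
        using tri[of a b c] cl'[of a b] cl'[of b c] cl'[of a c] that CI' by (auto simp: B_def)
    qed (use symF in auto)
    have BI: "B \<subseteq> I - A" "B \<subseteq> C'" using CI' by (auto simp: B_def)
    have "R a c" "R b d" "R c e" "R d a" "R e b"
      using p BI cl'[of a c] cl'[of b d] cl'[of c e] cl'[of d a] cl'[of e b] by auto
    moreover have "full a c" "full b d" "full c e" "full d a" "full e b"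
      using p BI C'(1) cl[of a c] cl[of b d] cl[of c e] cl[of d a] cl[of e b] by auto
    moreover have "\<forall>p\<in>{a,b,c,d,e}. F q p"
    proof
      fix x assume "x \<in> {a,b,c,d,e}"
      then have "x \<in> B" using p by simp
      then show "F q x" using clA[of q x] q by (auto simp: B_def)
    qed
    moreover have "q \<in> I \<inter> A" using q CI' by auto
    ultimately have "q \<in> I \<inter> A \<and> {a,b,c,d,e} \<subseteq> I - A \<and> distinct [a,b,c,d,e] \<and>
     (\<forall>p\<in>{a,b,c,d,e}. F q p) \<and>
     F a b \<and> F b c \<and> F c d \<and> F d e \<and> F e a \<and> R a c \<and> R b d \<and> R c e \<and> R d a \<and> R e b \<and>
     full a c \<and> full b d \<and> full c e \<and> full d a \<and> full e b"
      using p BI by simp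
    then show ?thesis unfolding has_core_def by (intro exI)
  next
    case 3
    then obtain K where "K \<subseteq> C' \<inter> A" "card K = 2" by (meson obtain_subset_with_card_n)
    then obtain a1 a2 where a: "a1 \<in> C' \<inter> A" "a2 \<in> C' \<inter> A" "a1 \<noteq> a2" by (auto simp: card_2_iff)
    have "R b c" if "b \<in> B" "c \<in> B" "b \<noteq> c" for b c
    proof (rule ccontr)
      assume "\<not> R b c"
      then have Fbc: "F b c" using cl' that by (auto simp: B_def)
      have "card {a1,a2,b,c} + card {b,c} \<le> 5"
      proof (rule blue_bound)
        show "{a1,a2,b,c} \<subseteq> I" using a that CI' by (auto simp: B_def)
        show "F i j \<or> H i j" if "i \<in> {a1,a2,b,c}" "j \<in> {a1,a2,b,c}" "i \<noteq> j" for i j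
        proof (cases "i \<in> A \<or> j \<in> A")
          case True
          then show ?thesis using clA[of i j] that a \<open>b \<in> B\<close> \<open>c \<in> B\<close> by (auto simp: B_def)
        next
          case False
          then show ?thesis using Fbc symF[of b c] that a by auto
        qed
        show "F i j" if "i \<in> {b,c}" "j \<in> {b,c}" "i \<noteq> j" for i j using Fbc symF[of b c] that by auto
      qed (use that in \<open>auto simp: B_def\<close>)
      moreover have "a1 \<noteq> b" "a1 \<noteq> c" "a2 \<noteq> b" "a2 \<noteq> c" using a that by (auto simp: B_def)
      ultimately show False using a that by simp
    qed
    then have "card B \<le> 2" by (intro red_clique_card) (use CI' B_def in auto)
    then have A4: "card (C' \<inter> A) \<ge> 4" using cAB by simp
    show ?thesis
    proof (cases "B = {}")
      case True
      have "card (C' \<inter> A) + card ({}::'a set) \<le> 5" by (rule blue_bound) (use clA CI' in auto)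
      then show ?thesis using True cAB by simp
    next
      case False
      then obtain b where b: "b \<in> B" by blast
      have "card (insert b (C' \<inter> A)) + card {b} \<le> 5"
        by (rule blue_bound) (use clA CI' b B_def in auto)
      then show ?thesis using A4 b fC by (simp add: B_def)
    qed
  qed
qed

end

text \<open>\<open>S\<close> is the support of a Lagrangian maximiser. The condition
  \<open>kkt\<close> is stationarity read as a deficit: 1 minus the linear form at \<open>i\<close>
  is the weight of \<open>i\<close> itself plus half the weight of its half neighbours, and it is
  the same \<open>\<mu>\<close> everywhere. The bound 0.1675 is 1 - 0.8325.\<close>

locale reduced_opt = reduced +
  fixes S :: "'a set" and x :: "'a \<Rightarrow> real" and \<mu> :: real
  assumes SI: "S \<subseteq> I" and xpos: "i \<in> S \<Longrightarrow> x i > 0" and xsum: "sum x S = 1"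
    and clS: "i \<in> S \<Longrightarrow> j \<in> S \<Longrightarrow> i \<noteq> j \<Longrightarrow> R i j \<or> F i j \<or> H i j"
    and kkt: "i \<in> S \<Longrightarrow> x i + (\<Sum>j\<in>{j\<in>S. half i j}. x j) / 2 = \<mu>"
    and mu: "\<mu> < 0.1675"
begin

lemma finS: "finite S" using SI fin finite_subset by blast

lemma xnn: "i \<in> S \<Longrightarrow> 0 \<le> x i" using xpos[of i] by simp

lemma inI: "i \<in> S \<Longrightarrow> i \<in> I" using SI by blast

lemma bl: "i \<in> S \<Longrightarrow> j \<in> S \<Longrightarrow> i \<noteq> j \<Longrightarrow> \<not> R i j \<Longrightarrow> F i j \<or> H i j" using clS by blast

lemma xle: assumes "i \<in> S" shows "x i \<le> \<mu>"
proof -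
  have "(\<Sum>j\<in>{j\<in>S. half i j}. x j) \<ge> 0" by (rule sum_nonneg) (use xpos in \<open>auto intro: less_imp_le\<close>)
  then show ?thesis using kkt[OF assms] by simp
qed

lemma mupos: "\<mu> > 0"
proof -
  have "S \<noteq> {}" using xsum by auto
  then obtain i where "i \<in> S" by blast
  then show ?thesis using xle[of i] xpos[of i] by linarith
qed

lemma sum_le_card: assumes "T \<subseteq> S" shows "sum x T \<le> card T * \<mu>"
  using sum_bounded_above[of T x \<mu>] xle assms by (simp add: subset_iff)

section \<open>Weights of neighbourhoods and cliques in the support\<close>

definition Rn where "Rn v = {j\<in>S. R v j}"
definition Fn where "Fn v = {j\<in>S. F v j}"
definition Hn where "Hn v = {j\<in>S. half v j}"

lemma nbr_sub: "Rn v \<subseteq> S" "Fn v \<subseteq> S" "Hn v \<subseteq> S" by (auto simp: Rn_def Fn_def Hn_def)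

lemma nbr_fin: "finite (Rn v)" "finite (Fn v)" "finite (Hn v)" by (simp_all add: Rn_def Fn_def Hn_def finS)

text \<open>By \<open>kkt\<close> the half neighbours of \<open>v\<close> weigh
  \<open>2 * (\<mu> - x v)\<close>, and all other clusters are red or \<open>F\<close> neighbours.
  Only an inequality results, because a sparse red pair is counted in both \<open>Rn\<close> and
  \<open>Hn\<close>.\<close>

lemma RF_sum: assumes "v \<in> S" shows "sum x (Rn v) + sum x (Fn v) \<ge> 1 - 2 * \<mu> + x v"
proof -
  have union: "sum x (P \<union> Q) \<le> sum x P + sum x Q" if "P \<subseteq> S" "Q \<subseteq> S" for P Q
  proof -
    have "sum x (P \<union> Q) + sum x (P \<inter> Q) = sum x P + sum x Q"
      using that finS by (intro sum.union_inter) (auto intro: finite_subset)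
    moreover have "sum x (P \<inter> Q) \<ge> 0" by (rule sum_nonneg) (use that xnn in auto)
    ultimately show ?thesis by simp
  qed
  have "S \<subseteq> insert v (Rn v \<union> (Fn v \<union> Hn v))" using assms clS by (auto simp: Rn_def Fn_def Hn_def half_def)
  then have "S = {v} \<union> (Rn v \<union> (Fn v \<union> Hn v))" using nbr_sub[of v] assms by auto
  then have "sum x S = sum x ({v} \<union> (Rn v \<union> (Fn v \<union> Hn v)))" by simp
  also have "\<dots> \<le> sum x {v} + sum x (Rn v \<union> (Fn v \<union> Hn v))"
    by (rule union) (use nbr_sub[of v] assms in auto)
  also have "sum x (Rn v \<union> (Fn v \<union> Hn v)) \<le> sum x (Rn v) + sum x (Fn v \<union> Hn v)"
    by (rule union) (use nbr_sub[of v] in auto)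
  also have "sum x (Fn v \<union> Hn v) \<le> sum x (Fn v) + sum x (Hn v)"
    by (rule union) (use nbr_sub[of v] in auto)
  finally show ?thesis using kkt[OF assms] xsum by (simp add: Hn_def)
qed

text \<open>In an \<open>H\<close> clique all other members are half neighbours of each member, so
  \<open>kkt\<close> bounds the weight of \<open>i\<close> plus that of the whole clique by
  \<open>2 * \<mu>\<close>; sum this over the clique.\<close>

lemma H_clique_sum:
  assumes TS: "T \<subseteq> S" and cl: "\<And>i j. i \<in> T \<Longrightarrow> j \<in> T \<Longrightarrow> i \<noteq> j \<Longrightarrow> H i j"
  shows "(real (card T) + 1) * sum x T \<le> 2 * real (card T) * \<mu>"
proof -
  have fT: "finite T" using TS finS finite_subset by blast
  have "x i + sum x T \<le> 2 * \<mu>" if i: "i \<in> T" for i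
  proof -
    have "sum x (T - {i}) \<le> sum x (Hn i)"
      by (rule sum_mono2) (use nbr_fin TS cl i xnn nbr_sub(3)[of i] in \<open>auto simp: Hn_def half_def\<close>)
    moreover have "sum x T = x i + sum x (T - {i})" using i fT by (simp add: sum.remove)
    ultimately show ?thesis using kkt[of i] i TS by (auto simp: Hn_def)
  qed
  then have "(\<Sum>i\<in>T. x i + sum x T) \<le> (\<Sum>i\<in>T. 2 * \<mu>)" by (rule sum_mono)
  then show ?thesis by (simp add: sum.distrib algebra_simps)
qed

text \<open>Averaging \<open>kkt\<close> over \<open>T\<close> with weights \<open>x\<close> gives
  \<open>s2 + X * X - q \<le> 2 * X * \<mu>\<close>, where \<open>q\<close> is the form of the full
  pairs. Motzkin-Straus bounds \<open>q\<close> from above and Cauchy-Schwarz bounds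
  \<open>s2\<close> from below. For \<open>T = S\<close> this turns bounds on full cliques and on
  the support size into a lower bound for \<open>\<mu>\<close>.\<close>

lemma full_clique_sum:
  assumes TS: "T \<subseteq> S" and k: "k > 0"
    and nocl: "\<And>C. C \<subseteq> T \<Longrightarrow> (\<And>i j. i \<in> C \<Longrightarrow> j \<in> C \<Longrightarrow> i \<noteq> j \<Longrightarrow> full i j) \<Longrightarrow> card C \<le> k"
  shows "sum x T * (real k + real (card T)) \<le> 2 * real k * real (card T) * \<mu>"
proof (cases "T = {}")
  case False
  have fT: "finite T" using TS finS finite_subset by blast
  define X where "X = sum x T"
  have Xpos: "X > 0" unfolding X_def using False fT TS xpos by (intro sum_pos) auto
  define G where "G = (\<lambda>i j. full i j)"
  define q where "q = quad T (\<lambda>i j. of_bool (G i j)) x"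
  define s2 where "s2 = (\<Sum>i\<in>T. (x i)^2)"
  have ms: "k * q \<le> (real k - 1) * X^2"
    unfolding q_def X_def
  proof (rule motzkin_straus)
    show "0 \<le> x i" if "i \<in> T" for i using xpos[of i] that TS by auto
    show "G i j = G j i" for i j using full_sym[of i j] by (simp add: G_def)
  qed (use fT nocl k full_irr in \<open>auto simp: G_def\<close>)
  have cs: "X^2 \<le> card T * s2"
    unfolding X_def s2_def using Cauchy_Schwarz_ineq_sum[of "\<lambda>_. 1" x T] by simp
  have tp: "card T > 0" using False fT by (simp add: card_gt_0_iff)
  have split: "X = (\<Sum>j\<in>T. of_bool (G i j) * x j) + x i + sum x (Hn i \<inter> T)" if i: "i \<in> T" for i
  proof -
    have "X = (\<Sum>j\<in>T. of_bool (G i j) * x j + (if j = i then x i else 0) + (if j \<in> Hn i then x j else 0))"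
      unfolding X_def
    proof (rule sum.cong[OF refl])
      fix j assume "j \<in> T"
      then show "x j = of_bool (G i j) * x j + (if j = i then x i else 0) + (if j \<in> Hn i then x j else 0)"
        using clS[of i j] i TS full_half[of i j] full_irr[of i] half_irr[of i]
        by (auto simp: G_def Hn_def full_def half_def)
    qed
    also have "\<dots> = (\<Sum>j\<in>T. of_bool (G i j) * x j) + x i + sum x (T \<inter> Hn i)"
      using fT i by (simp add: sum.distrib sum.delta' sum.inter_restrict)
    finally show ?thesis by (simp add: Int_commute)
  qed
  have "x i * (x i + (X - (\<Sum>j\<in>T. of_bool (G i j) * x j) - x i) / 2) \<le> x i * \<mu>" if i: "i \<in> T" for i
  proof (rule mult_left_mono)
    have "sum x (Hn i \<inter> T) \<le> sum x (Hn i)"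
      by (rule sum_mono2) (use nbr_fin nbr_sub[of i] xnn in blast)+
    then show "x i + (X - (\<Sum>j\<in>T. of_bool (G i j) * x j) - x i) / 2 \<le> \<mu>"
      using split[OF i] kkt[of i] i TS by (auto simp: Hn_def)
    show "0 \<le> x i" using i TS xpos by (auto intro: less_imp_le)
  qed
  then have "(\<Sum>i\<in>T. x i * (x i + (X - (\<Sum>j\<in>T. of_bool (G i j) * x j) - x i) / 2)) \<le> (\<Sum>i\<in>T. x i * \<mu>)"
    by (rule sum_mono)
  also have "(\<Sum>i\<in>T. x i * \<mu>) = X * \<mu>" by (simp add: X_def sum_distrib_right)
  also have "(\<Sum>i\<in>T. x i * (x i + (X - (\<Sum>j\<in>T. of_bool (G i j) * x j) - x i) / 2)) = (s2 + X * X - q) / 2"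
  proof -
    have "(\<Sum>i\<in>T. x i * (x i + (X - (\<Sum>j\<in>T. of_bool (G i j) * x j) - x i) / 2))
       = (\<Sum>i\<in>T. ((x i)^2 + x i * X - x i * (\<Sum>j\<in>T. of_bool (G i j) * x j)) / 2)"
      by (rule sum.cong[OF refl]) (simp add: field_simps power2_eq_square)
    also have "\<dots> = (s2 + X * X - q) / 2"
      unfolding q_def quad_alt lin_def s2_def sum_divide_distrib[symmetric]
      by (simp add: sum.distrib sum_subtractf X_def sum_distrib_right)
    finally show ?thesis .
  qed
  finally have main: "s2 + X * X - q \<le> 2 * X * \<mu>" by simp
  define t where "t = real (card T)"
  have t: "t > 0" using tp by (simp add: t_def)
  have "k * t * (s2 + X * X - q) \<le> k * t * (2 * X * \<mu>)"
    by (rule mult_left_mono[OF main]) (use t in simp)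
  moreover have "t * (k * q) \<le> t * ((real k - 1) * X^2)" by (rule mult_left_mono[OF ms]) (use t in simp)
  moreover have "k * X^2 \<le> k * (t * s2)" by (rule mult_left_mono) (use cs in \<open>auto simp: t_def\<close>)
  ultimately have "X * (X * (k + t)) \<le> X * (2 * k * t * \<mu>)"
    by (simp add: algebra_simps power2_eq_square)
  then show ?thesis using Xpos by (simp add: X_def t_def)
qed simp

section \<open>Bounding the number of clusters in the support\<close>

lemma red_tri: "a \<in> S \<Longrightarrow> b \<in> S \<Longrightarrow> c \<in> S \<Longrightarrow> R a b \<Longrightarrow> R b c \<Longrightarrow> R a c \<Longrightarrow> False"
  using tri inI by blast

lemma blue_bound_S:
  assumes "J \<subseteq> S" "D \<subseteq> J" "D \<inter> A = {}" "\<And>i j. i \<in> J \<Longrightarrow> j \<in> J \<Longrightarrow> i \<noteq> j \<Longrightarrow> \<not> R i j"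
    "\<And>i j. i \<in> D \<Longrightarrow> j \<in> D \<Longrightarrow> i \<noteq> j \<Longrightarrow> F i j"
  shows "card J + card D \<le> 5"
proof (rule blue_bound)
  show "J \<subseteq> I" using assms(1) SI by (rule subset_trans)
  show "F i j \<or> H i j" if "i \<in> J" "j \<in> J" "i \<noteq> j" for i j
    using bl[of i j] assms(1) assms(4)[OF that] that by (simp add: subset_iff)
qed (fact assms)+

lemma Rn_nonred: assumes "v \<in> S" "i \<in> Rn v" "j \<in> Rn v" shows "\<not> R i j"
  using assms red_tri[of i v j] symR[of i v] by (auto simp: Rn_def)

lemma A_nonred: assumes "i \<in> A \<or> j \<in> A" shows "\<not> R i j"
  using assms RA[of i j] RA[of j i] symR[of i j] by blast

lemma Rn_not_A: "j \<in> Rn v \<Longrightarrow> j \<notin> A" using A_nonred[of v j] by (auto simp: Rn_def)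

text \<open>Next to two clusters of \<open>A\<close>, three clusters without red pairs and with one
  of them doubled would count 6, so Ramsey leaves at most five clusters outside \<open>A\<close>.
  Next to three, even a single non-red pair counts 6, so the clusters outside \<open>A\<close> form
  a red clique of at most two.\<close>

lemma many_A: assumes "card (S \<inter> A) \<ge> 2" shows "card S \<le> 7"
proof -
  have fA: "finite (S \<inter> A)" "finite (S - A)" using finS by auto
  have cS: "card S = card (S \<inter> A) + card (S - A)"
    using finS by (rule card_Int_Diff)
  have B5: "card (S - A) \<le> 5"
  proof (rule ccontr)
    assume "\<not> ?thesis"
    then have "card (S - A) \<ge> 6" by simp
    then obtain a b c where abc: "a \<in> S - A" "b \<in> S - A" "c \<in> S - A" "a \<noteq> b" "b \<noteq> c" "a \<noteq> c"
      "(R a b \<and> R b c \<and> R a c) \<or> (\<not> R a b \<and> \<not> R b c \<and> \<not> R a c)"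
      by (rule ramsey_3_3[where P=R, OF _ symR])
    then have nr: "\<not> R a b" "\<not> R b c" "\<not> R a c" using red_tri[of a b c] by auto
    have "card ({a,b,c} \<union> (S \<inter> A)) + card {a} \<le> 5"
      by (rule blue_bound_S) (use abc nr A_nonred symR[of a b] symR[of b c] symR[of a c] in auto)
    moreover have "card ({a,b,c} \<union> (S \<inter> A)) = 3 + card (S \<inter> A)"
      using abc fA by (subst card_Un_disjoint) auto
    ultimately show False using assms by simp
  qed
  show ?thesis
  proof (cases "card (S \<inter> A) = 2")
    case True then show ?thesis using cS B5 by simp
  next
    case False
    then have A3: "card (S \<inter> A) \<ge> 3" using assms by simp
    have "R i j" if "i \<in> S - A" "j \<in> S - A" "i \<noteq> j" for i j
    proof (rule ccontr)
      assume n: "\<not> R i j"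
      have "card ({i,j} \<union> (S \<inter> A)) + card {i} \<le> 5"
        by (rule blue_bound_S) (use that n A_nonred symR[of i j] in auto)
      moreover have "card ({i,j} \<union> (S \<inter> A)) = 2 + card (S \<inter> A)"
        using that fA by (subst card_Un_disjoint) auto
      ultimately show False using A3 by simp
    qed
    then have B2: "card (S - A) \<le> 2" by (intro red_clique_card) (use SI in auto)
    have "card (S \<inter> A) + card ({}::'a set) \<le> 5"
      by (rule blue_bound_S) (use A_nonred in auto)
    then show ?thesis using cS B2 by simp
  qed
qed

text \<open>The cluster \<open>q\<close> can be added to every blue configuration in
  \<open>B\<close>. Red neighbourhoods then have at most three clusters and weight at most
  \<open>2 * \<mu>\<close>, so \<open>RF_sum\<close> gives every cluster an \<open>F\<close>
  neighbour in \<open>B\<close>. An \<open>F\<close> pair sends red to all the rest of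
  \<open>B\<close>, hence \<open>n \<le> 8\<close>. Clusters of red degree three are light, the
  others span no \<open>F\<close> pair, and together they cannot reach weight 1.\<close>

lemma one_A_false:
  assumes SA: "S \<inter> A = {q}" and N: "card S \<ge> 8"
  shows False
proof -
  define B where "B = S - {q}"
  define n where "n = card B"
  have q: "q \<in> S" "q \<in> A" using SA by auto
  have BA: "B \<inter> A = {}" "B \<subseteq> S" using SA by (auto simp: B_def)
  have fB: "finite B" using finS by (simp add: B_def)
  have n7: "n \<ge> 7" using N q finS by (simp add: n_def B_def)
  have RnB: "Rn v \<subseteq> B" for v using Rn_not_A[of _ v] q nbr_sub(1)[of v] by (auto simp: B_def)
  have qB: "q \<notin> B" by (simp add: B_def)
  have qn: "\<not> R q i" "\<not> R i q" for i using A_nonred q by auto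
  define r where "r v = card (Rn v)" for v
  have r3: "r v \<le> 3" if v: "v \<in> B" for v
  proof (cases "Rn v = {}")
    case False
    then obtain j where j: "j \<in> Rn v" by blast
    have "card (insert q (Rn v)) + card {j} \<le> 5"
      by (rule blue_bound_S) (use q j RnB[of v] BA Rn_nonred[of v] v qn in auto)
    moreover have "q \<notin> Rn v" using RnB qB by blast
    ultimately show ?thesis using nbr_fin[of v] by (simp add: r_def)
  qed (simp add: r_def)
  \<comment> \<open>An \<open>F\<close> pair among the red neighbours could be doubled next to
    \<open>q\<close>, counting 4 + 2 = 6; so the three form an \<open>H\<close> clique.\<close>
  have X3: "sum x (Rn v) \<le> 1.5 * \<mu>" if v: "v \<in> B" and r: "r v = 3" for v
  proof -
    have "H i j" if ij: "i \<in> Rn v" "j \<in> Rn v" "i \<noteq> j" for i j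
    proof (rule ccontr)
      assume "\<not> H i j"
      then have Fij: "F i j" using clS[of i j] ij nbr_sub(1)[of v] Rn_nonred[of v i j] v BA by blast
      have "card (insert q (Rn v)) + card {i,j} \<le> 5"
        by (rule blue_bound_S) (use q ij RnB[of v] BA Rn_nonred[of v] v qn Fij symF[of i j] in auto)
      moreover have "q \<notin> Rn v" using RnB qB by blast
      ultimately show False using nbr_fin[of v] r ij by (simp add: r_def)
    qed
    then have "(real (r v) + 1) * sum x (Rn v) \<le> 2 * real (r v) * \<mu>"
      unfolding r_def by (intro H_clique_sum nbr_sub)
    then show ?thesis using r by simp
  qed
  have X2: "sum x (Rn v) \<le> 2 * \<mu>" if v: "v \<in> B" and r: "r v \<le> 2" for v
  proof -
    have "sum x (Rn v) \<le> real (r v) * \<mu>" unfolding r_def by (intro sum_le_card nbr_sub)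
    also have "\<dots> \<le> 2 * \<mu>" by (rule mult_right_mono) (use r mupos in auto)
    finally show ?thesis .
  qed
  have Xr: "sum x (Rn v) \<le> 2 * \<mu>" if v: "v \<in> B" for v
    using X2[OF v] X3[OF v] r3[OF v] mupos by (cases "r v = 3") auto
  have FnB: "sum x (Fn v \<inter> B) \<le> 2 * \<mu>" if v: "v \<in> B" for v
  proof -
    have "R i j" if ij: "i \<in> Fn v \<inter> B" "j \<in> Fn v \<inter> B" "i \<noteq> j" for i j
    proof (rule ccontr)
      assume nr: "\<not> R i j"
      have f: "F v i" "F v j" using ij by (auto simp: Fn_def)
      have ne: "v \<noteq> i" "v \<noteq> j" "q \<noteq> v" "q \<noteq> i" "q \<noteq> j" using f irrF ij v qB by auto
      have "card {q,v,i,j} + card {v,i} \<le> 5"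
        by (rule blue_bound_S) (use q ij v BA nr f qn RF[of v i] RF[of v j] symR[of v i] symR[of v j] symR[of i j] symF[of v i] in auto)
      then show False using ne ij by simp
    qed
    then have "card (Fn v \<inter> B) \<le> 2" by (intro red_clique_card) (use BA SI in auto)
    moreover have "sum x (Fn v \<inter> B) \<le> real (card (Fn v \<inter> B)) * \<mu>" by (rule sum_le_card) (use BA in auto)
    moreover have "real (card (Fn v \<inter> B)) * \<mu> \<le> 2 * \<mu>" by (rule mult_right_mono) (use calculation mupos in auto)
    ultimately show ?thesis by simp
  qed
  have Fnq: "sum x (Fn v) \<le> \<mu> + sum x (Fn v \<inter> B)" if v: "v \<in> B" for v
  proof -
    have "sum x (Fn v) \<le> sum x (insert q (Fn v \<inter> B))"
      by (rule sum_mono2) (use nbr_sub(2)[of v] xnn q BA fB in \<open>auto simp: B_def\<close>)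
    also have "\<dots> = x q + sum x (Fn v \<inter> B)" using qB fB by simp
    finally show ?thesis using xle[OF q(1)] by simp
  qed
  have exF: "\<exists>u\<in>B. F v u" if v: "v \<in> B" for v
  proof (rule ccontr)
    assume "\<not> ?thesis"
    then have "Fn v \<inter> B = {}" by (auto simp: Fn_def)
    then have "sum x (Fn v) \<le> \<mu>" using Fnq[OF v] by simp
    then show False using RF_sum[of v] Xr[OF v] v BA mu xpos[of v] by auto
  qed
  have rr: "n \<le> 2 + r u + r v" if uv: "u \<in> B" "v \<in> B" "F u v" for u v
  proof -
    have ne: "u \<noteq> v" "q \<noteq> u" "q \<noteq> v" using uv irrF qB by auto
    have "B \<subseteq> {u,v} \<union> (Rn u \<union> Rn v)"
    proof
      fix z assume z: "z \<in> B"
      show "z \<in> {u,v} \<union> (Rn u \<union> Rn v)"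
      proof (rule ccontr)
        assume n: "z \<notin> {u,v} \<union> (Rn u \<union> Rn v)"
        then have nr: "\<not> R u z" "\<not> R v z" using z BA by (auto simp: Rn_def)
        have "card {q,u,v,z} + card {u,v} \<le> 5"
          by (rule blue_bound_S) (use q uv z BA nr qn RF[of u v] symR[of u v] symR[of u z] symR[of v z] symF[of u v] in auto)
        moreover have "q \<noteq> z" using z qB by blast
        ultimately show False using ne n by auto
      qed
    qed
    then have "n \<le> card ({u,v} \<union> (Rn u \<union> Rn v))" unfolding n_def by (rule card_mono[rotated]) (use nbr_fin in auto)
    also have "\<dots> \<le> card {u,v} + (card (Rn u) + card (Rn v))"
      by (rule order.trans[OF card_Un_le]) (use card_Un_le[of "Rn u" "Rn v"] in simp)
    finally show ?thesis using ne by (simp add: r_def)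
  qed
  \<comment> \<open>6.5 is 1.5 for the red neighbours, 1 for \<open>q\<close>, 2 for the
    \<open>F\<close> neighbours in \<open>B\<close>, and 2 from \<open>RF_sum\<close>.\<close>
  have x3: "x v \<le> 6.5 * \<mu> - 1" if v: "v \<in> B" and r: "r v = 3" for v
    using RF_sum[of v] X3[OF v r] Fnq[OF v] FnB[OF v] v BA by auto
  define U where "U = {v\<in>B. r v \<le> 2}"
  have UB: "U \<subseteq> B" "finite U" using fB by (auto simp: U_def)
  have nFU: "\<not> F u v" if "u \<in> U" "v \<in> U" for u v
    using rr[of u v] that n7 by (auto simp: U_def)
  \<comment> \<open>Full pairs inside \<open>U\<close> are red because no pair in \<open>U\<close>
    is \<open>F\<close>, so full cliques there have at most two clusters.\<close>
  have XU: "sum x U * (2 + real (card U)) \<le> 4 * real (card U) * \<mu>"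
  proof -
    have "sum x U * (real 2 + real (card U)) \<le> 2 * real 2 * real (card U) * \<mu>"
    proof (rule full_clique_sum)
      show "card C \<le> 2" if C: "C \<subseteq> U" "\<And>i j. i \<in> C \<Longrightarrow> j \<in> C \<Longrightarrow> i \<noteq> j \<Longrightarrow> full i j" for C
      proof (rule red_clique_card)
        show "C \<subseteq> I" using C(1) UB BA SI by auto
        show "R i j" if "i \<in> C" "j \<in> C" "i \<noteq> j" for i j
          using C(2)[OF that] nFU[of i j] C(1) that by (auto simp: full_def)
      qed
    qed (use UB BA in auto)
    then show ?thesis by simp
  qed
  obtain v0 where v0: "v0 \<in> B" using n7 by (force simp: n_def)
  then obtain u0 where "u0 \<in> B" "F v0 u0" using exF by blast
  then have n8: "n \<le> 8" using rr[of v0 u0] r3[of v0] r3[of u0] v0 by simp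
  have U8: "card U = 0" if "n = 8"
  proof -
    have "r v = 3" if v: "v \<in> B" for v
    proof -
      obtain u where "u \<in> B" "F v u" using exF[OF v] by blast
      then show ?thesis using rr[of v u] r3[of v] r3[of u] v \<open>n = 8\<close> by simp
    qed
    then have "U = {}" by (auto simp: U_def)
    then show ?thesis by simp
  qed
  have cBU: "card (B - U) = n - card U" "card U \<le> n" using UB fB by (auto simp: n_def card_Diff_subset card_mono)
  have "sum x (B - U) \<le> real (card (B - U)) * (6.5 * \<mu> - 1)"
    by (rule sum_bounded_above, rule x3) (use r3 in \<open>fastforce simp: U_def\<close>)+
  moreover have "1 = x q + (sum x U + sum x (B - U))"
  proof -
    have "1 = x q + sum x B" using xsum q finS by (simp add: B_def sum.remove)
    also have "sum x B = sum x U + sum x (B - U)" using UB fB by (metis add.commute sum.subset_diff)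
    finally show ?thesis .
  qed
  ultimately have main: "1 \<le> \<mu> + sum x U + (real n - real (card U)) * (6.5 * \<mu> - 1)"
    using xle[OF q(1)] cBU by (simp add: of_nat_diff)
  have "n = 7 \<or> n = 8" using n7 n8 by linarith
  moreover have "card U = 0 \<or> card U = 1 \<or> card U = 2 \<or> card U = 3 \<or> card U = 4 \<or> card U = 5 \<or> card U = 6 \<or> card U = 7"
    if "n = 7" using cBU that by linarith
  ultimately show False using main XU U8 mu mupos by (elim disjE) auto
qed

text \<open>Red degrees are at most 4, and an \<open>F\<close> pair leaves at most two further
  clusters red to neither end. So \<open>|S|\<close> is at most 2 + 2 + 4 + 4 = 12, and equality
  makes every red degree 4. Then both neighbourhoods of a cluster are so light that every cluster
  weighs less than 1/12.\<close>

lemma no_A_false_large: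
  assumes SA: "S \<inter> A = {}" and N: "card S \<ge> 12"
  shows False
proof -
  define r where "r v = card (Rn v)" for v
  have nA: "T \<subseteq> S \<Longrightarrow> T \<inter> A = {}" for T using SA by auto
  have r4: "r v \<le> 4" if v: "v \<in> S" for v
  proof (cases "Rn v = {}")
    case False
    then obtain j where j: "j \<in> Rn v" by blast
    have "card (Rn v) + card {j} \<le> 5"
      by (rule blue_bound_S) (use j nbr_sub(1)[of v] nA[of "{j}"] Rn_nonred[of v] v in auto)
    then show ?thesis by (simp add: r_def)
  qed (simp add: r_def)
  have X4: "sum x (Rn v) \<le> 1.6 * \<mu>" if v: "v \<in> S" and r: "r v = 4" for v
  proof -
    have "H i j" if ij: "i \<in> Rn v" "j \<in> Rn v" "i \<noteq> j" for i j
    proof (rule ccontr)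
      assume "\<not> H i j"
      then have Fij: "F i j" using clS[of i j] ij nbr_sub(1)[of v] Rn_nonred[of v i j] v by blast
      have "card (Rn v) + card {i,j} \<le> 5"
        by (rule blue_bound_S) (use ij nbr_sub(1)[of v] nA[of "{i,j}"] Rn_nonred[of v] v Fij symF[of i j] in auto)
      then show False using r ij by (simp add: r_def)
    qed
    then have "(real (r v) + 1) * sum x (Rn v) \<le> 2 * real (r v) * \<mu>"
      unfolding r_def by (intro H_clique_sum nbr_sub)
    then show ?thesis using r by simp
  qed
  have X3: "sum x (Rn v) \<le> 3 * \<mu>" if v: "v \<in> S" for v
  proof (cases "r v = 4")
    case True then show ?thesis using X4[OF v] mupos by simp
  next
    case False
    have "sum x (Rn v) \<le> real (r v) * \<mu>" unfolding r_def by (intro sum_le_card nbr_sub)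
    also have "\<dots> \<le> 3 * \<mu>" by (rule mult_right_mono) (use False r4[OF v] mupos in auto)
    finally show ?thesis .
  qed
  have exF: "\<exists>u\<in>S. F v u" if v: "v \<in> S" for v
  proof (rule ccontr)
    assume "\<not> ?thesis"
    then have "Fn v = {}" by (auto simp: Fn_def)
    then show False using RF_sum[of v] X3[OF v] v mu xpos[of v] by auto
  qed
  have rr: "card S \<le> 4 + r u + r v" if uv: "u \<in> S" "v \<in> S" "F u v" for u v
  proof -
    have ne: "u \<noteq> v" using uv irrF by auto
    define C where "C = {z\<in>S. z \<noteq> u \<and> z \<noteq> v \<and> \<not> R u z \<and> \<not> R v z}"
    have "R i j" if ij: "i \<in> C" "j \<in> C" "i \<noteq> j" for i j
    proof (rule ccontr)
      assume nr: "\<not> R i j"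
      have "card {u,v,i,j} + card {u,v} \<le> 5"
        by (rule blue_bound_S) (use ij uv nA[of "{u,v}"] nr RF[of u v] symR[of u v] symR[of u i] symR[of u j] symR[of v i] symR[of v j]
            symR[of i j] symF[of u v] in \<open>auto simp: C_def\<close>)
      moreover have "u \<noteq> i" "u \<noteq> j" "v \<noteq> i" "v \<noteq> j" using ij by (auto simp: C_def)
      ultimately show False using ne ij by simp
    qed
    moreover have "C \<subseteq> I" using SI by (auto simp: C_def)
    ultimately have "card C \<le> 2" by (intro red_clique_card)
    moreover have "S \<subseteq> ({u,v} \<union> C) \<union> (Rn u \<union> Rn v)" by (auto simp: C_def Rn_def)
    then have "card S \<le> card (({u,v} \<union> C) \<union> (Rn u \<union> Rn v))"
      by (rule card_mono[rotated]) (use nbr_fin finS in \<open>auto simp: C_def\<close>)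
    moreover have "card (({u,v} \<union> C) \<union> (Rn u \<union> Rn v)) \<le> (card {u,v} + card C) + (card (Rn u) + card (Rn v))"
      by (meson add_mono card_Un_le order_trans)
    ultimately show ?thesis using ne by (simp add: r_def)
  qed
  have all4: "r v = 4 \<and> card S = 12" if v: "v \<in> S" for v
  proof -
    obtain u where "u \<in> S" "F v u" using exF[OF v] by blast
    then show ?thesis using rr[of v u] r4[of v] r4[of u] v N by linarith
  qed
  \<comment> \<open>An \<open>F\<close> neighbourhood of \<open>t\<close> clusters spans no
    \<open>F\<close> pair, so \<open>full_clique_sum\<close> with \<open>k = 2\<close> bounds its
    weight by \<open>4 * t / (2 + t) * \<mu>\<close>. Ramsey gives \<open>t \<le> 5\<close>, where
    this is 20/7.\<close>
  have XF: "sum x (Fn v) \<le> 20/7 * \<mu>" if v: "v \<in> S" for v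
  proof -
    have nF: "\<not> F i j" if ij: "i \<in> Fn v" "j \<in> Fn v" for i j
      using no_F_triangle[of i v j] ij v SA SI symF[of i v] by (auto simp: Fn_def)
    have f5: "card (Fn v) \<le> 5"
    proof (rule ccontr)
      assume "\<not> ?thesis"
      then have "card (Fn v) \<ge> 6" by simp
      then obtain a b c where abc: "a \<in> Fn v" "b \<in> Fn v" "c \<in> Fn v" "a \<noteq> b" "b \<noteq> c" "a \<noteq> c"
        "(R a b \<and> R b c \<and> R a c) \<or> (\<not> R a b \<and> \<not> R b c \<and> \<not> R a c)"
        by (rule ramsey_3_3[where P=R, OF _ symR])
      then have nr: "\<not> R a b" "\<not> R b c" "\<not> R a c" using red_tri[of a b c] nbr_sub(2)[of v] by auto
      have f: "F v a" "F v b" "F v c" "v \<noteq> a" "v \<noteq> b" "v \<noteq> c" using abc irrF by (auto simp: Fn_def)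
      have "card {v,a,b,c} + card {v,a} \<le> 5"
        by (rule blue_bound_S) (use abc v nbr_sub(2)[of v] nA[of "{v,a}"] nr f RF[of v a] RF[of v b] RF[of v c]
            symR[of v a] symR[of v b] symR[of v c] symR[of a b] symR[of b c] symR[of a c] symF[of v a] in auto)
      then show False using abc f by simp
    qed
    have main: "sum x (Fn v) * (real 2 + real (card (Fn v))) \<le> 2 * real 2 * real (card (Fn v)) * \<mu>"
    proof (rule full_clique_sum)
      show "card C \<le> 2" if C: "C \<subseteq> Fn v" "\<And>i j. i \<in> C \<Longrightarrow> j \<in> C \<Longrightarrow> i \<noteq> j \<Longrightarrow> full i j" for C
      proof (rule red_clique_card)
        show "C \<subseteq> I" using C(1) nbr_sub(2)[of v] SI by auto
        show "R i j" if "i \<in> C" "j \<in> C" "i \<noteq> j" for i j using C(2)[OF that] nF[of i j] C(1) that by (auto simp: full_def)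
      qed
    qed (use nbr_sub in auto)
    have "card (Fn v) = 0 \<or> card (Fn v) = 1 \<or> card (Fn v) = 2 \<or> card (Fn v) = 3 \<or> card (Fn v) = 4 \<or> card (Fn v) = 5"
      using f5 by linarith
    then show ?thesis using main mupos by (elim disjE) (auto simp: nbr_fin)
  qed
  \<comment> \<open>0.0817 rounds up \<open>(1.6 + 20/7 + 2) * 0.1675 - 1\<close>, and 12 times it
    is below 1.\<close>
  have xb: "x v \<le> 0.0817" if v: "v \<in> S" for v
    using RF_sum[OF v] X4[OF v] XF[OF v] all4[OF v] mu by auto
  obtain v where v: "v \<in> S" using N by fastforce
  have "sum x S \<le> real (card S) * 0.0817" by (rule sum_bounded_above) (use xb in auto)
  then show False using xsum all4[OF v] by simp
qed

section \<open>Pentagons in the support and their twins\<close>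

definition pent where
  "pent a b c d e \<longleftrightarrow> {a,b,c,d,e} \<subseteq> S \<and> distinct [a,b,c,d,e] \<and>
     F a b \<and> F b c \<and> F c d \<and> F d e \<and> F e a \<and> R a c \<and> R b d \<and> R c e \<and> R d a \<and> R e b"

text \<open>Such a \<open>z\<close> is attached to \<open>b\<close>, \<open>c\<close>,
  \<open>d\<close>, \<open>e\<close> exactly as \<open>a\<close> is, so it could take the place of
  \<open>a\<close> in the pentagon.\<close>

definition twin where
  "twin z a b c d e \<longleftrightarrow> z \<in> S \<and> H z a \<and> F z b \<and> R z c \<and> R z d \<and> F z e"

lemma pent_rot: "pent a b c d e \<Longrightarrow> pent b c d e a"
  by (auto simp: pent_def)

lemma twin_notin: "pent a b c d e \<Longrightarrow> twin z a b c d e \<Longrightarrow> z \<notin> {a,b,c,d,e}"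
  using irrH irrF irrR by (auto simp: twin_def)

lemma pent_mem: assumes "pent a b c d e"
  shows "a \<in> S" "b \<in> S" "c \<in> S" "d \<in> S" "e \<in> S"
    "a \<noteq> b" "a \<noteq> c" "a \<noteq> d" "a \<noteq> e" "b \<noteq> c" "b \<noteq> d" "b \<noteq> e" "c \<noteq> d" "c \<noteq> e" "d \<noteq> e"
    "F a b" "F b c" "F c d" "F d e" "F e a" "R a c" "R b d" "R c e" "R d a" "R e b"
  using assms by (auto simp: pent_def)

context
  assumes SA: "S \<inter> A = {}"
begin

lemma noF3: assumes "a \<in> S" "b \<in> S" "c \<in> S" "F a b" "F b c" "F a c" shows False
  using no_F_triangle[of a b c] assms SA SI by auto

lemma noF4:
  assumes "a \<in> S" "b \<in> S" "c \<in> S" "d \<in> S" "distinct [a,b,c,d]" "F a b"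
    "\<not> R a c" "\<not> R a d" "\<not> R b c" "\<not> R b d" "\<not> R c d"
  shows False
proof -
  have "card {a,b,c,d} + card {a,b} \<le> 5"
    by (rule blue_bound_S) (use assms SA RF[of a b] symR[of a b] symR[of a c] symR[of a d] symR[of b c] symR[of b d] symR[of c d] symF[of a b] in auto)
  then show False using assms by simp
qed

text \<open>If \<open>z c\<close> were \<open>F\<close>, then \<open>z b\<close> and
  \<open>z d\<close> would have to be red, closing a red triangle with \<open>b d\<close>. So
  \<open>z c\<close> is red, and the other three relations follow one after the other.\<close>

lemma near_pattern:
  assumes p: "pent a b c d e" and z: "z \<in> S" "z \<notin> {a,b,c,d,e}"
    and nH: "\<not> H z b" "\<not> H z c" "\<not> H z d" "\<not> H z e"
  shows "F z b \<and> R z c \<and> R z d \<and> F z e"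
proof -
  note m = pent_mem[OF p]
  have o: "R z b \<or> F z b" "R z c \<or> F z c" "R z d \<or> F z d" "R z e \<or> F z e"
    using clS[of z b] clS[of z c] clS[of z d] clS[of z e] m z nH by auto
  have f: "\<not> (F z b \<and> F z c)" "\<not> (F z c \<and> F z d)" "\<not> (F z d \<and> F z e)"
    using noF3[of z b c] noF3[of z c d] noF3[of z d e] m z by auto
  have r: "\<not> (R z b \<and> R z d)" "\<not> (R z c \<and> R z e)" "\<not> (R z e \<and> R z b)"
    using red_tri[of z b d] red_tri[of z c e] red_tri[of z e b] m z by auto
  show ?thesis using o f r by blast
qed

definition s where "s a b c d e z = w z a + w z b + w z c + w z d + w z e"

text \<open>Without any half pair the patterns of \<open>near_pattern\<close> for different
  rotations contradict each other. Two half pairs cost a full unit. A single one sits at the vertex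
  whose twin \<open>z\<close> is; it cannot be a sparse red pair, since \<open>z\<close> and that
  vertex have a common red neighbour.\<close>

lemma s_cases:
  assumes p: "pent a b c d e" and z: "z \<in> S" "z \<notin> {a,b,c,d,e}"
  shows "s a b c d e z \<le> 4 \<or> s a b c d e z \<le> 4.5 \<and> (twin z a b c d e \<or> twin z b c d e a \<or> twin z c d e a b \<or> twin z d e a b c \<or> twin z e a b c d)"
proof -
  note p1 = pent_rot[OF p] note p2 = pent_rot[OF p1] note p3 = pent_rot[OF p2] note p4 = pent_rot[OF p3]
  have zz: "z \<notin> {b,c,d,e,a}" "z \<notin> {c,d,e,a,b}" "z \<notin> {d,e,a,b,c}" "z \<notin> {e,a,b,c,d}" using z by auto
  note pat = near_pattern[OF p z] near_pattern[OF p1 z(1) zz(1)] near_pattern[OF p2 z(1) zz(2)]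
    near_pattern[OF p3 z(1) zz(3)] near_pattern[OF p4 z(1) zz(4)]
  note pm = pent_mem[OF p]
  have w1: "w z u \<le> 1" and wh: "half z u \<Longrightarrow> w z u = 1/2" for u
    using full_half[of z u] by (auto simp: w_def)
  note w1s = w1[of a] w1[of b] w1[of c] w1[of d] w1[of e]
  have dis: "\<not> (F z u \<and> R z u)" for u using RF[of z u] by auto
  have hH: "H z u \<Longrightarrow> half z u" for u by (simp add: half_def)
  have some: "half z a \<or> half z b \<or> half z c \<or> half z d \<or> half z e" using pat dis hH by blast
  show ?thesis
  proof (cases "(half z a \<and> half z b) \<or> (half z a \<and> half z c) \<or> (half z a \<and> half z d) \<or> (half z a \<and> half z e) \<or> (half z b \<and> half z c)
      \<or> (half z b \<and> half z d) \<or> (half z b \<and> half z e) \<or> (half z c \<and> half z d) \<or> (half z c \<and> half z e) \<or> (half z d \<and> half z e)")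
    case True
    then have "s a b c d e z \<le> 4"
      unfolding s_def by (elim disjE conjE; use w1s in \<open>simp add: wh\<close>)
    then show ?thesis by simp
  next
    case False
    have "s a b c d e z \<le> 4.5"
      using some unfolding s_def by (elim disjE; use w1s in \<open>simp add: wh\<close>)
    moreover from some have "twin z a b c d e \<or> twin z b c d e a \<or> twin z c d e a b \<or> twin z d e a b c \<or> twin z e a b c d"
    proof (elim disjE)
      assume h: "half z a"
      have m: "F z b \<and> R z c \<and> R z d \<and> F z e" using h False hH by (intro pat(1)) blast+
      then have "\<not> R z a" using red_tri[of z a c] pm z(1) symR[of a c] by auto
      then have "twin z a b c d e" using m h z(1) by (simp add: twin_def half_def)
      then show ?thesis by simp
    next
      assume h: "half z b"
      have m: "F z c \<and> R z d \<and> R z e \<and> F z a" using h False hH by (intro pat(2)) blast+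
      then have "\<not> R z b" using red_tri[of z b d] pm z(1) symR[of b d] by auto
      then have "twin z b c d e a" using m h z(1) by (simp add: twin_def half_def)
      then show ?thesis by simp
    next
      assume h: "half z c"
      have m: "F z d \<and> R z e \<and> R z a \<and> F z b" using h False hH by (intro pat(3)) blast+
      then have "\<not> R z c" using red_tri[of z c e] pm z(1) symR[of c e] by auto
      then have "twin z c d e a b" using m h z(1) by (simp add: twin_def half_def)
      then show ?thesis by simp
    next
      assume h: "half z d"
      have m: "F z e \<and> R z a \<and> R z b \<and> F z c" using h False hH by (intro pat(4)) blast+
      then have "\<not> R z d" using red_tri[of z d a] pm z(1) symR[of d a] by auto
      then have "twin z d e a b c" using m h z(1) by (simp add: twin_def half_def)
      then show ?thesis by simp
    next
      assume h: "half z e"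
      have m: "F z a \<and> R z b \<and> R z c \<and> F z d" using h False hH by (intro pat(5)) blast+
      then have "\<not> R z e" using red_tri[of z e b] pm z(1) symR[of e b] by auto
      then have "twin z e a b c d" using m h z(1) by (simp add: twin_def half_def)
      then show ?thesis by simp
    qed
    ultimately show ?thesis by simp
  qed
qed

text \<open>The common red neighbour \<open>c\<close> keeps \<open>z z'\<close> from being red, so
  \<open>z\<close>, \<open>b\<close>, \<open>a\<close>, \<open>z'\<close> contain no red pair and
  \<open>z\<close>, \<open>b\<close> can be doubled.\<close>

lemma twin_unique:
  assumes p: "pent a b c d e" and t: "twin z a b c d e" "twin z' a b c d e"
  shows "z = z'"
proof (rule ccontr)
  assume ne: "z \<noteq> z'"
  note m = pent_mem[OF p]
  have z: "z \<in> S" "H z a" "F z b" "R z c" and z': "z' \<in> S" "H z' a" "F z' b" "R z' c" using t by (auto simp: twin_def)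
  have ni: "z \<notin> {a,b,c,d,e}" "z' \<notin> {a,b,c,d,e}" using twin_notin[OF p] t by auto
  have nr: "\<not> R z z'" using red_tri[of z z' c] z z' m by auto
  show False
    by (rule noF4[of z b a z']) (use z z' m ni ne nr RH[of z a] RH[of z' a] RF[of z b] RF[of z' b] RF[of a b]
       symR[of a b] symR[of a z'] symR[of b z'] in auto)
qed

text \<open>The common red neighbour \<open>d\<close> keeps \<open>z z'\<close> from being red, and
  \<open>a\<close>, \<open>b\<close> can be doubled next to both twins.\<close>

lemma twin_adjacent:
  assumes p: "pent a b c d e" and t: "twin z a b c d e" "twin z' b c d e a"
  shows False
proof -
  note m = pent_mem[OF p]
  have z: "z \<in> S" "H z a" "F z b" "R z d" and z': "z' \<in> S" "H z' b" "F z' a" "R z' d" using t by (auto simp: twin_def)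
  have ne: "z \<noteq> z'" using z z' FH by auto
  have ni: "z \<notin> {a,b,c,d,e}" "z' \<notin> {b,c,d,e,a}" using twin_notin[OF p t(1)] twin_notin[OF pent_rot[OF p] t(2)] by auto
  have nr: "\<not> R z z'" using red_tri[of z z' d] z z' m by auto
  show False
    by (rule noF4[of a b z z']) (use z z' m ni ne nr RH[of z a] RH[of z' b] RF[of z b] RF[of z' a] RF[of a b]
       symR[of a z] symR[of a z'] symR[of b z'] symR[of b z] in auto)
qed

lemma sum_s:
  assumes p: "pent a b c d e"
  shows "(\<Sum>v\<in>S. x v * s a b c d e v) = 5 * (1 - \<mu>)"
proof -
  have row: "(\<Sum>v\<in>S. x v * w v u) = 1 - \<mu>" if u: "u \<in> S" for u
  proof -
    have "(\<Sum>v\<in>S. x v * w v u) = (\<Sum>v\<in>S. x v - (if v = u then x u else 0) - (if v \<in> Hn u then x v / 2 else 0))"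
    proof (rule sum.cong[OF refl])
      fix v assume v: "v \<in> S"
      show "x v * w v u = x v - (if v = u then x u else 0) - (if v \<in> Hn u then x v / 2 else 0)"
        using clS[of u v] u v full_sym[of u v] half_sym[of u v] full_irr[of u] half_irr[of u]
          full_half[of u v] by (auto simp: w_def Hn_def full_def half_def)
    qed
    also have "\<dots> = 1 - x u - sum (\<lambda>v. x v / 2) (S \<inter> Hn u)"
      using finS u xsum by (simp add: sum_subtractf sum.delta' sum.inter_restrict)
    also have "S \<inter> Hn u = Hn u" using nbr_sub(3)[of u] by blast
    also have "1 - x u - sum (\<lambda>v. x v / 2) (Hn u) = 1 - \<mu>"
      using kkt[OF u] by (simp add: Hn_def sum_divide_distrib)
    finally show ?thesis .
  qed
  note m = pent_mem[OF p]
  show ?thesis unfolding s_def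
    by (simp add: distrib_left sum.distrib row m)
qed

text \<open>The weighted mean of \<open>s\<close> is \<open>5 * (1 - \<mu>)\<close>, more than
  4.1625, while only twins exceed 4, and by at most 1/2. So twins weigh at least 2 * 0.1625 =
  0.325.\<close>

lemma twin_sum:
  assumes p: "pent a b c d e"
  defines "Z \<equiv> {z\<in>S. twin z a b c d e \<or> twin z b c d e a \<or> twin z c d e a b \<or> twin z d e a b c \<or> twin z e a b c d}"
  shows "sum x Z \<ge> 0.325"
proof -
  note m = pent_mem[OF p]
  have sle: "s a b c d e v \<le> 4 + (if v \<in> Z then 1/2 else 0)" if v: "v \<in> S" for v
  proof (cases "v \<in> {a,b,c,d,e}")
    case True
    have w0: "w u u = 0" for u using full_irr half_irr by (simp add: w_def)
    have w1: "w u u' \<le> 1" for u u' by (simp add: w_def)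
    have "s a b c d e v \<le> 4"
      using True w0[of v] w1[of v a] w1[of v b] w1[of v c] w1[of v d] w1[of v e] unfolding s_def by auto
    then show ?thesis by simp
  next
    case False
    then show ?thesis using s_cases[OF p v False] v by (auto simp: Z_def)
  qed
  have "5 * (1 - \<mu>) \<le> (\<Sum>v\<in>S. x v * (4 + (if v \<in> Z then 1/2 else 0)))"
    unfolding sum_s[OF p, symmetric]
    by (intro sum_mono mult_left_mono sle xnn)
  also have "\<dots> = (\<Sum>v\<in>S. 4 * x v + (if v \<in> Z then x v / 2 else 0))"
    by (rule sum.cong) auto
  also have "\<dots> = 4 + sum (\<lambda>v. x v / 2) (S \<inter> Z)"
    using finS xsum by (simp add: sum.distrib sum.inter_restrict sum_distrib_left[symmetric])
  also have "S \<inter> Z = Z" by (auto simp: Z_def)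
  also have "sum (\<lambda>v. x v / 2) Z = sum x Z / 2" by (simp add: sum_divide_distrib)
  finally show ?thesis using mu by simp
qed

text \<open>Next to a twin at \<open>a\<close> there are none at \<open>b\<close> or
  \<open>e\<close>, and at most one at \<open>c\<close> and \<open>d\<close> together, which weighs
  at most \<open>\<mu>\<close>. What is left of the total is 0.325 - 0.1675 = 0.1575.\<close>

lemma twin_large:
  assumes p: "pent a b c d e" and t: "twin z a b c d e"
  shows "x z \<ge> 0.1575"
proof -
  define Za where "Za = {z\<in>S. twin z a b c d e}"
  define Zb where "Zb = {z\<in>S. twin z b c d e a}"
  define Zc where "Zc = {z\<in>S. twin z c d e a b}"
  define Zd where "Zd = {z\<in>S. twin z d e a b c}"
  define Ze where "Ze = {z\<in>S. twin z e a b c d}"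
  note p1 = pent_rot[OF p] note p2 = pent_rot[OF p1] note p3 = pent_rot[OF p2] note p4 = pent_rot[OF p3]
  have zS: "z \<in> S" using t by (simp add: twin_def)
  have a: "Za = {z}" unfolding Za_def using twin_unique[OF p _ t] t zS by blast
  have b: "Zb = {}" using twin_adjacent[OF p t] by (auto simp: Zb_def)
  have e: "Ze = {}" using twin_adjacent[OF p4 _ t] by (auto simp: Ze_def)
  have cd: "sum x Zc + sum x Zd \<le> \<mu>"
  proof -
    have one: "sum x Q \<le> \<mu>" if uq: "\<And>u v. u \<in> Q \<Longrightarrow> v \<in> Q \<Longrightarrow> u = v" and sub: "Q \<subseteq> S" for Q
    proof (cases "Q = {}")
      case False
      then obtain u where "u \<in> Q" by blast
      then have "Q = {u}" using uq by blast
      then show ?thesis using xle[of u] sub by simp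
    qed (use mupos in simp)
    have "Zc = {} \<or> Zd = {}" using twin_adjacent[OF p2] by (auto simp: Zc_def Zd_def)
    moreover have "sum x Zc \<le> \<mu>" unfolding Zc_def by (rule one) (use twin_unique[OF p2] in blast)+
    moreover have "sum x Zd \<le> \<mu>" unfolding Zd_def by (rule one) (use twin_unique[OF p3] in blast)+
    ultimately show ?thesis by auto
  qed
  have "{z\<in>S. twin z a b c d e \<or> twin z b c d e a \<or> twin z c d e a b \<or> twin z d e a b c \<or> twin z e a b c d}
      = Za \<union> (Zc \<union> Zd)" using b e by (auto simp: Za_def Zb_def Zc_def Zd_def Ze_def)
  then have "0.325 \<le> sum x (Za \<union> (Zc \<union> Zd))" using twin_sum[OF p] by simp
  also have "\<dots> \<le> sum x Za + sum x (Zc \<union> Zd)"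
    by (subst sum.union_inter[symmetric]) (use finS xnn in \<open>auto simp: Za_def Zc_def Zd_def intro!: sum_nonneg\<close>)
  also have "sum x (Zc \<union> Zd) \<le> sum x Zc + sum x Zd"
    by (subst sum.union_inter[symmetric]) (use finS xnn in \<open>auto simp: Za_def Zc_def Zd_def intro!: sum_nonneg\<close>)
  finally show ?thesis using a cd mu by simp
qed

text \<open>Exchanging \<open>z\<close> and \<open>a\<close> gives a pentagon with \<open>a\<close>
  as a twin, so both weigh at least 0.1575. As they are half neighbours, \<open>kkt\<close> would
  make \<open>\<mu>\<close> at least 1.5 * 0.1575.\<close>

lemma twin_exchange:
  assumes p: "pent a b c d e" and t: "twin z a b c d e"
  shows False
proof -
  note m = pent_mem[OF p]
  have z: "z \<in> S" "H z a" "F z b" "R z c" "R z d" "F z e" using t by (auto simp: twin_def)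
  have ni: "z \<notin> {a,b,c,d,e}" by (rule twin_notin[OF p t])
  have p': "pent z b c d e"
    unfolding pent_def using m z ni symF[of z e] symR[of z d] by auto
  have t': "twin a z b c d e"
    unfolding twin_def using m z symH[of z a] symF[of e a] symR[of d a] by auto
  have "x z \<ge> 0.1575" "x a \<ge> 0.1575" using twin_large[OF p t] twin_large[OF p' t'] by auto
  moreover have "x a \<le> sum x (Hn z)"
    by (rule member_le_sum) (use m z xnn nbr_fin in \<open>auto simp: Hn_def half_def\<close>)
  ultimately show False using kkt[OF z(1)] mu by (simp add: Hn_def)
qed

lemma no_pent: assumes p: "pent a b c d e" shows False
proof -
  note p1 = pent_rot[OF p] note p2 = pent_rot[OF p1] note p3 = pent_rot[OF p2] note p4 = pent_rot[OF p3]
  have Z: "{z\<in>S. twin z a b c d e \<or> twin z b c d e a \<or> twin z c d e a b \<or> twin z d e a b c \<or> twin z e a b c d} = {}"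
    using twin_exchange[OF p] twin_exchange[OF p1] twin_exchange[OF p2] twin_exchange[OF p3] twin_exchange[OF p4]
    by auto
  show False using twin_sum[OF p] unfolding Z by simp
qed

end

text \<open>Without a core, full cliques have at most five clusters, and
  \<open>full_clique_sum\<close> excludes \<open>|S| \<le> 7\<close>, since 12/70 exceeds 0.1675.
  Larger supports miss \<open>A\<close> and have at most 11 clusters. There a full 5-clique would be
  a pentagon, so \<open>k = 4\<close> is available, and 15/88 exceeds 0.1675 as well.\<close>

theorem core_exists: has_core
proof (rule ccontr)
  assume nc: "\<not> has_core"
  have cl5: "card C \<le> 5" if "C \<subseteq> S" "\<And>i j. i \<in> C \<Longrightarrow> j \<in> C \<Longrightarrow> i \<noteq> j \<Longrightarrow> full i j" for C
  proof (rule ccontr)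
    assume "\<not> ?thesis"
    then show False using full_K6_core[of C] that nc SI by auto
  qed
  have "S \<noteq> {}" using xsum by auto
  then have N0: "card S > 0" using finS by (simp add: card_gt_0_iff)
  have N8: "card S \<ge> 8"
  proof (rule ccontr)
    assume "\<not> ?thesis"
    then have N: "real (card S) \<le> 7" by simp
    have "sum x S * (real 5 + real (card S)) \<le> 2 * real 5 * real (card S) * \<mu>"
      by (rule full_clique_sum) (use cl5 in auto)
    moreover have "real (card S) * \<mu> \<le> real (card S) * 0.1675" by (rule mult_left_mono) (use mu in auto)
    ultimately show False using N xsum by simp
  qed
  have "card (S \<inter> A) < 2" using many_A N8 by (cases "card (S \<inter> A) \<ge> 2") auto
  moreover have "card (S \<inter> A) \<noteq> 1" using one_A_false N8 by (auto simp: card_1_singleton_iff)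
  ultimately have "card (S \<inter> A) = 0" by linarith
  then have SA: "S \<inter> A = {}" using finS by simp
  have N11: "card S \<le> 11" using no_A_false_large[OF SA] by (cases "card S \<ge> 12") auto
  have cl4: "card C \<le> 4" if C: "C \<subseteq> S" "\<And>i j. i \<in> C \<Longrightarrow> j \<in> C \<Longrightarrow> i \<noteq> j \<Longrightarrow> full i j" for C
  proof (rule ccontr)
    assume "\<not> ?thesis"
    then have C5: "card C = 5" using cl5[OF that] by simp
    obtain a b c d e where p: "C = {a,b,c,d,e}" "distinct [a,b,c,d,e]"
      "F a b" "F b c" "F c d" "F d e" "F e a" "\<not> F a c" "\<not> F b d" "\<not> F c e" "\<not> F d a" "\<not> F e b"
    proof (rule two_coloured_K5_pentagon[of C F, OF C5 symF])
      show "\<not> F u w" if "u \<in> C" "v \<in> C" "w \<in> C" "F u v" "F v w" for u v w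
        using noF3[OF SA, of u v w] that C(1) by auto
      show "F u w" if "u \<in> C" "v \<in> C" "w \<in> C" "u \<noteq> v" "v \<noteq> w" "u \<noteq> w" "\<not> F u v" "\<not> F v w" for u v w
        using red_tri[of u v w] C(2)[of u v] C(2)[of v w] C(2)[of u w] that C(1) unfolding full_def by blast
    qed
    have "pent a b c d e"
      unfolding pent_def using p C(1) C(2)[of a c] C(2)[of b d] C(2)[of c e] C(2)[of d a] C(2)[of e b] by (auto simp: full_def)
    then show False by (rule no_pent[OF SA])
  qed
  have "sum x S * (real 4 + real (card S)) \<le> 2 * real 4 * real (card S) * \<mu>"
    by (rule full_clique_sum) (use cl4 in auto)
  moreover have "real (card S) * \<mu> \<le> real (card S) * 0.1675" by (rule mult_left_mono) (use mu in auto)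
  moreover have "real (card S) \<le> 11" using N11 by simp
  ultimately show False using xsum by simp
qed

end

theorem (in reduced) dense_has_core:
  assumes y: "\<And>i. i \<in> I \<Longrightarrow> 0 \<le> y i" "sum y I = 1" and dense: "quad I w y > 0.8325"
  shows has_core
proof -
  have wsym: "w k l = w l k" for k l using full_sym[of k l] half_sym[of k l] by (simp add: w_def)
  have wdiag: "w k k = 0" for k using full_irr half_irr by (simp add: w_def)
  obtain S x where Sx: "S \<subseteq> I" "\<And>i. i \<in> S \<Longrightarrow> x i > 0" "sum x S = 1"
    "\<And>i j. i \<in> S \<Longrightarrow> j \<in> S \<Longrightarrow> i \<noteq> j \<Longrightarrow> w i j \<noteq> 0"
    "\<And>i. i \<in> S \<Longrightarrow> lin S w x i \<ge> quad I w y"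
    "\<And>i j. i \<in> S \<Longrightarrow> j \<in> S \<Longrightarrow> lin S w x i = lin S w x j"
  proof (rule lagrangian_max[where w = w and ?x0.0 = y, OF fin wsym wdiag])
    show "0 \<le> y i" if "i \<in> I" for i by (rule y(1)[OF that])
    show "sum y I = 1" by (rule y(2))
  qed (rule that, assumption+)
  have fS: "finite S" using Sx(1) fin finite_subset by blast
  have "S \<noteq> {}" using Sx(3) by auto
  then obtain i0 where i0: "i0 \<in> S" by blast
  define \<mu> where "\<mu> = 1 - lin S w x i0"
  have cl: "R i j \<or> F i j \<or> H i j" if "i \<in> S" "j \<in> S" "i \<noteq> j" for i j
    using Sx(4)[OF that] by (auto simp: w_def full_def half_def split: if_splits)
  have kkt: "x i + (\<Sum>j\<in>{j\<in>S. half i j}. x j) / 2 = \<mu>" if i: "i \<in> S" for i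
  proof -
    have "lin S w x i = (\<Sum>j\<in>S. x j - (if j = i then x i else 0) - (if j \<in> {j\<in>S. half i j} then x j / 2 else 0))"
      unfolding lin_def
    proof (rule sum.cong[OF refl])
      fix j assume "j \<in> S"
      then show "w i j * x j = x j - (if j = i then x i else 0) - (if j \<in> {j\<in>S. half i j} then x j / 2 else 0)"
        using cl[of i j] i full_irr[of i] half_irr[of i] full_half[of i j] by (auto simp: w_def full_def half_def)
    qed
    also have "\<dots> = 1 - x i - sum (\<lambda>j. x j / 2) (S \<inter> {j\<in>S. half i j})"
      using fS i Sx(3) by (simp add: sum_subtractf sum.delta' sum.inter_restrict)
    also have "S \<inter> {j\<in>S. half i j} = {j\<in>S. half i j}" by blast
    finally show ?thesis using Sx(6)[OF i i0] by (simp add: \<mu>_def sum_divide_distrib)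
  qed
  have "\<mu> < 0.1675" using Sx(5)[OF i0] dense by (simp add: \<mu>_def)
  then interpret reduced_opt I A R F H L S x \<mu>
    by unfold_locales (use Sx(1-3) cl kkt in auto)
  show ?thesis by (rule core_exists)
qed

section \<open>A regularity lemma\<close>

definition ecount :: "('a \<Rightarrow> 'a \<Rightarrow> bool) \<Rightarrow> 'a set \<Rightarrow> 'a set \<Rightarrow> real" where
  "ecount r X Y = (\<Sum>x\<in>X. \<Sum>y\<in>Y. of_bool (r x y))"

definition dens :: "('a \<Rightarrow> 'a \<Rightarrow> bool) \<Rightarrow> 'a set \<Rightarrow> 'a set \<Rightarrow> real" where
  "dens r X Y = ecount r X Y / (real (card X) * real (card Y))"

definition regular :: "real \<Rightarrow> ('a \<Rightarrow> 'a \<Rightarrow> bool) \<Rightarrow> 'a set \<Rightarrow> 'a set \<Rightarrow> bool" where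
  "regular \<epsilon> r X Y \<longleftrightarrow> (\<forall>A B. A \<subseteq> X \<longrightarrow> B \<subseteq> Y \<longrightarrow> \<epsilon> * card X \<le> card A \<longrightarrow> \<epsilon> * card Y \<le> card B \<longrightarrow>
     \<bar>dens r A B - dens r X Y\<bar> \<le> \<epsilon>)"

text \<open>The labelling \<open>f\<close> stands for the partition of \<open>V\<close> into its fibres.\<close>
definition cell :: "'a set \<Rightarrow> ('a \<Rightarrow> nat) \<Rightarrow> nat \<Rightarrow> 'a set" where
  "cell V f a = {x\<in>V. f x = a}"

definition avg :: "('a \<Rightarrow> 'a \<Rightarrow> bool) \<Rightarrow> 'a set \<Rightarrow> ('a \<Rightarrow> nat) \<Rightarrow> 'a \<Rightarrow> 'a \<Rightarrow> real" where
  "avg r V f x y = dens r (cell V f (f x)) (cell V f (f y))"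

text \<open>The sum runs over vertex pairs instead of weighted pairs of cells, which makes energies
  of different labellings comparable term by term. Summing over colours yields one partition for all
  colours at once.\<close>

definition energy :: "('c \<Rightarrow> 'a \<Rightarrow> 'a \<Rightarrow> bool) \<Rightarrow> 'a set \<Rightarrow> ('a \<Rightarrow> nat) \<Rightarrow> real" where
  "energy r V f = (\<Sum>c\<in>UNIV. \<Sum>x\<in>V. \<Sum>y\<in>V. (avg (r c) V f x y)^2)"

definition irregularity :: "real \<Rightarrow> ('c \<Rightarrow> 'a \<Rightarrow> 'a \<Rightarrow> bool) \<Rightarrow> 'a set \<Rightarrow> ('a \<Rightarrow> nat) \<Rightarrow> real" where
  "irregularity \<epsilon> r V f = (\<Sum>c\<in>UNIV. \<Sum>a\<in>f ` V. \<Sum>b\<in>f ` V.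
     if regular \<epsilon> (r c) (cell V f a) (cell V f b) then 0 else real (card (cell V f a)) * real (card (cell V f b)))"

lemma ecount_nonneg: "ecount r X Y \<ge> 0"
  unfolding ecount_def by (intro sum_nonneg) auto

lemma ecount_le: "ecount r X Y \<le> real (card X) * real (card Y)"
proof -
  have "ecount r X Y \<le> (\<Sum>x\<in>X. \<Sum>y\<in>Y. 1)" unfolding ecount_def by (intro sum_mono) auto
  then show ?thesis by simp
qed

lemma dens_bounds: "0 \<le> dens r X Y" "dens r X Y \<le> 1"
proof -
  show "0 \<le> dens r X Y" using ecount_nonneg[of r X Y] by (simp add: dens_def)
  show "dens r X Y \<le> 1"
    unfolding dens_def using ecount_le[of r X Y] by (intro divide_le_eq_1[THEN iffD2]) (auto simp: zero_less_mult_iff)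
qed

lemma ecount_dens: assumes "finite X" "finite Y" shows "ecount r X Y = dens r X Y * (real (card X) * real (card Y))"
proof (cases "card X = 0 \<or> card Y = 0")
  case True
  then have "ecount r X Y = 0" using assms by (auto simp: ecount_def)
  then show ?thesis using True by auto
qed (simp add: dens_def)

lemma sum_cells:
  assumes "finite V" "T1 \<subseteq> V" "T2 \<subseteq> V"
    and "\<And>x y. x \<in> T1 \<Longrightarrow> y \<in> V \<Longrightarrow> f y = f x \<Longrightarrow> y \<in> T1" "\<And>x y. x \<in> T2 \<Longrightarrow> y \<in> V \<Longrightarrow> f y = f x \<Longrightarrow> y \<in> T2"
  shows "(\<Sum>x\<in>T1. \<Sum>y\<in>T2. \<phi> x y) = (\<Sum>a\<in>f ` T1. \<Sum>b\<in>f ` T2. \<Sum>x\<in>cell V f a. \<Sum>y\<in>cell V f b. (\<phi> x y :: real))"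
proof -
  have fin: "finite T1" "finite T2" using finite_subset[OF assms(2,1)] finite_subset[OF assms(3,1)] by auto
  have c1: "{x\<in>T1. f x = a} = cell V f a" if "a \<in> f ` T1" for a
  proof
    show "{x\<in>T1. f x = a} \<subseteq> cell V f a" using assms(2) by (auto simp: cell_def)
    show "cell V f a \<subseteq> {x\<in>T1. f x = a}" using that assms(4) by (fastforce simp: cell_def)
  qed
  have c2: "{x\<in>T2. f x = a} = cell V f a" if "a \<in> f ` T2" for a
  proof
    show "{x\<in>T2. f x = a} \<subseteq> cell V f a" using assms(3) by (auto simp: cell_def)
    show "cell V f a \<subseteq> {x\<in>T2. f x = a}" using that assms(5) by (fastforce simp: cell_def)
  qed
  have "(\<Sum>x\<in>T1. \<Sum>y\<in>T2. \<phi> x y) = (\<Sum>a\<in>f ` T1. \<Sum>x\<in>{x\<in>T1. f x = a}. \<Sum>y\<in>T2. \<phi> x y)"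
    by (rule sum.image_gen[OF fin(1)])
  also have "\<dots> = (\<Sum>a\<in>f ` T1. \<Sum>x\<in>cell V f a. \<Sum>b\<in>f ` T2. \<Sum>y\<in>cell V f b. \<phi> x y)"
  proof (rule sum.cong[OF refl])
    fix a assume a: "a \<in> f ` T1"
    show "(\<Sum>x\<in>{x\<in>T1. f x = a}. \<Sum>y\<in>T2. \<phi> x y) = (\<Sum>x\<in>cell V f a. \<Sum>b\<in>f ` T2. \<Sum>y\<in>cell V f b. \<phi> x y)"
      unfolding c1[OF a]
    proof (rule sum.cong[OF refl])
      fix x
      have "(\<Sum>y\<in>T2. \<phi> x y) = (\<Sum>b\<in>f ` T2. \<Sum>y\<in>{y\<in>T2. f y = b}. \<phi> x y)"
        by (rule sum.image_gen[OF fin(2)])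
      also have "\<dots> = (\<Sum>b\<in>f ` T2. \<Sum>y\<in>cell V f b. \<phi> x y)"
        by (rule sum.cong[OF refl]) (simp add: c2)
      finally show "(\<Sum>y\<in>T2. \<phi> x y) = (\<Sum>b\<in>f ` T2. \<Sum>y\<in>cell V f b. \<phi> x y)" .
    qed
  qed
  also have "\<dots> = (\<Sum>a\<in>f ` T1. \<Sum>b\<in>f ` T2. \<Sum>x\<in>cell V f a. \<Sum>y\<in>cell V f b. \<phi> x y)"
    by (rule sum.cong[OF refl], rule sum.swap)
  finally show ?thesis .
qed

lemma sum_avg:
  assumes "finite V" "T1 \<subseteq> V" "T2 \<subseteq> V"
    and "\<And>x y. x \<in> T1 \<Longrightarrow> y \<in> V \<Longrightarrow> f y = f x \<Longrightarrow> y \<in> T1" "\<And>x y. x \<in> T2 \<Longrightarrow> y \<in> V \<Longrightarrow> f y = f x \<Longrightarrow> y \<in> T2"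
  shows "(\<Sum>x\<in>T1. \<Sum>y\<in>T2. avg r V f x y) = ecount r T1 T2"
proof -
  have "(\<Sum>x\<in>T1. \<Sum>y\<in>T2. avg r V f x y) = (\<Sum>a\<in>f ` T1. \<Sum>b\<in>f ` T2. \<Sum>x\<in>cell V f a. \<Sum>y\<in>cell V f b. avg r V f x y)"
    by (rule sum_cells[OF assms])
  also have "\<dots> = (\<Sum>a\<in>f ` T1. \<Sum>b\<in>f ` T2. ecount r (cell V f a) (cell V f b))"
  proof (intro sum.cong[OF refl])
    fix a b
    have "(\<Sum>x\<in>cell V f a. \<Sum>y\<in>cell V f b. avg r V f x y) = (\<Sum>x\<in>cell V f a. \<Sum>y\<in>cell V f b. dens r (cell V f a) (cell V f b))"
      by (intro sum.cong refl) (auto simp: avg_def cell_def)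
    also have "\<dots> = ecount r (cell V f a) (cell V f b)"
      using assms(1) by (subst ecount_dens) (auto simp: cell_def)
    finally show "(\<Sum>x\<in>cell V f a. \<Sum>y\<in>cell V f b. avg r V f x y) = ecount r (cell V f a) (cell V f b)" .
  qed
  also have "\<dots> = ecount r T1 T2" unfolding ecount_def by (rule sum_cells[OF assms, symmetric])
  finally show ?thesis .
qed

lemma double_sum_square:
  fixes h :: "'a \<Rightarrow> 'a \<Rightarrow> real"
  shows "(\<Sum>x\<in>A. \<Sum>y\<in>B. h x y)^2 \<le> real (card A) * real (card B) * (\<Sum>x\<in>A. \<Sum>y\<in>B. (h x y)^2)"
  using Cauchy_Schwarz_ineq_sum[of "\<lambda>_. 1" "\<lambda>(x,y). h x y" "A \<times> B"]
  by (simp add: sum.cartesian_product card_cartesian_product split_def)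

definition finer :: "'a set \<Rightarrow> ('a \<Rightarrow> nat) \<Rightarrow> ('a \<Rightarrow> nat) \<Rightarrow> bool" where
  "finer V f' f \<longleftrightarrow> (\<forall>x\<in>V. \<forall>y\<in>V. f' x = f' y \<longrightarrow> f x = f y)"

text \<open>Pythagoras: since the cells of \<open>f'\<close> subdivide \<open>X\<close> and
  \<open>Y\<close>, the finer averages have mean \<open>dens r X Y\<close> on \<open>X\<close> times
  \<open>Y\<close>.\<close>

lemma cell_energy:
  fixes a b :: nat
  assumes V: "finite V" and ref: "finer V f' f"
  defines "X \<equiv> cell V f a" and "Y \<equiv> cell V f b"
  shows "(\<Sum>x\<in>X. \<Sum>y\<in>Y. (avg r V f' x y)^2) =
    (\<Sum>x\<in>X. \<Sum>y\<in>Y. (avg r V f x y)^2) + (\<Sum>x\<in>X. \<Sum>y\<in>Y. (avg r V f' x y - dens r X Y)^2)"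
proof -
  let ?d = "dens r X Y"
  have fin: "finite X" "finite Y" using V by (auto simp: X_def Y_def cell_def)
  have s: "(\<Sum>x\<in>X. \<Sum>y\<in>Y. avg r V f' x y) = ?d * (real (card X) * real (card Y))"
    unfolding ecount_dens[OF fin, symmetric]
  proof (rule sum_avg[OF V])
    have *: "y \<in> cell V f k" if "x \<in> cell V f k" "y \<in> V" "f' y = f' x" for x y k
    proof -
      have "f y = f x" using ref that unfolding finer_def cell_def by blast
      then show ?thesis using that by (simp add: cell_def)
    qed
    show "y \<in> X" if "x \<in> X" "y \<in> V" "f' y = f' x" for x y using *[OF that[unfolded X_def]] by (simp add: X_def)
    show "y \<in> Y" if "x \<in> Y" "y \<in> V" "f' y = f' x" for x y using *[OF that[unfolded Y_def]] by (simp add: Y_def)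
  qed (auto simp: X_def Y_def cell_def)
  have q: "(\<Sum>x\<in>X. \<Sum>y\<in>Y. (avg r V f x y)^2) = (\<Sum>x\<in>X. \<Sum>y\<in>Y. ?d^2)"
    by (intro sum.cong refl) (auto simp: avg_def X_def Y_def cell_def)
  have "(\<Sum>x\<in>X. \<Sum>y\<in>Y. (avg r V f' x y - ?d)^2)
     = (\<Sum>x\<in>X. \<Sum>y\<in>Y. (avg r V f' x y)^2 - 2 * ?d * avg r V f' x y + ?d^2)"
    by (intro sum.cong refl) (simp add: power2_eq_square algebra_simps)
  also have "\<dots> = (\<Sum>x\<in>X. \<Sum>y\<in>Y. (avg r V f' x y)^2) - 2 * ?d * (\<Sum>x\<in>X. \<Sum>y\<in>Y. avg r V f' x y)
      + (\<Sum>x\<in>X. \<Sum>y\<in>Y. ?d^2)"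
    by (simp add: sum.distrib sum_subtractf sum_distrib_left)
  finally show ?thesis unfolding q s by (simp add: power2_eq_square algebra_simps)
qed

text \<open>Because \<open>A\<close> and \<open>B\<close> are unions of cells of \<open>f'\<close>,
  the finer averages keep the deviation of more than \<open>\<epsilon>\<close> on \<open>A\<close>
  times \<open>B\<close>. Cauchy-Schwarz gives \<open>\<epsilon>^2\<close> times the size of that
  rectangle, which is itself at least \<open>\<epsilon>^2\<close> of the whole.\<close>

lemma irregular_gain:
  fixes \<epsilon> :: real
  assumes V: "finite V" and e: "\<epsilon> > 0" and X: "X \<subseteq> V" "Y \<subseteq> V" and A: "A \<subseteq> X" and B: "B \<subseteq> Y"
    and big: "\<epsilon> * card X \<le> card A" "\<epsilon> * card Y \<le> card B" and irr: "\<bar>dens r A B - dens r X Y\<bar> > \<epsilon>"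
    and cl: "\<And>x y. x \<in> A \<Longrightarrow> y \<in> V \<Longrightarrow> f' y = f' x \<Longrightarrow> y \<in> A" "\<And>x y. x \<in> B \<Longrightarrow> y \<in> V \<Longrightarrow> f' y = f' x \<Longrightarrow> y \<in> B"
  shows "(\<Sum>x\<in>X. \<Sum>y\<in>Y. (avg r V f' x y - dens r X Y)^2) \<ge> \<epsilon>^4 * (real (card X) * real (card Y))"
proof -
  let ?d = "dens r X Y"
  have fin: "finite X" "finite Y" "finite A" "finite B" using finite_subset[OF X(1) V] finite_subset[OF X(2) V] A B by (auto intro: finite_subset)
  define ab where "ab = real (card A) * real (card B)"
  have "ab \<ge> (\<epsilon> * card X) * (\<epsilon> * card Y)"
    unfolding ab_def by (rule mult_mono) (use big e in auto)
  then have ab1: "ab \<ge> \<epsilon>^2 * (real (card X) * real (card Y))" by (simp add: power2_eq_square mult_ac)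
  have ab0: "ab \<ge> 0" by (simp add: ab_def)
  have s: "(\<Sum>x\<in>A. \<Sum>y\<in>B. avg r V f' x y - ?d) = (dens r A B - ?d) * ab"
  proof -
    have "(\<Sum>x\<in>A. \<Sum>y\<in>B. avg r V f' x y) = dens r A B * ab"
      unfolding ab_def ecount_dens[OF fin(3,4), symmetric]
      by (rule sum_avg[OF V _ _ cl]) (use A B X in auto)
    then show ?thesis by (simp add: sum_subtractf ab_def algebra_simps)
  qed
  define Q where "Q = (\<Sum>x\<in>A. \<Sum>y\<in>B. (avg r V f' x y - ?d)^2)"
  have "((dens r A B - ?d) * ab)^2 \<le> ab * Q"
    using double_sum_square[of "\<lambda>x y. avg r V f' x y - ?d" B A] unfolding s ab_def Q_def by simp
  then have "ab * ((dens r A B - ?d)^2 * ab) \<le> ab * Q" by (simp add: power2_eq_square mult_ac)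
  moreover have Q0: "Q \<ge> 0" unfolding Q_def by (intro sum_nonneg) auto
  ultimately have "(dens r A B - ?d)^2 * ab \<le> Q"
    using ab0 by (cases "ab = 0") auto
  moreover have "\<epsilon>^2 * ab \<le> (dens r A B - ?d)^2 * ab"
  proof (rule mult_right_mono[OF _ ab0])
    have "\<epsilon>^2 \<le> \<bar>dens r A B - ?d\<bar>^2" by (rule power_mono) (use irr e in auto)
    then show "\<epsilon>^2 \<le> (dens r A B - ?d)^2" by simp
  qed
  moreover have "\<epsilon>^2 * (\<epsilon>^2 * (real (card X) * real (card Y))) \<le> \<epsilon>^2 * ab"
    by (rule mult_left_mono[OF ab1]) simp
  moreover have "Q \<le> (\<Sum>x\<in>X. \<Sum>y\<in>Y. (avg r V f' x y - ?d)^2)"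
  proof -
    have "Q \<le> (\<Sum>x\<in>A. \<Sum>y\<in>Y. (avg r V f' x y - ?d)^2)"
      unfolding Q_def by (rule sum_mono, rule sum_mono2) (use fin B in auto)
    also have "\<dots> \<le> (\<Sum>x\<in>X. \<Sum>y\<in>Y. (avg r V f' x y - ?d)^2)"
      by (rule sum_mono2) (use fin A in \<open>auto intro: sum_nonneg\<close>)
    finally show ?thesis .
  qed
  ultimately show ?thesis by (simp add: power4_eq_xxxx power2_eq_square mult_ac)
qed

lemma energy_le:
  fixes r :: "'c::finite \<Rightarrow> 'a \<Rightarrow> 'a \<Rightarrow> bool"
  shows "energy r V f \<le> CARD('c) * (real (card V))^2"
proof -
  have "energy r V f \<le> (\<Sum>c\<in>(UNIV::'c set). \<Sum>x\<in>V. \<Sum>y\<in>V. 1)"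
    unfolding energy_def
  proof (intro sum_mono)
    show "(avg (r c) V f x y)\<^sup>2 \<le> 1" for c x y
      unfolding avg_def using dens_bounds[of "r c" "cell V f (f x)" "cell V f (f y)"] by (simp add: power_le_one)
  qed
  then show ?thesis by (simp add: power2_eq_square mult.assoc)
qed

text \<open>All cells are cut simultaneously along the witnesses of all irregular pairs. Each such
  pair then gains \<open>\<epsilon>^4\<close> times its size, and the remaining pairs lose
  nothing.\<close>

lemma energy_step:
  fixes r :: "'c::finite \<Rightarrow> 'a \<Rightarrow> 'a \<Rightarrow> bool"
  assumes V: "finite V" and e: "\<epsilon> > 0" and fK: "f ` V \<subseteq> {..<K}"
    and bad: "irregularity \<epsilon> r V f > \<epsilon> * (real (card V))^2"
  obtains f' where "f' ` V \<subseteq> {..<K * (2 ^ (CARD('c) * K) * 2 ^ (CARD('c) * K))}" "finer V f' f"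
    "energy r V f' \<ge> energy r V f + \<epsilon>^5 * (real (card V))^2"
proof -
  define wit where "wit c a b A B \<longleftrightarrow> A \<subseteq> cell V f a \<and> B \<subseteq> cell V f b \<and> \<epsilon> * card (cell V f a) \<le> card A \<and>
     \<epsilon> * card (cell V f b) \<le> card B \<and> \<bar>dens (r c) A B - dens (r c) (cell V f a) (cell V f b)\<bar> > \<epsilon>" for c a b A B
  have "\<exists>W. \<forall>c a b. \<not> regular \<epsilon> (r c) (cell V f a) (cell V f b) \<longrightarrow> wit c a b (fst (W c a b)) (snd (W c a b))"
  proof -
    have "\<forall>c a b. \<exists>p. \<not> regular \<epsilon> (r c) (cell V f a) (cell V f b) \<longrightarrow> wit c a b (fst p) (snd p)"
      by (auto simp: regular_def wit_def not_le)
    then show ?thesis by metis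
  qed
  then obtain W where W: "\<And>c a b. \<not> regular \<epsilon> (r c) (cell V f a) (cell V f b) \<Longrightarrow> wit c a b (fst (W c a b)) (snd (W c a b))"
    by blast
  define Aw where "Aw c a b = fst (W c a b)" for c a b
  define Bw where "Bw c a b = snd (W c a b)" for c a b
  \<comment> \<open>The new label remembers the old cell and, for each colour and each partner cell,
    on which side of the witness set \<open>x\<close> lies, as first and as second component of the
    pair.\<close>
  define h where "h x = (f x, {(c,b). b < K \<and> x \<in> Aw c (f x) b}, {(c,a). a < K \<and> x \<in> Bw c a (f x)})" for x
  let ?U = "UNIV \<times> {..<K} :: ('c \<times> nat) set"
  have fU: "finite ?U" by simp
  have cU: "card ?U = CARD('c) * K" by (simp add: card_cartesian_product)
  have hsub: "h ` V \<subseteq> {..<K} \<times> (Pow ?U \<times> Pow ?U)" using fK by (auto simp: h_def)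
  have fh: "finite (h ` V)" using V by simp
  have "card (h ` V) \<le> card ({..<K} \<times> (Pow ?U \<times> Pow ?U))"
    by (rule card_mono[OF _ hsub]) simp
  also have "\<dots> = K * (2 ^ (CARD('c) * K) * 2 ^ (CARD('c) * K))"
    by (simp add: card_cartesian_product card_Pow cU)
  finally have ch: "card (h ` V) \<le> K * (2 ^ (CARD('c) * K) * 2 ^ (CARD('c) * K))" .
  \<comment> \<open>The structured labels are renumbered by an initial segment, so that the number
    of cells is again bounded by the range of a natural-number labelling.\<close>
  obtain \<phi> :: "_ \<Rightarrow> nat" and n where \<phi>: "\<phi> ` (h ` V) = {i. i < n}" "inj_on \<phi> (h ` V)"
    using finite_imp_inj_to_nat_seg[OF fh] by blast
  have "n = card (h ` V)" using card_image[OF \<phi>(2)] \<phi>(1) by simp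
  define f' where "f' x = \<phi> (h x)" for x
  have f'h: "h x = h y" if "x \<in> V" "y \<in> V" "f' x = f' y" for x y
    using inj_onD[OF \<phi>(2), of "h x" "h y"] that by (simp add: f'_def)
  have img: "f' ` V \<subseteq> {..<K * (2 ^ (CARD('c) * K) * 2 ^ (CARD('c) * K))}"
  proof -
    have "f' ` V = {i. i < n}" unfolding f'_def using \<phi>(1) by (simp add: image_image)
    then show ?thesis using \<open>n = card (h ` V)\<close> ch by auto
  qed
  have ref: "finer V f' f"
    unfolding finer_def
  proof (intro ballI impI)
    fix x y assume "x \<in> V" "y \<in> V" "f' x = f' y"
    from f'h[OF this] show "f x = f y" by (simp add: h_def)
  qed
  have gain: "(\<Sum>x\<in>cell V f a. \<Sum>y\<in>cell V f b. (avg (r c) V f' x y)^2) \<ge>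
      (\<Sum>x\<in>cell V f a. \<Sum>y\<in>cell V f b. (avg (r c) V f x y)^2) + \<epsilon>^4 *
       (if regular \<epsilon> (r c) (cell V f a) (cell V f b) then 0 else real (card (cell V f a)) * real (card (cell V f b)))"
    if ab: "a \<in> f ` V" "b \<in> f ` V" for a b c
  proof (cases "regular \<epsilon> (r c) (cell V f a) (cell V f b)")
    case True
    have "(\<Sum>x\<in>cell V f a. \<Sum>y\<in>cell V f b. (avg (r c) V f' x y - dens (r c) (cell V f a) (cell V f b))^2) \<ge> 0"
      by (intro sum_nonneg) auto
    then show ?thesis using True cell_energy[OF V ref, where a=a and b=b and r="r c"] by simp
  next
    case False
    note wi = W[OF False, folded Aw_def Bw_def, unfolded wit_def]
    have aK: "a < K" "b < K" using ab fK by auto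
    have cA: "y \<in> Aw c a b" if "x \<in> Aw c a b" "y \<in> V" "f' y = f' x" for x y
    proof -
      have x: "x \<in> V" "f x = a" using wi that by (auto simp: cell_def)
      have "h y = h x" using f'h[OF that(2) x(1) that(3)] .
      then have "f y = f x" "{(c,b). b < K \<and> y \<in> Aw c (f y) b} = {(c,b). b < K \<and> x \<in> Aw c (f x) b}"
        unfolding h_def prod.inject by - ((elim conjE, assumption)+)
      from this(2) have "(c,b) \<in> {(c,b). b < K \<and> y \<in> Aw c (f y) b} \<longleftrightarrow> (c,b) \<in> {(c,b). b < K \<and> x \<in> Aw c (f x) b}"
        by (simp only:)
      then show ?thesis using x aK that \<open>f y = f x\<close> by simp
    qed
    have cB: "y \<in> Bw c a b" if "x \<in> Bw c a b" "y \<in> V" "f' y = f' x" for x y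
    proof -
      have x: "x \<in> V" "f x = b" using wi that by (auto simp: cell_def)
      have "h y = h x" using f'h[OF that(2) x(1) that(3)] .
      then have "f y = f x" "{(c,a). a < K \<and> y \<in> Bw c a (f y)} = {(c,a). a < K \<and> x \<in> Bw c a (f x)}"
        unfolding h_def prod.inject by - ((elim conjE, assumption)+)
      from this(2) have "(c,a) \<in> {(c,a). a < K \<and> y \<in> Bw c a (f y)} \<longleftrightarrow> (c,a) \<in> {(c,a). a < K \<and> x \<in> Bw c a (f x)}"
        by (simp only:)
      then show ?thesis using x aK that \<open>f y = f x\<close> by simp
    qed
    have "(\<Sum>x\<in>cell V f a. \<Sum>y\<in>cell V f b. (avg (r c) V f' x y - dens (r c) (cell V f a) (cell V f b))^2)
       \<ge> \<epsilon>^4 * (real (card (cell V f a)) * real (card (cell V f b)))"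
      by (rule irregular_gain[OF V e _ _ _ _ _ _ _ cA cB]) (use wi in \<open>auto simp: cell_def\<close>)
    then show ?thesis using False cell_energy[OF V ref, where a=a and b=b and r="r c"] by simp
  qed
  have split: "energy r V f0 = (\<Sum>c\<in>UNIV. \<Sum>a\<in>f ` V. \<Sum>b\<in>f ` V. \<Sum>x\<in>cell V f a. \<Sum>y\<in>cell V f b. (avg (r c) V f0 x y)^2)" for f0
    unfolding energy_def by (rule sum.cong[OF refl], rule sum_cells[OF V]) auto
  have "energy r V f + \<epsilon>^4 * irregularity \<epsilon> r V f = (\<Sum>c\<in>UNIV. \<Sum>a\<in>f ` V. \<Sum>b\<in>f ` V.
      (\<Sum>x\<in>cell V f a. \<Sum>y\<in>cell V f b. (avg (r c) V f x y)^2) + \<epsilon>^4 *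
       (if regular \<epsilon> (r c) (cell V f a) (cell V f b) then 0 else real (card (cell V f a)) * real (card (cell V f b))))"
    unfolding split irregularity_def by (simp only: sum.distrib sum_distrib_left)
  also have "\<dots> \<le> energy r V f'"
    unfolding split by (intro sum_mono gain)
  finally have main: "energy r V f + \<epsilon>^4 * irregularity \<epsilon> r V f \<le> energy r V f'" .
  have "\<epsilon>^4 * (\<epsilon> * (real (card V))^2) \<le> \<epsilon>^4 * irregularity \<epsilon> r V f"
    by (rule mult_left_mono) (use bad e in auto)
  then have "energy r V f' \<ge> energy r V f + \<epsilon>^5 * (real (card V))^2"
    using main by (simp add: power4_eq_xxxx eval_nat_numeral mult_ac)
  then show ?thesis by (rule that[OF img ref])
qed

lemma finer_trans: "finer V f g \<Longrightarrow> finer V g h \<Longrightarrow> finer V f h"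
proof -
  assume *: "finer V f g" "finer V g h"
  show ?thesis unfolding finer_def
  proof (intro ballI impI)
    fix x y assume "x \<in> V" "y \<in> V" "f x = f y"
    then have "g x = g y" using *(1) unfolding finer_def by blast
    then show "h x = h y" using *(2) \<open>x \<in> V\<close> \<open>y \<in> V\<close> unfolding finer_def by blast
  qed
qed

text \<open>\<open>j\<close> counts the refinements that may still be needed: each one gains
  \<open>\<epsilon>^5\<close> times the square of \<open>card V\<close>, and the energy never
  exceeds \<open>CARD('c)\<close> times that square, so at \<open>j = 0\<close> a further gain is
  impossible.\<close>

lemma regularity_aux:
  assumes e: "\<epsilon> > 0"
  shows "\<exists>K'. \<forall>(V::'a set) (r :: 'c::finite \<Rightarrow> 'a \<Rightarrow> 'a \<Rightarrow> bool) f. finite V \<longrightarrow> f ` V \<subseteq> {..<K} \<longrightarrow>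
     energy r V f \<ge> (CARD('c) - real j * \<epsilon>^5) * (real (card V))^2 \<longrightarrow>
     (\<exists>f'. f' ` V \<subseteq> {..<K'} \<and> finer V f' f \<and> irregularity \<epsilon> r V f' \<le> \<epsilon> * (real (card V))^2)"
proof (induction j arbitrary: K)
  case 0
  show ?case
  proof (intro exI[of _ K] allI impI)
    fix V :: "'a set" and r :: "'c \<Rightarrow> 'a \<Rightarrow> 'a \<Rightarrow> bool" and f :: "'a \<Rightarrow> nat"
    assume a: "finite V" "f ` V \<subseteq> {..<K}" "energy r V f \<ge> (CARD('c) - real 0 * \<epsilon>^5) * (real (card V))^2"
    have "irregularity \<epsilon> r V f \<le> \<epsilon> * (real (card V))^2"
    proof (rule ccontr)
      assume n: "\<not> ?thesis"
      obtain f' where "energy r V f' \<ge> energy r V f + \<epsilon>^5 * (real (card V))^2"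
        by (rule energy_step[OF a(1) e a(2), where r = r]) (use n in auto)
      \<comment> \<open>For empty \<open>V\<close> the guaranteed gain is zero and would not
        contradict the energy bound; there the irregularity itself vanishes.\<close>
      moreover have "card V \<noteq> 0"
      proof
        assume "card V = 0"
        then have "V = {}" using a(1) by simp
        then show False using n by (simp add: irregularity_def)
      qed
      then have "\<epsilon>^5 * (real (card V))^2 > 0" using e by simp
      ultimately show False using energy_le[of r V f'] a(3) by simp
    qed
    then show "\<exists>f'. f' ` V \<subseteq> {..<K} \<and> finer V f' f \<and> irregularity \<epsilon> r V f' \<le> \<epsilon> * (real (card V))^2"
      using a(2) by (intro exI[of _ f]) (auto simp: finer_def)
  qed
next
  case (Suc j)
  let ?K1 = "K * (2 ^ (CARD('c) * K) * 2 ^ (CARD('c) * K))"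
  from Suc.IH[of ?K1] obtain K' where "\<forall>(V::'a set) (r :: 'c \<Rightarrow> 'a \<Rightarrow> 'a \<Rightarrow> bool) f. finite V \<longrightarrow> f ` V \<subseteq> {..<?K1} \<longrightarrow>
     energy r V f \<ge> (CARD('c) - real j * \<epsilon>^5) * (real (card V))^2 \<longrightarrow>
     (\<exists>f'. f' ` V \<subseteq> {..<K'} \<and> finer V f' f \<and> irregularity \<epsilon> r V f' \<le> \<epsilon> * (real (card V))^2)"
    ..
  note K' = this[rule_format]
  show ?case
  proof (intro exI[of _ "max K K'"] allI impI)
    fix V :: "'a set" and r :: "'c \<Rightarrow> 'a \<Rightarrow> 'a \<Rightarrow> bool" and f :: "'a \<Rightarrow> nat"
    assume a: "finite V" "f ` V \<subseteq> {..<K}" "energy r V f \<ge> (CARD('c) - real (Suc j) * \<epsilon>^5) * (real (card V))^2"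
    show "\<exists>f'. f' ` V \<subseteq> {..<max K K'} \<and> finer V f' f \<and> irregularity \<epsilon> r V f' \<le> \<epsilon> * (real (card V))^2"
    proof (cases "irregularity \<epsilon> r V f \<le> \<epsilon> * (real (card V))^2")
      case True
      then show ?thesis using a(2) by (intro exI[of _ f]) (auto simp: finer_def)
    next
      case False
      obtain f1 where f1: "f1 ` V \<subseteq> {..<?K1}" "finer V f1 f"
        "energy r V f1 \<ge> energy r V f + \<epsilon>^5 * (real (card V))^2"
        by (rule energy_step[OF a(1) e a(2), where r = r]) (use False in auto)
      have "energy r V f1 \<ge> (CARD('c) - real j * \<epsilon>^5) * (real (card V))^2"
        using f1(3) a(3) by (simp add: algebra_simps)
      then obtain f' where "f' ` V \<subseteq> {..<K'}" "finer V f' f1" "irregularity \<epsilon> r V f' \<le> \<epsilon> * (real (card V))^2"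
        using K'[OF a(1) f1(1)] by blast
      then show ?thesis using finer_trans[OF _ f1(2)] by (intro exI[of _ f']) auto
    qed
  qed
qed

theorem regularity:
  assumes e: "\<epsilon> > 0"
  obtains K' where "\<And>(V::'a set) (r :: 'c::finite \<Rightarrow> 'a \<Rightarrow> 'a \<Rightarrow> bool) f. finite V \<Longrightarrow> f ` V \<subseteq> {..<K} \<Longrightarrow>
     \<exists>f'. f' ` V \<subseteq> {..<K'} \<and> finer V f' f \<and> irregularity \<epsilon> r V f' \<le> \<epsilon> * (real (card V))^2"
proof -
  obtain j :: nat where j: "real j * \<epsilon>^5 \<ge> CARD('c)"
    using e by (metis (full_types) reals_Archimedean3 less_imp_le zero_less_power)
  from regularity_aux[OF e, where 'a='a and 'c='c, of K j] obtain K' where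
     "\<forall>(V::'a set) (r :: 'c \<Rightarrow> 'a \<Rightarrow> 'a \<Rightarrow> bool) f. finite V \<longrightarrow> f ` V \<subseteq> {..<K} \<longrightarrow>
     energy r V f \<ge> (CARD('c) - real j * \<epsilon>^5) * (real (card V))^2 \<longrightarrow>
     (\<exists>f'. f' ` V \<subseteq> {..<K'} \<and> finer V f' f \<and> irregularity \<epsilon> r V f' \<le> \<epsilon> * (real (card V))^2)"
    ..
  note K' = this[rule_format]
  show ?thesis
  proof (rule that[of K'])
    fix V :: "'a set" and r :: "'c \<Rightarrow> 'a \<Rightarrow> 'a \<Rightarrow> bool" and f :: "'a \<Rightarrow> nat"
    assume a: "finite V" "f ` V \<subseteq> {..<K}"
    have "energy r V f \<ge> 0" unfolding energy_def by (intro sum_nonneg) auto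
    moreover have "(CARD('c) - real j * \<epsilon>^5) * (real (card V))^2 \<le> 0"
      by (rule mult_nonpos_nonneg) (use j in auto)
    ultimately show "\<exists>f'. f' ` V \<subseteq> {..<K'} \<and> finer V f' f \<and> irregularity \<epsilon> r V f' \<le> \<epsilon> * (real (card V))^2"
      by (intro K' a) simp
  qed
qed

lemma ecount_sym: assumes "\<And>x y. r x y \<longleftrightarrow> r y x" shows "ecount r X Y = ecount r Y X"
proof -
  have "ecount r X Y = (\<Sum>y\<in>Y. \<Sum>x\<in>X. of_bool (r x y))" unfolding ecount_def by (rule sum.swap)
  also have "\<dots> = ecount r Y X" unfolding ecount_def by (intro sum.cong refl) (subst assms, rule refl)
  finally show ?thesis .
qed

lemma dens_sym: assumes "\<And>x y. r x y \<longleftrightarrow> r y x" shows "dens r X Y = dens r Y X"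
  unfolding dens_def ecount_sym[of r X Y, OF assms] by (simp add: mult.commute)

lemma regular_sym: assumes "\<And>x y. r x y \<longleftrightarrow> r y x" "regular \<epsilon> r X Y" shows "regular \<epsilon> r Y X"
  unfolding regular_def
proof (intro allI impI)
  fix A B assume a: "A \<subseteq> Y" "B \<subseteq> X" "\<epsilon> * card Y \<le> card A" "\<epsilon> * card X \<le> card B"
  then have "\<bar>dens r B A - dens r X Y\<bar> \<le> \<epsilon>" using assms(2) unfolding regular_def by blast
  then show "\<bar>dens r A B - dens r Y X\<bar> \<le> \<epsilon>"
    unfolding dens_sym[of r A B, OF assms(1)] dens_sym[of r Y X, OF assms(1)] .
qed

lemma ecount_mono: assumes "\<And>x y. x \<in> X \<Longrightarrow> y \<in> Y \<Longrightarrow> r x y \<Longrightarrow> r' x y" shows "ecount r X Y \<le> ecount r' X Y"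
  unfolding ecount_def by (intro sum_mono) (use assms in auto)

lemma ecount_or: "ecount (\<lambda>x y. r x y \<or> r' x y) X Y \<le> ecount r X Y + ecount r' X Y"
  unfolding ecount_def sum.distrib[symmetric] by (intro sum_mono) auto

lemma ecount_deg: "finite Y \<Longrightarrow> ecount r X Y = (\<Sum>x\<in>X. real (card {y\<in>Y. r x y}))"
  unfolding ecount_def by (intro sum.cong refl) (simp add: sum.If_cases Int_def of_bool_def)

lemma few_low_degrees:
  assumes reg: "regular \<epsilon> r X Y" and fin: "finite X" "finite Y" and C: "C \<subseteq> X" "D \<subseteq> Y" and D: "\<epsilon> * card Y \<le> card D" "card D > 0"
    and e: "\<epsilon> > 0" and X: "card X > 0"
  shows "real (card {v\<in>C. real (card {y\<in>D. r v y}) < (dens r X Y - \<epsilon>) * card D}) \<le> \<epsilon> * card X"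
proof (rule ccontr)
  define B where "B = {v\<in>C. real (card {y\<in>D. r v y}) < (dens r X Y - \<epsilon>) * card D}"
  assume "\<not> ?thesis"
  then have big: "\<epsilon> * card X < card B" by (simp add: B_def)
  have "B \<subseteq> X" using C by (auto simp: B_def)
  have fD: "finite D" and fB: "finite B"
    using finite_subset[OF C(2) fin(2)] finite_subset[OF \<open>B \<subseteq> X\<close> fin(1)] by auto
  have "0 \<le> \<epsilon> * card X" using e by simp
  then have "B \<noteq> {}" using big by auto
  have "ecount r B D = (\<Sum>x\<in>B. real (card {y\<in>D. r x y}))" by (rule ecount_deg[OF fD])
  also have "\<dots> < (\<Sum>x\<in>B. (dens r X Y - \<epsilon>) * card D)"
    by (rule sum_strict_mono) (use fB \<open>B \<noteq> {}\<close> in \<open>auto simp: B_def\<close>)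
  finally have "ecount r B D < (dens r X Y - \<epsilon>) * (real (card B) * real (card D))" by (simp add: mult_ac)
  moreover have "real (card B) * real (card D) > 0" using fB \<open>B \<noteq> {}\<close> D by (simp add: card_gt_0_iff)
  ultimately have "dens r B D < dens r X Y - \<epsilon>" unfolding dens_def[of r B D] by (simp add: divide_less_eq)
  moreover have "\<bar>dens r B D - dens r X Y\<bar> \<le> \<epsilon>"
    using reg \<open>B \<subseteq> X\<close> C(2) big D(1) unfolding regular_def by auto
  ultimately show False by linarith
qed

section \<open>Embedding cliques and cores\<close>

text \<open>Colour \<open>True\<close> is red, \<open>False\<close> is blue.\<close>
locale rt_graph =
  fixes V A :: "nat set" and r :: "bool \<Rightarrow> nat \<Rightarrow> nat \<Rightarrow> bool" and m :: real
  assumes finV: "finite V" and AV: "A \<subseteq> V"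
    and symr: "r c x y \<longleftrightarrow> r c y x" and irr: "\<not> r c x x"
    and redA: "r True x y \<Longrightarrow> x \<notin> A"
    and red_triangle_free: "x \<in> V \<Longrightarrow> y \<in> V \<Longrightarrow> z \<in> V \<Longrightarrow> r True x y \<Longrightarrow> r True y z \<Longrightarrow> \<not> r True x z"
    and blue_K6_free: "K \<subseteq> V \<Longrightarrow> (\<And>x y. x \<in> K \<Longrightarrow> y \<in> K \<Longrightarrow> x \<noteq> y \<Longrightarrow> r False x y) \<Longrightarrow> card K \<le> 5"
    and blue_edge: "X \<subseteq> V - A \<Longrightarrow> real (card X) \<ge> m \<Longrightarrow> \<exists>u\<in>X. \<exists>v\<in>X. r False u v"
begin

text \<open>Clusters contributing a single vertex are treated first: two vertices of a doubled cluster
  have a large common neighbourhood only across pairs of density above one half.\<close>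
lemma embed:
  fixes X C :: "'b \<Rightarrow> nat set" and \<mu> :: "'b \<Rightarrow> nat" and col :: "'b \<Rightarrow> 'b \<Rightarrow> bool" and \<epsilon> \<epsilon>0 \<tau> :: real
  assumes e: "0 < \<epsilon>" "\<epsilon> \<le> \<epsilon>0 / 2" "12 * \<epsilon> \<le> \<tau>" "0 < \<epsilon>0" "\<epsilon>0 \<le> 1"
    and J: "finite J" "card J \<le> 6"
    and X: "\<And>i. i \<in> J \<Longrightarrow> X i \<subseteq> V \<and> card (X i) > 0"
    and C: "\<And>i. i \<in> J \<Longrightarrow> C i \<subseteq> X i \<and> real (card (C i)) \<ge> \<tau> * (2 / \<epsilon>0) ^ card J * real (card (X i))"
    and \<mu>: "\<And>i. i \<in> J \<Longrightarrow> \<mu> i = 1 \<or> \<mu> i = 2 \<and> X i \<inter> A = {} \<and> \<tau> / 2 * real (card (X i)) \<ge> m"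
    and pair: "\<And>i j. i \<in> J \<Longrightarrow> j \<in> J \<Longrightarrow> i \<noteq> j \<Longrightarrow> col i j = col j i \<and> regular \<epsilon> (r (col i j)) (X i) (X j) \<and>
       dens (r (col i j)) (X i) (X j) \<ge> \<epsilon>0 \<and> (\<mu> i = 2 \<and> \<mu> j = 2 \<longrightarrow> dens (r (col i j)) (X i) (X j) \<ge> 1/2 + \<epsilon>0)"
  shows "\<exists>K. (\<forall>i\<in>J. K i \<subseteq> C i \<and> card (K i) = \<mu> i \<and> (\<forall>x\<in>K i. \<forall>y\<in>K i. x \<noteq> y \<longrightarrow> r False x y)) \<and>
    (\<forall>i\<in>J. \<forall>j\<in>J. i \<noteq> j \<longrightarrow> (\<forall>x\<in>K i. \<forall>y\<in>K j. r (col i j) x y))"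
  using J X C \<mu> pair
proof (induction "card J" arbitrary: J C)
  case 0
  then show ?case by simp
next
  case (Suc k)
  note J = Suc.prems(1,2) and X = Suc.prems(3) and C = Suc.prems(4) and \<mu> = Suc.prems(5) and pair = Suc.prems(6)
  have "\<exists>i\<in>J. \<mu> i = 1 \<or> (\<forall>j\<in>J. \<mu> j = 2)"
  proof (cases "\<exists>i\<in>J. \<mu> i = 1")
    case False
    moreover have "J \<noteq> {}" using Suc(2) by auto
    ultimately show ?thesis using \<mu> by blast
  qed blast
  then obtain i where i: "i \<in> J" "\<mu> i = 1 \<or> (\<forall>j\<in>J. \<mu> j = 2)" by blast
  define J' where "J' = J - {i}"
  have cJ': "card J' = k" "finite J'" using Suc(2) i J by (auto simp: J'_def)
  have k5: "k \<le> 5" using Suc(2) J by simp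
  define M where "M = 2 / \<epsilon>0"
  have M1: "M \<ge> 1" using e by (simp add: M_def)
  have tau0: "\<tau> > 0" using e by simp
  have Mk: "M ^ l \<ge> 1" for l using M1 by simp
  define d where "d j = dens (r (col i j)) (X i) (X j)" for j
  define bad where "bad j = {v\<in>C i. real (card {y\<in>C j. r (col i j) v y}) < (d j - \<epsilon>) * card (C j)}" for j
  have fX: "finite (X j)" if "j \<in> J" for j using X[OF that] by (auto intro: card_ge_0_finite)
  have fC: "finite (C j)" if "j \<in> J" for j using C[OF that] fX[OF that] finite_subset by blast
  have Cbig: "real (card (C j)) \<ge> \<tau> * real (card (X j))" "card (C j) > 0" if j: "j \<in> J" for j
  proof -
    have "\<tau> * 1 * real (card (X j)) \<le> \<tau> * M ^ card J * real (card (X j))"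
      by (intro mult_right_mono mult_left_mono Mk) (use tau0 in auto)
    then show 1: "real (card (C j)) \<ge> \<tau> * real (card (X j))" using C[OF j] unfolding M_def by simp
    have "\<tau> * real (card (X j)) > 0" using tau0 X[OF j] by simp
    then show "card (C j) > 0" using 1 by linarith
  qed
  have bad: "real (card (bad j)) \<le> \<epsilon> * card (X i)" if j: "j \<in> J'" for j
    unfolding bad_def d_def
  proof (rule few_low_degrees)
    have jJ: "j \<in> J" "i \<noteq> j" using j by (auto simp: J'_def)
    show "regular \<epsilon> (r (col i j)) (X i) (X j)" using pair[OF i(1) jJ] by blast
    show "finite (X i)" "finite (X j)" using fX jJ i by auto
    show "C i \<subseteq> X i" "C j \<subseteq> X j" using C jJ i by auto
    have "\<epsilon> * real (card (X j)) \<le> \<tau> * real (card (X j))" by (rule mult_right_mono) (use e in auto)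
    then show "\<epsilon> * real (card (X j)) \<le> real (card (C j))" using Cbig(1)[OF jJ(1)] by linarith
    show "0 < card (C j)" by (rule Cbig(2)[OF jJ(1)])
    show "0 < card (X i)" using X[OF i(1)] by simp
  qed (fact e(1))
  \<comment> \<open>Vertices with typical degree into all remaining candidate sets. At most
    \<open>5 * \<epsilon>\<close> of \<open>X i\<close> is discarded, which is below
    \<open>\<tau> / 2\<close>.\<close>
  define T where "T = C i - (\<Union>j\<in>J'. bad j)"
  have TC: "T \<subseteq> C i" by (auto simp: T_def)
  have Tbig: "real (card T) \<ge> \<tau> / 2 * real (card (X i))"
  proof -
    have "card (C i) \<le> card T + card (\<Union>j\<in>J'. bad j)"
    proof -
      have "card (C i) \<le> card (T \<union> (\<Union>j\<in>J'. bad j))"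
        by (rule card_mono) (use fC[OF i(1)] cJ' in \<open>auto simp: T_def bad_def\<close>)
      then show ?thesis using card_Un_le order_trans by blast
    qed
    moreover have "real (card (\<Union>j\<in>J'. bad j)) \<le> 5 * (\<epsilon> * card (X i))"
    proof -
      have "real (card (\<Union>j\<in>J'. bad j)) \<le> (\<Sum>j\<in>J'. real (card (bad j)))"
        using card_UN_le[OF cJ'(2), of bad] by (metis of_nat_le_iff of_nat_sum)
      also have "\<dots> \<le> real (card J') * (\<epsilon> * card (X i))" by (rule sum_bounded_above) (use bad in auto)
      also have "\<dots> \<le> 5 * (\<epsilon> * card (X i))" by (rule mult_right_mono) (use cJ' k5 e in auto)
      finally show ?thesis .
    qed
    ultimately have "real (card T) \<ge> \<tau> * real (card (X i)) - 5 * (\<epsilon> * card (X i))"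
      using Cbig(1)[OF i(1)] by linarith
    moreover have "(5 * \<epsilon>) * card (X i) \<le> (\<tau> / 2) * card (X i)" by (rule mult_right_mono) (use e in auto)
    ultimately show ?thesis by (simp add: algebra_simps)
  qed
  have Tdeg: "real (card {y\<in>C j. r (col i j) v y}) \<ge> (d j - \<epsilon>) * card (C j)" if "v \<in> T" "j \<in> J'" for v j
    using that by (auto simp: T_def bad_def)
  have Tne: "T \<noteq> {}"
  proof -
    have "\<tau> / 2 * real (card (X i)) > 0" using tau0 X[OF i(1)] by simp
    then show ?thesis using Tbig by auto
  qed
  have dj: "d j \<ge> \<epsilon>0" if "j \<in> J'" for j using pair[OF i(1), of j] that by (auto simp: J'_def d_def)
  have "\<exists>Q. Q \<subseteq> T \<and> card Q = \<mu> i \<and> (\<forall>x\<in>Q. \<forall>y\<in>Q. x \<noteq> y \<longrightarrow> r False x y) \<and>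
      (\<forall>j\<in>J'. real (card {y\<in>C j. \<forall>v\<in>Q. r (col i j) v y}) \<ge> \<epsilon>0 / 2 * real (card (C j)))"
  proof (cases "\<mu> i = 1")
    case True
    obtain v where v: "v \<in> T" using Tne by blast
    have "real (card {y\<in>C j. r (col i j) v y}) \<ge> \<epsilon>0 / 2 * real (card (C j))" if j: "j \<in> J'" for j
    proof -
      have "\<epsilon>0 / 2 * real (card (C j)) \<le> (d j - \<epsilon>) * real (card (C j))"
        by (rule mult_right_mono) (use dj[OF j] e in auto)
      then show ?thesis using Tdeg[OF v j] by linarith
    qed
    then show ?thesis using True v by (intro exI[of _ "{v}"]) auto
  next
    case False
    then have \<mu>2: "\<mu> j = 2" if "j \<in> J" for j using i that by blast
    have XA: "X i \<inter> A = {}" "\<tau> / 2 * real (card (X i)) \<ge> m" using \<mu>[OF i(1)] False by auto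
    have "T \<subseteq> V - A" using TC C[OF i(1)] X[OF i(1)] XA by auto
    then obtain u v where uv: "u \<in> T" "v \<in> T" "r False u v" using blue_edge[of T] Tbig XA by auto
    have ne: "u \<noteq> v" using uv irr by auto
    have "real (card {y\<in>C j. \<forall>z\<in>{u,v}. r (col i j) z y}) \<ge> \<epsilon>0 / 2 * real (card (C j))" if j: "j \<in> J'" for j
    proof -
      have jJ: "j \<in> J" "i \<noteq> j" using j by (auto simp: J'_def)
      let ?U = "{y\<in>C j. r (col i j) u y}" and ?W = "{y\<in>C j. r (col i j) v y}"
      have "card ?U + card ?W = card (?U \<union> ?W) + card (?U \<inter> ?W)"
        by (rule card_Un_Int) (use fC[OF jJ(1)] in auto)
      moreover have "card (?U \<union> ?W) \<le> card (C j)" by (rule card_mono) (use fC[OF jJ(1)] in auto)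
      moreover have "?U \<inter> ?W = {y\<in>C j. \<forall>z\<in>{u,v}. r (col i j) z y}" by auto
      ultimately have "real (card ?U) + real (card ?W) - real (card (C j)) \<le> real (card {y\<in>C j. \<forall>z\<in>{u,v}. r (col i j) z y})"
        by simp
      \<comment> \<open>Inclusion-exclusion: each of \<open>u\<close>, \<open>v\<close> sees at
        least the proportion \<open>1/2 + \<epsilon>0/2\<close> of \<open>C j\<close>, so together
        they share at least \<open>\<epsilon>0\<close> of it.\<close>
      moreover have "d j \<ge> 1/2 + \<epsilon>0" using pair[OF i(1) jJ] \<mu>2[OF i(1)] \<mu>2[OF jJ(1)] unfolding d_def by blast
      then have "(1/2 + \<epsilon>0/2) * card (C j) \<le> (d j - \<epsilon>) * card (C j)"
        by (intro mult_right_mono) (use e in auto)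
      moreover have "0 \<le> \<epsilon>0 * card (C j)" using e by simp
      ultimately show ?thesis using Tdeg[OF uv(1) j] Tdeg[OF uv(2) j] by (simp add: algebra_simps)
    qed
    then show ?thesis using uv ne \<mu>2[OF i(1)] symr[of False u v] by (intro exI[of _ "{u,v}"]) auto
  qed
  then obtain Q where Q: "Q \<subseteq> T" "card Q = \<mu> i" "\<forall>x\<in>Q. \<forall>y\<in>Q. x \<noteq> y \<longrightarrow> r False x y"
    "\<And>j. j \<in> J' \<Longrightarrow> real (card {y\<in>C j. \<forall>v\<in>Q. r (col i j) v y}) \<ge> \<epsilon>0 / 2 * real (card (C j))" by blast
  define C' where "C' j = {y\<in>C j. \<forall>v\<in>Q. r (col i j) v y}" for j
  have "\<exists>K. (\<forall>i\<in>J'. K i \<subseteq> C' i \<and> card (K i) = \<mu> i \<and> (\<forall>x\<in>K i. \<forall>y\<in>K i. x \<noteq> y \<longrightarrow> r False x y)) \<and>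
    (\<forall>i\<in>J'. \<forall>j\<in>J'. i \<noteq> j \<longrightarrow> (\<forall>x\<in>K i. \<forall>y\<in>K j. r (col i j) x y))"
  proof (rule Suc(1))
    show "k = card J'" using cJ' by simp
    show "C' j \<subseteq> X j \<and> real (card (C' j)) \<ge> \<tau> * (2 / \<epsilon>0) ^ card J' * real (card (X j))" if j: "j \<in> J'" for j
    proof
      have jJ: "j \<in> J" using j by (auto simp: J'_def)
      show "C' j \<subseteq> X j" using C[OF jJ] by (auto simp: C'_def)
      \<comment> \<open>One treated cluster costs every remaining candidate set a factor
        \<open>\<epsilon>0 / 2\<close>, which the drop of one power of
        \<open>2 / \<epsilon>0\<close> in the hypothesis pays for.\<close>
      have "\<epsilon>0 / 2 * (\<tau> * (2 / \<epsilon>0) ^ card J * real (card (X j))) \<le> \<epsilon>0 / 2 * real (card (C j))"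
        by (rule mult_left_mono) (use C[OF jJ] e in auto)
      also have "\<dots> \<le> real (card (C' j))" using Q(4)[OF j] by (simp add: C'_def)
      also have "\<epsilon>0 / 2 * (\<tau> * (2 / \<epsilon>0) ^ card J * real (card (X j))) = \<tau> * (2 / \<epsilon>0) ^ card J' * real (card (X j))"
        using e cJ' Suc(2)[symmetric] by (simp add: field_simps)
      finally show "real (card (C' j)) \<ge> \<tau> * (2 / \<epsilon>0) ^ card J' * real (card (X j))" .
    qed
    show "card J' \<le> 6" using cJ' k5 by simp
    show "finite J'" by (rule cJ'(2))
    fix j assume j: "j \<in> J'"
    then have jJ: "j \<in> J" by (simp add: J'_def)
    show "X j \<subseteq> V \<and> card (X j) > 0" by (rule X[OF jJ])
    show "\<mu> j = 1 \<or> \<mu> j = 2 \<and> X j \<inter> A = {} \<and> \<tau> / 2 * real (card (X j)) \<ge> m" by (rule \<mu>[OF jJ])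
    fix l assume l: "l \<in> J'" "j \<noteq> l"
    show "col j l = col l j \<and> regular \<epsilon> (r (col j l)) (X j) (X l) \<and>
       dens (r (col j l)) (X j) (X l) \<ge> \<epsilon>0 \<and> (\<mu> j = 2 \<and> \<mu> l = 2 \<longrightarrow> dens (r (col j l)) (X j) (X l) \<ge> 1/2 + \<epsilon>0)"
      by (rule pair) (use jJ l in \<open>auto simp: J'_def\<close>)
  qed
  then obtain K where KK: "\<forall>i\<in>J'. K i \<subseteq> C' i \<and> card (K i) = \<mu> i \<and> (\<forall>x\<in>K i. \<forall>y\<in>K i. x \<noteq> y \<longrightarrow> r False x y)"
    "\<forall>i\<in>J'. \<forall>j\<in>J'. i \<noteq> j \<longrightarrow> (\<forall>x\<in>K i. \<forall>y\<in>K j. r (col i j) x y)"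
    by (elim exE conjE) (rule that, assumption+)
  note K = bspec[OF KK(1)]
  have K2: "r (col j l) x y" if "j \<in> J'" "l \<in> J'" "j \<noteq> l" "x \<in> K j" "y \<in> K l" for j l x y
    using KK(2) that by simp
  define K1 where "K1 = K(i := Q)"
  have iJ': "i \<notin> J'" by (simp add: J'_def)
  have cross: "r (col i j) x y" if "j \<in> J'" "x \<in> Q" "y \<in> K j" for j x y
    using K[OF that(1)] that by (auto simp: C'_def)
  show ?case
  proof (intro exI[of _ K1] conjI ballI impI)
    fix j assume j: "j \<in> J"
    show "K1 j \<subseteq> C j" using K[of j] Q(1) TC j by (cases "j = i") (auto simp: K1_def J'_def C'_def)
    show "card (K1 j) = \<mu> j" using K[of j] Q(2) j by (cases "j = i") (auto simp: K1_def J'_def)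
    fix x y assume "x \<in> K1 j" "y \<in> K1 j" "x \<noteq> y"
    then show "r False x y" using K[of j] Q(3) j by (cases "j = i") (auto simp: K1_def J'_def)
  next
    fix j l x y assume a: "j \<in> J" "l \<in> J" "j \<noteq> l" "x \<in> K1 j" "y \<in> K1 l"
    consider "j = i" | "l = i" | "j \<in> J'" "l \<in> J'" using a by (auto simp: J'_def)
    then show "r (col j l) x y"
    proof cases
      case 1
      then show ?thesis using cross[of l x y] a by (simp add: K1_def J'_def)
    next
      case 2
      then have "r (col i j) y x" using cross[of j y x] a by (simp add: K1_def J'_def)
      moreover have "col j l = col i j" using pair[of j l] a 2 by auto
      ultimately show ?thesis using symr[of "col i j" y x] by simp
    next
      case 3
      moreover from 3 have "j \<noteq> i" "l \<noteq> i" using iJ' by blast+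
      ultimately show ?thesis using K2[of j l x y] a by (simp add: K1_def)
    qed
  qed
qed

definition core :: "nat \<Rightarrow> (nat \<Rightarrow> nat) \<Rightarrow> (nat \<Rightarrow> nat) \<Rightarrow> bool" where
  "core q u v \<longleftrightarrow> q \<in> A \<and> (\<forall>i<5. u i \<in> V - A \<and> v i \<in> V - A \<and> r False (u i) (v i) \<and>
     r False q (u i) \<and> r False q (v i) \<and>
     (\<forall>x\<in>{u i, v i}. \<forall>y\<in>{u ((i+1) mod 5), v ((i+1) mod 5)}. r False x y) \<and>
     (\<forall>x\<in>{u i, v i}. \<forall>y\<in>{u ((i+2) mod 5), v ((i+2) mod 5)}. r True x y))"

end

text \<open>\<open>\<tau>\<close> is chosen so that \<open>\<tau> * (2 / \<epsilon>0)^6 = 1\<close>: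
  then \<open>embed\<close> can start from entire cells for up to six clusters.
  \<open>\<epsilon> = \<tau>/12\<close> is the regularity it asks for. The bound on \<open>m\<close>
  makes every subset of proportion \<open>\<tau> / 2\<close> of a big cell outside \<open>A\<close>
  large enough to contain a blue edge.\<close>

locale rt_partition = rt_graph +
  fixes f :: "nat \<Rightarrow> nat" and K :: nat and \<epsilon> \<epsilon>0 \<tau> \<gamma> :: real
  assumes params: "\<epsilon>0 = 1/20000" "\<tau> = (\<epsilon>0/2)^6" "\<epsilon> = \<tau>/12" "\<gamma> = 1/40000"
    and fK: "f ` V \<subseteq> {..<K}" and Vne: "V \<noteq> {}"
    and fA: "x \<in> V \<Longrightarrow> y \<in> V \<Longrightarrow> f x = f y \<Longrightarrow> x \<in> A \<Longrightarrow> y \<in> A"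
    and irregular: "irregularity \<epsilon> r V f \<le> \<epsilon> * (real (card V))^2"
    and small_cells: "real (card (cell V f a)) \<le> real (card V) / 20000"
    and m_small: "m \<le> \<tau> / 2 * (\<gamma> * real (card V) / real K)"
    and dense: "ecount (\<lambda>x y. r True x y \<or> r False x y) V V > 0.8328 * (real (card V))^2"
begin

abbreviation "I \<equiv> f ` V"
abbreviation "C \<equiv> cell V f"
abbreviation "D c a b \<equiv> dens (r c) (C a) (C b)"
abbreviation "both \<equiv> (\<lambda>x y. r True x y \<or> r False x y)"

definition big where "big a \<longleftrightarrow> real (card (C a)) \<ge> \<gamma> * real (card V) / real K"
definition good where "good a b \<longleftrightarrow> a \<in> I \<and> b \<in> I \<and> a \<noteq> b \<and> big a \<and> big b \<and>
  regular \<epsilon> (r True) (C a) (C b) \<and> regular \<epsilon> (r False) (C a) (C b)"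
definition IA where "IA = {a\<in>I. C a \<subseteq> A}"
text \<open>Positive red density takes precedence: such a pair is red whatever its blue density, and
  its total density is judged by \<open>LL\<close>. This keeps the three relations disjoint.\<close>

definition RR where "RR a b \<longleftrightarrow> good a b \<and> D True a b \<ge> \<epsilon>0"
definition FF where "FF a b \<longleftrightarrow> good a b \<and> D True a b < \<epsilon>0 \<and> D False a b \<ge> 1/2 + \<epsilon>0"
definition HH where "HH a b \<longleftrightarrow> good a b \<and> D True a b < \<epsilon>0 \<and> D False a b < 1/2 + \<epsilon>0 \<and> D False a b \<ge> \<epsilon>0"
definition LL where "LL a b \<longleftrightarrow> dens both (C a) (C b) \<le> 1/2 + 2 * \<epsilon>0"

lemma e_bounds: "0 < \<epsilon>" "\<epsilon> \<le> \<epsilon>0 / 2" "12 * \<epsilon> \<le> \<tau>" "0 < \<epsilon>0" "\<epsilon>0 \<le> 1" "\<epsilon> \<le> 1/100000" "0 < \<tau>"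
  unfolding params by (simp_all add: power_divide)

lemma nV: "real (card V) > 0" using Vne finV by (simp add: card_gt_0_iff)

lemma K0: "K > 0" using fK Vne by fastforce

lemma Dsym: "D c a b = D c b a" by (rule dens_sym) (rule symr)

lemma good_sym: "good a b \<longleftrightarrow> good b a"
  using regular_sym[of "r True" \<epsilon> "C a" "C b", OF symr] regular_sym[of "r True" \<epsilon> "C b" "C a", OF symr]
    regular_sym[of "r False" \<epsilon> "C a" "C b", OF symr] regular_sym[of "r False" \<epsilon> "C b" "C a", OF symr]
  by (auto simp: good_def)

lemma cell_A: assumes "a \<in> I" "a \<notin> IA" shows "C a \<inter> A = {}"
proof (rule ccontr)
  assume "C a \<inter> A \<noteq> {}"
  then obtain x where x: "x \<in> V" "f x = a" "x \<in> A" by (auto simp: cell_def)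
  have "C a \<subseteq> A"
  proof
    fix y assume "y \<in> C a"
    then have "y \<in> V" "f x = f y" using x by (auto simp: cell_def)
    then show "y \<in> A" using fA[of x y] x by simp
  qed
  then show False using assms by (simp add: IA_def)
qed

lemma big_pos: assumes "big a" shows "card (C a) > 0"
proof -
  have "\<gamma> * real (card V) / real K > 0" using nV K0 params by simp
  then show ?thesis using assms by (auto simp: big_def)
qed

lemma embed_cells:
  assumes J: "finite J" "card J \<le> 6" "card J \<ge> 2"
    and \<mu>: "\<And>i. i \<in> J \<Longrightarrow> \<mu> i = (1::nat) \<or> \<mu> i = 2 \<and> i \<notin> IA"
    and pair: "\<And>i j. i \<in> J \<Longrightarrow> j \<in> J \<Longrightarrow> i \<noteq> j \<Longrightarrow> good i j \<and> col i j = col j i \<and> D (col i j) i j \<ge> \<epsilon>0 \<and>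
       (\<mu> i = 2 \<and> \<mu> j = 2 \<longrightarrow> D (col i j) i j \<ge> 1/2 + \<epsilon>0)"
  shows "\<exists>K. (\<forall>i\<in>J. K i \<subseteq> C i \<and> card (K i) = \<mu> i \<and> (\<forall>x\<in>K i. \<forall>y\<in>K i. x \<noteq> y \<longrightarrow> r False x y)) \<and>
    (\<forall>i\<in>J. \<forall>j\<in>J. i \<noteq> j \<longrightarrow> (\<forall>x\<in>K i. \<forall>y\<in>K j. r (col i j) x y))"
proof -
  \<comment> \<open>Bigness comes only with \<open>good\<close> pairs, so every cell needs a partner
    in \<open>J\<close>; this is the purpose of \<open>card J \<ge> 2\<close>.\<close>
  have ig: "i \<in> I \<and> big i" if i: "i \<in> J" for i
  proof -
    obtain j where "j \<in> J" "j \<noteq> i"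
    proof (rule ccontr)
      assume n: "\<not> thesis"
      have "J \<subseteq> {i}" using n that by blast
      then have "card J \<le> card {i}" by (intro card_mono) auto
      then show False using J by simp
    qed
    then show ?thesis using pair[of i j] i by (auto simp: good_def)
  qed
  have tM: "\<tau> * (2 / \<epsilon>0) ^ card J \<le> 1"
  proof -
    have "(2 / \<epsilon>0) ^ card J \<le> (2 / \<epsilon>0) ^ 6" by (rule power_increasing) (use J params in auto)
    then have "\<tau> * (2 / \<epsilon>0) ^ card J \<le> \<tau> * (2 / \<epsilon>0) ^ 6" using e_bounds by (intro mult_left_mono) auto
    also have "\<dots> = 1" unfolding params by (simp add: power_divide)
    finally show ?thesis .
  qed
  show ?thesis
  proof (rule embed[where X = C and \<epsilon> = \<epsilon> and \<epsilon>0 = \<epsilon>0 and \<tau> = \<tau>])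
    fix i assume i: "i \<in> J"
    show "C i \<subseteq> V \<and> card (C i) > 0" using ig[OF i] big_pos by (auto simp: cell_def)
    have "\<tau> * (2 / \<epsilon>0) ^ card J * real (card (C i)) \<le> 1 * real (card (C i))"
      by (rule mult_right_mono[OF tM]) simp
    then show "C i \<subseteq> C i \<and> \<tau> * (2 / \<epsilon>0) ^ card J * real (card (C i)) \<le> real (card (C i))" by simp
    have "m \<le> \<tau> / 2 * real (card (C i))"
      by (rule order.trans[OF m_small], rule mult_left_mono) (use ig[OF i] e_bounds in \<open>auto simp: big_def\<close>)
    then show "\<mu> i = 1 \<or> \<mu> i = 2 \<and> C i \<inter> A = {} \<and> m \<le> \<tau> / 2 * real (card (C i))"
      using \<mu>[OF i] cell_A[of i] ig[OF i] by auto
    fix j assume j: "j \<in> J" "i \<noteq> j"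
    have "regular \<epsilon> (r (col i j)) (C i) (C j)"
      using pair[OF i j] by (cases "col i j") (auto simp: good_def)
    then show "col i j = col j i \<and> regular \<epsilon> (r (col i j)) (C i) (C j) \<and> \<epsilon>0 \<le> D (col i j) i j \<and>
      (\<mu> i = 2 \<and> \<mu> j = 2 \<longrightarrow> 1/2 + \<epsilon>0 \<le> D (col i j) i j)" using pair[OF i j] by blast
  qed (use e_bounds J in auto)
qed

lemma cells_disjoint: "i \<noteq> j \<Longrightarrow> C i \<inter> C j = {}" by (auto simp: cell_def)

text \<open>Otherwise the cells of \<open>J\<close>, those of \<open>S\<close> contributing two
  vertices each, would embed as a blue clique on six vertices.\<close>

lemma blue_bound_cells:
  assumes J: "J \<subseteq> I" and DJ: "S \<subseteq> J" "S \<inter> IA = {}"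
    and p: "\<And>i j. i \<in> J \<Longrightarrow> j \<in> J \<Longrightarrow> i \<noteq> j \<Longrightarrow> good i j \<and> D False i j \<ge> \<epsilon>0"
    and p2: "\<And>i j. i \<in> S \<Longrightarrow> j \<in> S \<Longrightarrow> i \<noteq> j \<Longrightarrow> D False i j \<ge> 1/2 + \<epsilon>0"
  shows "card J + card S \<le> 5"
proof (rule ccontr)
  assume n: "\<not> ?thesis"
  have fJ: "finite J" using J finV finite_subset by blast
  \<comment> \<open>Cut down to a count of exactly six, since \<open>embed\<close> is budgeted for
    at most six cells. Doubled cells are given up first.\<close>
  have "\<exists>J' S'. J' \<subseteq> J \<and> S' \<subseteq> S \<and> S' \<subseteq> J' \<and> card J' + card S' = 6"
  proof (cases "card J \<ge> 6")
    case True
    then obtain J' where "J' \<subseteq> J" "card J' = 6" by (meson obtain_subset_with_card_n)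
    then show ?thesis by (intro exI[of _ J'] exI[of _ "{}"]) auto
  next
    case False
    then have "6 - card J \<le> card S" using n by simp
    then obtain S' where "S' \<subseteq> S" "card S' = 6 - card J" by (meson obtain_subset_with_card_n)
    then show ?thesis using False DJ by (intro exI[of _ J] exI[of _ S']) auto
  qed
  then obtain J' S' where JS: "J' \<subseteq> J" "S' \<subseteq> S" "S' \<subseteq> J'" "card J' + card S' = 6" by blast
  have fJ': "finite J'" using JS fJ finite_subset by blast
  have "card S' \<le> card J'" by (rule card_mono[OF fJ' JS(3)])
  define \<mu> where "\<mu> i = (if i \<in> S' then 2 else 1::nat)" for i
  have "\<exists>K. (\<forall>i\<in>J'. K i \<subseteq> C i \<and> card (K i) = \<mu> i \<and> (\<forall>x\<in>K i. \<forall>y\<in>K i. x \<noteq> y \<longrightarrow> r False x y)) \<and>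
    (\<forall>i\<in>J'. \<forall>j\<in>J'. i \<noteq> j \<longrightarrow> (\<forall>x\<in>K i. \<forall>y\<in>K j. r False x y))"
  proof (rule embed_cells[where col = "\<lambda>_ _. False"])
    show "card J' \<le> 6" "2 \<le> card J'" using JS \<open>card S' \<le> card J'\<close> by linarith+
    show "\<mu> i = 1 \<or> \<mu> i = 2 \<and> i \<notin> IA" for i using JS DJ by (auto simp: \<mu>_def)
    fix i j assume ij: "i \<in> J'" "j \<in> J'" "i \<noteq> j"
    have "i \<in> J" "j \<in> J" using ij JS by auto
    then show "good i j \<and> False = False \<and> \<epsilon>0 \<le> D False i j \<and> (\<mu> i = 2 \<and> \<mu> j = 2 \<longrightarrow> 1/2 + \<epsilon>0 \<le> D False i j)"
      using p[of i j] p2[of i j] ij JS(2) by (auto simp: \<mu>_def split: if_splits)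
  qed (rule fJ')
  then obtain K where KK: "\<forall>i\<in>J'. K i \<subseteq> C i \<and> card (K i) = \<mu> i \<and> (\<forall>x\<in>K i. \<forall>y\<in>K i. x \<noteq> y \<longrightarrow> r False x y)"
    "\<forall>i\<in>J'. \<forall>j\<in>J'. i \<noteq> j \<longrightarrow> (\<forall>x\<in>K i. \<forall>y\<in>K j. r False x y)"
    by (elim exE conjE) (rule that, assumption+)
  have K: "K i \<subseteq> C i" "card (K i) = \<mu> i" "\<And>x y. x \<in> K i \<Longrightarrow> y \<in> K i \<Longrightarrow> x \<noteq> y \<Longrightarrow> r False x y" if "i \<in> J'" for i
    using bspec[OF KK(1) that] by auto
  have K4: "r False x y" if "i \<in> J'" "j \<in> J'" "i \<noteq> j" "x \<in> K i" "y \<in> K j" for i j x y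
    using KK(2) that by simp
  have fC: "finite (C i)" for i using finV by (simp add: cell_def)
  have "card (\<Union>i\<in>J'. K i) = (\<Sum>i\<in>J'. card (K i))"
  proof (rule card_UN_disjoint[OF fJ'])
    show "\<forall>i\<in>J'. finite (K i)" using finite_subset[OF K(1) fC] by simp
    show "\<forall>i\<in>J'. \<forall>j\<in>J'. i \<noteq> j \<longrightarrow> K i \<inter> K j = {}"
    proof (intro ballI impI)
      fix i j assume "i \<in> J'" "j \<in> J'" "i \<noteq> j"
      then show "K i \<inter> K j = {}" using K(1)[of i] K(1)[of j] cells_disjoint[of i j] by auto
    qed
  qed
  also have "\<dots> = (\<Sum>i\<in>J'. 1 + (if i \<in> S' then 1 else 0))" by (rule sum.cong) (auto simp: K(2) \<mu>_def)
  also have "\<dots> = card J' + card (J' \<inter> S')" by (simp only: sum.distrib, simp add: fJ' sum.inter_restrict[symmetric])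
  also have "J' \<inter> S' = S'" using JS by auto
  finally have "card (\<Union>i\<in>J'. K i) = 6" using JS by simp
  moreover have "card (\<Union>i\<in>J'. K i) \<le> 5"
  proof (rule blue_K6_free)
    show "(\<Union>i\<in>J'. K i) \<subseteq> V"
    proof
      fix x assume "x \<in> (\<Union>i\<in>J'. K i)"
      then obtain i where "i \<in> J'" "x \<in> K i" by blast
      then show "x \<in> V" using K(1)[of i] by (auto simp: cell_def)
    qed
    fix x y assume "x \<in> (\<Union>i\<in>J'. K i)" "y \<in> (\<Union>i\<in>J'. K i)" "x \<noteq> y"
    then obtain i j where "i \<in> J'" "x \<in> K i" "j \<in> J'" "y \<in> K j" by blast
    then show "r False x y" using K(3)[of i x y] K4[of i j x y] \<open>x \<noteq> y\<close> by (cases "i = j") auto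
  qed
  ultimately show False by simp
qed

lemma reduced_cells: "reduced I IA RR FF HH LL"
proof
  show "finite I" using finV by simp
  show "RR a b \<longleftrightarrow> RR b a" for a b using good_sym[of a b] Dsym[of True a b] by (simp add: RR_def)
  show "FF a b \<longleftrightarrow> FF b a" for a b using good_sym[of a b] Dsym[of True a b] Dsym[of False a b] by (simp add: FF_def)
  show "HH a b \<longleftrightarrow> HH b a" for a b using good_sym[of a b] Dsym[of True a b] Dsym[of False a b] by (simp add: HH_def)
  show "LL a b \<longleftrightarrow> LL b a" for a b
  proof -
    have "dens both (C a) (C b) = dens both (C b) (C a)"
      by (rule dens_sym) (use symr[of True] symr[of False] in metis)
    then show ?thesis by (simp add: LL_def)
  qed
  show "\<not> RR a a" "\<not> FF a a" "\<not> HH a a" for a by (auto simp: RR_def FF_def HH_def good_def)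
  show "\<not> (RR a b \<and> FF a b)" "\<not> (RR a b \<and> HH a b)" "\<not> (FF a b \<and> HH a b)" for a b by (auto simp: RR_def FF_def HH_def)
  show "a \<notin> IA" if "RR a b" for a b
  proof
    assume "a \<in> IA"
    then have "C a \<subseteq> A" by (simp add: IA_def)
    then have "ecount (r True) (C a) (C b) = 0" unfolding ecount_def using redA by (intro sum.neutral ballI) auto
    then have "D True a b = 0" by (simp add: dens_def)
    then show False using that e_bounds by (simp add: RR_def)
  qed
  show "\<not> RR a c" if "RR a b" "RR b c" for a b c
  proof
    assume ac: "RR a c"
    have g: "good a b" "good b c" "good a c" "D True a b \<ge> \<epsilon>0" "D True b c \<ge> \<epsilon>0" "D True a c \<ge> \<epsilon>0" using that ac by (auto simp: RR_def)
    have ne: "a \<noteq> b" "b \<noteq> c" "a \<noteq> c" using g by (auto simp: good_def)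
    have "\<exists>K. (\<forall>i\<in>{a,b,c}. K i \<subseteq> C i \<and> card (K i) = 1 \<and> (\<forall>x\<in>K i. \<forall>y\<in>K i. x \<noteq> y \<longrightarrow> r False x y)) \<and>
    (\<forall>i\<in>{a,b,c}. \<forall>j\<in>{a,b,c}. i \<noteq> j \<longrightarrow> (\<forall>x\<in>K i. \<forall>y\<in>K j. r True x y))"
    proof (rule embed_cells[where col = "\<lambda>_ _. True" and \<mu> = "\<lambda>_. 1"])
      fix i j assume ij: "i \<in> {a,b,c}" "j \<in> {a,b,c}" "i \<noteq> j"
      have "good i j \<and> D True i j \<ge> \<epsilon>0"
        using ij g good_sym[of a b] good_sym[of b c] good_sym[of a c] Dsym[of True a b] Dsym[of True b c] Dsym[of True a c] by auto
      then show "good i j \<and> True = True \<and> \<epsilon>0 \<le> D True i j \<and> ((1::nat) = 2 \<and> (1::nat) = 2 \<longrightarrow> 1/2 + \<epsilon>0 \<le> D True i j)" by simp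
    qed (use ne in auto)
    then obtain K where KK: "\<forall>i\<in>{a,b,c}. K i \<subseteq> C i \<and> card (K i) = 1 \<and> (\<forall>x\<in>K i. \<forall>y\<in>K i. x \<noteq> y \<longrightarrow> r False x y)"
      "\<forall>i\<in>{a,b,c}. \<forall>j\<in>{a,b,c}. i \<noteq> j \<longrightarrow> (\<forall>x\<in>K i. \<forall>y\<in>K j. r True x y)"
      by (elim exE conjE) (rule that, assumption+)
    have K: "K i \<subseteq> C i \<and> card (K i) = 1" if "i \<in> {a,b,c}" for i using bspec[OF KK(1) that] by blast
    have K2: "r True x y" if "i \<in> {a,b,c}" "j \<in> {a,b,c}" "i \<noteq> j" "x \<in> K i" "y \<in> K j" for i j x y
      using bspec[OF bspec[OF KK(2) that(1)] that(2)] that by blast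
    obtain x y z where xyz: "K a = {x}" "K b = {y}" "K c = {z}" using K[of a] K[of b] K[of c] by (auto simp: card_1_singleton_iff)
    then have "x \<in> V" "y \<in> V" "z \<in> V" using K[of a] K[of b] K[of c] by (auto simp: cell_def)
    moreover have "r True x y" "r True y z" "r True x z" using K2[of a b x y] K2[of b c y z] K2[of a c x z] xyz ne by auto
    ultimately show False using red_triangle_free by blast
  qed
  show "card J + card S \<le> 5" if J: "J \<subseteq> I" "S \<subseteq> J" "S \<inter> IA = {}"
    "\<And>i j. i \<in> J \<Longrightarrow> j \<in> J \<Longrightarrow> i \<noteq> j \<Longrightarrow> FF i j \<or> HH i j"
    "\<And>i j. i \<in> S \<Longrightarrow> j \<in> S \<Longrightarrow> i \<noteq> j \<Longrightarrow> FF i j" for J S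
  proof (rule blue_bound_cells[OF J(1-3)])
    show "good i j \<and> \<epsilon>0 \<le> D False i j" if "i \<in> J" "j \<in> J" "i \<noteq> j" for i j
      using J(4)[OF that] by (auto simp: FF_def HH_def)
    show "1/2 + \<epsilon>0 \<le> D False i j" if "i \<in> S" "j \<in> S" "i \<noteq> j" for i j
      using J(5)[OF that] by (auto simp: FF_def)
  qed
qed

interpretation red: reduced I IA RR FF HH LL by (rule reduced_cells)

lemma sum_cell_card: "(\<Sum>a\<in>I. real (card (C a))) = real (card V)"
proof -
  have "real (card V) = (\<Sum>x\<in>V. 1)" by simp
  also have "\<dots> = (\<Sum>a\<in>I. \<Sum>x\<in>{x\<in>V. f x = a}. 1)" by (rule sum.image_gen[OF finV])
  also have "\<dots> = (\<Sum>a\<in>I. real (card (C a)))" by (simp add: cell_def)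
  finally show ?thesis by simp
qed

text \<open>Every defect of the pair contributes 1, which dominates any density; only good pairs
  have to be compared with the weight.\<close>

lemma pair_weight:
  assumes ab: "a \<in> I" "b \<in> I"
  defines "irr \<equiv> (\<lambda>c. if regular \<epsilon> (r c) (C a) (C b) then 0 else 1)"
  shows "ecount both (C a) (C b) \<le> real (card (C a)) * real (card (C b)) *
    (red.w a b + 2 * \<epsilon>0 + irr True + irr False + of_bool (a = b) + of_bool (\<not> big a) + of_bool (\<not> big b))"
proof -
  let ?p = "real (card (C a)) * real (card (C b))"
  have fC: "finite (C i)" for i using finV by (simp add: cell_def)
  have w0: "red.w a b \<ge> 0" by (simp add: red.w_def)
  have i0: "irr c \<ge> 0" for c by (simp add: irr_def)
  have *: "ecount both (C a) (C b) \<le> ?p * t" if "dens both (C a) (C b) \<le> t" for t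
    unfolding ecount_dens[OF fC fC] using mult_left_mono[OF that, of ?p] by (simp add: mult.commute)
  show ?thesis
  proof (rule *)
    have d1: "dens both (C a) (C b) \<le> 1" by (rule dens_bounds)
    have dd: "dens both (C a) (C b) \<le> D True a b + D False a b"
      unfolding dens_def add_divide_distrib[symmetric] by (rule divide_right_mono[OF ecount_or]) simp
    show "dens both (C a) (C b) \<le> red.w a b + 2 * \<epsilon>0 + irr True + irr False + of_bool (a = b) + of_bool (\<not> big a) + of_bool (\<not> big b)"
    proof (cases "good a b")
      case False
      then have "irr True = 1 \<or> irr False = 1 \<or> a = b \<or> \<not> big a \<or> \<not> big b" using ab by (auto simp: good_def irr_def)
      then show ?thesis using d1 w0 i0[of True] i0[of False] e_bounds by (elim disjE) auto
    next
      case True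
      have nn: "irr True + irr False + of_bool (a = b) + of_bool (\<not> big a) + of_bool (\<not> big b) \<ge> (0::real)"
        using i0[of True] i0[of False] by simp
      have "dens both (C a) (C b) \<le> red.w a b + 2 * \<epsilon>0"
      proof (cases "D True a b \<ge> \<epsilon>0")
        case R: True
        then show ?thesis using d1 True e_bounds
          by (cases "LL a b") (auto simp: red.w_def red.full_def red.half_def RR_def LL_def FF_def HH_def)
      next
        case R: False
        show ?thesis
        proof (cases "D False a b \<ge> 1/2 + \<epsilon>0")
          case F: True
          then show ?thesis using d1 True R e_bounds by (auto simp: red.w_def red.full_def FF_def)
        next
          case F: False
          show ?thesis
          proof (cases "D False a b \<ge> \<epsilon>0")
            case H: True
            then have "red.w a b = 1/2" using True R F by (auto simp: red.w_def red.full_def red.half_def FF_def RR_def HH_def)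
            then show ?thesis using dd R F by simp
          next
            case H: False
            then show ?thesis using dd R w0 by simp
          qed
        qed
      qed
      then show ?thesis using nn by simp
    qed
  qed
qed

text \<open>The passage from 0.8328 to 0.8325 has 0.0003 to spend. It pays 0.0001 for
  \<open>2 * \<epsilon>0\<close>, at most 0.00001 for irregular pairs, 0.00005 for pairs inside a
  cell and 0.00005 for small cells on either side.\<close>

lemma dense_weights: "quad I red.w (\<lambda>a. real (card (C a)) / real (card V)) > 0.8325"
proof -
  define n where "n = real (card V)"
  define P where "P a = real (card (C a))" for a
  define irr where "irr c a b = (if regular \<epsilon> (r c) (C a) (C b) then 0 else 1 :: real)" for c a b
  have n0: "n > 0" using nV by (simp add: n_def)
  have P0: "P a \<ge> 0" for a by (simp add: P_def)
  have sP: "(\<Sum>a\<in>I. P a) = n" unfolding P_def n_def by (rule sum_cell_card)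
  have "ecount both V V = (\<Sum>a\<in>I. \<Sum>b\<in>I. ecount both (C a) (C b))"
    unfolding ecount_def by (rule sum_cells[OF finV]) auto
  also have "\<dots> \<le> (\<Sum>a\<in>I. \<Sum>b\<in>I. P a * P b * (red.w a b + 2 * \<epsilon>0 + irr True a b + irr False a b + of_bool (a = b) + of_bool (\<not> big a) + of_bool (\<not> big b)))"
    unfolding P_def irr_def by (intro sum_mono pair_weight)
  also have "\<dots> = (\<Sum>a\<in>I. \<Sum>b\<in>I. P a * P b * red.w a b) + (\<Sum>a\<in>I. \<Sum>b\<in>I. P a * P b * (2 * \<epsilon>0))
     + ((\<Sum>a\<in>I. \<Sum>b\<in>I. P a * P b * irr True a b) + (\<Sum>a\<in>I. \<Sum>b\<in>I. P a * P b * irr False a b))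
     + (\<Sum>a\<in>I. \<Sum>b\<in>I. P a * P b * of_bool (a = b))
     + (\<Sum>a\<in>I. \<Sum>b\<in>I. P a * P b * of_bool (\<not> big a)) + (\<Sum>a\<in>I. \<Sum>b\<in>I. P a * P b * of_bool (\<not> big b))"
    by (simp only: distrib_left sum.distrib add.assoc)
  also have "(\<Sum>a\<in>I. \<Sum>b\<in>I. P a * P b * red.w a b) = n^2 * quad I red.w (\<lambda>a. P a / n)"
    unfolding quad_def sum_distrib_left using n0 by (intro sum.cong refl) (simp add: power2_eq_square field_simps)
  also have "(\<Sum>a\<in>I. \<Sum>b\<in>I. P a * P b * (2 * \<epsilon>0)) = 2 * \<epsilon>0 * n^2"
    by (simp add: sum_distrib_left[symmetric] sum_distrib_right[symmetric] sP power2_eq_square)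
  also have "(\<Sum>a\<in>I. \<Sum>b\<in>I. P a * P b * irr True a b) + (\<Sum>a\<in>I. \<Sum>b\<in>I. P a * P b * irr False a b) = irregularity \<epsilon> r V f"
    unfolding irregularity_def UNIV_bool by (simp add: P_def irr_def if_distrib[where f="\<lambda>z. _ * z"] cong: if_cong)
  also have "(\<Sum>a\<in>I. \<Sum>b\<in>I. P a * P b * of_bool (a = b)) = (\<Sum>a\<in>I. P a * P a)"
    by (intro sum.cong refl) (simp add: of_bool_def if_distrib[where f="\<lambda>z. _ * z"] sum.delta finV cong: if_cong)
  also have "(\<Sum>a\<in>I. \<Sum>b\<in>I. P a * P b * of_bool (\<not> big a)) = n * (\<Sum>a\<in>I. P a * of_bool (\<not> big a))"
    unfolding sum_distrib_left sP[symmetric] sum_distrib_right by (intro sum.cong refl) simp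
  also have "(\<Sum>a\<in>I. \<Sum>b\<in>I. P a * P b * of_bool (\<not> big b)) = n * (\<Sum>a\<in>I. P a * of_bool (\<not> big a))"
    unfolding sP[symmetric] sum_product by (simp only: mult.assoc)
  finally have main: "ecount both V V \<le> n^2 * quad I red.w (\<lambda>a. P a / n) + 2 * \<epsilon>0 * n^2 + irregularity \<epsilon> r V f
    + (\<Sum>a\<in>I. P a * P a) + n * (\<Sum>a\<in>I. P a * of_bool (\<not> big a)) + n * (\<Sum>a\<in>I. P a * of_bool (\<not> big a))" .
  have diag: "(\<Sum>a\<in>I. P a * P a) \<le> n^2 / 20000"
  proof -
    have "(\<Sum>a\<in>I. P a * P a) \<le> (\<Sum>a\<in>I. P a * (n / 20000))"
      by (intro sum_mono mult_left_mono P0) (use small_cells in \<open>simp add: P_def n_def\<close>)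
    also have "\<dots> = n^2 / 20000" unfolding sum_distrib_right[symmetric] sP by (simp add: power2_eq_square)
    finally show ?thesis .
  qed
  have small: "(\<Sum>a\<in>I. P a * of_bool (\<not> big a)) \<le> \<gamma> * n"
  proof -
    have "(\<Sum>a\<in>I. P a * of_bool (\<not> big a)) \<le> real (card I) * (\<gamma> * n / real K)"
      by (rule sum_bounded_above) (use params n0 in \<open>auto simp: big_def P_def n_def not_le\<close>)
    also have "\<dots> \<le> real K * (\<gamma> * n / real K)"
    proof (rule mult_right_mono)
      show "real (card I) \<le> real K" using card_mono[OF _ fK] by simp
      show "0 \<le> \<gamma> * n / real K" using params n0 by simp
    qed
    also have "\<dots> = \<gamma> * n" using K0 by simp
    finally show ?thesis .
  qed
  have "n * (\<Sum>a\<in>I. P a * of_bool (\<not> big a)) \<le> n * (\<gamma> * n)" by (rule mult_left_mono[OF small]) (use n0 in simp)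
  moreover have "\<epsilon> * n^2 \<le> 1/100000 * n^2" by (rule mult_right_mono) (use e_bounds in auto)
  ultimately have "0.8328 * n^2 < n^2 * quad I red.w (\<lambda>a. P a / n) + 2 * \<epsilon>0 * n^2 + 1/100000 * n^2 + n^2/20000 + 2 * (n * (\<gamma> * n))"
    using main dense irregular diag unfolding n_def[symmetric] by linarith
  moreover have "n * (\<gamma> * n) = n^2 / 40000" by (simp add: params(4) power2_eq_square)
  moreover have "2 * \<epsilon>0 * n^2 = n^2 / 10000" by (simp add: params(1))
  moreover have "n^2 > 0" using n0 by simp
  moreover have "0.8328 * n^2 = 8328 / 10000 * n^2" by simp
  ultimately have "8325 / 10000 * n^2 < n^2 * quad I red.w (\<lambda>a. P a / n)" by linarith
  then have "0.8325 * n^2 < n^2 * quad I red.w (\<lambda>a. P a / n)" by simp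
  then have "n^2 * 0.8325 < n^2 * quad I red.w (\<lambda>a. P a / n)" by (simp only: mult.commute)
  then have "0.8325 < quad I red.w (\<lambda>a. P a / n)" using n0 by (simp only: mult_less_cancel_left_pos zero_less_power)
  then show ?thesis by (simp add: P_def n_def)
qed

lemma has_core: "red.has_core"
proof (rule red.dense_has_core)
  show "(\<Sum>a\<in>I. real (card (C a)) / real (card V)) = 1"
    unfolding sum_divide_distrib[symmetric] sum_cell_card using nV by simp
qed (use dense_weights in auto)

text \<open>Blue density \<open>\<epsilon>0\<close> on \<open>a c\<close> would make
  \<open>q\<close>, \<open>a\<close>, \<open>b\<close>, \<open>c\<close> a blue configuration in
  which \<open>a\<close>, \<open>b\<close> can be doubled, a count of 6. So the blue density is
  below \<open>\<epsilon>0\<close>, while the total exceeds \<open>1/2 + 2 * \<epsilon>0\<close>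
  because the pair is full.\<close>

lemma red_pair_strong:
  assumes q: "q \<in> I" "FF q a" "FF q b" "FF q c" and F: "FF a b" "FF b c" and R: "RR a c" "red.full a c"
    and nA: "a \<notin> IA" "b \<notin> IA" and qA: "q \<in> IA"
  shows "D True a c \<ge> 1/2 + \<epsilon>0"
proof -
  have g: "good q a" "good q b" "good q c" "good a b" "good b c" "good a c" using assms by (auto simp: FF_def RR_def)
  have D: "D False q a \<ge> 1/2 + \<epsilon>0" "D False q b \<ge> 1/2 + \<epsilon>0" "D False q c \<ge> 1/2 + \<epsilon>0" "D False a b \<ge> 1/2 + \<epsilon>0" "D False b c \<ge> 1/2 + \<epsilon>0"
    using assms by (auto simp: FF_def)
  have ne: "q \<noteq> a" "q \<noteq> b" "q \<noteq> c" "a \<noteq> b" "b \<noteq> c" "a \<noteq> c" using g by (auto simp: good_def)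
  have "D False a c < \<epsilon>0"
  proof (rule ccontr)
    assume "\<not> ?thesis"
    then have ac: "D False a c \<ge> \<epsilon>0" by simp
    have D': "D False q a \<ge> \<epsilon>0" "D False q b \<ge> \<epsilon>0" "D False q c \<ge> \<epsilon>0" "D False a b \<ge> \<epsilon>0" "D False b c \<ge> \<epsilon>0"
      using D by auto
    have "card {q,a,b,c} + card {a,b} \<le> 5"
    proof (rule blue_bound_cells)
      show "{q,a,b,c} \<subseteq> I" using g by (auto simp: good_def)
      show "{a,b} \<inter> IA = {}" using nA by auto
      have half_sym: "good j i \<and> D False j i \<ge> \<epsilon>0" if "good i j" "D False i j \<ge> \<epsilon>0" for i j
        using that good_sym[of i j] Dsym[of False i j] by simp
      show "good i j \<and> \<epsilon>0 \<le> D False i j" if "i \<in> {q,a,b,c}" "j \<in> {q,a,b,c}" "i \<noteq> j" for i j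
        using that g D' ac half_sym[of q a] half_sym[of q b] half_sym[of q c] half_sym[of a b] half_sym[of b c] half_sym[of a c] by auto
      show "1/2 + \<epsilon>0 \<le> D False i j" if "i \<in> {a,b}" "j \<in> {a,b}" "i \<noteq> j" for i j
        using that D(4) Dsym[of False a b] by auto
    qed auto
    then show False using ne by simp
  qed
  moreover have "dens both (C a) (C c) \<le> D True a c + D False a c"
    unfolding dens_def add_divide_distrib[symmetric] by (rule divide_right_mono[OF ecount_or]) simp
  moreover have "\<not> LL a c" using R by (auto simp: red.full_def RR_def FF_def)
  ultimately show ?thesis by (simp add: LL_def)
qed

lemma core: "\<exists>q u v. core q u v"
proof -
  obtain q a b c d e where "q \<in> I \<inter> IA \<and> {a,b,c,d,e} \<subseteq> I - IA \<and> distinct [a,b,c,d,e] \<and>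
     (\<forall>p\<in>{a,b,c,d,e}. FF q p) \<and>
     FF a b \<and> FF b c \<and> FF c d \<and> FF d e \<and> FF e a \<and> RR a c \<and> RR b d \<and> RR c e \<and> RR d a \<and> RR e b \<and>
     red.full a c \<and> red.full b d \<and> red.full c e \<and> red.full d a \<and> red.full e b"
    using has_core unfolding red.has_core_def by (elim exE) (rule that)
  then have q: "q \<in> I" "q \<in> IA" and nA: "a \<notin> IA" "b \<notin> IA" "c \<notin> IA" "d \<notin> IA" "e \<notin> IA"
    and pI: "a \<in> I" "b \<in> I" "c \<in> I" "d \<in> I" "e \<in> I"
    and ne: "distinct [a,b,c,d,e]"
    and Fq: "FF q a" "FF q b" "FF q c" "FF q d" "FF q e"
    and FP: "FF a b" "FF b c" "FF c d" "FF d e" "FF e a"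
    and RP: "RR a c" "RR b d" "RR c e" "RR d a" "RR e b"
    and full: "red.full a c" "red.full b d" "red.full c e" "red.full d a" "red.full e b" by auto
  \<comment> \<open>\<open>RR i j\<close>, read as a colour, is the colour in which the pair is
    embedded; \<open>ok\<close> is the density that allows doubling at both ends in that
    colour.\<close>
  define ok where "ok i j \<longleftrightarrow> good i j \<and> D (RR i j) i j \<ge> 1/2 + \<epsilon>0" for i j
  have okF: "ok i j" if "FF i j" for i j
  proof -
    have "RR i j = False" using that by (auto simp: FF_def RR_def)
    then show ?thesis using that by (simp add: ok_def FF_def)
  qed
  have okR: "ok i j" if "RR i j" "D True i j \<ge> 1/2 + \<epsilon>0" for i j
  proof -
    have "RR i j = True" using that by simp
    then show ?thesis using that(2) that(1)[unfolded RR_def] by (simp add: ok_def)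
  qed
  have ok_sym: "ok j i" if "ok i j" for i j
  proof -
    have "RR j i = RR i j" using good_sym[of i j] Dsym[of True i j] by (simp add: RR_def)
    then show ?thesis using that good_sym[of i j] Dsym[of "RR i j" i j] by (simp add: ok_def)
  qed
  have oks: "ok q a" "ok q b" "ok q c" "ok q d" "ok q e" "ok a b" "ok b c" "ok c d" "ok d e" "ok e a"
    using okF Fq FP by auto
  have oks2: "ok a c" "ok b d" "ok c e" "ok d a" "ok e b"
    using okR[OF RP(1) red_pair_strong[OF q(1) Fq(1,2,3) FP(1,2) RP(1) full(1) nA(1,2) q(2)]]
      okR[OF RP(2) red_pair_strong[OF q(1) Fq(2,3,4) FP(2,3) RP(2) full(2) nA(2,3) q(2)]]
      okR[OF RP(3) red_pair_strong[OF q(1) Fq(3,4,5) FP(3,4) RP(3) full(3) nA(3,4) q(2)]]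
      okR[OF RP(4) red_pair_strong[OF q(1) Fq(4,5,1) FP(4,5) RP(4) full(4) nA(4,5) q(2)]]
      okR[OF RP(5) red_pair_strong[OF q(1) Fq(5,1,2) FP(5,1) RP(5) full(5) nA(5,1) q(2)]] by auto
  note oks' = oks[THEN ok_sym] oks2[THEN ok_sym]
  define J where "J = {q,a,b,c,d,e}"
  have qne: "q \<noteq> a" "q \<noteq> b" "q \<noteq> c" "q \<noteq> d" "q \<noteq> e" using Fq by (auto simp: FF_def good_def)
  have cJ: "card J = 6" using ne qne by (simp add: J_def)
  define \<mu> where "\<mu> i = (if i = q then 1 else 2::nat)" for i
  have "\<exists>K. (\<forall>i\<in>J. K i \<subseteq> C i \<and> card (K i) = \<mu> i \<and> (\<forall>x\<in>K i. \<forall>y\<in>K i. x \<noteq> y \<longrightarrow> r False x y)) \<and>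
    (\<forall>i\<in>J. \<forall>j\<in>J. i \<noteq> j \<longrightarrow> (\<forall>x\<in>K i. \<forall>y\<in>K j. r (RR i j) x y))"
  proof (rule embed_cells)
    show "\<mu> i = 1 \<or> \<mu> i = 2 \<and> i \<notin> IA" if "i \<in> J" for i using that nA by (auto simp: \<mu>_def J_def)
    fix i j assume ij: "i \<in> J" "j \<in> J" "i \<noteq> j"
    have "ok i j"
      using ij(3) ij(1,2)[unfolded J_def, simplified] oks oks2 oks' by (elim disjE) (simp_all only: simp_thms)
    then have g: "good i j" "D (RR i j) i j \<ge> 1/2 + \<epsilon>0" by (auto simp: ok_def)
    have "RR i j = RR j i" using good_sym[of i j] Dsym[of True i j] by (simp add: RR_def)
    moreover have "D (RR i j) i j \<ge> \<epsilon>0" using g(2) by simp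
    ultimately show "good i j \<and> RR i j = RR j i \<and> \<epsilon>0 \<le> D (RR i j) i j \<and> (\<mu> i = 2 \<and> \<mu> j = 2 \<longrightarrow> 1/2 + \<epsilon>0 \<le> D (RR i j) i j)"
      using g by blast
  qed (use cJ in \<open>auto simp: J_def\<close>)
  then obtain K where KK: "\<forall>i\<in>J. K i \<subseteq> C i \<and> card (K i) = \<mu> i \<and> (\<forall>x\<in>K i. \<forall>y\<in>K i. x \<noteq> y \<longrightarrow> r False x y)"
    "\<forall>i\<in>J. \<forall>j\<in>J. i \<noteq> j \<longrightarrow> (\<forall>x\<in>K i. \<forall>y\<in>K j. r (RR i j) x y)"
    by (elim exE conjE) (rule that, assumption+)
  have K: "K i \<subseteq> C i" "card (K i) = \<mu> i" "\<And>x y. x \<in> K i \<Longrightarrow> y \<in> K i \<Longrightarrow> x \<noteq> y \<Longrightarrow> r False x y" if "i \<in> J" for i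
    using bspec[OF KK(1) that] by auto
  have KF: "r False x y" if "i \<in> J" "j \<in> J" "FF i j" "x \<in> K i" "y \<in> K j" for i j x y
  proof -
    have "i \<noteq> j" "RR i j = False" using that by (auto simp: FF_def RR_def good_def)
    then show ?thesis using bspec[OF bspec[OF KK(2) that(1)] that(2)] that by metis
  qed
  have KR: "r True x y" if "i \<in> J" "j \<in> J" "RR i j" "x \<in> K i" "y \<in> K j" for i j x y
  proof -
    have "i \<noteq> j" "RR i j = True" using that by (auto simp: FF_def RR_def good_def)
    then show ?thesis using bspec[OF bspec[OF KK(2) that(1)] that(2)] that by metis
  qed
  define P where "P i = [a,b,c,d,e] ! i" for i
  have i5: "i = 0 \<or> i = 1 \<or> i = 2 \<or> i = 3 \<or> i = 4" if "i < 5" for i :: nat using that by linarith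
  have P: "P i \<in> J \<and> P i \<in> I \<and> P i \<notin> IA \<and> P i \<noteq> q \<and> FF q (P i) \<and> FF (P i) (P ((i+1) mod 5)) \<and> RR (P i) (P ((i+2) mod 5))"
    if "i < 5" for i
    using i5[OF that] nA pI Fq FP RP qne by (elim disjE) (simp_all add: P_def J_def)
  have "\<exists>u v. u \<noteq> v \<and> K (P i) = {u, v}" if "i < 5" for i
    using K(2)[of "P i"] P[OF that] by (auto simp: \<mu>_def card_2_iff)
  then have "\<exists>u v. \<forall>i<5. u i \<noteq> v i \<and> K (P i) = {u i, v i}" by metis
  then obtain u v where uv: "\<And>i. i < 5 \<Longrightarrow> u i \<noteq> v i \<and> K (P i) = {u i, v i}" by blast
  have "card (K q) = 1" using K(2)[of q] by (simp add: J_def \<mu>_def)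
  then obtain q0 where q0: "K q = {q0}" by (auto simp: card_1_singleton_iff)
  have qJ: "q \<in> J" by (simp add: J_def)
  have "core q0 u v"
    unfolding core_def
  proof (intro conjI allI impI)
    show "q0 \<in> A" using K(1)[OF qJ] q0 q(2) by (auto simp: IA_def)
    fix i :: nat assume i: "i < 5"
    note Pi = P[OF i] and uvi = uv[OF i]
    have i1: "(i+1) mod 5 < 5" "(i+2) mod 5 < 5" by auto
    have "K (P i) \<subseteq> V - A"
      using K(1)[of "P i"] Pi cell_A[of "P i"] by (auto simp: cell_def)
    then show "u i \<in> V - A" "v i \<in> V - A" using uvi by auto
    show "r False (u i) (v i)" using K(3)[of "P i" "u i" "v i"] Pi uvi by auto
    show "r False q0 (u i)" "r False q0 (v i)"
      using KF[OF qJ, of "P i" q0 "u i"] KF[OF qJ, of "P i" q0 "v i"] Pi uvi q0 by auto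
    show "\<forall>x\<in>{u i, v i}. \<forall>y\<in>{u ((i+1) mod 5), v ((i+1) mod 5)}. r False x y"
      using KF[of "P i" "P ((i+1) mod 5)"] Pi P[OF i1(1)] uvi uv[OF i1(1)] by blast
    show "\<forall>x\<in>{u i, v i}. \<forall>y\<in>{u ((i+2) mod 5), v ((i+2) mod 5)}. r True x y"
      using KR[of "P i" "P ((i+2) mod 5)"] Pi P[OF i1(2)] uvi uv[OF i1(2)] by blast
  qed
  then show ?thesis by blast
qed

end

section \<open>Cores in dense graphs\<close>

lemma card_residue_class:
  assumes "k > 0" shows "card {j. j < n \<and> j mod k = c} \<le> n div k + (1::nat)"
proof -
  have "card {j. j < n \<and> j mod k = c} \<le> card {..n div k}"
  proof (rule card_inj_on_le[of "\<lambda>j. j div k"])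
    show "inj_on (\<lambda>j. j div k) {j. j < n \<and> j mod k = c}"
    proof (rule inj_onI)
      fix i j assume "i \<in> {j. j < n \<and> j mod k = c}" "j \<in> {j. j < n \<and> j mod k = c}" "i div k = j div k"
      then show "i = j" using div_mult_mod_eq[of i k] div_mult_mod_eq[of j k] by simp
    qed
    show "(\<lambda>j. j div k) ` {j. j < n \<and> j mod k = c} \<subseteq> {..n div k}" by (auto intro: div_le_mono)
  qed simp
  then show ?thesis by simp
qed

text \<open>The regularity lemma is started from a labelling whose classes are small and lie inside
  or outside \<open>A\<close>. Both properties pass to every refinement, and the number of cells
  depends on constants only, so \<open>\<delta>\<close> does too.\<close>

theorem core_exists:
  obtains \<delta> :: real where "\<delta> > 0"
    "\<And>V A r m. rt_graph V A r m \<Longrightarrow> card V \<ge> 40000 \<Longrightarrow> m \<le> \<delta> * real (card V) \<Longrightarrow>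
       ecount (\<lambda>x y. r True x y \<or> r False x y) V V > 0.8328 * (real (card V))^2 \<Longrightarrow>
       \<exists>q u v. rt_graph.core V A r q u v"
proof -
  define \<epsilon>0 \<tau> \<epsilon> \<gamma> :: real where "\<epsilon>0 = 1/20000" and "\<tau> = (\<epsilon>0/2)^6" and "\<epsilon> = \<tau>/12" and "\<gamma> = 1/40000"
  have e: "\<epsilon> > 0" "\<tau> > 0" by (auto simp: \<epsilon>_def \<tau>_def \<epsilon>0_def)
  obtain K where K: "\<And>(V::nat set) (r :: bool \<Rightarrow> nat \<Rightarrow> nat \<Rightarrow> bool) f. finite V \<Longrightarrow> f ` V \<subseteq> {..<2 * 40000} \<Longrightarrow>
     \<exists>f'. f' ` V \<subseteq> {..<K} \<and> finer V f' f \<and> irregularity \<epsilon> r V f' \<le> \<epsilon> * (real (card V))^2"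
    by (rule regularity[OF e(1)]) (rule that)
  \<comment> \<open>\<open>K + 1\<close> avoids a division by zero: \<open>K > 0\<close> is known
    only once a nonempty \<open>V\<close> is given.\<close>
  define \<delta> where "\<delta> = \<tau> / 2 * (\<gamma> / real (K + 1))"
  show ?thesis
  proof (rule that[of \<delta>])
    show "\<delta> > 0" using e by (simp add: \<delta>_def \<gamma>_def)
    fix V A r m
    assume g: "rt_graph V A r m" and n: "card V \<ge> 40000" and m: "m \<le> \<delta> * real (card V)"
      and dense: "ecount (\<lambda>x y. r True x y \<or> r False x y) V V > 0.8328 * (real (card V))^2"
    interpret rt_graph V A r m by (rule g)
    obtain h where h: "bij_betw h V {0..<card V}" using ex_bij_betw_finite_nat[OF finV] by blast
    \<comment> \<open>The residue of an enumeration cuts \<open>V\<close> into 40000 almost equal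
      classes, and the parity records membership in \<open>A\<close>.\<close>
    define f0 where "f0 x = 2 * (h x mod 40000) + (if x \<in> A then 1 else 0)" for x
    have "f0 ` V \<subseteq> {..<2 * 40000}"
    proof -
      have "f0 x < 2 * 40000" for x
      proof -
        have "h x mod 40000 \<le> 39999" using mod_less_divisor[of 40000 "h x"] by linarith
        then show ?thesis by (simp add: f0_def)
      qed
      then show ?thesis by auto
    qed
    then obtain f where f: "f ` V \<subseteq> {..<K}" "finer V f f0" "irregularity \<epsilon> r V f \<le> \<epsilon> * (real (card V))^2"
      using K[OF finV] by blast
    have f0: "h x mod 40000 = h y mod 40000 \<and> (x \<in> A \<longleftrightarrow> y \<in> A)" if "x \<in> V" "y \<in> V" "f x = f y" for x y
    proof -
      have "f0 x = f0 y" using f(2) that unfolding finer_def by blast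
      then have eq: "2 * (h x mod 40000) + (if x \<in> A then 1 else 0) = 2 * (h y mod 40000) + (if y \<in> A then 1 else 0)"
        by (simp add: f0_def)
      have arith: "p = q \<and> s = t" if "2 * p + s = 2 * q + t" "s < 2" "t < 2" for p q s t :: nat
        using that by presburger
      have "h x mod 40000 = h y mod 40000 \<and> (if x \<in> A then 1 else 0 :: nat) = (if y \<in> A then 1 else 0)"
        by (rule arith[OF eq]) (simp_all split: if_split)
      then show ?thesis by (simp split: if_splits)
    qed
    have Vne: "V \<noteq> {}" using n by auto
    have K0: "K > 0" using f(1) Vne by fastforce
    have small: "real (card (cell V f a)) \<le> real (card V) / 20000" for a
    proof (cases "cell V f a = {}")
      case False
      then obtain x where x: "x \<in> V" "f x = a" by (auto simp: cell_def)
      have "card (cell V f a) \<le> card {j. j < card V \<and> j mod 40000 = h x mod 40000}"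
      proof (rule card_inj_on_le[of h])
        show "inj_on h (cell V f a)" using h by (auto simp: bij_betw_def cell_def intro: inj_on_subset)
        show "h ` cell V f a \<subseteq> {j. j < card V \<and> j mod 40000 = h x mod 40000}"
        proof
          fix j assume "j \<in> h ` cell V f a"
          then obtain y where y: "y \<in> V" "f y = a" "j = h y" by (auto simp: cell_def)
          have "h y < card V" using h y(1) by (auto simp: bij_betw_def)
          then show "j \<in> {j. j < card V \<and> j mod 40000 = h x mod 40000}" using f0[OF y(1) x(1)] x y by simp
        qed
      qed simp
      also have "\<dots> \<le> card V div 40000 + 1" by (rule card_residue_class) simp
      finally have "real (card (cell V f a)) \<le> real (card V div 40000) + 1" by simp
      \<comment> \<open>The second summand absorbs the rounding term 1; this is where
        \<open>card V \<ge> 40000\<close> enters.\<close>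
      also have "\<dots> \<le> real (card V) / 40000 + real (card V) / 40000"
        using of_nat_div_le_of_nat[of "card V" 40000, where 'a=real] n by simp
      finally show ?thesis by simp
    qed simp
    interpret rt_partition V A r m f K \<epsilon> \<epsilon>0 \<tau> \<gamma>
    proof unfold_locales
      have "\<gamma> / real (K + 1) \<le> \<gamma> / real K" using K0 by (intro divide_left_mono) (auto simp: \<gamma>_def)
      then have "\<delta> * real (card V) \<le> \<tau> / 2 * (\<gamma> / real K) * real (card V)"
        unfolding \<delta>_def by (intro mult_right_mono mult_left_mono) (use e in auto)
      then show "m \<le> \<tau> / 2 * (\<gamma> * real (card V) / real K)" using m by simp
      show "y \<in> A" if "x \<in> V" "y \<in> V" "f x = f y" "x \<in> A" for x y using f0[OF that(1-3)] that(4) by simp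
    qed (fact \<epsilon>0_def \<tau>_def \<epsilon>_def \<gamma>_def f(1) Vne f(3) small dense)+
    show "\<exists>q u v. core q u v" by (rule core)
  qed
qed

section \<open>Attachment to a core\<close>

text \<open>\<open>b\<close>, \<open>r\<close> and \<open>a\<close> count the blue, red and all
  neighbours of a vertex in the five core pairs; here red occurs only at pairs 0 and 1. These two
  contribute at most 4, so \<open>b2 + b3 + b4 \<ge> 4\<close>, whereas adding two of the
  constraints gives \<open>b2 + 2 * b3 + b4 \<le> 4\<close>. Hence \<open>b3 = 0\<close>, and
  everything else is forced.\<close>

lemma pentagon_count_aux:
  fixes b0 b1 b2 b3 b4 r0 r1 a0 a1 a2 a3 a4 :: int
  assumes "b0 \<ge> 0" "b1 \<ge> 0" "b3 \<ge> 0" "r0 \<le> 2" "r1 \<le> 2" "a0 \<le> 2" "a1 \<le> 2"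
   "a0 \<le> b0 + r0" "a1 \<le> b1 + r1" "a2 \<le> b2" "a3 \<le> b3" "a4 \<le> b4"
   "b1 + b2 \<le> 2" "b2 + b3 \<le> 2" "b3 + b4 \<le> 2" "b4 + b0 \<le> 2" "a0 + a1 + a2 + a3 + a4 \<ge> 8"
  shows "a0 + a1 + a2 + a3 + a4 = 8 \<and> b2 = 2 \<and> b4 = 2 \<and> r0 = 2 \<and> r1 = 2"
proof -
  have "b2 + b3 + b4 \<ge> 4" using assms by linarith
  then have b: "b3 = 0" "b2 = 2" "b4 = 2" using assms by linarith+
  then have "b0 = 0" "b1 = 0" using assms by linarith+
  then show ?thesis using assms b by linarith
qed

lemma pentagon_count_with_apex:
  fixes b0 b1 b2 b3 b4 r0 r1 r2 r3 r4 a0 a1 a2 a3 a4 :: int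
  assumes b: "b0 \<ge> 0" "b1 \<ge> 0" "b2 \<ge> 0" "b3 \<ge> 0" "b4 \<ge> 0"
   and r: "r0 \<le> 2" "r1 \<le> 2" "r2 \<le> 2" "r3 \<le> 2" "r4 \<le> 2"
   and a: "a0 \<le> 2" "a1 \<le> 2" "a2 \<le> 2" "a3 \<le> 2" "a4 \<le> 2"
   and abr: "a0 \<le> b0 + r0" "a1 \<le> b1 + r1" "a2 \<le> b2 + r2" "a3 \<le> b3 + r3" "a4 \<le> b4 + r4"
   and rr: "r0 = 0 \<or> r2 = 0" "r1 = 0 \<or> r3 = 0" "r2 = 0 \<or> r4 = 0" "r3 = 0 \<or> r0 = 0" "r4 = 0 \<or> r1 = 0"
   and bb: "b0 + b1 \<le> 2" "b1 + b2 \<le> 2" "b2 + b3 \<le> 2" "b3 + b4 \<le> 2" "b4 + b0 \<le> 2"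
   and s: "a0 + a1 + a2 + a3 + a4 \<ge> 8"
  shows "a0 + a1 + a2 + a3 + a4 = 8 \<and> ((b1 = 2 \<and> b4 = 2 \<and> r2 = 2 \<and> r3 = 2) \<or> (b2 = 2 \<and> b0 = 2 \<and> r3 = 2 \<and> r4 = 2)
   \<or> (b3 = 2 \<and> b1 = 2 \<and> r4 = 2 \<and> r0 = 2) \<or> (b4 = 2 \<and> b2 = 2 \<and> r0 = 2 \<and> r1 = 2) \<or> (b0 = 2 \<and> b3 = 2 \<and> r1 = 2 \<and> r2 = 2))"
proof -
  have "(r2 = 0 \<and> r3 = 0 \<and> r4 = 0) \<or> (r3 = 0 \<and> r4 = 0 \<and> r0 = 0) \<or> (r4 = 0 \<and> r0 = 0 \<and> r1 = 0)
    \<or> (r0 = 0 \<and> r1 = 0 \<and> r2 = 0) \<or> (r1 = 0 \<and> r2 = 0 \<and> r3 = 0)" using rr by blast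
  then show ?thesis
  proof (elim disjE)
    assume "r2 = 0 \<and> r3 = 0 \<and> r4 = 0"
    then show ?thesis using pentagon_count_aux[of b0 b1 b3 r0 r1 a0 a1 a2 b2 a3 a4 b4] b r a abr bb s by simp
  next
    assume "r3 = 0 \<and> r4 = 0 \<and> r0 = 0"
    then show ?thesis using pentagon_count_aux[of b1 b2 b4 r1 r2 a1 a2 a3 b3 a4 a0 b0] b r a abr bb s by simp
  next
    assume "r4 = 0 \<and> r0 = 0 \<and> r1 = 0"
    then show ?thesis using pentagon_count_aux[of b2 b3 b0 r2 r3 a2 a3 a4 b4 a0 a1 b1] b r a abr bb s by simp
  next
    assume "r0 = 0 \<and> r1 = 0 \<and> r2 = 0"
    then show ?thesis using pentagon_count_aux[of b3 b4 b1 r3 r4 a3 a4 a0 b0 a1 a2 b2] b r a abr bb s by simp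
  next
    assume "r1 = 0 \<and> r2 = 0 \<and> r3 = 0"
    then show ?thesis using pentagon_count_aux[of b4 b0 b2 r4 r0 a4 a0 a1 b1 a2 a3 b3] b r a abr bb s by simp
  qed
qed
text \<open>With all ten neighbours present, red is confined to two consecutive pairs, and the other
  three are completely blue although some of them are consecutive.\<close>

lemma pentagon_count_without_apex:
  fixes b0 b1 b2 b3 b4 r0 r1 r2 r3 r4 a0 a1 a2 a3 a4 :: int
  assumes "a0 \<le> 2" "a1 \<le> 2" "a2 \<le> 2" "a3 \<le> 2" "a4 \<le> 2"
   "a0 \<le> b0 + r0" "a1 \<le> b1 + r1" "a2 \<le> b2 + r2" "a3 \<le> b3 + r3" "a4 \<le> b4 + r4"
   "r0 = 0 \<or> r2 = 0" "r1 = 0 \<or> r3 = 0" "r2 = 0 \<or> r4 = 0" "r3 = 0 \<or> r0 = 0" "r4 = 0 \<or> r1 = 0"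
   "b0 \<le> 1 \<or> b1 \<le> 1" "b1 \<le> 1 \<or> b2 \<le> 1" "b2 \<le> 1 \<or> b3 \<le> 1" "b3 \<le> 1 \<or> b4 \<le> 1" "b4 \<le> 1 \<or> b0 \<le> 1"
  shows "a0 + a1 + a2 + a3 + a4 \<le> 9"
proof (rule ccontr)
  assume "\<not> ?thesis"
  then have "a0 = 2" "a1 = 2" "a2 = 2" "a3 = 2" "a4 = 2" using assms(1-5) by linarith+
  then show False using assms by (elim disjE) (simp_all)
qed

text \<open>At most two of five cyclically arranged pairs are complete: 2 + 2 + 1 + 1 + 1.\<close>

lemma pentagon_count_single:
  fixes b0 b1 b2 b3 b4 :: int
  assumes "b0 \<le> 2" "b1 \<le> 2" "b2 \<le> 2" "b3 \<le> 2" "b4 \<le> 2"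
   "b0 \<le> 1 \<or> b1 \<le> 1" "b1 \<le> 1 \<or> b2 \<le> 1" "b2 \<le> 1 \<or> b3 \<le> 1" "b3 \<le> 1 \<or> b4 \<le> 1" "b4 \<le> 1 \<or> b0 \<le> 1"
  shows "b0 + b1 + b2 + b3 + b4 \<le> 7"
  using assms by (elim disjE) linarith+

lemma sum5:
  fixes g :: "nat \<Rightarrow> 'b::comm_monoid_add"
  shows "(\<Sum>i<5. g i) = g 0 + g 1 + g 2 + g 3 + g 4"
  by (simp add: eval_nat_numeral ac_simps)

context rt_graph
begin

lemma no_blue_K6:
  assumes "a \<in> V" "b \<in> V" "c \<in> V" "d \<in> V" "e \<in> V" "g \<in> V"
    "r False a b" "r False a c" "r False a d" "r False a e" "r False a g"
    "r False b c" "r False b d" "r False b e" "r False b g"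
    "r False c d" "r False c e" "r False c g" "r False d e" "r False d g" "r False e g"
  shows False
proof -
  have s: "r False y x" if "r False x y" for x y using that symr[of False x y] by simp
  note s' = assms(7-21)[THEN s]
  have ne: "x \<noteq> y" if "r False x y" for x y using that irr by auto
  have "card {a,b,c,d,e,g} = 6" using assms(7-21)[THEN ne] by simp
  moreover have "card {a,b,c,d,e,g} \<le> 5"
  proof (rule blue_K6_free)
    fix x y assume xy: "x \<in> {a,b,c,d,e,g}" "y \<in> {a,b,c,d,e,g}" "x \<noteq> y"
    show "r False x y"
      using xy(3) xy(1,2)[simplified] assms(7-21) s' by (elim disjE) (simp_all only: simp_thms)
  qed (use assms in auto)
  ultimately show False by simp
qed

definition adj where "adj x y \<longleftrightarrow> r True x y \<or> r False x y"

lemma adj_sym: "adj x y \<longleftrightarrow> adj y x" using symr[of True x y] symr[of False x y] by (simp add: adj_def)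

end

section \<open>Vertices attached to a fixed core\<close>

locale rt_core = rt_graph +
  fixes q :: nat and u v :: "nat \<Rightarrow> nat"
  assumes core: "core q u v"
begin

lemma qA: "q \<in> A" "q \<in> V" using core AV by (auto simp: core_def)

lemma uv: assumes "i < 5" shows "u i \<in> V" "v i \<in> V" "u i \<notin> A" "v i \<notin> A" "r False (u i) (v i)" "r False q (u i)" "r False q (v i)"
  using core assms by (auto simp: core_def)

lemma uv_blue: assumes "i < 5" "j = (i + 1) mod 5" "x \<in> {u i, v i}" "y \<in> {u j, v j}" shows "r False x y"
  using core assms unfolding core_def by blast

lemma uv_red: assumes "i < 5" "j = (i + 2) mod 5" "x \<in> {u i, v i}" "y \<in> {u j, v j}" shows "r True x y"
  using core assms unfolding core_def by blast

definition bl where "bl z i = (of_bool (r False z (u i)) + of_bool (r False z (v i)) :: int)"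
definition rd where "rd z i = (of_bool (r True z (u i)) + of_bool (r True z (v i)) :: int)"
definition ad where "ad z i = (of_bool (adj z (u i)) + of_bool (adj z (v i)) :: int)"
definition score where "score z = 2 * of_bool (adj z q) + (\<Sum>i<5. ad z i)"

text \<open>\<open>z\<close> is attached like the pair \<open>j\<close> itself; modulo 5 the offsets
  4 and 3 stand for -1 and -2.\<close>

definition part where
  "part z j \<longleftrightarrow> r False z q \<and> bl z ((j+1) mod 5) = 2 \<and> bl z ((j+4) mod 5) = 2 \<and> rd z ((j+2) mod 5) = 2 \<and> rd z ((j+3) mod 5) = 2"

lemma bounds: "bl z i \<ge> 0" "bl z i \<le> 2" "rd z i \<ge> 0" "rd z i \<le> 2" "ad z i \<le> 2" "ad z i \<le> bl z i + rd z i"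
  by (auto simp: bl_def rd_def ad_def adj_def)

lemma rd0: "rd z i \<noteq> 0 \<longleftrightarrow> (\<exists>x\<in>{u i, v i}. r True z x)"
  by (cases "r True z (u i)"; cases "r True z (v i)"; simp add: rd_def)

lemma bl0: "bl z i \<noteq> 0 \<longleftrightarrow> (\<exists>x\<in>{u i, v i}. r False z x)"
  by (cases "r False z (u i)"; cases "r False z (v i)"; simp add: bl_def)

lemma rd_excl: assumes z: "z \<in> V" and i: "i < 5" "j = (i + 2) mod 5" shows "rd z i = 0 \<or> rd z j = 0"
proof (rule ccontr)
  assume n: "\<not> ?thesis"
  then obtain x y where xy: "x \<in> {u i, v i}" "y \<in> {u j, v j}" "r True z x" "r True z y"
    unfolding de_Morgan_disj rd0 by blast
  have j: "j < 5" using i by simp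
  have V: "x \<in> V" "y \<in> V" using xy uv[OF i(1)] uv[OF j] by auto
  have "r True x y" by (rule uv_red[OF i xy(1,2)])
  then show False using red_triangle_free[OF z V xy(3)] xy(4) by blast
qed

lemma bl2: "bl z i = 2 \<longleftrightarrow> r False z (u i) \<and> r False z (v i)" by (simp add: bl_def)
lemma rd2: "rd z i = 2 \<longleftrightarrow> r True z (u i) \<and> r True z (v i)" by (simp add: rd_def)

lemma bl_next_sym: "y \<in> {u j, v j} \<Longrightarrow> x \<in> {u i, v i} \<Longrightarrow> i < 5 \<Longrightarrow> j = (i + 1) mod 5 \<Longrightarrow> r False y x"
  using uv_blue[of i j x y] symr[of False x y] by simp

text \<open>A vertex of \<open>A\<close> has only blue neighbours. If \<open>q\<close> is one of
  them, two consecutive complete pairs would form a blue 6-clique with \<open>z\<close> and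
  \<open>q\<close>, so the score is at most 2 + 7. Otherwise only the ten other core vertices count,
  and a score of 10 needs all of them.\<close>

lemma score_A:
  assumes z: "z \<in> V" "z \<in> A"
  shows "score z \<le> 9 \<or> score z = 10 \<and> (\<forall>i<5. r False z (u i) \<and> r False z (v i))"
proof -
  have nr: "\<not> r True z y" for y using redA z by blast
  have ab: "ad z i = bl z i" for i by (simp add: ad_def bl_def adj_def nr)
  have adjF: "adj z y \<longleftrightarrow> r False z y" for y by (simp add: adj_def nr)
  show ?thesis
  proof (cases "adj z q")
    case True
    then have zq: "r False z q" by (simp add: adjF)
    have no: "bl z i \<le> 1 \<or> bl z j \<le> 1" if i: "i < 5" "j = (i+1) mod 5" for i j
    proof (rule ccontr)
      assume "\<not> ?thesis"
      then have b: "bl z i = 2" "bl z j = 2" using bounds(2)[of z i] bounds(2)[of z j] by auto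
      have j: "j < 5" using i by simp
      show False
        by (rule no_blue_K6[of z q "u i" "v i" "u j" "v j"])
          (use z zq b qA uv[OF i(1)] uv[OF j] uv_blue[OF i] in \<open>auto simp: bl2\<close>)
    qed
    have "bl z 0 + bl z 1 + bl z 2 + bl z 3 + bl z 4 \<le> 7"
      by (rule pentagon_count_single[OF bounds(2) bounds(2) bounds(2) bounds(2) bounds(2)]) (rule no; simp)+
    then show ?thesis using True by (simp add: score_def sum5 ab)
  next
    case False
    have sc: "score z = bl z 0 + bl z 1 + bl z 2 + bl z 3 + bl z 4" using False by (simp add: score_def sum5 ab)
    note b = bounds(2)[of z 0] bounds(2)[of z 1] bounds(2)[of z 2] bounds(2)[of z 3] bounds(2)[of z 4]
    show ?thesis
    proof (cases "score z \<le> 9")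
      case False
      then have "bl z 0 = 2" "bl z 1 = 2" "bl z 2 = 2" "bl z 3 = 2" "bl z 4 = 2" using sc b by linarith+
      note e = this
      have "r False z (u i) \<and> r False z (v i)" if "i < 5" for i
      proof -
        have "i = 0 \<or> i = 1 \<or> i = 2 \<or> i = 3 \<or> i = 4" using that by linarith
        then have "bl z i = 2" using e by (elim disjE) simp_all
        then show ?thesis by (simp only: bl2)
      qed
      moreover have "score z = 10" unfolding sc e by simp
      ultimately show ?thesis by blast
    qed simp
  qed
qed

text \<open>The blue neighbour \<open>z'\<close> with the same trace on the core doubles
  \<open>z\<close>: four further vertices of a blue clique joined to \<open>z\<close> already give a
  contradiction. This supplies the hypotheses on blue counts in the pentagon lemmas.\<close>

lemma score_B:
  assumes z: "z \<in> V" "z \<notin> A" and z': "z' \<in> V" and zz: "r False z z'"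
    and same: "\<And>c y. y \<in> insert q (u ` {..<5} \<union> v ` {..<5}) \<Longrightarrow> r c z y \<longleftrightarrow> r c z' y"
  shows "score z \<le> 9 \<or> score z = 10 \<and> (\<exists>j<5. part z j)"
proof -
  have su: "r c z (u i) \<longleftrightarrow> r c z' (u i)" "r c z (v i) \<longleftrightarrow> r c z' (v i)" if "i < 5" for c i
    using same[of "u i" c] same[of "v i" c] that by auto
  note b = bounds[of z 0] bounds[of z 1] bounds[of z 2] bounds[of z 3] bounds[of z 4]
  have rx: "rd z 0 = 0 \<or> rd z 2 = 0" "rd z 1 = 0 \<or> rd z 3 = 0" "rd z 2 = 0 \<or> rd z 4 = 0" "rd z 3 = 0 \<or> rd z 0 = 0" "rd z 4 = 0 \<or> rd z 1 = 0"
    by (rule rd_excl[OF z(1)]; simp)+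
  show ?thesis
  proof (cases "adj z q")
    case True
    have zq: "r False z q" using True redA[of q z] qA symr[of True z q] by (auto simp: adj_def)
    have zq': "r False z' q" using zq same[of q False] by simp
    \<comment> \<open>The clique consists of \<open>z\<close>, \<open>z'\<close>, \<open>q\<close>,
      a complete pair \<open>j\<close> and one more blue neighbour \<open>x\<close> joined to both
      vertices of that pair.\<close>
    have K: False if x: "x = u i \<or> x = v i" "r False z x" and j: "r False z (u j)" "r False z (v j)" and i: "i < 5" "j < 5" "r False (u j) x" "r False (v j) x" for x i j
    proof -
      have x': "r False z' x" "x \<in> V" "r False q x" using x su[OF i(1)] uv[OF i(1)] by auto
      have j': "r False z' (u j)" "r False z' (v j)" using j su[OF i(2)] by auto
      have qs: "r False z q" "r False z' q" using zq zq' .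
      show False
        by (rule no_blue_K6[of z z' q "u j" "v j" x])
          (use z z' zz x x' j j' qs i uv[OF i(2)] qA in auto)
    qed
    have no1: "bl z i \<le> 1 \<or> bl z j = 0" if i: "i < 5" "j = (i+1) mod 5" for i j
    proof (rule ccontr)
      assume n: "\<not> ?thesis"
      then have "bl z i = 2" using bounds(2)[of z i] by auto
      then have zi: "r False z (u i)" "r False z (v i)" by (auto simp: bl2)
      obtain x where x: "x = u j \<or> x = v j" "r False z x" using n unfolding de_Morgan_disj bl0 by blast
      show False by (rule K[OF x zi]) (use i x uv_blue[OF i, of "u i" x] uv_blue[OF i, of "v i" x] in auto)
    qed
    have no2: "bl z j \<le> 1 \<or> bl z i = 0" if i: "i < 5" "j = (i+1) mod 5" for i j
    proof (rule ccontr)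
      assume n: "\<not> ?thesis"
      then have "bl z j = 2" using bounds(2)[of z j] by auto
      then have zi: "r False z (u j)" "r False z (v j)" by (auto simp: bl2)
      obtain x where x: "x = u i \<or> x = v i" "r False z x" using n unfolding de_Morgan_disj bl0 by blast
      show False by (rule K[OF x zi]) (use i x bl_next_sym[of "u j" j x i] bl_next_sym[of "v j" j x i] in auto)
    qed
    have no12: "bl z i + bl z j \<le> 2" if i: "i < 5" "j = (i+1) mod 5" for i j
      using no1[OF i] no2[OF i] bounds(1,2)[of z i] bounds(1,2)[of z j] by linarith
    have o: "bl z 0 + bl z 1 \<le> 2" "bl z 1 + bl z 2 \<le> 2" "bl z 2 + bl z 3 \<le> 2" "bl z 3 + bl z 4 \<le> 2" "bl z 4 + bl z 0 \<le> 2"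
      by (rule no12; simp)+
    have sc: "score z = 2 + (ad z 0 + ad z 1 + ad z 2 + ad z 3 + ad z 4)" using True by (simp add: score_def sum5)
    show ?thesis
    proof (cases "score z \<le> 9")
      case False
      then have "8 \<le> ad z 0 + ad z 1 + ad z 2 + ad z 3 + ad z 4" using sc by simp
      note P = pentagon_count_with_apex[OF b(1) b(7) b(13) b(19) b(25) b(4) b(10) b(16) b(22) b(28)
          b(5) b(11) b(17) b(23) b(29) b(6) b(12) b(18) b(24) b(30) rx o this]
      have res: "ad z 0 + ad z 1 + ad z 2 + ad z 3 + ad z 4 = 8" by (rule P[THEN conjunct1])
      have res2: "part z 0 \<or> part z 1 \<or> part z 2 \<or> part z 3 \<or> part z 4"
        using P[THEN conjunct2] zq by (simp add: part_def numeral_2_eq_2)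
      have "\<exists>j<5. part z j" using res2 by (elim disjE) (rule exI, rule conjI[rotated], assumption, simp)+
      then show ?thesis using sc res by simp
    qed simp
  next
    case False
    have no: "bl z i \<le> 1 \<or> bl z j \<le> 1" if i: "i < 5" "j = (i+1) mod 5" for i j
    proof (rule ccontr)
      assume "\<not> ?thesis"
      then have "bl z i = 2" "bl z j = 2" using bounds(2)[of z i] bounds(2)[of z j] by auto
      then have bb: "r False z (u i)" "r False z (v i)" "r False z (u j)" "r False z (v j)" by (auto simp: bl2)
      have j: "j < 5" using i by simp
      have bb': "r False z' (u i)" "r False z' (v i)" "r False z' (u j)" "r False z' (v j)" using bb su[OF i(1)] su[OF j] by auto
      show False
        by (rule no_blue_K6[of z z' "u i" "v i" "u j" "v j"])
          (use z z' zz bb bb' uv[OF i(1)] uv[OF j] uv_blue[OF i] in auto)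
    qed
    have "ad z 0 + ad z 1 + ad z 2 + ad z 3 + ad z 4 \<le> 9"
      by (rule pentagon_count_without_apex[OF b(5) b(11) b(17) b(23) b(29) b(6) b(12) b(18) b(24) b(30) rx]) (rule no; simp)+
    then show ?thesis using False by (simp add: score_def sum5)
  qed
qed

lemma score_le: "score z \<le> 12"
  using bounds(5)[of z 0] bounds(5)[of z 1] bounds(5)[of z 2] bounds(5)[of z 3] bounds(5)[of z 4]
  by (simp add: score_def sum5)

definition Q where "Q = insert q (u ` {..<5} \<union> v ` {..<5})"

lemma Q_mem: "q \<in> Q" "i < 5 \<Longrightarrow> u i \<in> Q" "i < 5 \<Longrightarrow> v i \<in> Q" by (auto simp: Q_def)

lemma Q_card: "finite Q" "card Q \<le> 11"
proof -
  show "finite Q" by (simp add: Q_def)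
  have "card (u ` {..<5::nat} \<union> v ` {..<5}) \<le> card (u ` {..<5::nat}) + card (v ` {..<5::nat})" by (rule card_Un_le)
  also have "\<dots> \<le> 5 + 5" using card_image_le[of "{..<5::nat}" u] card_image_le[of "{..<5::nat}" v] by simp
  finally show "card Q \<le> 11" unfolding Q_def using card_insert_le_m1[of 11 "u ` {..<5} \<union> v ` {..<5}" q] by simp
qed

definition pattern where "pattern z = {(c,y). y \<in> Q \<and> r c z y}"

lemma pattern_eq: assumes "pattern z = pattern w" "y \<in> Q" shows "r c z y \<longleftrightarrow> r c w y"
proof -
  have "(c,y) \<in> pattern z \<longleftrightarrow> (c,y) \<in> pattern w" using assms(1) by simp
  then show ?thesis using assms(2) by (simp add: pattern_def)
qed

lemma pattern_score:
  assumes p: "pattern z = pattern w"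
  shows "score z = score w" "part z j \<longleftrightarrow> part w j"
proof -
  note e = pattern_eq[OF p]
  have "ad z i = ad w i" "bl z i = bl w i" "rd z i = rd w i" if "i < 5" for i
    using e[OF Q_mem(2)[OF that]] e[OF Q_mem(3)[OF that]] by (simp_all add: ad_def bl_def rd_def adj_def)
  then show "score z = score w" "part z j \<longleftrightarrow> part w j"
    using e[OF Q_mem(1)] by (simp_all add: score_def part_def adj_def)
qed

definition good where "good z \<longleftrightarrow> (if z \<in> A then \<forall>i<5. r False z (u i) \<and> r False z (v i) else \<exists>j<5. part z j)"

text \<open>A class of at least \<open>m\<close> vertices outside \<open>A\<close> with equal trace
  contains a blue edge, which provides the partner needed in \<open>score_B\<close>. Vertices in
  smaller classes are set aside.\<close>

definition exceptional where "exceptional = {z\<in>V - A. real (card {w\<in>V - A. pattern w = pattern z}) < m}"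

text \<open>A trace is a set of pairs of a colour and one of at most 11 core vertices, so there are
  at most 2^22 classes, each with fewer than \<open>m\<close> exceptional vertices.\<close>

lemma exceptional_card: assumes "m > 0" shows "real (card exceptional) \<le> 2^22 * m"
proof -
  have sub: "pattern ` exceptional \<subseteq> Pow (UNIV \<times> Q)" by (auto simp: pattern_def)
  have "card (pattern ` exceptional) \<le> card (Pow ((UNIV::bool set) \<times> Q))"
    by (rule card_mono[OF _ sub]) (simp add: Q_card)
  also have "\<dots> = 2 ^ (2 * card Q)" by (simp add: card_Pow Q_card card_cartesian_product)
  also have "\<dots> \<le> 2 ^ 22" by (rule power_increasing) (use Q_card in auto)
  finally have c: "card (pattern ` exceptional) \<le> 2 ^ 22" .
  have fe: "finite exceptional" using finV by (simp add: exceptional_def)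
  have "real (card exceptional) = (\<Sum>z\<in>exceptional. 1)" by simp
  also have "\<dots> = (\<Sum>p\<in>pattern ` exceptional. \<Sum>z\<in>{z\<in>exceptional. pattern z = p}. 1)" by (rule sum.image_gen[OF fe])
  also have "\<dots> \<le> (\<Sum>p\<in>pattern ` exceptional. m)"
  proof (rule sum_mono)
    fix p assume "p \<in> pattern ` exceptional"
    then obtain z where z: "z \<in> exceptional" "p = pattern z" by blast
    have "card {w\<in>exceptional. pattern w = p} \<le> card {w\<in>V - A. pattern w = pattern z}"
      by (rule card_mono) (use finV z in \<open>auto simp: exceptional_def\<close>)
    moreover have "real (card {w\<in>V - A. pattern w = pattern z}) < m" using z(1) by (simp add: exceptional_def)
    ultimately show "(\<Sum>z\<in>{z\<in>exceptional. pattern z = p}. 1) \<le> m" by simp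
  qed
  also have "\<dots> = real (card (pattern ` exceptional)) * m" by simp
  also have "\<dots> \<le> 2 ^ 22 * m"
  proof (rule mult_right_mono)
    have "real (card (pattern ` exceptional)) \<le> real (2 ^ 22)" using c of_nat_le_iff by blast
    then show "real (card (pattern ` exceptional)) \<le> 2 ^ 22" by simp
  qed (use assms in simp)
  finally show ?thesis .
qed

text \<open>For exceptional vertices only the trivial bound 12 = 10 - 1 + 3 is claimed. For the
  others the score of \<open>z\<close> is that of an end of a blue edge inside its class.\<close>

lemma score_bound:
  assumes z: "z \<in> V"
  shows "score z \<le> 10 - of_bool (\<not> good z) + 3 * of_bool (z \<in> exceptional)"
proof (cases "z \<in> A")
  case True
  then show ?thesis using score_A[OF z True] by (auto simp: good_def exceptional_def)
next
  case A: False
  show ?thesis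
  proof (cases "z \<in> exceptional")
    case True
    then show ?thesis using score_le[of z] by simp
  next
    case False
    then have "real (card {w\<in>V - A. pattern w = pattern z}) \<ge> m" using z A by (simp add: exceptional_def)
    then obtain a b where ab: "a \<in> V - A" "pattern a = pattern z" "b \<in> V - A" "pattern b = pattern z" "r False a b"
      using blue_edge[of "{w\<in>V - A. pattern w = pattern z}"] by auto
    have "score a \<le> 9 \<or> score a = 10 \<and> (\<exists>j<5. part a j)"
    proof (rule score_B)
      show "a \<in> V" "a \<notin> A" "b \<in> V" "r False a b" using ab by auto
      fix c y assume "y \<in> insert q (u ` {..<5} \<union> v ` {..<5})"
      then show "r c a y \<longleftrightarrow> r c b y" using pattern_eq[of a b y c] ab by (simp add: Q_def)
    qed
    then have "score z \<le> 9 \<or> score z = 10 \<and> (\<exists>j<5. part z j)" using pattern_score[OF ab(2)] by simp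
    then show ?thesis using A by (auto simp: good_def)
  qed
qed

lemma score_sum:
  assumes deg: "\<And>x. x \<in> Q \<Longrightarrow> real (card {y\<in>V. adj x y}) \<ge> d"
  shows "(\<Sum>z\<in>V. real_of_int (score z)) \<ge> 12 * d"
proof -
  have s: "(\<Sum>z\<in>V. of_bool (adj z x)) = real (card {y\<in>V. adj x y})" for x
  proof -
    have "{y\<in>V. adj y x} = {y\<in>V. adj x y}" using adj_sym[of _ x] by simp
    then show ?thesis using finV by (simp add: of_bool_def sum.If_cases Int_def)
  qed
  have "(\<Sum>z\<in>V. real_of_int (score z)) = 2 * (\<Sum>z\<in>V. of_bool (adj z q)) +
     (\<Sum>i<5. (\<Sum>z\<in>V. of_bool (adj z (u i))) + (\<Sum>z\<in>V. of_bool (adj z (v i))))"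
    unfolding score_def ad_def by (simp add: sum.distrib sum_distrib_left sum.swap[of _ V])
  also have "\<dots> = 2 * real (card {y\<in>V. adj q y}) + (\<Sum>i<5. real (card {y\<in>V. adj (u i) y}) + real (card {y\<in>V. adj (v i) y}))"
    unfolding s ..
  also have "\<dots> \<ge> 2 * d + (\<Sum>i<(5::nat). d + d)"
    by (intro add_mono mult_left_mono sum_mono deg Q_mem) auto
  finally show ?thesis by simp
qed

text \<open>Double counting: the degrees of the core vertices make the mean score at least
  \<open>10 - 12 * \<eta>\<close>, while every vertex that is not good lowers it by 1 and every
  exceptional one raises it by at most 3.\<close>

lemma bad_card:
  assumes m: "m > 0" and deg: "\<And>x. x \<in> Q \<Longrightarrow> real (card {y\<in>V. adj x y}) \<ge> (5/6 - \<eta>) * real (card V)"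
  shows "real (card {z\<in>V. \<not> good z}) \<le> 12 * \<eta> * real (card V) + 3 * 2^22 * m"
proof -
  have ex: "exceptional \<subseteq> V" by (auto simp: exceptional_def)
  have "12 * ((5/6 - \<eta>) * real (card V)) \<le> (\<Sum>z\<in>V. real_of_int (score z))" by (rule score_sum[OF deg])
  also have "\<dots> \<le> (\<Sum>z\<in>V. 10 - of_bool (\<not> good z) + 3 * of_bool (z \<in> exceptional))"
  proof (rule sum_mono)
    fix z assume "z \<in> V"
    from score_bound[OF this] have "real_of_int (score z) \<le> real_of_int (10 - of_bool (\<not> good z) + 3 * of_bool (z \<in> exceptional))"
      by (simp only: of_int_le_iff)
    then show "real_of_int (score z) \<le> 10 - of_bool (\<not> good z) + 3 * of_bool (z \<in> exceptional)" by simp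
  qed
  also have "\<dots> = 10 * real (card V) - real (card {z\<in>V. \<not> good z}) + 3 * real (card (V \<inter> exceptional))"
    using finV by (simp add: sum.distrib sum_subtractf of_bool_def sum.If_cases Int_def sum_distrib_left[symmetric])
  also have "V \<inter> exceptional = exceptional" using ex by auto
  finally show ?thesis using exceptional_card[OF m] by (simp add: algebra_simps)
qed

text \<open>Vertices that are not good are thrown into class 0 together with the part inside
  \<open>A\<close>, so that every vertex receives a label.\<close>

definition label where "label z = (if z \<in> A \<or> \<not> good z then 0 else Suc (LEAST j. j < 5 \<and> part z j))"

lemma label_part: assumes "good z" "label z = Suc j" shows "z \<notin> A" "j < 5" "part z j"
proof -
  show "z \<notin> A" using assms by (auto simp: label_def)
  then have "\<exists>j. j < 5 \<and> part z j" "j = (LEAST j. j < 5 \<and> part z j)" using assms by (auto simp: good_def label_def)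
  then show "j < 5" "part z j" using LeastI_ex[of "\<lambda>j. j < 5 \<and> part z j"] by auto
qed

lemma label_0: assumes "good z" "label z = 0" shows "z \<in> A"
  using assms by (simp add: label_def split: if_splits)

lemma label_less: "label z < 6"
proof (cases "z \<in> A \<or> \<not> good z")
  case False
  then have "\<exists>j. j < 5 \<and> part z j" by (auto simp: good_def)
  from LeastI_ex[OF this] show ?thesis using False by (simp add: label_def)
qed (simp add: label_def)

text \<open>Two adjacent good vertices of class 0 complete two consecutive core pairs to a blue
  6-clique. In class \<open>j + 1\<close> a common red neighbour makes internal edges blue;
  \<open>m\<close> good neighbours of \<open>x\<close> there would contain a blue edge, and this
  edge, \<open>x\<close>, \<open>q\<close> and an adjacent core pair form a blue 6-clique.\<close>

lemma internal_degree:
  assumes x: "x \<in> V" "good x" and m: "m > 0"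
  shows "real (card {y\<in>V. adj x y \<and> label x = label y}) \<le> real (card {z\<in>V. \<not> good z}) + m"
proof -
  let ?B = "{z\<in>V. \<not> good z}"
  define W where "W = {y\<in>V. adj x y \<and> label x = label y \<and> good y}"
  have "card {y\<in>V. adj x y \<and> label x = label y} \<le> card (?B \<union> W)"
    by (rule card_mono) (use finV in \<open>auto simp: W_def\<close>)
  also have "\<dots> \<le> card ?B + card W" by (rule card_Un_le)
  finally have 1: "real (card {y\<in>V. adj x y \<and> label x = label y}) \<le> real (card ?B) + real (card W)" by simp
  have "real (card W) \<le> m"
  proof (cases "label x")
    case 0
    have "W = {}"
    proof (rule ccontr)
      assume "W \<noteq> {}"
      then obtain y where y: "y \<in> V" "adj x y" "label y = 0" "good y" using 0 by (auto simp: W_def)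
      have xA: "x \<in> A" "y \<in> A" using label_0 x y 0 by auto
      have bx: "r False x (u i) \<and> r False x (v i)" "r False y (u i) \<and> r False y (v i)" if "i < 5" for i
        using x(2) y(4) xA that by (auto simp: good_def)
      have xy: "r False x y" using y(2) redA[of x y] xA by (auto simp: adj_def)
      have i: "(0::nat) < 5" "(1::nat) < 5" "1 = (0 + 1) mod (5::nat)" by auto
      show False
        by (rule no_blue_K6[of x y "u 0" "v 0" "u 1" "v 1"])
          (use x y xy bx[OF i(1)] bx[OF i(2)] uv[OF i(1)] uv[OF i(2)] uv_blue[OF i(1,3)] in auto)
    qed
    then show ?thesis using m by simp
  next
    case (Suc j)
    note px = label_part[OF x(2) Suc]
    have Wp: "y \<in> V - A" "part y j" "r False x y" if "y \<in> W" for y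
    proof -
      have y: "y \<in> V" "adj x y" "label y = Suc j" "good y" using that Suc by (auto simp: W_def)
      note py = label_part[OF y(4,3)]
      show "y \<in> V - A" "part y j" using y py by auto
      have k: "(j+2) mod 5 < 5" by simp
      have "r True x (u ((j+2) mod 5))" "r True y (u ((j+2) mod 5))"
        using px(3) py(3) by (auto simp: part_def rd2)
      then have "\<not> r True x y"
        using red_triangle_free[OF x(1) y(1) uv(1)[OF k]] by blast
      then show "r False x y" using y(2) by (simp add: adj_def)
    qed
    show ?thesis
    proof (rule ccontr)
      assume "\<not> ?thesis"
      then have "real (card W) \<ge> m" by simp
      moreover have "W \<subseteq> V - A" using Wp(1) by blast
      ultimately obtain a b where ab: "a \<in> W" "b \<in> W" "r False a b" using blue_edge[of W] by blast
      have k: "(j+1) mod 5 < 5" by simp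
      have bq: "r False z q" "r False z (u ((j+1) mod 5))" "r False z (v ((j+1) mod 5))" if "part z j" for z
        using that by (auto simp: part_def bl2)
      show False
        by (rule no_blue_K6[of x a b q "u ((j+1) mod 5)" "v ((j+1) mod 5)"])
          (use x ab Wp[OF ab(1)] Wp[OF ab(2)] bq[OF px(3)] bq[OF Wp(2)[OF ab(1)]] bq[OF Wp(2)[OF ab(2)]] qA uv[OF k] in simp_all)
    qed
  qed
  then show ?thesis using 1 by simp
qed

lemma few_internal_edges:
  assumes m: "m > 0" and deg: "\<And>x. x \<in> Q \<Longrightarrow> real (card {y\<in>V. adj x y}) \<ge> (5/6 - \<eta>) * real (card V)"
  shows "ecount (\<lambda>x y. adj x y \<and> label x = label y) V V \<le> (24 * \<eta> * real (card V) + 2^25 * m) * real (card V)"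
proof -
  let ?B = "{z\<in>V. \<not> good z}" and ?n = "real (card V)"
  have "ecount (\<lambda>x y. adj x y \<and> label x = label y) V V = (\<Sum>x\<in>V. real (card {y\<in>V. adj x y \<and> label x = label y}))"
    by (rule ecount_deg[OF finV])
  also have "\<dots> \<le> (\<Sum>x\<in>V. real (card ?B) + m + of_bool (\<not> good x) * ?n)"
  proof (rule sum_mono)
    fix x assume x: "x \<in> V"
    show "real (card {y\<in>V. adj x y \<and> label x = label y}) \<le> real (card ?B) + m + of_bool (\<not> good x) * ?n"
    proof (cases "good x")
      case True
      then show ?thesis using internal_degree[OF x True m] by simp
    next
      case False
      have "card {y\<in>V. adj x y \<and> label x = label y} \<le> card V" by (rule card_mono) (use finV in auto)
      then show ?thesis using False m by simp
    qed
  qed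
  also have "\<dots> = (2 * real (card ?B) + m) * ?n"
  proof -
    have "(\<Sum>x\<in>V. of_bool (\<not> good x)) = real (card ?B)"
      using finV by (simp add: of_bool_def sum.If_cases Int_def)
    then have "(\<Sum>x\<in>V. of_bool (\<not> good x) * ?n) = real (card ?B) * ?n" by (simp only: sum_distrib_right[symmetric])
    then show ?thesis by (simp add: sum.distrib algebra_simps)
  qed
  also have "\<dots> \<le> (24 * \<eta> * ?n + 2^25 * m) * ?n"
  proof (rule mult_right_mono)
    show "2 * real (card ?B) + m \<le> 24 * \<eta> * ?n + 2^25 * m" using bad_card[OF m deg] m by simp
  qed simp
  finally show ?thesis .
qed

end

section \<open>From density to a sixfold partition\<close>

abbreviation both :: "(bool \<Rightarrow> 'a \<Rightarrow> 'a \<Rightarrow> bool) \<Rightarrow> 'a \<Rightarrow> 'a \<Rightarrow> bool" where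
  "both r \<equiv> (\<lambda>x y. r True x y \<or> r False x y)"

lemma rt_graph_subset:
  assumes "rt_graph V A r m" "W \<subseteq> V"
  shows "rt_graph W (A \<inter> W) r m"
proof -
  interpret rt_graph V A r m by fact
  show ?thesis
  proof
    show "finite W" using finite_subset[OF assms(2) finV] .
    show "r c x y \<longleftrightarrow> r c y x" for c x y by (rule symr)
    show "\<not> r c x x" for c x by (rule irr)
    show "x \<notin> A \<inter> W" if "r True x y" for x y using redA[OF that] by simp
    show "\<not> r True x z" if "x \<in> W" "y \<in> W" "z \<in> W" "r True x y" "r True y z" for x y z
      using red_triangle_free[of x y z] that assms(2) by blast
    show "card K \<le> 5" if "K \<subseteq> W" "\<And>x y. x \<in> K \<Longrightarrow> y \<in> K \<Longrightarrow> x \<noteq> y \<Longrightarrow> r False x y" for K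
      by (rule blue_K6_free) (use that assms(2) in auto)
    show "\<exists>u\<in>X. \<exists>v\<in>X. r False u v" if "X \<subseteq> W - A \<inter> W" "m \<le> real (card X)" for X
      by (rule blue_edge) (use that assms(2) in auto)
  qed auto
qed

text \<open>\<open>\<eta>\<close> may be negative. Then the first conclusion says that not all
  degrees can exceed 5/6 by more than the order of \<open>m\<close>, which yields the edge bound.
  For small positive \<open>\<eta>\<close> the second conclusion yields the partition.\<close>

lemma core_dichotomy:
  obtains \<delta> :: real where "\<delta> > 0"
    "\<And>V A r m \<eta>. rt_graph V A r m \<Longrightarrow> card V \<ge> 40000 \<Longrightarrow> m \<le> \<delta> * real (card V) \<Longrightarrow> m > 0 \<Longrightarrow>
       ecount (both r) V V > 0.8328 * (real (card V))^2 \<Longrightarrow>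
       (\<forall>x\<in>V. real (card {y\<in>V. both r x y}) \<ge> (5/6 - \<eta>) * real (card V)) \<Longrightarrow>
       0 \<le> 12 * \<eta> * real (card V) + 3 * 2^22 * m \<and>
       (\<exists>f. (\<forall>x. f x < (6::nat)) \<and>
         ecount (\<lambda>x y. both r x y \<and> f x = f y) V V \<le> (24 * \<eta> * real (card V) + 2^25 * m) * real (card V))"
proof -
  obtain \<delta> :: real where d: "\<delta> > 0"
    "\<And>V A r m. rt_graph V A r m \<Longrightarrow> card V \<ge> 40000 \<Longrightarrow> m \<le> \<delta> * real (card V) \<Longrightarrow>
       ecount (\<lambda>x y. r True x y \<or> r False x y) V V > 0.8328 * (real (card V))^2 \<Longrightarrow>
       \<exists>q u v. rt_graph.core V A r q u v"
    by (rule core_exists) (rule that, assumption)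
  show ?thesis
  proof (rule that[OF d(1)])
    fix V A r m \<eta>
    assume a: "rt_graph V A r m" "card V \<ge> 40000" "m \<le> \<delta> * real (card V)" "m > 0"
       "ecount (both r) V V > 0.8328 * (real (card V))^2"
       and deg: "\<forall>x\<in>V. real (card {y\<in>V. both r x y}) \<ge> (5/6 - \<eta>) * real (card V)"
    obtain q u v where "rt_graph.core V A r q u v" using d(2)[OF a(1,2,3,5)] by blast
    then interpret rt_core V A r m q u v
      using a(1) by (simp add: rt_core_def rt_core_axioms_def)
    have QV: "x \<in> V" if "x \<in> Q" for x using that qA uv by (auto simp: Q_def)
    have dg: "real (card {y\<in>V. adj x y}) \<ge> (5/6 - \<eta>) * real (card V)" if "x \<in> Q" for x
      using bspec[OF deg QV[OF that]] by (simp add: adj_def)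
    have "0 \<le> real (card {z\<in>V. \<not> good z})" by simp
    then have 1: "0 \<le> 12 * \<eta> * real (card V) + 3 * 2^22 * m" using bad_card[OF a(4) dg] by linarith
    have "ecount (\<lambda>x y. both r x y \<and> label x = label y) V V \<le> (24 * \<eta> * real (card V) + 2^25 * m) * real (card V)"
      using few_internal_edges[OF a(4) dg] by (simp add: adj_def)
    then show "0 \<le> 12 * \<eta> * real (card V) + 3 * 2^22 * m \<and>
       (\<exists>f. (\<forall>x. f x < (6::nat)) \<and>
         ecount (\<lambda>x y. both r x y \<and> f x = f y) V V \<le> (24 * \<eta> * real (card V) + 2^25 * m) * real (card V))"
      using 1 label_less by blast
  qed
qed

text \<open>\<open>W\<close> maximises \<open>e(W) - \<beta>|W|\<^sup>2\<close>.\<close>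
lemma dense_subset_min_degree:
  assumes V: "finite V" and sym: "\<And>x y. R x y \<longleftrightarrow> R y x" and irr: "\<And>x. \<not> R x x"
  obtains W where "W \<subseteq> V" "ecount R W W - \<beta> * (real (card W))^2 \<ge> ecount R V V - \<beta> * (real (card V))^2"
    "\<And>x. x \<in> W \<Longrightarrow> real (card {y\<in>W. R x y}) \<ge> \<beta> * (real (card W) - 1/2)"
proof -
  define \<phi> where "\<phi> W = ecount R W W - \<beta> * (real (card W))^2" for W
  have fin: "finite (\<phi> ` Pow V)" "\<phi> ` Pow V \<noteq> {}" using V by auto
  have "Max (\<phi> ` Pow V) \<in> \<phi> ` Pow V" by (rule Max_in[OF fin])
  then obtain W where W0: "W \<subseteq> V" "Max (\<phi> ` Pow V) = \<phi> W" by auto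
  have Wmax: "\<phi> W' \<le> \<phi> W" if "W' \<subseteq> V" for W'
    unfolding W0(2)[symmetric] by (rule Max_ge[OF fin(1)]) (use that in auto)
  note W = W0(1) Wmax
  have fW: "finite W" using W(1) V finite_subset by blast
  show ?thesis
  proof (rule that[OF W(1)])
    show "ecount R V V - \<beta> * (real (card V))^2 \<le> ecount R W W - \<beta> * (real (card W))^2"
      using W(2)[of V] by (simp add: \<phi>_def)
    fix x assume x: "x \<in> W"
    let ?U = "W - {x}"
    have d: "(\<Sum>y\<in>W. of_bool (R x y)) = real (card {y\<in>W. R x y})" using fW by (simp add: of_bool_def sum.If_cases Int_def)
    have "ecount R W W = (\<Sum>y\<in>W. of_bool (R x y)) + (\<Sum>z\<in>?U. \<Sum>y\<in>W. of_bool (R z y))"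
      unfolding ecount_def by (rule sum.remove[OF fW x])
    also have "(\<Sum>z\<in>?U. \<Sum>y\<in>W. of_bool (R z y)) = (\<Sum>z\<in>?U. of_bool (R z x) + (\<Sum>y\<in>?U. of_bool (R z y) :: real))"
      by (intro sum.cong refl sum.remove[OF fW x])
    also have "\<dots> = (\<Sum>z\<in>?U. of_bool (R z x)) + ecount R ?U ?U" by (simp add: sum.distrib ecount_def)
    also have "(\<Sum>z\<in>?U. of_bool (R z x)) = (\<Sum>z\<in>?U. of_bool (R x z) :: real)" by (intro sum.cong refl) (subst sym, rule refl)
    also have "\<dots> = (\<Sum>z\<in>W. of_bool (R x z))" using sum.remove[OF fW x, of "\<lambda>z. of_bool (R x z) :: real"] irr by simp
    finally have e: "ecount R W W = 2 * real (card {y\<in>W. R x y}) + ecount R ?U ?U" unfolding d by simp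
    have "card W > 0" using x fW by (auto simp: card_gt_0_iff)
    then have c: "real (card ?U) = real (card W) - 1" using x by (simp add: of_nat_diff)
    \<comment> \<open>Deleting \<open>x\<close> costs twice its degree and lowers the square of the
      size by \<open>2 * card W - 1\<close>; this is the origin of the 1/2.\<close>
    have "\<phi> ?U \<le> \<phi> W" by (rule W(2)) (use W(1) in auto)
    then show "\<beta> * (real (card W) - 1/2) \<le> real (card {y\<in>W. R x y})"
      unfolding \<phi>_def e c by (simp add: power2_eq_square algebra_simps)
  qed
qed

lemma ecount_le_square: "finite V \<Longrightarrow> ecount R V V \<le> (real (card V))^2"
  using ecount_le[of R V V] by (simp add: power2_eq_square)

text \<open>A denser graph has a subset \<open>W\<close> of linear size in which all degrees exceed
  \<open>(5/6 + \<theta>/4) * card W\<close>, and \<open>core_dichotomy\<close> with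
  \<open>\<eta> = - \<theta>/4\<close> refutes this.\<close>

lemma edge_upper_bound:
  fixes \<theta> :: real
  assumes t: "0 < \<theta>" "\<theta> \<le> 1"
  obtains \<delta> N where "\<delta> > 0"
    "\<And>V A r m. rt_graph V A r m \<Longrightarrow> real (card V) \<ge> N \<Longrightarrow> m \<le> \<delta> * real (card V) \<Longrightarrow> m > 0 \<Longrightarrow>
       ecount (both r) V V \<le> (5/6 + \<theta>) * (real (card V))^2"
proof -
  obtain \<delta>1 :: real where d: "\<delta>1 > 0"
    "\<And>V A r m \<eta>. rt_graph V A r m \<Longrightarrow> card V \<ge> 40000 \<Longrightarrow> m \<le> \<delta>1 * real (card V) \<Longrightarrow> m > 0 \<Longrightarrow>
       ecount (both r) V V > 0.8328 * (real (card V))^2 \<Longrightarrow>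
       (\<forall>x\<in>V. real (card {y\<in>V. both r x y}) \<ge> (5/6 - \<eta>) * real (card V)) \<Longrightarrow>
       0 \<le> 12 * \<eta> * real (card V) + 3 * 2^22 * m \<and>
       (\<exists>f. (\<forall>x. f x < (6::nat)) \<and>
         ecount (\<lambda>x y. both r x y \<and> f x = f y) V V \<le> (24 * \<eta> * real (card V) + 2^25 * m) * real (card V))"
    by (rule core_dichotomy) (rule that, assumption)
  define c where "c = \<theta> / 2"
  \<comment> \<open>The dichotomy would give
    \<open>3 * \<theta> * card W \<le> 3 * 2^22 * m\<close>, but this choice keeps the right side at
    half the left.\<close>
  define \<delta>2 where "\<delta>2 = min \<delta>1 (\<theta> / 2^23)"
  have c: "0 < c" "c \<le> 1" using t by (auto simp: c_def)
  have d2: "\<delta>2 > 0" "\<delta>2 \<le> \<delta>1" "\<delta>2 \<le> \<theta> / 2^23" using d(1) t by (auto simp: \<delta>2_def)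
  define N where "N = (40000 + 4 / \<theta>) / c"
  show ?thesis
  proof (rule that[of "\<delta>2 * c" N])
    show "0 < \<delta>2 * c" using d2 c by simp
    fix V A r m
    assume g: "rt_graph V A r m" and n: "real (card V) \<ge> N" and m: "m \<le> \<delta>2 * c * real (card V)" "m > 0"
    interpret rt_graph V A r m by (rule g)
    show "ecount (both r) V V \<le> (5/6 + \<theta>) * (real (card V))^2"
    proof (rule ccontr)
      assume "\<not> ?thesis"
      then have big: "ecount (both r) V V > (5/6 + \<theta>) * (real (card V))^2" by simp
      have sy: "both r x y \<longleftrightarrow> both r y x" and ir: "\<not> both r x x" for x y
        using symr[of True x y] symr[of False x y] irr by auto
      obtain W where W: "W \<subseteq> V" "ecount (both r) W W - (5/6 + c) * (real (card W))^2 \<ge> ecount (both r) V V - (5/6 + c) * (real (card V))^2"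
        "\<And>x. x \<in> W \<Longrightarrow> real (card {y\<in>W. both r x y}) \<ge> (5/6 + c) * (real (card W) - 1/2)"
        by (rule dense_subset_min_degree[where \<beta> = "5/6 + c" and R = "both r", OF finV sy ir]) (rule that, assumption+)
      have fW: "finite W" using W(1) finV finite_subset by blast
      have W1: "ecount (both r) W W \<ge> (5/6 + c) * (real (card W))^2 + c * (real (card V))^2"
        using W(2) big by (simp add: c_def algebra_simps)
      have "c * (real (card V))^2 \<le> ecount (both r) W W"
      proof -
        have "0 \<le> (5/6 + c) * (real (card W))^2" using c by simp
        then show ?thesis using W1 by linarith
      qed
      also have "\<dots> \<le> (real (card W))^2" by (rule ecount_le_square[OF fW])
      finally have sq: "c * (real (card V))^2 \<le> (real (card W))^2" .
      have "(c * real (card V))^2 \<le> c * (real (card V))^2"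
      using mult_right_mono[of c 1 "c * (real (card V))^2"] c by (simp add: power2_eq_square mult_ac)
      then have "(c * real (card V))^2 \<le> (real (card W))^2" using sq by linarith
      then have cW: "c * real (card V) \<le> real (card W)" by (rule power2_le_imp_le) simp
      have "40000 + 4 / \<theta> \<le> c * real (card V)" using n c by (simp add: N_def field_simps)
      then have nW: "40000 + 4 / \<theta> \<le> real (card W)" using cW by linarith
      have t4: "4 / \<theta> > 0" using t by simp
      have W4: "card W \<ge> 40000" using nW t4 by linarith
      have "\<delta>2 * c * real (card V) \<le> \<delta>2 * real (card W)" using cW d2 by (simp add: mult_left_mono mult.assoc)
      then have mW2: "m \<le> \<delta>2 * real (card W)" using m by linarith
      have mW: "m \<le> \<delta>1 * real (card W)" "m \<le> \<theta> / 2^23 * real (card W)"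
        using mW2 d2 mult_right_mono[of \<delta>2 \<delta>1 "real (card W)"] mult_right_mono[of \<delta>2 "\<theta>/2^23" "real (card W)"] by auto
      have Wp: "real (card W) > 0" using W4 by simp
      have dens: "ecount (both r) W W > 0.8328 * (real (card W))^2"
      proof -
        have "0.8328 * (real (card W))^2 < (5/6 + c) * (real (card W))^2" by (rule mult_strict_right_mono) (use c Wp in auto)
        moreover have "0 \<le> c * (real (card V))^2" using c by simp
        ultimately show ?thesis using W1 by linarith
      qed
      have deg: "real (card {y\<in>W. both r x y}) \<ge> (5/6 - (- \<theta> / 4)) * real (card W)" if "x \<in> W" for x
      proof -
        have "1 \<le> \<theta> / 4 * real (card W)" using nW t by (simp add: field_simps)
        moreover have "(5/6 + c) * (real (card W) - 1/2) = (5/6 + \<theta>/4) * real (card W) + \<theta>/4 * real (card W) - 5/12 - \<theta>/4"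
          by (simp add: c_def field_simps)
        ultimately have "(5/6 + \<theta>/4) * real (card W) \<le> (5/6 + c) * (real (card W) - 1/2)"
          using t by linarith
        then show ?thesis using W(3)[OF that] by simp
      qed
      have "0 \<le> 12 * (- \<theta> / 4) * real (card W) + 3 * 2^22 * m"
        using d(2)[OF rt_graph_subset[OF g W(1)] W4 mW(1) m(2) dens ballI[OF deg]] by blast
      moreover have "3 * 2^22 * m \<le> 3 * 2^22 * (\<theta> / 2^23 * real (card W))" by (rule mult_left_mono[OF mW(2)]) simp
      moreover have "\<theta> * real (card W) > 0" using t Wp by simp
      ultimately show False by simp
    qed
  qed
qed

text \<open>In a suitable \<open>W\<close> all degrees are nearly 5/6 of its size, so it has a
  partition. Comparing the density of \<open>V\<close> with the edge bound for \<open>W\<close>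
  shows that almost nothing lies outside \<open>W\<close>, and the labels there do not
  matter.\<close>

theorem dense_six_partition:
  fixes \<theta> :: real
  assumes t: "0 < \<theta>"
  obtains \<eta> \<delta> N where "\<eta> > 0" "\<delta> > 0"
    "\<And>V A r m. rt_graph V A r m \<Longrightarrow> real (card V) \<ge> N \<Longrightarrow> m \<le> \<delta> * real (card V) \<Longrightarrow> m > 0 \<Longrightarrow>
       ecount (both r) V V \<ge> (5/6 - \<eta>) * (real (card V))^2 \<Longrightarrow>
       \<exists>f. (\<forall>x. f x < (6::nat)) \<and> ecount (\<lambda>x y. both r x y \<and> f x = f y) V V \<le> \<theta> * (real (card V))^2"
proof -
  \<comment> \<open>51 = 48 + 1 + 2: 24 times the degree deficit \<open>2 * \<kappa>\<close>, the
    term with \<open>m\<close>, and the pairs meeting \<open>V - W\<close>. The bound 1/10000 keeps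
    \<open>5/6 - \<kappa>\<close> above 0.8328.\<close>
  define \<kappa> where "\<kappa> = min (\<theta> / 51) (1/10000)"
  have k: "\<kappa> > 0" "\<kappa> \<le> \<theta> / 51" "\<kappa> \<le> 1/10000" using t by (auto simp: \<kappa>_def)
  \<comment> \<open>Quadratic in \<open>\<kappa>\<close>, because the comparison of \<open>V\<close>
    and \<open>W\<close> is divided by \<open>\<kappa>\<close> and should still leave an error of
    order \<open>\<kappa>\<close>.\<close>
  define \<eta> where "\<eta> = \<kappa>^2 / 2"
  have e: "\<eta> > 0" "\<eta> \<le> \<kappa> / 2" "\<eta> \<le> 1"   proof -
    have 1: "\<kappa> * \<kappa> \<le> \<kappa> * 1" by (rule mult_left_mono) (use k in auto)
    have 2: "\<eta> = \<kappa> * \<kappa> / 2" by (simp add: \<eta>_def power2_eq_square)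
    show "\<eta> > 0" using k by (simp add: 2)
    show "\<eta> \<le> \<kappa> / 2" "\<eta> \<le> 1" using 1 2 k by linarith+
  qed
  obtain \<delta>0 N0 where d0: "\<delta>0 > 0"
    "\<And>V A r m. rt_graph V A r m \<Longrightarrow> real (card V) \<ge> N0 \<Longrightarrow> m \<le> \<delta>0 * real (card V) \<Longrightarrow> m > 0 \<Longrightarrow>
       ecount (both r) V V \<le> (5/6 + \<eta>) * (real (card V))^2"
    by (rule edge_upper_bound[OF e(1,3)]) (rule that, assumption)
  obtain \<delta>1 :: real where d: "\<delta>1 > 0"
    "\<And>V A r m \<eta>. rt_graph V A r m \<Longrightarrow> card V \<ge> 40000 \<Longrightarrow> m \<le> \<delta>1 * real (card V) \<Longrightarrow> m > 0 \<Longrightarrow>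
       ecount (both r) V V > 0.8328 * (real (card V))^2 \<Longrightarrow>
       (\<forall>x\<in>V. real (card {y\<in>V. both r x y}) \<ge> (5/6 - \<eta>) * real (card V)) \<Longrightarrow>
       0 \<le> 12 * \<eta> * real (card V) + 3 * 2^22 * m \<and>
       (\<exists>f. (\<forall>x. f x < (6::nat)) \<and>
         ecount (\<lambda>x y. both r x y \<and> f x = f y) V V \<le> (24 * \<eta> * real (card V) + 2^25 * m) * real (card V))"
    by (rule core_dichotomy) (rule that, assumption)
  define c where "c = \<kappa> / 2"
  have c: "0 < c" "c \<le> 1" using k by (auto simp: c_def)
  define \<delta>2 where "\<delta>2 = min \<delta>1 (min \<delta>0 (\<kappa> / 2^25))"
  have d2: "\<delta>2 > 0" "\<delta>2 \<le> \<delta>1" "\<delta>2 \<le> \<delta>0" "\<delta>2 \<le> \<kappa> / 2^25" using d(1) d0(1) k by (auto simp: \<delta>2_def)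
  define N where "N = (40000 + \<bar>N0\<bar> + 1 / \<kappa>) / c"
  show ?thesis
  proof (rule that[OF e(1), of "\<delta>2 * c" N])
    show "0 < \<delta>2 * c" using d2 c by simp
    fix V A r m
    assume g: "rt_graph V A r m" and n: "real (card V) \<ge> N" and m: "m \<le> \<delta>2 * c * real (card V)" "m > 0"
      and big: "ecount (both r) V V \<ge> (5/6 - \<eta>) * (real (card V))^2"
    interpret rt_graph V A r m by (rule g)
    have sy: "both r x y \<longleftrightarrow> both r y x" and ir: "\<not> both r x x" for x y
      using symr[of True x y] symr[of False x y] irr by auto
    obtain W where W: "W \<subseteq> V" "ecount (both r) W W - (5/6 - \<kappa>) * (real (card W))^2 \<ge> ecount (both r) V V - (5/6 - \<kappa>) * (real (card V))^2"
      "\<And>x. x \<in> W \<Longrightarrow> real (card {y\<in>W. both r x y}) \<ge> (5/6 - \<kappa>) * (real (card W) - 1/2)"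
      by (rule dense_subset_min_degree[where \<beta> = "5/6 - \<kappa>" and R = "both r", OF finV sy ir]) (rule that, assumption+)
    have fW: "finite W" using W(1) finV finite_subset by blast
    have W1: "ecount (both r) W W \<ge> (5/6 - \<kappa>) * (real (card W))^2 + (\<kappa> - \<eta>) * (real (card V))^2"
      using W(2) big by (simp add: algebra_simps)
    have "c * (real (card V))^2 \<le> (\<kappa> - \<eta>) * (real (card V))^2" by (rule mult_right_mono) (use e in \<open>auto simp: c_def\<close>)
    moreover have k0: "0 \<le> (5/6 - \<kappa>) * (real (card W))^2" using k by simp
    ultimately have "c * (real (card V))^2 \<le> ecount (both r) W W" using W1 by linarith
    also have "\<dots> \<le> (real (card W))^2" by (rule ecount_le_square[OF fW])
    finally have sq: "c * (real (card V))^2 \<le> (real (card W))^2" .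
    have "(c * real (card V))^2 \<le> c * (real (card V))^2"
      using mult_right_mono[of c 1 "c * (real (card V))^2"] c by (simp add: power2_eq_square mult_ac)
    then have "(c * real (card V))^2 \<le> (real (card W))^2" using sq by linarith
    then have cW: "c * real (card V) \<le> real (card W)" by (rule power2_le_imp_le) simp
    have "40000 + \<bar>N0\<bar> + 1 / \<kappa> \<le> c * real (card V)" using n c by (simp add: N_def field_simps)
    then have nW: "40000 + \<bar>N0\<bar> + 1 / \<kappa> \<le> real (card W)" using cW by linarith
    have k1: "1 / \<kappa> > 0" using k by simp
    have W4: "card W \<ge> 40000" "real (card W) \<ge> N0" using nW k1 by linarith+
    have "\<delta>2 * c * real (card V) \<le> \<delta>2 * real (card W)" using cW d2 by (simp add: mult_left_mono mult.assoc)
    then have mW2: "m \<le> \<delta>2 * real (card W)" using m by linarith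
    have mW: "m \<le> \<delta>1 * real (card W)" "m \<le> \<delta>0 * real (card W)" "m \<le> \<kappa> / 2^25 * real (card W)"
      using mW2 d2 mult_right_mono[of \<delta>2 \<delta>1 "real (card W)"] mult_right_mono[of \<delta>2 \<delta>0 "real (card W)"]
        mult_right_mono[of \<delta>2 "\<kappa>/2^25" "real (card W)"] by auto
    have Wp: "real (card W) > 0" using W4 by simp
    have gW: "rt_graph W (A \<inter> W) r m" by (rule rt_graph_subset[OF g W(1)])
    have dens: "ecount (both r) W W > 0.8328 * (real (card W))^2"
    proof -
      have "0.8328 * (real (card W))^2 < (5/6 - \<kappa>) * (real (card W))^2" by (rule mult_strict_right_mono) (use k Wp in auto)
      moreover have "0 \<le> (\<kappa> - \<eta>) * (real (card V))^2" using e k by simp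
      ultimately show ?thesis using W1 by linarith
    qed
    have deg: "real (card {y\<in>W. both r x y}) \<ge> (5/6 - 2 * \<kappa>) * real (card W)" if "x \<in> W" for x
    proof -
      have "1 / \<kappa> \<le> real (card W)" using nW by linarith
      then have "1 \<le> \<kappa> * real (card W)" using k by (simp add: field_simps)
      moreover have "(5/6 - \<kappa>) * (real (card W) - 1/2) = (5/6 - 2 * \<kappa>) * real (card W) + \<kappa> * real (card W) - 5/12 + \<kappa>/2"
        by (simp add: field_simps)
      ultimately have "(5/6 - 2 * \<kappa>) * real (card W) \<le> (5/6 - \<kappa>) * (real (card W) - 1/2)"
        using k by linarith
      then show ?thesis using W(3)[OF that] by simp
    qed
    obtain f where f: "\<forall>x. f x < (6::nat)"
      "ecount (\<lambda>x y. both r x y \<and> f x = f y) W W \<le> (24 * (2 * \<kappa>) * real (card W) + 2^25 * m) * real (card W)"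
      using d(2)[OF gW W4(1) mW(1) m(2) dens ballI[OF deg]] by blast
    have "ecount (both r) W W \<le> (5/6 + \<eta>) * (real (card W))^2"
      by (rule d0(2)[OF gW W4(2) mW(2) m(2)])
    then have "(\<kappa> - \<eta>) * (real (card V))^2 \<le> (\<kappa> + \<eta>) * (real (card W))^2" using W1 by (simp add: algebra_simps)
    moreover have cWV: "real (card W) \<le> real (card V)" using card_mono[OF finV W(1)] by simp
    moreover have "(real (card W))^2 \<le> (real (card V))^2" by (rule power_mono[OF cWV]) simp
    then have "\<eta> * (real (card W))^2 \<le> \<eta> * (real (card V))^2" using e by (simp add: mult_left_mono)
    ultimately have "\<kappa> * (real (card V))^2 \<le> \<kappa> * (real (card W))^2 + 2 * \<eta> * (real (card V))^2" by (simp add: algebra_simps)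
    also have "2 * \<eta> * (real (card V))^2 = \<kappa> * (\<kappa> * (real (card V))^2)" by (simp add: \<eta>_def power2_eq_square)
    finally have "\<kappa> * (real (card V))^2 \<le> \<kappa> * ((real (card W))^2 + \<kappa> * (real (card V))^2)" by (simp add: algebra_simps)
    then have V2: "(real (card V))^2 \<le> (real (card W))^2 + \<kappa> * (real (card V))^2" using k by simp
    have VW: "real (card (V - W)) \<le> \<kappa> * real (card V)"
    proof -
      have "(real (card W))^2 \<le> real (card W) * real (card V)" using cWV by (simp add: power2_eq_square mult_left_mono)
      then have "real (card V) * real (card V) \<le> (real (card W) + \<kappa> * real (card V)) * real (card V)"
        using V2 by (simp add: power2_eq_square algebra_simps)
      moreover have "real (card V) > 0" using cWV Wp by linarith
      ultimately have "real (card V) \<le> real (card W) + \<kappa> * real (card V)" by simp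
      moreover have "real (card (V - W)) = real (card V) - real (card W)"
        using card_Diff_subset[OF fW W(1)] card_mono[OF finV W(1)] by (simp add: of_nat_diff)
      ultimately show ?thesis by linarith
    qed
    have int: "ecount (\<lambda>x y. both r x y \<and> f x = f y) V V \<le> ecount (\<lambda>x y. both r x y \<and> f x = f y) W W + 2 * real (card (V - W)) * real (card V)"
    proof -
      let ?R = "\<lambda>x y. both r x y \<and> f x = f y"
      have split: "ecount ?R X V = ecount ?R X W + ecount ?R X (V - W)" for X
        unfolding ecount_def sum.distrib[symmetric] using finV W(1)
        by (intro sum.cong refl) (metis (no_types, lifting) add.commute sum.subset_diff)
      have "ecount ?R V V = ecount ?R W V + ecount ?R (V - W) V"
        unfolding ecount_def using finV W(1) by (metis (no_types, lifting) add.commute sum.subset_diff)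
      moreover have "ecount ?R (V - W) V \<le> real (card (V - W)) * real (card V)" by (rule ecount_le)
      moreover have "ecount ?R W (V - W) \<le> real (card W) * real (card (V - W))" by (rule ecount_le)
      moreover have "real (card W) * real (card (V - W)) \<le> real (card V) * real (card (V - W))" by (rule mult_right_mono[OF cWV]) simp
      ultimately show ?thesis using split[of W] by (simp add: algebra_simps)
    qed
    have "2^25 * m \<le> \<kappa> * real (card W)" using mW(3) by simp
    then have "(24 * (2 * \<kappa>) * real (card W) + 2^25 * m) * real (card W) \<le> (49 * \<kappa> * real (card W)) * real (card W)"
      by (intro mult_right_mono) auto
    also have "\<dots> = 49 * \<kappa> * (real (card W))^2" by (simp add: power2_eq_square)
    also have "\<dots> \<le> 49 * \<kappa> * (real (card V))^2" using \<open>(real (card W))^2 \<le> (real (card V))^2\<close> k by (simp add: mult_left_mono)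
    finally have "ecount (\<lambda>x y. both r x y \<and> f x = f y) W W \<le> 49 * \<kappa> * (real (card V))^2" using f(2) by linarith
    moreover have "real (card (V - W)) * real (card V) \<le> \<kappa> * real (card V) * real (card V)" by (rule mult_right_mono[OF VW]) simp
    ultimately have "ecount (\<lambda>x y. both r x y \<and> f x = f y) V V \<le> 51 * \<kappa> * (real (card V))^2"
      using int by (simp add: power2_eq_square)
    also have "\<dots> \<le> \<theta> * (real (card V))^2" by (rule mult_right_mono) (use k in auto)
    finally show "\<exists>f. (\<forall>x. f x < (6::nat)) \<and> ecount (\<lambda>x y. both r x y \<and> f x = f y) V V \<le> \<theta> * (real (card V))^2"
      using f(1) by blast
  qed
qed

section \<open>Translation from edge sets and edge colourings\<close>

lemma ecount_edges:
  assumes "graph n E"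
  shows "ecount (\<lambda>x y. {x, y} \<in> E) {..<n} {..<n} = 2 * real (card E)"
proof -
  have fE: "finite E"
    by (rule finite_subset[of _ "Pow {..<n}"]) (use assms in \<open>auto simp: graph_def\<close>)
  have "ecount (\<lambda>x y. {x, y} \<in> E) {..<n} {..<n} = (\<Sum>x<n. \<Sum>y<n. \<Sum>e\<in>E. of_bool ({x, y} = e))"
    unfolding ecount_def
  proof (intro sum.cong refl)
    fix x y :: nat
    show "of_bool ({x, y} \<in> E) = (\<Sum>e\<in>E. of_bool ({x, y} = e) :: real)"
      using fE by (simp add: of_bool_def sum.delta)
  qed
  also have "\<dots> = (\<Sum>x<n. \<Sum>e\<in>E. \<Sum>y<n. of_bool ({x, y} = e))" by (intro sum.cong refl sum.swap)
  also have "\<dots> = (\<Sum>e\<in>E. \<Sum>x<n. \<Sum>y<n. of_bool ({x, y} = e))" by (rule sum.swap)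
  also have "\<dots> = (\<Sum>e\<in>E. 2)"
  proof (rule sum.cong[OF refl])
    fix e assume "e \<in> E"
    then obtain a b where ab: "e = {a, b}" "a \<noteq> b" "a < n" "b < n" using assms by (auto simp: graph_def)
    have "(\<Sum>x<n. \<Sum>y<n. of_bool ({x, y} = e) :: real) = (\<Sum>x<n. (if x = a then 1 else 0) + (if x = b then 1 else 0))"
    proof (rule sum.cong[OF refl])
      fix x
      have "(\<Sum>y<n. of_bool ({x, y} = e) :: real) = (\<Sum>y<n. (if y = b then if x = a then 1 else 0 else 0) + (if y = a then if x = b then 1 else 0 else 0))"
        by (rule sum.cong[OF refl]) (use ab in \<open>auto simp: doubleton_eq_iff\<close>)
      then show "(\<Sum>y<n. of_bool ({x, y} = e) :: real) = (if x = a then 1 else 0) + (if x = b then 1 else 0)"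
        using ab by (simp add: sum.distrib)
    qed
    also have "\<dots> = 2" using ab by (simp add: sum.distrib)
    finally show "(\<Sum>x<n. \<Sum>y<n. of_bool ({x, y} = e) :: real) = 2" .
  qed
  finally show ?thesis by simp
qed

lemma indep_set_finite:
  fixes n :: nat
  shows "finite {card I | I. I \<subseteq> {..<n} \<and> (\<forall>x\<in>I. \<forall>y\<in>I. x \<noteq> y \<longrightarrow> {x, y} \<notin> E)}"
proof (rule finite_subset[of _ "{..n}"])
  show "{card I | I. I \<subseteq> {..<n} \<and> (\<forall>x\<in>I. \<forall>y\<in>I. x \<noteq> y \<longrightarrow> {x, y} \<notin> E)} \<subseteq> {..n}"
  proof
    fix k assume "k \<in> {card I | I. I \<subseteq> {..<n} \<and> (\<forall>x\<in>I. \<forall>y\<in>I. x \<noteq> y \<longrightarrow> {x, y} \<notin> E)}"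
    then obtain I where "I \<subseteq> {..<n}" "k = card I" by blast
    then show "k \<in> {..n}" using card_mono[of "{..<n}" I] by simp
  qed
qed simp

lemma indep_num_ge:
  assumes "I \<subseteq> {..<n}" "\<And>x y. x \<in> I \<Longrightarrow> y \<in> I \<Longrightarrow> x \<noteq> y \<Longrightarrow> {x, y} \<notin> E"
  shows "card I \<le> indep_num n E"
  unfolding indep_num_def by (rule Max_ge[OF indep_set_finite]) (use assms in blast)

lemma indep_num_le:
  assumes "\<And>I. I \<subseteq> {..<n} \<Longrightarrow> (\<And>x y. x \<in> I \<Longrightarrow> y \<in> I \<Longrightarrow> x \<noteq> y \<Longrightarrow> {x, y} \<notin> E) \<Longrightarrow> real (card I) \<le> b"
  shows "real (indep_num n E) \<le> b"
proof -
  have "indep_num n E \<in> {card I | I. I \<subseteq> {..<n} \<and> (\<forall>x\<in>I. \<forall>y\<in>I. x \<noteq> y \<longrightarrow> {x, y} \<notin> E)}"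
    unfolding indep_num_def
  proof (rule Max_in[OF indep_set_finite])
    have "card ({}::nat set) \<in> {card I | I. I \<subseteq> {..<n} \<and> (\<forall>x\<in>I. \<forall>y\<in>I. x \<noteq> y \<longrightarrow> {x, y} \<notin> E)}" by blast
    then show "{card I | I. I \<subseteq> {..<n} \<and> (\<forall>x\<in>I. \<forall>y\<in>I. x \<noteq> y \<longrightarrow> {x, y} \<notin> E)} \<noteq> {}" by blast
  qed
  then obtain I where "I \<subseteq> {..<n}" "\<forall>x\<in>I. \<forall>y\<in>I. x \<noteq> y \<longrightarrow> {x, y} \<notin> E" "indep_num n E = card I" by blast
  then show ?thesis using assms[of I] by simp
qed

text \<open>Sets of at least \<open>b\<close> vertices without \<open>R\<close> pairs are removed as
  long as any exist. Each removal uses up \<open>b\<close> vertices, which bounds the number of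
  pieces.\<close>

lemma greedy_independent_pieces:
  fixes b :: real
  assumes "finite V" "b > 0"
  shows "\<exists>A F. A \<subseteq> V \<and> \<Union>F = V - A \<and> finite F \<and> b * real (card F) \<le> real (card V) \<and>
    (\<forall>X\<in>F. \<forall>x\<in>X. \<forall>y\<in>X. \<not> R x y) \<and> (\<forall>X\<subseteq>A. (\<forall>x\<in>X. \<forall>y\<in>X. \<not> R x y) \<longrightarrow> real (card X) < b)"
  using assms(1)
proof (induction "card V" arbitrary: V rule: less_induct)
  case less
  show ?case
  proof (cases "\<forall>X\<subseteq>V. (\<forall>x\<in>X. \<forall>y\<in>X. \<not> R x y) \<longrightarrow> real (card X) < b")
    case True
    then show ?thesis by (intro exI[of _ V] exI[of _ "{}"]) simp
  next
    case False
    then obtain X where X: "X \<subseteq> V" "\<forall>x\<in>X. \<forall>y\<in>X. \<not> R x y" "b \<le> real (card X)" by (auto simp: not_less)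
    have fX: "finite X" using X less.prems finite_subset by blast
    have cX: "card X > 0" using X assms(2) by (cases "card X") auto
    have c: "card (V - X) = card V - card X" "card X \<le> card V"
      using card_Diff_subset[OF fX X(1)] card_mono[OF less.prems X(1)] by auto
    have "\<exists>A F. A \<subseteq> V - X \<and> \<Union>F = V - X - A \<and> finite F \<and> b * real (card F) \<le> real (card (V - X)) \<and>
      (\<forall>X\<in>F. \<forall>x\<in>X. \<forall>y\<in>X. \<not> R x y) \<and> (\<forall>X\<subseteq>A. (\<forall>x\<in>X. \<forall>y\<in>X. \<not> R x y) \<longrightarrow> real (card X) < b)"
      by (rule less.hyps) (use c cX less.prems in auto)
    then obtain A F where A: "A \<subseteq> V - X" "\<Union>F = V - X - A" "finite F" "b * real (card F) \<le> real (card (V - X))"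
      "\<forall>X\<in>F. \<forall>x\<in>X. \<forall>y\<in>X. \<not> R x y" "\<forall>X\<subseteq>A. (\<forall>x\<in>X. \<forall>y\<in>X. \<not> R x y) \<longrightarrow> real (card X) < b"
      by (elim exE conjE) (rule that, assumption+)
    have "card (insert X F) \<le> Suc (card F)" by (simp add: card_insert_le_m1 card_insert_if A(3))
    then have "b * real (card (insert X F)) \<le> b * (1 + real (card F))" using assms(2) by (intro mult_left_mono) auto
    also have "\<dots> \<le> real (card X) + real (card (V - X))" using A(4) X(3) by (simp add: algebra_simps)
    also have "\<dots> = real (card V)" using c by (simp add: of_nat_diff)
    finally have "b * real (card (insert X F)) \<le> real (card V)" .
    moreover have "\<Union>(insert X F) = V - A" using A(1,2) X(1) by auto
    ultimately show ?thesis using A X by (intro exI[of _ A] exI[of _ "insert X F"]) auto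
  qed
qed

lemma KK_free_blue:
  assumes "\<nexists>K. mono_clique n E c False 6 K" "K \<subseteq> {..<n}"
    "\<And>x y. x \<in> K \<Longrightarrow> y \<in> K \<Longrightarrow> x \<noteq> y \<Longrightarrow> {x, y} \<in> E \<and> \<not> c {x, y}"
  shows "card K \<le> 5"
proof (rule ccontr)
  assume "\<not> ?thesis"
  then have "6 \<le> card K" by simp
  then obtain K' where K': "K' \<subseteq> K" "card K' = 6" by (meson obtain_subset_with_card_n)
  have "mono_clique n E c False 6 K'"
    unfolding mono_clique_def
  proof (intro conjI ballI impI)
    show "K' \<subseteq> {..<n}" using K'(1) assms(2) by auto
    show "card K' = 6" by (rule K'(2))
    fix x y assume "x \<in> K'" "y \<in> K'" "x \<noteq> y"
    then show "{x, y} \<in> E" "c {x, y} = False" using assms(3)[of x y] K'(1) by auto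
  qed
  then show False using assms(1) by blast
qed

text \<open>The task is to turn a colouring into an \<open>rt_graph\<close> at the cost of few
  edges. The removed pieces make up \<open>B\<close>; inside a piece every edge is blue, and this is
  where small independence number becomes a statement about blue edges.\<close>

theorem six_partition:
  fixes \<theta> :: real
  assumes t: "0 < \<theta>"
  obtains \<eta> N where "\<eta> > 0"
    "\<And>n E. real n \<ge> N \<Longrightarrow> graph n E \<Longrightarrow> KK_free 3 6 n E \<Longrightarrow> real (indep_num n E) \<le> \<eta> * real n \<Longrightarrow>
       real (card E) \<ge> (5/12 - \<eta>) * (real n)^2 \<Longrightarrow>
       \<exists>f. (\<forall>x. f x < (6::nat)) \<and> ecount (\<lambda>x y. {x, y} \<in> E \<and> f x = f y) {..<n} {..<n} \<le> \<theta> * (real n)^2"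
proof -
  have t2: "0 < \<theta> / 2" using t by simp
  obtain \<eta>0 \<delta>0 N0 where d: "\<eta>0 > 0" "\<delta>0 > 0"
    "\<And>V A r m. rt_graph V A r m \<Longrightarrow> real (card V) \<ge> N0 \<Longrightarrow> m \<le> \<delta>0 * real (card V) \<Longrightarrow> m > 0 \<Longrightarrow>
       ecount (both r) V V \<ge> (5/6 - \<eta>0) * (real (card V))^2 \<Longrightarrow>
       \<exists>f. (\<forall>x. f x < (6::nat)) \<and> ecount (\<lambda>x y. both r x y \<and> f x = f y) V V \<le> \<theta> / 2 * (real (card V))^2"
    by (rule dense_six_partition[OF t2]) (rule that, assumption+)
  \<comment> \<open>The deleted red edges amount to at most \<open>2 * \<beta>\<close> times
    \<open>n^2\<close> ordered pairs. They are charged twice: against the required density and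
    against the final count.\<close>
  define \<beta> where "\<beta> = min \<eta>0 \<theta> / 4"
  have b: "\<beta> > 0" "\<beta> \<le> \<eta>0 / 4" "\<beta> \<le> \<theta> / 4" using d t by (auto simp: \<beta>_def)
  define \<eta> where "\<eta> = min (\<eta>0 / 4) (\<delta>0 * \<beta> / 2)"
  have e: "\<eta> > 0" "\<eta> \<le> \<eta>0 / 4" "\<eta> \<le> \<delta>0 * \<beta> / 2" using d b by (auto simp: \<eta>_def)
  define N where "N = \<bar>N0\<bar> + 2 / (\<delta>0 * \<beta>) + 1"
  show ?thesis
  proof (rule that[OF e(1), of N])
    fix n E
    assume n: "real n \<ge> N" and g: "graph n E" and KK: "KK_free 3 6 n E"
      and al: "real (indep_num n E) \<le> \<eta> * real n" and ed: "real (card E) \<ge> (5/12 - \<eta>) * (real n)^2"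
    have db: "2 / (\<delta>0 * \<beta>) > 0" using d b by simp
    have nN: "real n \<ge> N0" "real n \<ge> 2 / (\<delta>0 * \<beta>)" "real n > 0" using n db abs_ge_self[of N0] unfolding N_def by linarith+
    obtain c where c: "\<nexists>K. mono_clique n E c True 3 K" "\<nexists>K. mono_clique n E c False 6 K"
      using KK by (auto simp: KK_free_def)
    have Eirr: "{x, x} \<notin> E" for x using g by (auto simp: graph_def doubleton_eq_iff)
    define V where "V = {..<n}"
    have cV: "card V = n" "finite V" by (auto simp: V_def)
    define R where "R x y \<longleftrightarrow> {x, y} \<in> E \<and> c {x, y}" for x y
    have Rsym: "R x y \<longleftrightarrow> R y x" for x y by (simp add: R_def insert_commute)
    have Rtri: False if "x \<in> V" "y \<in> V" "z \<in> V" "R x y" "R y z" "R x z" for x y z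
    proof -
      have ne: "x \<noteq> y" "y \<noteq> z" "x \<noteq> z" using that Eirr by (auto simp: R_def)
      have "R y x" "R z y" "R z x" using that Rsym by blast+
      then have "mono_clique n E c True 3 {x, y, z}"
        using that ne by (auto simp: mono_clique_def R_def V_def)
      then show False using c(1) by blast
    qed
    have bn: "\<beta> * real n > 0" using b nN by simp
    obtain A F where A: "A \<subseteq> V" "\<Union>F = V - A" "finite F" "\<beta> * real n * real (card F) \<le> real (card V)"
      "\<forall>X\<in>F. \<forall>x\<in>X. \<forall>y\<in>X. \<not> R x y" "\<forall>X\<subseteq>A. (\<forall>x\<in>X. \<forall>y\<in>X. \<not> R x y) \<longrightarrow> real (card X) < \<beta> * real n"
      using greedy_independent_pieces[OF cV(2) bn, of R] by (elim exE conjE) (rule that, assumption+)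
    have cF: "real (card F) \<le> 1 / \<beta>"
    proof -
      have "(\<beta> * real (card F)) * real n \<le> 1 * real n" using A(4) cV by (simp add: mult_ac)
      then have "\<beta> * real (card F) \<le> 1" using nN by (simp only: mult_le_cancel_right_pos)
      then show ?thesis using b by (simp add: field_simps)
    qed
    \<comment> \<open>Red edges meeting \<open>A\<close> are dropped; blue edges are all
      kept.\<close>
    define r where "r col x y \<longleftrightarrow> (if col then R x y \<and> x \<notin> A \<and> y \<notin> A else {x, y} \<in> E \<and> \<not> c {x, y})" for col x y
    define a where "a = real (indep_num n E)"
    \<comment> \<open>There are at most \<open>1 / \<beta>\<close> pieces, so a set of
      \<open>m\<close> vertices of \<open>B\<close> has more than \<open>a\<close> of them in a
      single piece and hence contains an edge there.\<close>
    define m where "m = (a + 1) / \<beta>"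
    have G: "rt_graph V A r m"
    proof
      show "finite V" "A \<subseteq> V" using cV A by auto
      show "r cl x y \<longleftrightarrow> r cl y x" for cl x y using Rsym[of x y] by (auto simp: r_def insert_commute)
      show "\<not> r cl x x" for cl x using Eirr by (auto simp: r_def R_def)
      show "x \<notin> A" if "r True x y" for x y using that by (simp add: r_def)
      show "\<not> r True x z" if "x \<in> V" "y \<in> V" "z \<in> V" "r True x y" "r True y z" for x y z
        using Rtri[of x y z] that by (auto simp: r_def)
      show "card K \<le> 5" if "K \<subseteq> V" "\<And>x y. x \<in> K \<Longrightarrow> y \<in> K \<Longrightarrow> x \<noteq> y \<Longrightarrow> r False x y" for K
        by (rule KK_free_blue[OF c(2)]) (use that in \<open>auto simp: r_def V_def\<close>)
      show "\<exists>u\<in>X. \<exists>v\<in>X. r False u v" if X: "X \<subseteq> V - A" "m \<le> real (card X)" for X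
      proof -
        have fX: "finite X" using X(1) cV finite_subset by blast
        have "\<exists>P\<in>F. real (card (X \<inter> P)) > a"
        proof (rule ccontr)
          assume "\<not> ?thesis"
          then have sm: "real (card (X \<inter> P)) \<le> a" if "P \<in> F" for P using that by auto
          have "X = (\<Union>P\<in>F. X \<inter> P)" using X(1) A(2) by blast
          then have "card X \<le> (\<Sum>P\<in>F. card (X \<inter> P))" using card_UN_le[OF A(3), of "\<lambda>P. X \<inter> P"] by simp
          then have "real (card X) \<le> (\<Sum>P\<in>F. real (card (X \<inter> P)))" by (metis of_nat_le_iff of_nat_sum)
          also have "\<dots> \<le> real (card F) * a" by (rule sum_bounded_above) (use sm in auto)
          also have "\<dots> \<le> 1 / \<beta> * a" by (rule mult_right_mono[OF cF]) (simp add: a_def)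
          also have "\<dots> < m" using b by (simp add: m_def divide_strict_right_mono)
          finally show False using X(2) by simp
        qed
        then obtain P where P: "P \<in> F" "real (card (X \<inter> P)) > a" by blast
        have "\<not> (\<forall>x\<in>X \<inter> P. \<forall>y\<in>X \<inter> P. x \<noteq> y \<longrightarrow> {x, y} \<notin> E)"
        proof
          assume "\<forall>x\<in>X \<inter> P. \<forall>y\<in>X \<inter> P. x \<noteq> y \<longrightarrow> {x, y} \<notin> E"
          then have "card (X \<inter> P) \<le> indep_num n E" by (intro indep_num_ge) (use X(1) in \<open>auto simp: V_def\<close>)
          then show False using P(2) by (simp add: a_def)
        qed
        then obtain x y where xy: "x \<in> X \<inter> P" "y \<in> X \<inter> P" "{x, y} \<in> E" by blast
        have "\<not> R x y" using A(5) P(1) xy by blast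
        then have "r False x y" using xy by (simp add: r_def R_def)
        then show ?thesis using xy by blast
      qed
    qed
    have rem: "ecount (\<lambda>x y. R x y \<and> (x \<in> A \<or> y \<in> A)) V V \<le> 2 * \<beta> * (real n)^2"
    proof -
      have 1: "ecount (\<lambda>x y. R x y \<and> y \<in> A) V V \<le> \<beta> * (real n)^2"
      proof -
        have "ecount (\<lambda>x y. R x y \<and> y \<in> A) V V = (\<Sum>x\<in>V. real (card {y\<in>V. R x y \<and> y \<in> A}))" by (rule ecount_deg[OF cV(2)])
        also have "\<dots> \<le> (\<Sum>x\<in>V. \<beta> * real n)"
        proof (rule sum_mono)
          fix x assume x: "x \<in> V"
          \<comment> \<open>A red neighbourhood spans no red edge, so its trace on \<open>A\<close>
            is too small to be another piece.\<close>
          have "\<forall>u\<in>{y\<in>V. R x y \<and> y \<in> A}. \<forall>v\<in>{y\<in>V. R x y \<and> y \<in> A}. \<not> R u v"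
            using Rtri[OF x] by blast
          moreover have "{y\<in>V. R x y \<and> y \<in> A} \<subseteq> A" by blast
          ultimately have "real (card {y\<in>V. R x y \<and> y \<in> A}) < \<beta> * real n" using A(6) by blast
          then show "real (card {y\<in>V. R x y \<and> y \<in> A}) \<le> \<beta> * real n" by simp
        qed
        also have "\<dots> = \<beta> * (real n)^2" by (simp add: cV power2_eq_square)
        finally show ?thesis .
      qed
      have "ecount (\<lambda>x y. R x y \<and> x \<in> A) V V = ecount (\<lambda>x y. R x y \<and> y \<in> A) V V"
        unfolding ecount_def by (subst sum.swap) (intro sum.cong refl, simp add: Rsym)
      moreover have "ecount (\<lambda>x y. R x y \<and> (x \<in> A \<or> y \<in> A)) V V \<le> ecount (\<lambda>x y. R x y \<and> x \<in> A) V V + ecount (\<lambda>x y. R x y \<and> y \<in> A) V V"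
        using ecount_or[of "\<lambda>x y. R x y \<and> x \<in> A" "\<lambda>x y. R x y \<and> y \<in> A" V V] by (simp only: conj_disj_distribL)
      ultimately show ?thesis using 1 by simp
    qed
    have both: "{x, y} \<in> E \<Longrightarrow> both r x y \<or> (R x y \<and> (x \<in> A \<or> y \<in> A))" for x y by (auto simp: r_def R_def)
    have "2 * real (card E) = ecount (\<lambda>x y. {x, y} \<in> E) V V" using ecount_edges[OF g] by (simp add: V_def)
    also have "\<dots> \<le> ecount (\<lambda>x y. both r x y \<or> (R x y \<and> (x \<in> A \<or> y \<in> A))) V V" by (rule ecount_mono) (rule both)
    also have "\<dots> \<le> ecount (both r) V V + ecount (\<lambda>x y. R x y \<and> (x \<in> A \<or> y \<in> A)) V V" by (rule ecount_or)
    finally have "ecount (both r) V V \<ge> 2 * real (card E) - 2 * \<beta> * (real n)^2" using rem by linarith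
    moreover have "2 * ((5/12 - \<eta>) * (real n)^2) \<le> 2 * real (card E)" using ed by simp
    ultimately have eb: "ecount (both r) V V \<ge> (5/6 - 2 * \<eta> - 2 * \<beta>) * (real n)^2" by (simp add: algebra_simps)
    have "(5/6 - \<eta>0) * (real n)^2 \<le> (5/6 - 2 * \<eta> - 2 * \<beta>) * (real n)^2" by (rule mult_right_mono) (use e b in auto)
    then have dense: "ecount (both r) V V \<ge> (5/6 - \<eta>0) * (real (card V))^2" using eb cV by simp
    have ms: "m \<le> \<delta>0 * real (card V)"
    proof -
      have "a \<le> \<delta>0 * \<beta> / 2 * real n" using al e(3) mult_right_mono[OF e(3), of "real n"] by (simp add: a_def)
      moreover have "1 \<le> \<delta>0 * \<beta> / 2 * real n" using nN(2) d b by (simp add: field_simps)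
      ultimately have "a + 1 \<le> \<delta>0 * real n * \<beta>" by (simp add: algebra_simps)
      then show ?thesis using b cV by (simp add: m_def divide_le_eq)
    qed
    have m0: "m > 0" using b by (simp add: m_def a_def add_nonneg_pos)
    have nV: "real (card V) \<ge> N0" using nN cV by simp
    obtain f where f: "\<forall>x. f x < (6::nat)" "ecount (\<lambda>x y. both r x y \<and> f x = f y) V V \<le> \<theta> / 2 * (real (card V))^2"
      using d(3)[OF G nV ms m0 dense] by blast
    have "ecount (\<lambda>x y. {x, y} \<in> E \<and> f x = f y) V V \<le> ecount (\<lambda>x y. (both r x y \<and> f x = f y) \<or> (R x y \<and> (x \<in> A \<or> y \<in> A))) V V"
      by (rule ecount_mono) (use both in blast)
    also have "\<dots> \<le> ecount (\<lambda>x y. both r x y \<and> f x = f y) V V + ecount (\<lambda>x y. R x y \<and> (x \<in> A \<or> y \<in> A)) V V" by (rule ecount_or)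
    also have "\<dots> \<le> \<theta> / 2 * (real n)^2 + 2 * \<beta> * (real n)^2" using f(2) rem cV by simp
    also have "2 * \<beta> * (real n)^2 \<le> \<theta> / 2 * (real n)^2" by (rule mult_right_mono) (use b in auto)
    finally show "\<exists>f. (\<forall>x. f x < (6::nat)) \<and> ecount (\<lambda>x y. {x, y} \<in> E \<and> f x = f y) {..<n} {..<n} \<le> \<theta> * (real n)^2"
      using f(1) unfolding V_def by (intro exI[of _ f]) simp
  qed
qed

section \<open>Triangle-free graphs of small independence ratio\<close>

text \<open>A weighted form of independence ratio at most \<open>\<rho>\<close>, which leaves
  freedom in distributing weight; a blow-up recovers ordinary graphs. The condition on triples with
  \<open>x = y = z\<close> also forbids loops.\<close>

definition sparse_graph :: "real \<Rightarrow> 'a set \<Rightarrow> ('a \<Rightarrow> 'a \<Rightarrow> bool) \<Rightarrow> ('a \<Rightarrow> real) \<Rightarrow> bool" where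
  "sparse_graph \<rho> S R w \<longleftrightarrow> finite S \<and> (\<forall>x y. R x y \<longrightarrow> R y x) \<and> (\<forall>x y z. R x y \<longrightarrow> R y z \<longrightarrow> \<not> R x z) \<and>
     (\<forall>x\<in>S. 0 \<le> w x) \<and> sum w S = 1 \<and>
     (\<forall>I\<subseteq>S. (\<forall>x\<in>I. \<forall>y\<in>I. \<not> R x y) \<longrightarrow> sum w I \<le> \<rho>)"

lemma sparseD:
  assumes "sparse_graph \<rho> S R w"
  shows "finite S" "R x y \<Longrightarrow> R y x" "R x y \<Longrightarrow> R y z \<Longrightarrow> \<not> R x z" "x \<in> S \<Longrightarrow> 0 \<le> w x" "sum w S = 1"
    "I \<subseteq> S \<Longrightarrow> (\<forall>x\<in>I. \<forall>y\<in>I. \<not> R x y) \<Longrightarrow> sum w I \<le> \<rho>"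
proof -
  have "\<forall>x y. R x y \<longrightarrow> R y x" using assms unfolding sparse_graph_def by (elim conjE)
  then show "R x y \<Longrightarrow> R y x" by blast
  have "\<forall>x y z. R x y \<longrightarrow> R y z \<longrightarrow> \<not> R x z" using assms unfolding sparse_graph_def by (elim conjE)
  then show "R x y \<Longrightarrow> R y z \<Longrightarrow> \<not> R x z" by blast
  have "\<forall>I\<subseteq>S. (\<forall>x\<in>I. \<forall>y\<in>I. \<not> R x y) \<longrightarrow> sum w I \<le> \<rho>" using assms unfolding sparse_graph_def by (elim conjE)
  then show "I \<subseteq> S \<Longrightarrow> (\<forall>x\<in>I. \<forall>y\<in>I. \<not> R x y) \<Longrightarrow> sum w I \<le> \<rho>" by blast
  have "\<forall>x\<in>S. 0 \<le> w x" using assms unfolding sparse_graph_def by (elim conjE)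
  then show "x \<in> S \<Longrightarrow> 0 \<le> w x" by blast
  show "finite S" "sum w S = 1" using assms unfolding sparse_graph_def by - (elim conjE, assumption)+
qed

text \<open>The vertex set is pinned to natural numbers so that the construction, which changes the
  vertex type, can be iterated.\<close>

definition sparse_ratio :: "real \<Rightarrow> bool" where
  "sparse_ratio \<rho> \<longleftrightarrow> (\<exists>(S::nat set) R w. sparse_graph \<rho> S R w)"

lemma sparse_ratioI:
  fixes S :: "'a set"
  assumes s: "sparse_graph \<rho> S R w"
  shows "sparse_ratio \<rho>"
proof -
  note sD = sparseD[OF s]
  have fS: "finite S" by (rule sD(1))
  obtain h :: "'a \<Rightarrow> nat" and n where h: "h ` S = {i. i < n}" "inj_on h S"
    using finite_imp_inj_to_nat_seg[OF fS] by blast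
  define g where "g = inv_into S h"
  have gh: "g (h x) = x" if "x \<in> S" for x using that h(2) by (simp add: g_def)
  have "sparse_graph \<rho> (h ` S) (\<lambda>x y. R (g x) (g y)) (\<lambda>x. w (g x))"
    unfolding sparse_graph_def
  proof (intro conjI)
    show "finite (h ` S)" using fS by simp
    show "\<forall>x y. R (g x) (g y) \<longrightarrow> R (g y) (g x)" by (intro allI impI) (rule sD(2))
    show "\<forall>x y z. R (g x) (g y) \<longrightarrow> R (g y) (g z) \<longrightarrow> \<not> R (g x) (g z)" by (intro allI impI) (rule sD(3))
    show "\<forall>x\<in>h ` S. 0 \<le> w (g x)" using sD(4) gh by auto
    have sub: "sum (\<lambda>x. w (g x)) (h ` T) = sum w T" if "T \<subseteq> S" for T
      using that h(2) gh by (subst sum.reindex) (auto intro: inj_on_subset intro!: sum.cong simp: subset_iff)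
    show "sum (\<lambda>x. w (g x)) (h ` S) = 1" using sub[of S] sD(5) by simp
    show "\<forall>I\<subseteq>h ` S. (\<forall>x\<in>I. \<forall>y\<in>I. \<not> R (g x) (g y)) \<longrightarrow> sum (\<lambda>x. w (g x)) I \<le> \<rho>"
    proof (intro allI impI)
      fix I assume I: "I \<subseteq> h ` S" "\<forall>x\<in>I. \<forall>y\<in>I. \<not> R (g x) (g y)"
      then obtain T where T: "T \<subseteq> S" "I = h ` T" by (auto simp: subset_image_iff)
      have "\<forall>x\<in>T. \<forall>y\<in>T. \<not> R x y"
      proof (intro ballI)
        fix x y assume xy: "x \<in> T" "y \<in> T"
        then have "\<not> R (g (h x)) (g (h y))" using I(2) T(2) by blast
        then show "\<not> R x y" using gh[of x] gh[of y] T(1) xy by (simp add: subset_iff)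
      qed
      then have "sum w T \<le> \<rho>" by (rule sD(6)[OF T(1)])
      then show "sum (\<lambda>x. w (g x)) I \<le> \<rho>" using sub[OF T(1)] T(2) by simp
    qed
  qed
  then show ?thesis unfolding sparse_ratio_def by blast
qed

lemma sparse_ratio_mono: "sparse_ratio \<rho> \<Longrightarrow> \<rho> \<le> \<rho>' \<Longrightarrow> sparse_ratio \<rho>'"
proof -
  assume a: "sparse_ratio \<rho>" "\<rho> \<le> \<rho>'"
  then obtain S :: "nat set" and R w where s: "sparse_graph \<rho> S R w" by (auto simp: sparse_ratio_def)
  note sD = sparseD[OF s]
  have "sparse_graph \<rho>' S R w"
    unfolding sparse_graph_def
  proof (intro conjI allI impI ballI)
    show "sum w I \<le> \<rho>'" if "I \<subseteq> S" "\<forall>x\<in>I. \<forall>y\<in>I. \<not> R x y" for I using sD(6)[OF that] a(2) by simp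
  qed (fact sD)+
  then show ?thesis unfolding sparse_ratio_def by blast
qed

lemma sparse_ratio_1: "sparse_ratio 1"
proof (rule sparse_ratioI)
  show "sparse_graph 1 {0::nat} (\<lambda>_ _. False) (\<lambda>_. 1)"
    unfolding sparse_graph_def
  proof (intro conjI)
    show "\<forall>I\<subseteq>{0::nat}. (\<forall>x\<in>I. \<forall>y\<in>I. \<not> False) \<longrightarrow> sum (\<lambda>_. 1::real) I \<le> 1"
    proof (intro allI impI)
      fix I :: "nat set" assume "I \<subseteq> {0}"
      then have "card I \<le> card {0::nat}" by (intro card_mono) auto
      then show "sum (\<lambda>_. 1::real) I \<le> 1" by simp
    qed
  qed auto
qed

fun zykov :: "nat \<Rightarrow> ('a \<Rightarrow> 'a \<Rightarrow> bool) \<Rightarrow> (nat \<times> 'a) + (nat \<Rightarrow> 'a) \<Rightarrow> (nat \<times> 'a) + (nat \<Rightarrow> 'a) \<Rightarrow> bool" where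
  "zykov k R (Inl p) (Inl q) \<longleftrightarrow> fst p = fst q \<and> R (snd p) (snd q)"
| "zykov k R (Inl p) (Inr g) \<longleftrightarrow> fst p < k \<and> g (fst p) = snd p"
| "zykov k R (Inr g) (Inl p) \<longleftrightarrow> fst p < k \<and> g (fst p) = snd p"
| "zykov k R (Inr g) (Inr g') \<longleftrightarrow> False"

text \<open>Zykov's construction: \<open>k\<close> copies of the graph and, for every transversal of the copies, a new
  vertex joined to it. An independent set of average weight \<open>\<sigma>\<close> in the copies leaves room for
  at most a proportion \<open>exp (- k \<sigma>)\<close> of the transversals.\<close>
lemma sparse_ratio_step:
  assumes r: "0 < \<rho>" "\<rho> \<le> 1" and P: "sparse_ratio \<rho>"
  shows "sparse_ratio (\<rho> - \<rho>^2 / 4)"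
proof -
  obtain S :: "nat set" and R w where s: "sparse_graph \<rho> S R w" using P by (auto simp: sparse_ratio_def)
  have fS: "finite S" and w0: "\<And>x. x \<in> S \<Longrightarrow> 0 \<le> w x" and w1: "sum w S = 1"
    and Rs: "\<And>x y. R x y \<Longrightarrow> R y x" and Rt: "\<And>x y z. R x y \<Longrightarrow> R y z \<Longrightarrow> \<not> R x z"
    and ind: "\<And>I. I \<subseteq> S \<Longrightarrow> (\<forall>x\<in>I. \<forall>y\<in>I. \<not> R x y) \<Longrightarrow> sum w I \<le> \<rho>"
    by (fact sparseD[OF s])+
  \<comment> \<open>Enough copies that an independent set of average weight above
    \<open>\<rho> / 4\<close> leaves at most a proportion \<open>\<rho> / 2\<close> of the
    transversals.\<close>
  obtain k :: nat where k: "exp (- (real k * (\<rho> / 4))) \<le> \<rho> / 2" "k > 0"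
  proof -
    have "\<rho> / 4 > 0" using r by simp
    then obtain k0 :: nat where "real k0 * (\<rho> / 4) > - ln (\<rho> / 2)" using reals_Archimedean3 by blast
    moreover have "real k0 * (\<rho> / 4) \<le> real (Suc k0) * (\<rho> / 4)" using r by (intro mult_right_mono) auto
    ultimately have "- (real (Suc k0) * (\<rho> / 4)) \<le> ln (\<rho> / 2)" by linarith
    then have "exp (- (real (Suc k0) * (\<rho> / 4))) \<le> exp (ln (\<rho> / 2))" by (simp only: exp_le_cancel_iff)
    then show ?thesis using r that[of "Suc k0"] by simp
  qed
  define T where "T = (\<Pi>\<^sub>E i\<in>{..<k}. S)"
  have fT: "finite T" unfolding T_def by (rule finite_PiE) (use fS in auto)
  \<comment> \<open>The copies share the weight \<open>1 - \<rho>/2\<close> evenly; the transversals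
    share \<open>\<rho>/2\<close> like independent random choices from the copies.\<close>
  define W :: "(nat \<times> nat) + (nat \<Rightarrow> nat) \<Rightarrow> real" where "W p = (case p of Inl (i, v) \<Rightarrow> (1 - \<rho>/2) / real k * w v | Inr g \<Rightarrow> \<rho>/2 * (\<Prod>i<k. w (g i)))" for p
  let ?V = "Inl ` ({..<k} \<times> S) \<union> Inr ` T"
  have sumInl: "sum W (Inl ` Q) = (1 - \<rho>/2) / real k * (\<Sum>p\<in>Q. w (snd p))" for Q
    by (subst sum.reindex) (auto simp: W_def sum_distrib_left split_def)
  have sumInr: "sum W (Inr ` Q) = \<rho>/2 * (\<Sum>g\<in>Q. \<Prod>i<k. w (g i))" for Q
    by (subst sum.reindex) (auto simp: W_def sum_distrib_left)
  have "sparse_graph (\<rho> - \<rho>^2 / 4) ?V (zykov k R) W"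
    unfolding sparse_graph_def
  proof (intro conjI)
    show "finite ?V" using fS fT by simp
    show "\<forall>x y. zykov k R x y \<longrightarrow> zykov k R y x"
    proof (intro allI impI)
      fix x y assume "zykov k R x y"
      then show "zykov k R y x" by (cases x; cases y) (auto dest: Rs)
    qed
    show "\<forall>x y z. zykov k R x y \<longrightarrow> zykov k R y z \<longrightarrow> \<not> zykov k R x z"
    proof (intro allI impI notI)
      fix x y z assume a: "zykov k R x y" "zykov k R y z" "zykov k R x z"
      have irr: "\<not> R v v" for v using Rt[of v v v] by blast
      have Rt': "R u v \<Longrightarrow> R v t \<Longrightarrow> R u t \<Longrightarrow> False" for u v t using Rt by blast
      show False using a by (cases x; cases y; cases z; simp; metis irr Rt')
    qed
    show "\<forall>x\<in>?V. 0 \<le> W x"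
    proof
      fix x assume "x \<in> ?V"
      then show "0 \<le> W x"
      proof
        assume "x \<in> Inl ` ({..<k} \<times> S)"
        then show ?thesis using r w0 by (auto simp: W_def)
      next
        assume "x \<in> Inr ` T"
        then obtain g where g: "x = Inr g" "g \<in> T" by blast
        have "w (g i) \<ge> 0" if "i < k" for i using g(2) that by (intro w0) (auto simp: T_def)
        then show ?thesis using r g by (auto simp: W_def intro!: prod_nonneg mult_nonneg_nonneg)
      qed
    qed
    show "sum W ?V = 1"
    proof -
      have "sum W ?V = sum W (Inl ` ({..<k} \<times> S)) + sum W (Inr ` T)"
        by (rule sum.union_disjoint) (use fS fT in auto)
      also have "(\<Sum>p\<in>{..<k} \<times> S. w (snd p)) = real k"
        using sum.cartesian_product[of "\<lambda>i v. w v" S "{..<k}"] w1 by (simp add: split_def)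
      then have "sum W (Inl ` ({..<k} \<times> S)) = 1 - \<rho>/2" unfolding sumInl using k by simp
      also have "(\<Sum>g\<in>T. \<Prod>i<k. w (g i)) = (\<Prod>i<k. \<Sum>v\<in>S. w v)"
        unfolding T_def by (rule prod_sum_PiE[symmetric]) (use fS in auto)
      then have "sum W (Inr ` T) = \<rho>/2" unfolding sumInr by (simp add: w1)
      finally show ?thesis by simp
    qed
    show "\<forall>I\<subseteq>?V. (\<forall>x\<in>I. \<forall>y\<in>I. \<not> zykov k R x y) \<longrightarrow> sum W I \<le> \<rho> - \<rho>^2 / 4"
    proof (intro allI impI)
      fix I assume I: "I \<subseteq> ?V" "\<forall>x\<in>I. \<forall>y\<in>I. \<not> zykov k R x y"
      define J where "J i = {v\<in>S. Inl (i, v) \<in> I}" for i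
      define \<sigma> where "\<sigma> = (\<Sum>i<k. sum w (J i))"
      have fJ: "finite (J i)" for i using fS by (simp add: J_def)
      have Jr: "sum w (J i) \<le> \<rho>" for i
      proof (rule ind)
        show "J i \<subseteq> S" by (auto simp: J_def)
        show "\<forall>x\<in>J i. \<forall>y\<in>J i. \<not> R x y"
        proof (intro ballI)
          fix x y assume "x \<in> J i" "y \<in> J i"
          then have "\<not> zykov k R (Inl (i, x)) (Inl (i, y))" using I(2) unfolding J_def by blast
          then show "\<not> R x y" by simp
        qed
      qed
      have J0: "0 \<le> sum w (J i)" for i by (rule sum_nonneg) (use w0 in \<open>auto simp: J_def\<close>)
      define G where "G = {g\<in>T. Inr g \<in> I}"
      have "I = Inl ` (SIGMA i:{..<k}. J i) \<union> Inr ` G" using I(1) by (auto simp: J_def G_def)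
      then have "sum W I = sum W (Inl ` (SIGMA i:{..<k}. J i)) + sum W (Inr ` G)"
        by (simp only:) (rule sum.union_disjoint, use fJ fT in \<open>auto simp: G_def\<close>)
      also have "sum W (Inl ` (SIGMA i:{..<k}. J i)) = (1 - \<rho>/2) / real k * \<sigma>"
        unfolding sumInl \<sigma>_def using fJ by (subst sum.Sigma) (auto simp: split_def)
      also have "sum W (Inr ` G) \<le> \<rho>/2 * exp (- \<sigma>)"
        unfolding sumInr
      proof (rule mult_left_mono)
        have "(\<Sum>g\<in>G. \<Prod>i<k. w (g i)) \<le> (\<Sum>g\<in>(\<Pi>\<^sub>E i\<in>{..<k}. S - J i). \<Prod>i<k. w (g i))"
        proof (rule sum_mono2)
          show "finite (\<Pi>\<^sub>E i\<in>{..<k}. S - J i)" by (rule finite_PiE) (use fS in auto)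
          show "G \<subseteq> (\<Pi>\<^sub>E i\<in>{..<k}. S - J i)"
          proof
            fix g assume g: "g \<in> G"
            have "g i \<notin> J i" if "i < k" for i
            proof
              assume "g i \<in> J i"
              then have "Inl (i, g i) \<in> I" by (simp add: J_def)
              moreover have "Inr g \<in> I" using g by (simp add: G_def)
              ultimately have "\<not> zykov k R (Inr g) (Inl (i, g i))" using I(2) by blast
              then show False using that by simp
            qed
            then show "g \<in> (\<Pi>\<^sub>E i\<in>{..<k}. S - J i)" using g by (auto simp: G_def T_def PiE_iff)
          qed
          fix g assume "g \<in> (\<Pi>\<^sub>E i\<in>{..<k}. S - J i) - G"
          then have "w (g i) \<ge> 0" if "i < k" for i using that by (intro w0) (auto simp: PiE_iff)
          then show "0 \<le> (\<Prod>i<k. w (g i))" by (intro prod_nonneg) auto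
        qed
        also have "\<dots> = (\<Prod>i<k. \<Sum>v\<in>S - J i. w v)" by (rule prod_sum_PiE[symmetric]) (use fS in auto)
        also have "\<dots> \<le> (\<Prod>i<k. exp (- sum w (J i)))"
        proof (rule prod_mono)
          fix i
          have "(\<Sum>v\<in>S - J i. w v) = 1 - sum w (J i)"
            using w1 sum_diff[OF fS, of "J i" w] by (simp add: J_def)
          moreover have "0 \<le> (\<Sum>v\<in>S - J i. w v)" by (rule sum_nonneg) (use w0 in auto)
          ultimately show "0 \<le> (\<Sum>v\<in>S - J i. w v) \<and> (\<Sum>v\<in>S - J i. w v) \<le> exp (- sum w (J i))"
            using exp_ge_add_one_self[of "- sum w (J i)"] by simp
        qed
        also have "\<dots> = exp (- \<sigma>)" by (simp add: \<sigma>_def exp_sum sum_negf[symmetric])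
        finally show "(\<Sum>g\<in>G. \<Prod>i<k. w (g i)) \<le> exp (- \<sigma>)" .
      qed (use r in simp)
      also have "(1 - \<rho>/2) / real k * \<sigma> + \<rho>/2 * exp (- \<sigma>) \<le> \<rho> - \<rho>^2 / 4"
      \<comment> \<open>With little weight in the copies, even all transversals together stay within
        the bound. With more, the copies contribute at most their proportion \<open>\<rho>\<close>,
        and the transversals at most \<open>\<rho>/2 * (\<rho>/2)\<close>.\<close>
      proof (cases "\<sigma> \<le> real k * (\<rho> / 4)")
        case True
        have "(1 - \<rho>/2) / real k * \<sigma> \<le> (1 - \<rho>/2) / real k * (real k * (\<rho> / 4))"
          by (rule mult_left_mono[OF True]) (use r in simp)
        also have "\<dots> = (1 - \<rho>/2) * (\<rho> / 4)" using k by simp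
        finally have 1: "(1 - \<rho>/2) / real k * \<sigma> \<le> (1 - \<rho>/2) * (\<rho> / 4)" .
        have "\<sigma> \<ge> 0" unfolding \<sigma>_def by (rule sum_nonneg) (rule J0)
        then have 2: "\<rho>/2 * exp (- \<sigma>) \<le> \<rho>/2 * 1" using r by (intro mult_left_mono) auto
        have 3: "\<rho>^2 \<le> \<rho>" using r by (simp add: power2_eq_square mult_left_le)
        have "(1 - \<rho>/2) * (\<rho> / 4) = \<rho> / 4 - \<rho>^2 / 8" by (simp add: power2_eq_square algebra_simps)
        then show ?thesis using 1 2 3 r by linarith
      next
        case False
        have "\<sigma> \<le> real k * \<rho>" unfolding \<sigma>_def using sum_bounded_above[of "{..<k}" "\<lambda>i. sum w (J i)" \<rho>] Jr by simp
        then have "(1 - \<rho>/2) / real k * \<sigma> \<le> (1 - \<rho>/2) / real k * (real k * \<rho>)"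
          by (rule mult_left_mono) (use r in simp)
        also have "\<dots> = (1 - \<rho>/2) * \<rho>" using k by simp
        finally have 1: "(1 - \<rho>/2) / real k * \<sigma> \<le> (1 - \<rho>/2) * \<rho>" .
        have "exp (- \<sigma>) \<le> exp (- (real k * (\<rho> / 4)))" using False by simp
        then have "exp (- \<sigma>) \<le> \<rho> / 2" using k by linarith
        then have 2: "\<rho>/2 * exp (- \<sigma>) \<le> \<rho>/2 * (\<rho> / 2)" using r by (intro mult_left_mono) auto
        have "(1 - \<rho>/2) * \<rho> + \<rho>/2 * (\<rho> / 2) = \<rho> - \<rho>^2 / 4" by (simp add: power2_eq_square algebra_simps)
        then show ?thesis using 1 2 by linarith
      qed
      finally show "sum W I \<le> \<rho> - \<rho>^2 / 4" by simp
    qed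
  qed
  then show ?thesis by (rule sparse_ratioI)
qed

text \<open>While the ratio is above the target \<open>\<rho>\<close>, each step lowers it by at
  least \<open>\<rho>^2 / 4\<close>, so finitely many steps reach \<open>\<rho>\<close>.\<close>

lemma sparse_ratio_small: assumes r: "0 < \<rho>" "\<rho> \<le> 1" shows "sparse_ratio \<rho>"
proof -
  have step: "sparse_ratio (max \<rho> (1 - real j * \<rho>^2 / 4))" for j :: nat
  proof (induction j)
    case 0
    show ?case using sparse_ratio_1 r by simp
  next
    case (Suc j)
    let ?s = "max \<rho> (1 - real j * \<rho>^2 / 4)"
    have s: "0 < ?s" "?s \<le> 1" using r by auto
    have "sparse_ratio (?s - ?s^2 / 4)" by (rule sparse_ratio_step[OF s Suc])
    moreover have "?s - ?s^2 / 4 \<le> max \<rho> (1 - real (Suc j) * \<rho>^2 / 4)"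
    proof -
      have "\<rho>^2 \<le> ?s^2" by (rule power_mono) (use r in auto)
      then have 1: "?s - ?s^2 / 4 \<le> ?s - \<rho>^2 / 4" by simp
      have 2: "\<rho>^2 \<ge> 0" by simp
      have 3: "1 - real (Suc j) * \<rho>^2 / 4 = 1 - real j * \<rho>^2 / 4 - \<rho>^2 / 4" by (simp add: field_simps)
      show ?thesis using 1 2 unfolding 3 by linarith
    qed
    ultimately show ?case by (rule sparse_ratio_mono)
  qed
  have "\<rho>^2 / 4 > 0" using r by simp
  then obtain j :: nat where "real j * (\<rho>^2 / 4) > 1" using reals_Archimedean3 by blast
  then have "max \<rho> (1 - real j * \<rho>^2 / 4) = \<rho>" using r by simp
  then show ?thesis using step[of j] by simp
qed

text \<open>Blow-up: each \<open>v\<close> is replaced by \<open>w v * n\<close> copies, rounded up,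
  and \<open>n\<close> of the resulting vertices are kept. Rounding adds at most
  \<open>card S\<close> to an independent set, which is at most \<open>\<rho>/2 * n\<close> for
  large \<open>n\<close>.\<close>

lemma triangle_free_small_independence:
  assumes r: "0 < (\<rho>::real)" "\<rho> \<le> 1"
  obtains N where "\<And>n. real n \<ge> N \<Longrightarrow> \<exists>R :: nat \<Rightarrow> nat \<Rightarrow> bool. (\<forall>x y. R x y \<longrightarrow> R y x) \<and> (\<forall>x y z. R x y \<longrightarrow> R y z \<longrightarrow> \<not> R x z) \<and>
     (\<forall>I\<subseteq>{..<n}. (\<forall>x\<in>I. \<forall>y\<in>I. \<not> R x y) \<longrightarrow> real (card I) \<le> \<rho> * real n)"
proof -
  have r2: "0 < \<rho> / 2" "\<rho> / 2 \<le> 1" using r by auto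
  obtain S :: "nat set" and R w where s: "sparse_graph (\<rho>/2) S R w" using sparse_ratio_small[OF r2] by (auto simp: sparse_ratio_def)
  have fS: "finite S" and w0: "\<And>x. x \<in> S \<Longrightarrow> 0 \<le> w x" and w1: "sum w S = 1"
    and Rs: "\<And>x y. R x y \<Longrightarrow> R y x" and Rt: "\<And>x y z. R x y \<Longrightarrow> R y z \<Longrightarrow> \<not> R x z"
    and ind: "\<And>I. I \<subseteq> S \<Longrightarrow> (\<forall>x\<in>I. \<forall>y\<in>I. \<not> R x y) \<Longrightarrow> sum w I \<le> \<rho>/2"
    by (fact sparseD[OF s])+
  show ?thesis
  proof (rule that[of "2 * real (card S) / \<rho>"])
    fix n :: nat assume n: "real n \<ge> 2 * real (card S) / \<rho>"
    define c where "c v = nat \<lceil>w v * real n\<rceil>" for v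
    have cb: "w v * real n \<le> real (c v)" "real (c v) \<le> w v * real n + 1" if "v \<in> S" for v
    proof -
      have "0 \<le> w v * real n" using w0[OF that] by simp
      then show "w v * real n \<le> real (c v)" "real (c v) \<le> w v * real n + 1"
        unfolding c_def by linarith+
    qed
    define T where "T = (SIGMA v:S. {..<c v})"
    have fT: "finite T" using fS by (simp add: T_def)
    have "real n = (\<Sum>v\<in>S. w v * real n)" using w1 by (simp add: sum_distrib_right[symmetric])
    also have "\<dots> \<le> (\<Sum>v\<in>S. real (c v))" by (rule sum_mono) (rule cb)
    also have "\<dots> = real (card T)" using fS by (simp add: T_def)
    finally have "n \<le> card T" by simp
    then obtain T' where T': "T' \<subseteq> T" "card T' = n" by (meson obtain_subset_with_card_n)
    have fT': "finite T'" using T' fT finite_subset by blast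
    obtain h where h: "bij_betw h {..<n} T'"
      using ex_bij_betw_nat_finite[OF fT'] T'(2) by (auto simp: atLeast0LessThan)
    define \<phi> where "\<phi> x = fst (h x)" for x
    have "real (card I) \<le> \<rho> * real n" if I: "I \<subseteq> {..<n}" "\<forall>x\<in>I. \<forall>y\<in>I. \<not> R (\<phi> x) (\<phi> y)" for I
    proof -
      have hI: "h ` I \<subseteq> T'" using h I(1) by (auto simp: bij_betw_def)
      have pS: "\<phi> ` I \<subseteq> S"
      proof
        fix s assume "s \<in> \<phi> ` I"
        then obtain x where "x \<in> I" "s = fst (h x)" by (auto simp: \<phi>_def)
        moreover from this have "h x \<in> T" using hI T'(1) by blast
        ultimately show "s \<in> S" by (auto simp: T_def)
      qed
      have "card I = card (h ` I)" using h I(1) by (intro card_image[symmetric]) (auto simp: bij_betw_def intro: inj_on_subset)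
      also have "\<dots> \<le> card (SIGMA v:\<phi> ` I. {..<c v})"
      proof (rule card_mono)
        show "finite (SIGMA v:\<phi> ` I. {..<c v})" using pS fS finite_subset by blast
        show "h ` I \<subseteq> (SIGMA v:\<phi> ` I. {..<c v})"
        proof
          fix p assume "p \<in> h ` I"
          then obtain x where x: "x \<in> I" "p = h x" by blast
          then have "p \<in> T" using hI T'(1) by auto
          then have "fst p \<in> \<phi> ` I" "snd p < c (fst p)" using x by (auto simp: T_def \<phi>_def)
          then show "p \<in> (SIGMA v:\<phi> ` I. {..<c v})" by (cases p) simp
        qed
      qed
      also have "\<dots> = (\<Sum>v\<in>\<phi> ` I. c v)" using pS fS finite_subset by (subst card_SigmaI) auto
      finally have "real (card I) \<le> (\<Sum>v\<in>\<phi> ` I. real (c v))" by (metis of_nat_le_iff of_nat_sum)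
      also have "\<dots> \<le> (\<Sum>v\<in>\<phi> ` I. w v * real n + 1)" by (rule sum_mono) (use cb pS in auto)
      also have "\<dots> = sum w (\<phi> ` I) * real n + real (card (\<phi> ` I))" by (simp add: sum.distrib sum_distrib_right)
      also have "sum w (\<phi> ` I) * real n \<le> \<rho>/2 * real n"
        by (rule mult_right_mono, rule ind[OF pS]) (use I(2) in auto)
      also have "real (card (\<phi> ` I)) \<le> real (card S)" using card_mono[OF fS pS] by simp
      also have "real (card S) \<le> \<rho>/2 * real n" using n r by (simp add: field_simps)
      finally show ?thesis by simp
    qed
    then show "\<exists>R :: nat \<Rightarrow> nat \<Rightarrow> bool. (\<forall>x y. R x y \<longrightarrow> R y x) \<and> (\<forall>x y z. R x y \<longrightarrow> R y z \<longrightarrow> \<not> R x z) \<and>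
     (\<forall>I\<subseteq>{..<n}. (\<forall>x\<in>I. \<forall>y\<in>I. \<not> R x y) \<longrightarrow> real (card I) \<le> \<rho> * real n)"
      by (intro exI[of _ "\<lambda>x y. R (\<phi> x) (\<phi> y)"]) (use Rs Rt in blast)
  qed
qed

section \<open>The Turan graph and the edit distance\<close>

text \<open>The complete multipartite graph on the classes of \<open>f\<close>, which need not be
  balanced.\<close>

definition turan :: "nat \<Rightarrow> (nat \<Rightarrow> nat) \<Rightarrow> nat set set" where
  "turan n f = {{x, y} | x y. x < n \<and> y < n \<and> f x \<noteq> f y}"

lemma turan_mem: "{x, y} \<in> turan n f \<longleftrightarrow> x < n \<and> y < n \<and> f x \<noteq> f y"
  by (auto simp: turan_def doubleton_eq_iff)

lemma graph_turan: "graph n (turan n f)"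
  unfolding graph_def turan_def by blast

lemma graph_subset: "graph n E \<Longrightarrow> F \<subseteq> E \<Longrightarrow> graph n F"
  unfolding graph_def by blast

lemma graph_finite: "graph n E \<Longrightarrow> finite E"
  by (rule finite_subset[of _ "Pow {..<n}"]) (auto simp: graph_def)

lemma class_sizes:
  assumes "\<And>x. f x < (6::nat)"
  shows "(\<Sum>c<6. real (card {x\<in>{..<n}. f x = c})) = real n"
proof -
  have "(\<Sum>c\<in>{..<6}. \<Sum>x\<in>{x\<in>{..<n}. f x = c}. 1) = (\<Sum>x<n. 1::real)"
    by (rule sum.group) (use assms in auto)
  then show ?thesis by simp
qed

lemma same_class_count:
  fixes f :: "nat \<Rightarrow> nat"
  assumes f: "\<And>x. f x < (6::nat)"
  shows "ecount (\<lambda>x y. f x = f y) {..<n} {..<n} = (\<Sum>c<6. (real (card {x\<in>{..<n}. f x = c}))^2)"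
proof -
  have "ecount (\<lambda>x y. f x = f y) {..<n} {..<n} = (\<Sum>x<n. real (card {y\<in>{..<n}. f x = f y}))" by (rule ecount_deg) simp
  also have "\<dots> = (\<Sum>c<6. \<Sum>x\<in>{x\<in>{..<n}. f x = c}. real (card {y\<in>{..<n}. f x = f y}))"
    by (rule sum.group[symmetric]) (use f in auto)
  also have "\<dots> = (\<Sum>c<6. \<Sum>x\<in>{x\<in>{..<n}. f x = c}. real (card {y\<in>{..<n}. f y = c}))"
  proof (intro sum.cong refl)
    fix c x assume "x \<in> {x\<in>{..<n}. f x = c}"
    then have "{y\<in>{..<n}. f x = f y} = {y\<in>{..<n}. f y = c}" by auto
    then show "real (card {y\<in>{..<n}. f x = f y}) = real (card {y\<in>{..<n}. f y = c})" by simp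
  qed
  finally show ?thesis by (simp add: power2_eq_square)
qed

lemma ecount_compl: "ecount R {..<n} {..<n} + ecount (\<lambda>x y. \<not> R x y) {..<n} {..<n} = (real n)^2"
  unfolding ecount_def sum.distrib[symmetric] by (simp add: of_bool_not_iff power2_eq_square)

lemma turan_card:
  assumes f: "\<And>x. f x < (6::nat)"
  shows "2 * real (card (turan n f)) = (real n)^2 - (\<Sum>c<6. (real (card {x\<in>{..<n}. f x = c}))^2)"
proof -
  have "2 * real (card (turan n f)) = ecount (\<lambda>x y. {x, y} \<in> turan n f) {..<n} {..<n}"
    by (rule ecount_edges[OF graph_turan, symmetric])
  also have "\<dots> = ecount (\<lambda>x y. \<not> f x = f y) {..<n} {..<n}"
    unfolding ecount_def by (intro sum.cong refl) (simp add: turan_mem)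
  also have "\<dots> = (real n)^2 - ecount (\<lambda>x y. f x = f y) {..<n} {..<n}"
    using ecount_compl[of "\<lambda>x y. f x = f y" n] by simp
  finally show ?thesis by (simp only: same_class_count[OF f])
qed

text \<open>This identity gives both the maximal edge number of \<open>turan\<close> and, for nearly
  maximal edge number, nearly equal classes.\<close>

lemma class_variance:
  assumes f: "\<And>x. f x < (6::nat)"
  shows "(\<Sum>c<6. (real (card {x\<in>{..<n}. f x = c}) - real n / 6)^2) = (\<Sum>c<6. (real (card {x\<in>{..<n}. f x = c}))^2) - (real n)^2 / 6"
proof -
  let ?k = "\<lambda>c. real (card {x\<in>{..<n}. f x = c})"
  have "(\<Sum>c<6. (?k c - real n / 6)^2) = (\<Sum>c<6. (?k c)^2 - real n / 3 * ?k c + (real n)^2 / 36)"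
    by (intro sum.cong refl) (simp add: power2_eq_square field_simps)
  also have "\<dots> = (\<Sum>c<6. (?k c)^2) - real n / 3 * (\<Sum>c<6. ?k c) + 6 * ((real n)^2 / 36)"
    by (simp only: sum.distrib sum_subtractf sum_distrib_left[symmetric]) simp
  finally show ?thesis unfolding class_sizes[OF f] by (simp add: power2_eq_square)
qed

lemma turan_card_le:
  assumes f: "\<And>x. f x < (6::nat)"
  shows "2 * real (card (turan n f)) \<le> 5/6 * (real n)^2"
proof -
  have "0 \<le> (\<Sum>c<6. (real (card {x\<in>{..<n}. f x = c}) - real n / 6)^2)" by (rule sum_nonneg) simp
  then show ?thesis unfolding class_variance[OF f] turan_card[OF f] by simp
qed

section \<open>Graphs close to a complete 6-partite graph\<close>

lemma edges_outside_turan: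
  assumes "graph n E"
  shows "2 * real (card (E - turan n f)) = ecount (\<lambda>x y. {x, y} \<in> E \<and> f x = f y) {..<n} {..<n}"
proof -
  have "2 * real (card (E - turan n f)) = ecount (\<lambda>x y. {x, y} \<in> E - turan n f) {..<n} {..<n}"
    by (rule ecount_edges[OF graph_subset[OF assms], symmetric]) blast
  also have "\<dots> = ecount (\<lambda>x y. {x, y} \<in> E \<and> f x = f y) {..<n} {..<n}"
    unfolding ecount_def by (intro sum.cong refl) (simp add: turan_mem)
  finally show ?thesis .
qed

lemma edges_le_of_partition:
  assumes g: "graph n E" and f: "\<And>x. f x < (6::nat)"
    and int: "ecount (\<lambda>x y. {x, y} \<in> E \<and> f x = f y) {..<n} {..<n} \<le> \<theta> * (real n)^2"
  shows "2 * real (card E) \<le> (5/6 + \<theta>) * (real n)^2"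
proof -
  have fin: "finite E" "finite (turan n f)" using graph_finite g graph_turan by auto
  have "card E \<le> card ((E - turan n f) \<union> turan n f)" by (rule card_mono) (use fin in auto)
  also have "\<dots> \<le> card (E - turan n f) + card (turan n f)" by (rule card_Un_le)
  finally have "2 * real (card E) \<le> 2 * real (card (E - turan n f)) + 2 * real (card (turan n f))" by simp
  then show ?thesis using edges_outside_turan[OF g, of f] int turan_card_le[of f n, OF f] by (simp add: algebra_simps)
qed

text \<open>Few edges of \<open>E\<close> lie inside classes, and the multipartite graph has at most
  5/12 of \<open>n^2\<close> edges; so it has few edges missing from \<open>E\<close>, and it is
  itself nearly maximal, which controls the variance of its classes.\<close>

lemma close_to_turan:
  assumes g: "graph n E" and f: "\<And>x. f x < (6::nat)"
    and int: "ecount (\<lambda>x y. {x, y} \<in> E \<and> f x = f y) {..<n} {..<n} \<le> \<theta> * (real n)^2"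
    and e: "real (card E) \<ge> (5/12 - \<theta>) * (real n)^2"
  shows "real (card ((E - turan n f) \<union> (turan n f - E))) \<le> 2 * \<theta> * (real n)^2"
    "(\<Sum>c<6. (real (card {x\<in>{..<n}. f x = c}) - real n / 6)^2) \<le> 3 * \<theta> * (real n)^2"
proof -
  let ?T = "turan n f"
  have fin: "finite E" "finite ?T" using graph_finite g graph_turan by auto
  have 1: "2 * real (card (E - ?T)) \<le> \<theta> * (real n)^2" using edges_outside_turan[OF g, of f] int by simp
  have "card E = card (E \<inter> ?T) + card (E - ?T)" by (rule card_Int_Diff[OF fin(1)])
  then have 2: "real (card E) = real (card (E \<inter> ?T)) + real (card (E - ?T))" by simp
  have "card ?T = card (?T \<inter> E) + card (?T - E)" by (rule card_Int_Diff[OF fin(2)])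
  then have 3: "real (card ?T) = real (card (E \<inter> ?T)) + real (card (?T - E))" by (simp add: Int_commute)
  have 4: "2 * ((5/12 - \<theta>) * (real n)^2) \<le> 2 * real (card E)" using e by simp
  have 5: "2 * ((5/12 - \<theta>) * (real n)^2) = 5/6 * (real n)^2 - 2 * (\<theta> * (real n)^2)" by (simp add: algebra_simps)
  have "2 * real (card ?T) \<le> 5/6 * (real n)^2" by (rule turan_card_le[OF f])
  then have 6: "2 * real (card (?T - E)) \<le> 3 * (\<theta> * (real n)^2)" using 1 2 3 4 5 by linarith
  have "card ((E - ?T) \<union> (?T - E)) \<le> card (E - ?T) + card (?T - E)" by (rule card_Un_le)
  then have "real (card ((E - ?T) \<union> (?T - E))) \<le> real (card (E - ?T)) + real (card (?T - E))" by simp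
  then show "real (card ((E - ?T) \<union> (?T - E))) \<le> 2 * \<theta> * (real n)^2" using 1 6 by linarith
  have "2 * real (card ?T) \<ge> 5/6 * (real n)^2 - 3 * (\<theta> * (real n)^2)" using 1 2 3 4 5 by linarith
  then show "(\<Sum>c<6. (real (card {x\<in>{..<n}. f x = c}) - real n / 6)^2) \<le> 3 * \<theta> * (real n)^2"
    unfolding class_variance[OF f] turan_card[OF f] by simp
qed

text \<open>In each class as many vertices as the smaller of the two sizes allows are matched, at
  least \<open>n/6 - s\<close>. The unmatched vertices are mapped arbitrarily.\<close>

lemma aligning_permutation:
  assumes f: "\<And>x. f x < (6::nat)" and g: "\<And>x. g x < (6::nat)"
    and sf: "\<And>c. c < 6 \<Longrightarrow> real (card {x\<in>{..<n}. f x = c}) \<ge> real n / 6 - s"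
    and sg: "\<And>c. c < 6 \<Longrightarrow> real (card {x\<in>{..<n}. g x = c}) \<ge> real n / 6 - s"
  obtains \<pi> where "bij_betw \<pi> {..<n} {..<n}" "real (card {x\<in>{..<n}. f (\<pi> x) \<noteq> g x}) \<le> 6 * s"
proof -
  define F where "F c = {x\<in>{..<n}. f x = c}" for c
  define G where "G c = {x\<in>{..<n}. g x = c}" for c
  have "\<exists>F' G' h. F' \<subseteq> F c \<and> G' \<subseteq> G c \<and> card G' = min (card (F c)) (card (G c)) \<and> bij_betw h G' F'" for c
  proof -
    obtain F' where F': "F' \<subseteq> F c" "card F' = min (card (F c)) (card (G c))"
      by (metis min.cobounded1 obtain_subset_with_card_n)
    obtain G' where G': "G' \<subseteq> G c" "card G' = min (card (F c)) (card (G c))"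
      by (metis min.cobounded2 obtain_subset_with_card_n)
    have "finite F'" "finite G'" using finite_subset[OF F'(1)] finite_subset[OF G'(1)] by (auto simp: F_def G_def)
    then obtain h where "bij_betw h G' F'" using finite_same_card_bij[of G' F'] F'(2) G'(2) by auto
    then show ?thesis using F' G' by blast
  qed
  then obtain F' G' h where FG: "\<And>c. F' c \<subseteq> F c" "\<And>c. G' c \<subseteq> G c"
    "\<And>c. card (G' c) = min (card (F c)) (card (G c))" "\<And>c. bij_betw (h c) (G' c) (F' c)" by metis
  define k where "k x = h (g x) x" for x
  define UG where "UG = (\<Union>c<6. G' c)"
  define UF where "UF = (\<Union>c<6. F' c)"
  have UGn: "UG \<subseteq> {..<n}" and UFn: "UF \<subseteq> {..<n}" using FG(1,2) by (auto simp: UG_def UF_def F_def G_def)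
  have bk: "bij_betw k UG UF"
    unfolding UG_def UF_def
  proof (rule bij_betw_UNION_disjoint)
    show "disjoint_family_on F' {..<6}"
      unfolding disjoint_family_on_def
    proof (intro ballI impI)
      fix a b :: nat assume "a \<noteq> b"
      then show "F' a \<inter> F' b = {}" using FG(1)[of a] FG(1)[of b] by (auto simp: F_def)
    qed
    fix c assume "c \<in> {..<6::nat}"
    have "bij_betw k (G' c) (F' c) \<longleftrightarrow> bij_betw (h c) (G' c) (F' c)"
      by (rule bij_betw_cong) (use FG(2)[of c] in \<open>auto simp: k_def G_def\<close>)
    then show "bij_betw k (G' c) (F' c)" using FG(4) by simp
  qed
  have fU: "finite UG" "finite UF" using UGn UFn finite_subset by auto
  have cc: "card ({..<n} - UG) = card ({..<n} - UF)"
    using bij_betw_same_card[OF bk] card_Diff_subset[OF fU(1) UGn] card_Diff_subset[OF fU(2) UFn] by simp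
  obtain l where l: "bij_betw l ({..<n} - UG) ({..<n} - UF)"
    using finite_same_card_bij[OF _ _ cc] by auto
  define \<pi> where "\<pi> x = (if x \<in> UG then k x else l x)" for x
  have b1: "bij_betw \<pi> UG UF" using bk bij_betw_cong[of UG \<pi> k UF] by (simp add: \<pi>_def)
  have b2: "bij_betw \<pi> ({..<n} - UG) ({..<n} - UF)" using l bij_betw_cong[of "{..<n} - UG" \<pi> l "{..<n} - UF"] by (simp add: \<pi>_def)
  have "bij_betw \<pi> (UG \<union> ({..<n} - UG)) (UF \<union> ({..<n} - UF))" by (rule bij_betw_combine[OF b1 b2]) auto
  then have bij: "bij_betw \<pi> {..<n} {..<n}" using UGn UFn by (simp add: Un_absorb1)
  show ?thesis
  proof (rule that[OF bij])
    have "f (\<pi> x) = g x" if x: "x \<in> UG" for x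
    proof -
      obtain c where c: "c < 6" "x \<in> G' c" using x by (auto simp: UG_def)
      have gx: "g x = c" using FG(2)[of c] c by (auto simp: G_def)
      have "h c x \<in> F' c" using FG(4)[of c] c by (auto simp: bij_betw_def)
      then have "f (h c x) = c" using FG(1)[of c] by (auto simp: F_def)
      then show ?thesis using x gx by (simp add: \<pi>_def k_def)
    qed
    then have "{x\<in>{..<n}. f (\<pi> x) \<noteq> g x} \<subseteq> {..<n} - UG" by auto
    then have "card {x\<in>{..<n}. f (\<pi> x) \<noteq> g x} \<le> card ({..<n} - UG)" by (intro card_mono) auto
    moreover have "card ({..<n} - UG) = n - card UG" using card_Diff_subset[OF fU(1) UGn] by simp
    moreover have "card UG \<le> n" using card_mono[OF _ UGn] by simp
    ultimately have 1: "real (card {x\<in>{..<n}. f (\<pi> x) \<noteq> g x}) \<le> real n - real (card UG)" by linarith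
    have "card UG = (\<Sum>c<6. card (G' c))"
      unfolding UG_def
    proof (rule card_UN_disjoint)
      have "finite (G c)" for c by (simp add: G_def)
      then show "\<forall>c\<in>{..<6}. finite (G' c)" using finite_subset[OF FG(2)] by blast
      show "\<forall>a\<in>{..<6}. \<forall>b\<in>{..<6}. a \<noteq> b \<longrightarrow> G' a \<inter> G' b = {}"
      proof (intro ballI impI)
        fix a b :: nat assume "a \<noteq> b"
        then show "G' a \<inter> G' b = {}" using FG(2)[of a] FG(2)[of b] by (auto simp: G_def)
      qed
    qed simp
    then have "real (card UG) = (\<Sum>c<6. real (card (G' c)))" by simp
    also have "\<dots> \<ge> (\<Sum>c<(6::nat). real n / 6 - s)"
    proof (rule sum_mono)
      fix c assume "c \<in> {..<6::nat}"
      then show "real n / 6 - s \<le> real (card (G' c))" unfolding FG(3) using sf[of c] sg[of c] by (simp add: F_def G_def min_def)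
    qed
    finally have "real (card UG) \<ge> real n - 6 * s" by simp
    then show "real (card {x\<in>{..<n}. f (\<pi> x) \<noteq> g x}) \<le> 6 * s" using 1 by simp
  qed
qed

lemma edit_dist_le:
  assumes S: "graph n S" and Z: "graph n Z" and \<pi>: "bij_betw \<pi> {..<n} {..<n}"
  shows "edit_dist n S Z \<le> card ((S - (\<lambda>e. \<pi> ` e) ` Z) \<union> ((\<lambda>e. \<pi> ` e) ` Z - S))"
  unfolding edit_dist_def
proof (rule Min_le)
  show "finite {card ((S - (\<lambda>e. \<pi> ` e) ` Z) \<union> ((\<lambda>e. \<pi> ` e) ` Z - S)) | \<pi>. bij_betw \<pi> {..<n} {..<n}}"
  proof (rule finite_subset[of _ "{..card S + card Z}"])
    show "{card ((S - (\<lambda>e. \<pi> ` e) ` Z) \<union> ((\<lambda>e. \<pi> ` e) ` Z - S)) | \<pi>. bij_betw \<pi> {..<n} {..<n}} \<subseteq> {..card S + card Z}"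
    proof
      fix k assume "k \<in> {card ((S - (\<lambda>e. \<pi> ` e) ` Z) \<union> ((\<lambda>e. \<pi> ` e) ` Z - S)) | \<pi>. bij_betw \<pi> {..<n} {..<n}}"
      then obtain p where k: "k = card ((S - (\<lambda>e. p ` e) ` Z) \<union> ((\<lambda>e. p ` e) ` Z - S))" by blast
      have "k \<le> card (S - (\<lambda>e. p ` e) ` Z) + card ((\<lambda>e. p ` e) ` Z - S)" unfolding k by (rule card_Un_le)
      also have "card (S - (\<lambda>e. p ` e) ` Z) \<le> card S" by (rule card_mono) (use graph_finite[OF S] in auto)
      also have "card ((\<lambda>e. p ` e) ` Z - S) \<le> card ((\<lambda>e. p ` e) ` Z)" by (rule card_mono) (use graph_finite[OF Z] in auto)
      also have "\<dots> \<le> card Z" by (rule card_image_le[OF graph_finite[OF Z]])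
      finally show "k \<in> {..card S + card Z}" by simp
    qed
  qed simp
qed (use \<pi> in blast)

text \<open>Triangle inequality from \<open>S\<close> over both multipartite graphs to the image of
  \<open>Z\<close>. The two multipartite graphs differ only in pairs that contain the image of a
  misplaced vertex.\<close>

lemma edit_dist_via_turan:
  assumes S: "graph n S" and Z: "graph n Z" and \<pi>: "bij_betw \<pi> {..<n} {..<n}"
  shows "real (edit_dist n S Z) \<le> real (card ((S - turan n f) \<union> (turan n f - S))) + real (card ((Z - turan n g) \<union> (turan n g - Z)))
    + real (card {x\<in>{..<n}. f (\<pi> x) \<noteq> g x}) * real n"
proof -
  let ?P = "\<lambda>X. (\<lambda>e. \<pi> ` e) ` X"
  let ?F = "turan n f" and ?G = "turan n g"
  define M where "M = {x\<in>{..<n}. f (\<pi> x) \<noteq> g x}"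
  have fin: "finite S" "finite Z" "finite ?F" "finite ?G" using graph_finite S Z graph_turan by auto
  have fM: "finite M" by (simp add: M_def)
  define D where "D = (\<lambda>(x, y). {\<pi> x, \<pi> y}) ` (M \<times> {..<n})"
  have DI: "{\<pi> x, \<pi> y} \<in> D" if "x \<in> M" "y < n" for x y
    unfolding D_def by (rule image_eqI[of _ _ "(x, y)"]) (use that in auto)
  have D1: "?F - ?P ?G \<subseteq> D"
  proof
    fix e assume e: "e \<in> ?F - ?P ?G"
    then obtain a b where ab: "e = {a, b}" "a < n" "b < n" "f a \<noteq> f b" by (auto simp: turan_def)
    have "a \<in> \<pi> ` {..<n}" "b \<in> \<pi> ` {..<n}" using \<pi> ab by (auto simp: bij_betw_def)
    then obtain x y where xy: "x < n" "y < n" "a = \<pi> x" "b = \<pi> y" by auto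
    have "x \<in> M \<or> y \<in> M"
    proof (rule ccontr)
      assume "\<not> ?thesis"
      then have "g x \<noteq> g y" using xy ab by (auto simp: M_def)
      then have "{x, y} \<in> ?G" using xy by (simp add: turan_mem)
      then have "\<pi> ` {x, y} \<in> ?P ?G" by blast
      then show False using e ab xy by simp
    qed
    moreover have "e = {\<pi> x, \<pi> y}" "e = {\<pi> y, \<pi> x}" using ab xy by auto
    ultimately show "e \<in> D" using DI[of x y] DI[of y x] xy(1,2) by metis
  qed
  have D2: "?P ?G - ?F \<subseteq> D"
  proof
    fix e assume e: "e \<in> ?P ?G - ?F"
    then obtain x y where xy: "x < n" "y < n" "g x \<noteq> g y" "e = \<pi> ` {x, y}" by (auto simp: turan_def)
    have pn: "\<pi> x < n" "\<pi> y < n" using \<pi> xy by (auto simp: bij_betw_def)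
    have "f (\<pi> x) = f (\<pi> y)" using e xy pn by (auto simp: turan_mem)
    then have "x \<in> M \<or> y \<in> M" using xy by (auto simp: M_def)
    moreover have "e = {\<pi> x, \<pi> y}" "e = {\<pi> y, \<pi> x}" using xy by auto
    ultimately show "e \<in> D" using DI[of x y] DI[of y x] xy(1,2) by metis
  qed
  have fD: "finite D" using fM by (simp add: D_def)
  have "card D \<le> card (M \<times> {..<n})" unfolding D_def by (rule card_image_le) (use fM in simp)
  then have cD: "card D \<le> card M * n" by (simp add: card_cartesian_product)
  let ?A = "(S - ?F) \<union> (?F - S)" and ?B = "(Z - ?G) \<union> (?G - Z)"
  have sub: "(S - ?P Z) \<union> (?P Z - S) \<subseteq> ?A \<union> (D \<union> ?P ?B)"
  proof
    fix e assume "e \<in> (S - ?P Z) \<union> (?P Z - S)"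
    then show "e \<in> ?A \<union> (D \<union> ?P ?B)"
    proof
      assume e: "e \<in> S - ?P Z"
      show ?thesis
      proof (cases "e \<in> ?F \<and> e \<in> ?P ?G")
        case True
        then obtain d where "d \<in> ?G" "e = \<pi> ` d" by blast
        then show ?thesis using e by blast
      next
        case False
        then show ?thesis using e D1 by blast
      qed
    next
      assume e: "e \<in> ?P Z - S"
      then obtain d where d: "d \<in> Z" "e = \<pi> ` d" by blast
      show ?thesis
      proof (cases "d \<in> ?G \<and> e \<notin> ?F")
        case True
        then show ?thesis using d D2 by blast
      next
        case False
        then show ?thesis using e d by blast
      qed
    qed
  qed
  have "edit_dist n S Z \<le> card ((S - ?P Z) \<union> (?P Z - S))" by (rule edit_dist_le[OF S Z \<pi>])
  also have "\<dots> \<le> card (?A \<union> (D \<union> ?P ?B))" by (rule card_mono[OF _ sub]) (use fin fD in auto)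
  also have "\<dots> \<le> card ?A + (card D + card (?P ?B))" by (meson add_left_mono card_Un_le order_trans)
  also have "card (?P ?B) \<le> card ?B" by (rule card_image_le) (use fin in auto)
  finally have "edit_dist n S Z \<le> card ?A + (card M * n + card ?B)" using cD by simp
  then have "real (edit_dist n S Z) \<le> real (card ?A + (card M * n + card ?B))" by (simp only: of_nat_le_iff)
  then show ?thesis by (simp add: M_def)
qed

text \<open>The condition \<open>3 * \<theta> \<le> \<sigma>^2\<close> turns the variance bound into
  a deviation of at most \<open>\<sigma> * n\<close> for every single class.\<close>

lemma edit_dist_small:
  assumes S: "graph n S" and Z: "graph n Z" and f: "\<And>x. f x < (6::nat)" and g: "\<And>x. g x < (6::nat)"
    and intf: "ecount (\<lambda>x y. {x, y} \<in> S \<and> f x = f y) {..<n} {..<n} \<le> \<theta> * (real n)^2"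
    and intg: "ecount (\<lambda>x y. {x, y} \<in> Z \<and> g x = g y) {..<n} {..<n} \<le> \<theta> * (real n)^2"
    and eS: "real (card S) \<ge> (5/12 - \<theta>) * (real n)^2" and eZ: "real (card Z) \<ge> (5/12 - \<theta>) * (real n)^2"
    and s: "3 * \<theta> \<le> \<sigma>^2" "0 \<le> \<sigma>"
  shows "real (edit_dist n S Z) \<le> (4 * \<theta> + 6 * \<sigma>) * (real n)^2"
proof -
  have size: "real (card {x\<in>{..<n}. h x = c}) \<ge> real n / 6 - \<sigma> * real n"
    if "(\<Sum>c<6. (real (card {x\<in>{..<n}. h x = c}) - real n / 6)^2) \<le> 3 * \<theta> * (real n)^2" "c < 6" for h :: "nat \<Rightarrow> nat" and c
  proof -
    let ?d = "real (card {x\<in>{..<n}. h x = c}) - real n / 6"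
    have "?d^2 \<le> (\<Sum>c<6. (real (card {x\<in>{..<n}. h x = c}) - real n / 6)^2)"
      by (rule member_le_sum[where i = c and f = "\<lambda>c. (real (card {x\<in>{..<n}. h x = c}) - real n / 6)^2"]) (use that(2) in auto)
    also have "\<dots> \<le> 3 * \<theta> * (real n)^2" by (rule that(1))
    also have "\<dots> \<le> \<sigma>^2 * (real n)^2" by (rule mult_right_mono[OF s(1)]) simp
    finally have "\<bar>?d\<bar>^2 \<le> (\<sigma> * real n)^2" by (simp add: power_mult_distrib)
    then have "\<bar>?d\<bar> \<le> \<sigma> * real n" by (rule power2_le_imp_le) (use s in simp)
    then show ?thesis by linarith
  qed
  note cS = close_to_turan[OF S f intf eS] and cZ = close_to_turan[OF Z g intg eZ]
  obtain \<pi> where p: "bij_betw \<pi> {..<n} {..<n}" "real (card {x\<in>{..<n}. f (\<pi> x) \<noteq> g x}) \<le> 6 * (\<sigma> * real n)"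
    by (rule aligning_permutation[of f g n "\<sigma> * real n", OF f g size[OF cS(2)] size[OF cZ(2)]])
      (assumption, assumption, rule that, assumption+)
  have "real (card {x\<in>{..<n}. f (\<pi> x) \<noteq> g x}) * real n \<le> 6 * (\<sigma> * real n) * real n" by (rule mult_right_mono[OF p(2)]) simp
  then show ?thesis using edit_dist_via_turan[OF S Z p(1), of f g] cS(1) cZ(1) by (simp add: power2_eq_square algebra_simps)
qed

section \<open>Construction and main theorem\<close>

lemma independent_by_class:
  assumes E: "E = {{x, y} | x y. x < n \<and> y < n \<and> x \<noteq> y \<and> (x mod 6 \<noteq> y mod (6::nat) \<or> R x y)}"
  shows "{x, y} \<in> E \<longleftrightarrow> x < n \<and> y < n \<and> x \<noteq> y \<and> (x mod 6 \<noteq> y mod 6 \<or> R x y \<or> R y x)"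
  unfolding E by (auto simp: doubleton_eq_iff)

text \<open>The colouring of the construction: the classes \<open>1, \<dots>, 5\<close> carry the pentagon colouring, edges
  inside class \<open>0\<close> are red, and all other edges are blue.\<close>
definition red_classes :: "nat \<Rightarrow> nat \<Rightarrow> bool" where
  "red_classes a b \<longleftrightarrow> (a = 0 \<and> b = 0) \<or> (a > 0 \<and> b > 0 \<and> (a = b + 2 \<or> b = a + 2 \<or> a = b + 3 \<or> b = a + 3))"

lemma red_classes_sym: "red_classes a b \<longleftrightarrow> red_classes b a"
  by (auto simp: red_classes_def)

lemma red_classes_triangle:
  assumes "a < 6" "b < 6" "c < 6" "red_classes a b" "red_classes b c" "red_classes a c"
  shows "a = 0 \<and> b = 0 \<and> c = 0"
  using assms unfolding red_classes_def by linarith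

lemma blue_classes_card:
  assumes P: "P \<subseteq> {1..<6}" and bl: "\<And>a b. a \<in> P \<Longrightarrow> b \<in> P \<Longrightarrow> \<not> red_classes a b"
  shows "card P \<le> 2"
proof (rule ccontr)
  assume "\<not> ?thesis"
  then have "card P \<ge> 3" by simp
  then obtain a b c where abc: "a \<in> P" "b \<in> P" "c \<in> P" "a \<noteq> b" "b \<noteq> c" "a \<noteq> c" by (rule three_elements)
  have ne: "\<not> red_classes a b" "\<not> red_classes b c" "\<not> red_classes a c" using bl abc by auto
  have r: "1 \<le> a" "a < 6" "1 \<le> b" "b < 6" "1 \<le> c" "c < 6" using abc P by auto
  have five: "x = 1 \<or> x = 2 \<or> x = 3 \<or> x = 4 \<or> x = 5" if "1 \<le> x" "x < 6" for x :: nat using that by linarith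
  show False using five[OF r(1,2)] five[OF r(3,4)] five[OF r(5,6)] ne abc(4-6)
    by (elim disjE) (simp_all add: red_classes_def)
qed

lemma class_bound_2:
  assumes fin: "finite K" and nt: "\<And>x y z. x \<in> K \<Longrightarrow> y \<in> K \<Longrightarrow> z \<in> K \<Longrightarrow> x \<noteq> y \<Longrightarrow> y \<noteq> z \<Longrightarrow> x \<noteq> z \<Longrightarrow> False"
  shows "card K \<le> 2"
proof (rule ccontr)
  assume "\<not> ?thesis"
  then have "card K \<ge> 3" by simp
  then obtain a b c where abc: "a \<in> K" "b \<in> K" "c \<in> K" "a \<noteq> b" "b \<noteq> c" "a \<noteq> c" by (rule three_elements)
  then show False using nt by blast
qed

text \<open>A blue clique has at most one vertex in class 0, where edges are red, and meets at most
  two of the pentagon classes, each in at most two vertices since \<open>R\<close> is triangle-free: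
  1 + 2 * 2 = 5. A red triangle would lie within class 0, where it is a triangle of
  \<open>R\<close>.\<close>

lemma construction:
  assumes d: "0 < (\<delta>::real)"
  obtains N where "\<And>n. real n \<ge> N \<Longrightarrow> \<exists>E. graph n E \<and> KK_free 3 6 n E \<and> real (indep_num n E) < \<delta> * real n \<and>
     real (card E) \<ge> 5/12 * (real n)^2 - real n / 2"
proof -
  define \<rho> where "\<rho> = min (\<delta> / 2) 1"
  have r: "0 < \<rho>" "\<rho> \<le> 1" "\<rho> \<le> \<delta> / 2" using d by (auto simp: \<rho>_def)
  obtain N0 where N0: "\<And>n. real n \<ge> N0 \<Longrightarrow> \<exists>R :: nat \<Rightarrow> nat \<Rightarrow> bool. (\<forall>x y. R x y \<longrightarrow> R y x) \<and> (\<forall>x y z. R x y \<longrightarrow> R y z \<longrightarrow> \<not> R x z) \<and>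
     (\<forall>I\<subseteq>{..<n}. (\<forall>x\<in>I. \<forall>y\<in>I. \<not> R x y) \<longrightarrow> real (card I) \<le> \<rho> * real n)"
    by (rule triangle_free_small_independence[OF r(1,2)]) (rule that, assumption)
  show ?thesis
  proof (rule that[of "max N0 1"])
    fix n :: nat assume n: "real n \<ge> max N0 1"
    obtain R :: "nat \<Rightarrow> nat \<Rightarrow> bool" where R0: "\<forall>x y. R x y \<longrightarrow> R y x" "\<forall>x y z. R x y \<longrightarrow> R y z \<longrightarrow> \<not> R x z"
      "\<forall>I\<subseteq>{..<n}. (\<forall>x\<in>I. \<forall>y\<in>I. \<not> R x y) \<longrightarrow> real (card I) \<le> \<rho> * real n"
    proof -
      have "real n \<ge> N0" using n by simp
      from N0[OF this] show ?thesis by (elim exE conjE) (rule that, assumption+)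
    qed
    have Rs: "R x y \<Longrightarrow> R y x" for x y using R0(1) by blast
    have Rt: "R x y \<Longrightarrow> R y z \<Longrightarrow> R x z \<Longrightarrow> False" for x y z using R0(2) by blast
    have Rirr: "\<not> R x x" for x using Rt by blast
    define E where "E = {{x, y} | x y. x < n \<and> y < n \<and> x \<noteq> y \<and> (x mod 6 \<noteq> y mod (6::nat) \<or> R x y)}"
    have mem: "{x, y} \<in> E \<longleftrightarrow> x < n \<and> y < n \<and> x \<noteq> y \<and> (x mod 6 \<noteq> y mod 6 \<or> R x y)" for x y
      using independent_by_class[OF E_def, of x y] Rs[of y x] by blast
    have g: "graph n E" unfolding graph_def E_def by blast
    define c where "c e \<longleftrightarrow> (\<exists>x y. e = {x, y} \<and> red_classes (x mod 6) (y mod 6))" for e :: "nat set"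
    have cm: "c {x, y} \<longleftrightarrow> red_classes (x mod 6) (y mod 6)" for x y
      unfolding c_def using red_classes_sym[of "x mod 6" "y mod 6"] by (auto simp: doubleton_eq_iff)
    have m6: "x mod 6 < (6::nat)" for x by simp
    have "\<not> mono_clique n E c True 3 K" for K
    proof
      assume K: "mono_clique n E c True 3 K"
      then have "card K = 3" by (simp add: mono_clique_def)
      then obtain x y z where xyz: "K = {x, y, z}" "x \<noteq> y" "y \<noteq> z" "x \<noteq> z" by (auto simp: card_3_iff)
      have k: "{u, v} \<in> E \<and> c {u, v}" if "u \<in> K" "v \<in> K" "u \<noteq> v" for u v using K that unfolding mono_clique_def by blast
      have e: "{x, y} \<in> E" "{y, z} \<in> E" "{x, z} \<in> E" "c {x, y}" "c {y, z}" "c {x, z}"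
        using k[of x y] k[of y z] k[of x z] xyz by auto
      have "x mod 6 = 0 \<and> y mod 6 = 0 \<and> z mod 6 = 0"
        by (rule red_classes_triangle[OF m6 m6 m6]) (use e cm in auto)
      then have "R x y" "R y z" "R x z" using e by (auto simp: mem)
      then show False by (rule Rt)
    qed
    moreover have "\<not> mono_clique n E c False 6 K" for K
    proof
      assume K: "mono_clique n E c False 6 K"
      then have K6: "card K = 6" by (simp add: mono_clique_def)
      have fK: "finite K" using K6 by (metis card.infinite zero_neq_numeral)
      have k: "{u, v} \<in> E" "\<not> red_classes (u mod 6) (v mod 6)" if "u \<in> K" "v \<in> K" "u \<noteq> v" for u v
        using K that cm[of u v] unfolding mono_clique_def by blast+
      define K0 where "K0 = {x\<in>K. x mod 6 = 0}"
      define P where "P = (\<lambda>x. x mod 6) ` (K - K0)"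
      have "card K0 \<le> Suc 0"
      proof (rule card_le_Suc0_iff_eq[THEN iffD2])
        show "finite K0" using fK by (simp add: K0_def)
        show "\<forall>x\<in>K0. \<forall>y\<in>K0. x = y"
        proof (intro ballI, rule ccontr)
          fix x y assume "x \<in> K0" "y \<in> K0" "x \<noteq> y"
          then show False using k(2)[of x y] by (simp add: K0_def red_classes_def)
        qed
      qed
      have P2: "card P \<le> 2"
      proof (rule blue_classes_card)
        show "P \<subseteq> {1..<6}"
        proof
          fix p assume "p \<in> P"
          then obtain x where x: "x \<in> K" "x mod 6 \<noteq> 0" "p = x mod 6" by (auto simp: P_def K0_def)
          then show "p \<in> {1..<6}" using m6[of x] by auto
        qed
        fix a b assume "a \<in> P" "b \<in> P"
        then obtain x y where xy: "x \<in> K" "y \<in> K" "a = x mod 6" "b = y mod 6" "a \<noteq> 0" "b \<noteq> 0" by (auto simp: P_def K0_def)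
        show "\<not> red_classes a b"
        proof (cases "x = y")
          case True then show ?thesis using xy by (auto simp: red_classes_def)
        next
          case False then show ?thesis using k(2)[of x y] xy by simp
        qed
      qed
      have cls: "card {x\<in>K - K0. x mod 6 = p} \<le> 2" for p
      proof (rule class_bound_2)
        fix x y z assume a: "x \<in> {x\<in>K - K0. x mod 6 = p}" "y \<in> {x\<in>K - K0. x mod 6 = p}" "z \<in> {x\<in>K - K0. x mod 6 = p}"
          "x \<noteq> y" "y \<noteq> z" "x \<noteq> z"
        have "{x, y} \<in> E" "{y, z} \<in> E" "{x, z} \<in> E" using k(1)[of x y] k(1)[of y z] k(1)[of x z] a by auto
        then have "R x y" "R y z" "R x z" using a by (auto simp: mem)
        then show False by (rule Rt)
      qed (use fK in simp)
      have "card (K - K0) = (\<Sum>x\<in>K - K0. 1)" by simp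
      also have "\<dots> = (\<Sum>p\<in>P. \<Sum>x\<in>{x\<in>K - K0. x mod 6 = p}. 1)" unfolding P_def by (rule sum.image_gen) (use fK in simp)
      also have "\<dots> \<le> (\<Sum>p\<in>P. 2)" by (rule sum_mono) (use cls in simp)
      also have "\<dots> = card P * 2" by simp
      finally have "card (K - K0) \<le> 4" using P2 by simp
      moreover have "card K = card K0 + card (K - K0)"
      proof -
        have "K0 \<subseteq> K" by (auto simp: K0_def)
        then show ?thesis using card_Diff_subset[of K0 K] card_mono[of K K0] fK finite_subset[of K0 K] by simp
      qed
      ultimately show False using K6 \<open>card K0 \<le> Suc 0\<close> by simp
    qed
    ultimately have KK: "KK_free 3 6 n E" unfolding KK_free_def by blast
    have np: "real n > 0" using n by simp
    have "real (indep_num n E) \<le> \<rho> * real n"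
    proof (rule indep_num_le)
      fix I assume I: "I \<subseteq> {..<n}" "\<And>x y. x \<in> I \<Longrightarrow> y \<in> I \<Longrightarrow> x \<noteq> y \<Longrightarrow> {x, y} \<notin> E"
      \<comment> \<open>A single \<open>R\<close> on all \<open>n\<close> vertices serves the six
        classes: pairs across classes are edges anyway, so independence in \<open>E\<close> implies
        independence in \<open>R\<close>.\<close>
      have "\<forall>x\<in>I. \<forall>y\<in>I. \<not> R x y"
      proof (intro ballI notI)
        fix x y assume a: "x \<in> I" "y \<in> I" "R x y"
        have "x \<noteq> y" using a(3) Rirr by blast
        moreover have "x < n" "y < n" using a I(1) by auto
        ultimately have "{x, y} \<in> E" using a by (simp add: mem)
        then show False using I(2)[OF a(1,2) \<open>x \<noteq> y\<close>] by simp
      qed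
      then show "real (card I) \<le> \<rho> * real n" using R0(3) I(1) by blast
    qed
    also have "\<dots> \<le> \<delta> / 2 * real n" by (rule mult_right_mono[OF r(3)]) simp
    also have "\<dots> < \<delta> * real n" using d np by simp
    finally have al: "real (indep_num n E) < \<delta> * real n" .
    have "2 * real (card E) \<ge> 5/6 * (real n)^2 - real n"
    proof -
      have sub: "turan n (\<lambda>x. x mod 6) \<subseteq> E" unfolding turan_def E_def by blast
      have "card (turan n (\<lambda>x. x mod 6)) \<le> card E" by (rule card_mono[OF graph_finite[OF g] sub])
      moreover have "2 * real (card (turan n (\<lambda>x. x mod 6))) = (real n)^2 - (\<Sum>c<6. (real (card {x\<in>{..<n}. x mod 6 = c}))^2)"
        by (rule turan_card) simp
      moreover have "(\<Sum>c<6. (real (card {x\<in>{..<n}. x mod 6 = c}))^2) \<le> (\<Sum>c<6. (real n / 6 + 1) * real (card {x\<in>{..<n}. x mod 6 = c}))"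
      proof (rule sum_mono)
        fix c
        have "card {x\<in>{..<n}. x mod 6 = c} \<le> n div 6 + 1" using card_residue_class[of 6 n c] by simp
        then have "real (card {x\<in>{..<n}. x mod 6 = c}) \<le> real (n div 6) + 1" by linarith
        also have "\<dots> \<le> real n / 6 + 1" using of_nat_div_le_of_nat[of n 6, where 'a=real] by simp
        finally show "(real (card {x\<in>{..<n}. x mod 6 = c}))^2 \<le> (real n / 6 + 1) * real (card {x\<in>{..<n}. x mod 6 = c})"
          unfolding power2_eq_square by (rule mult_right_mono) simp
      qed
      moreover have "(\<Sum>c<6. (real n / 6 + 1) * real (card {x\<in>{..<n}. x mod 6 = c})) = (real n / 6 + 1) * real n"
        unfolding sum_distrib_left[symmetric] by (subst class_sizes[of "\<lambda>x. x mod 6" n]) simp_all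
      ultimately show ?thesis by (simp add: power2_eq_square algebra_simps)
    qed
    then show "\<exists>E. graph n E \<and> KK_free 3 6 n E \<and> real (indep_num n E) < \<delta> * real n \<and> real (card E) \<ge> 5/12 * (real n)^2 - real n / 2"
      using g KK al by (intro exI[of _ E]) simp
  qed
qed

section \<open>The limit statements\<close>

lemma RT_bdd: "bdd_above {card E | E. graph n E \<and> KK_free p q n E \<and> real (indep_num n E) < m}"
proof (rule bdd_aboveI[of _ "card (Pow {..<n})"])
  fix k assume "k \<in> {card E | E. graph n E \<and> KK_free p q n E \<and> real (indep_num n E) < m}"
  then obtain E where E: "graph n E" "k = card E" by blast
  have "E \<subseteq> Pow {..<n}" using E by (auto simp: graph_def)
  then show "k \<le> card (Pow {..<n})" unfolding E(2) by (intro card_mono) auto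
qed

lemma RT_ge:
  assumes "graph n E" "KK_free p q n E" "real (indep_num n E) < m"
  shows "card E \<le> RT n p q m"
  unfolding RT_def by (rule cSup_upper[OF _ RT_bdd]) (use assms in blast)

text \<open>The witness \<open>E0\<close> makes the set of edge numbers nonempty, so that the
  supremum is attained and the bound for admissible graphs applies to it.\<close>

lemma RT_le:
  assumes "graph n E0" "KK_free p q n E0" "real (indep_num n E0) < m"
    and "\<And>E. graph n E \<Longrightarrow> KK_free p q n E \<Longrightarrow> real (indep_num n E) < m \<Longrightarrow> real (card E) \<le> b"
  shows "real (RT n p q m) \<le> b"
proof -
  let ?S = "{card E | E. graph n E \<and> KK_free p q n E \<and> real (indep_num n E) < m}"
  have ne: "?S \<noteq> {}" using assms(1-3) by blast
  have "finite ?S" using RT_bdd[of n p q m] by (simp add: bdd_above_nat)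
  then have "RT n p q m \<in> ?S" unfolding RT_def using Max_in[OF _ ne] ne by (simp add: cSup_eq_Max)
  then show ?thesis using assms(4) by auto
qed

lemma ramsey_turan_density:
  assumes e: "0 < (\<epsilon>::real)"
  shows "\<exists>\<delta>0>0. \<forall>\<delta>::real. 0 < \<delta> \<and> \<delta> < \<delta>0 \<longrightarrow>
            (\<exists>N. \<forall>n\<ge>N. \<bar>real (RT n 3 6 (\<delta> * real n)) / (real n)^2 - 5/12\<bar> \<le> \<epsilon>)"
proof -
  obtain \<eta> N1 where h: "\<eta> > 0"
    "\<And>n E. real n \<ge> N1 \<Longrightarrow> graph n E \<Longrightarrow> KK_free 3 6 n E \<Longrightarrow> real (indep_num n E) \<le> \<eta> * real n \<Longrightarrow>
       real (card E) \<ge> (5/12 - \<eta>) * (real n)^2 \<Longrightarrow>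
       \<exists>f. (\<forall>x. f x < (6::nat)) \<and> ecount (\<lambda>x y. {x, y} \<in> E \<and> f x = f y) {..<n} {..<n} \<le> \<epsilon> * (real n)^2"
    by (rule six_partition[OF e]) (rule that, assumption)
  show ?thesis
  proof (intro exI[of _ \<eta>] conjI allI impI)
    show "\<eta> > 0" by (rule h(1))
    fix \<delta> :: real assume d: "0 < \<delta> \<and> \<delta> < \<eta>"
    obtain N2 where N2: "\<And>n. real n \<ge> N2 \<Longrightarrow> \<exists>E. graph n E \<and> KK_free 3 6 n E \<and> real (indep_num n E) < \<delta> * real n \<and>
     real (card E) \<ge> 5/12 * (real n)^2 - real n / 2"
      using construction[of \<delta>] d by blast
    obtain N :: nat where N: "real N \<ge> \<bar>N1\<bar> + \<bar>N2\<bar> + 1 / \<epsilon> + 1" using real_arch_simple by blast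
    show "\<exists>N. \<forall>n\<ge>N. \<bar>real (RT n 3 6 (\<delta> * real n)) / (real n)^2 - 5/12\<bar> \<le> \<epsilon>"
    proof (intro exI[of _ N] allI impI)
      fix n assume "N \<le> n"
      then have n: "real n \<ge> \<bar>N1\<bar> + \<bar>N2\<bar> + 1 / \<epsilon> + 1" using N by simp
      have e1: "1 / \<epsilon> > 0" using e by simp
      have nN: "real n \<ge> N1" "real n \<ge> N2" "real n \<ge> 1 / \<epsilon>" "real n > 0" using n e1 by linarith+
      obtain E0 where E0: "graph n E0" "KK_free 3 6 n E0" "real (indep_num n E0) < \<delta> * real n"
        "real (card E0) \<ge> 5/12 * (real n)^2 - real n / 2" using N2[OF nN(2)] by blast
      have "real (card E0) \<le> real (RT n 3 6 (\<delta> * real n))" using RT_ge[OF E0(1-3)] by simp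
      moreover have "real n / 2 \<le> \<epsilon> * (real n)^2"
      proof -
        have "1 \<le> \<epsilon> * real n" using nN(3) e by (simp add: field_simps)
        then have "1 * real n \<le> \<epsilon> * real n * real n" using nN by (intro mult_right_mono) auto
        then show ?thesis using nN by (simp add: power2_eq_square)
      qed
      ultimately have lo: "real (RT n 3 6 (\<delta> * real n)) \<ge> (5/12 - \<epsilon>) * (real n)^2" using E0(4) by (simp add: algebra_simps)
      have up: "real (RT n 3 6 (\<delta> * real n)) \<le> (5/12 + \<epsilon>) * (real n)^2"
      proof (rule RT_le[OF E0(1-3)])
        fix E assume E: "graph n E" "KK_free 3 6 n E" "real (indep_num n E) < \<delta> * real n"
        show "real (card E) \<le> (5/12 + \<epsilon>) * (real n)^2"
        \<comment> \<open>\<open>six_partition\<close> speaks only about nearly extremal graphs;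
          below its threshold the upper bound is immediate.\<close>
        proof (cases "real (card E) \<ge> (5/12 - \<eta>) * (real n)^2")
          case True
          have "\<delta> * real n \<le> \<eta> * real n" by (rule mult_right_mono) (use d in auto)
          then have "real (indep_num n E) \<le> \<eta> * real n" using E(3) by linarith
          then obtain f where f: "\<forall>x. f x < (6::nat)" "ecount (\<lambda>x y. {x, y} \<in> E \<and> f x = f y) {..<n} {..<n} \<le> \<epsilon> * (real n)^2"
            using h(2)[OF nN(1) E(1,2) _ True] by blast
          have "2 * real (card E) \<le> (5/6 + \<epsilon>) * (real n)^2" by (rule edges_le_of_partition[OF E(1) _ f(2)]) (use f(1) in blast)
          moreover have "0 \<le> \<epsilon> * (real n)^2" using e by simp
          ultimately show ?thesis by (simp add: algebra_simps)
        next
          case False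
          have "(5/12 - \<eta>) * (real n)^2 \<le> (5/12 + \<epsilon>) * (real n)^2" by (rule mult_right_mono) (use h e in auto)
          then show ?thesis using False by linarith
        qed
      qed
      have n2: "(real n)^2 > 0" using nN by simp
      have "real (RT n 3 6 (\<delta> * real n)) / (real n)^2 \<ge> 5/12 - \<epsilon>" using lo n2 by (simp add: pos_le_divide_eq)
      moreover have "real (RT n 3 6 (\<delta> * real n)) / (real n)^2 \<le> 5/12 + \<epsilon>" using up n2 by (simp add: pos_divide_le_eq)
      ultimately show "\<bar>real (RT n 3 6 (\<delta> * real n)) / (real n)^2 - 5/12\<bar> \<le> \<epsilon>" by linarith
    qed
  qed
qed

lemma weak_stability:
  fixes S Z :: "nat \<Rightarrow> nat set set"
  assumes g: "\<And>n. graph n (S n)" "\<And>n. graph n (Z n)" "\<And>n. KK_free 3 6 n (S n)" "\<And>n. KK_free 3 6 n (Z n)"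
    and aS: "(\<lambda>n. real (indep_num n (S n)) / real n) \<longlonglongrightarrow> 0" and aZ: "(\<lambda>n. real (indep_num n (Z n)) / real n) \<longlonglongrightarrow> 0"
    and eS: "(\<lambda>n. real (card (S n)) / (real n)^2) \<longlonglongrightarrow> 5/12" and eZ: "(\<lambda>n. real (card (Z n)) / (real n)^2) \<longlonglongrightarrow> 5/12"
  shows "(\<lambda>n. real (edit_dist n (S n) (Z n)) / (real n)^2) \<longlonglongrightarrow> 0"
proof (rule LIMSEQ_I)
  fix \<epsilon> :: real assume e: "0 < \<epsilon>"
  \<comment> \<open>With \<open>\<theta> \<le> \<sigma>\<close> the final error
    \<open>4 * \<theta> + 6 * \<sigma>\<close> is at most \<open>10 * \<sigma>\<close>, that is, at
    most \<open>\<epsilon> / 2\<close>.\<close>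
  define \<sigma> where "\<sigma> = min (\<epsilon> / 20) 1"
  have s: "0 < \<sigma>" "\<sigma> \<le> 1" "\<sigma> \<le> \<epsilon> / 20" using e by (auto simp: \<sigma>_def)
  define \<theta> where "\<theta> = \<sigma>^2 / 3"
  have t: "0 < \<theta>" "3 * \<theta> \<le> \<sigma>^2" "\<theta> \<le> \<sigma>"
  proof -
    have "\<sigma> * \<sigma> \<le> \<sigma> * 1" by (rule mult_left_mono) (use s in auto)
    moreover have "\<theta> = \<sigma> * \<sigma> / 3" by (simp add: \<theta>_def power2_eq_square)
    ultimately show "\<theta> \<le> \<sigma>" using s by linarith
    show "0 < \<theta>" using s by (simp add: \<theta>_def)
    show "3 * \<theta> \<le> \<sigma>^2" by (simp add: \<theta>_def)
  qed
  obtain \<eta> N1 where h: "\<eta> > 0"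
    "\<And>n E. real n \<ge> N1 \<Longrightarrow> graph n E \<Longrightarrow> KK_free 3 6 n E \<Longrightarrow> real (indep_num n E) \<le> \<eta> * real n \<Longrightarrow>
       real (card E) \<ge> (5/12 - \<eta>) * (real n)^2 \<Longrightarrow>
       \<exists>f. (\<forall>x. f x < (6::nat)) \<and> ecount (\<lambda>x y. {x, y} \<in> E \<and> f x = f y) {..<n} {..<n} \<le> \<theta> * (real n)^2"
    by (rule six_partition[OF t(1)]) (rule that, assumption)
  define \<kappa> where "\<kappa> = min \<eta> \<theta>"
  have k: "0 < \<kappa>" "\<kappa> \<le> \<eta>" "\<kappa> \<le> \<theta>" using h(1) t by (auto simp: \<kappa>_def)
  have "\<forall>\<^sub>F n in sequentially. real (indep_num n (S n)) / real n < \<eta>"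
    "\<forall>\<^sub>F n in sequentially. real (indep_num n (Z n)) / real n < \<eta>"
    "\<forall>\<^sub>F n in sequentially. real (card (S n)) / (real n)^2 > 5/12 - \<kappa>"
    "\<forall>\<^sub>F n in sequentially. real (card (Z n)) / (real n)^2 > 5/12 - \<kappa>"
    using order_tendstoD(2)[OF aS h(1)] order_tendstoD(2)[OF aZ h(1)] order_tendstoD(1)[OF eS, of "5/12 - \<kappa>"] order_tendstoD(1)[OF eZ, of "5/12 - \<kappa>"] k
    by simp_all
  moreover have "\<forall>\<^sub>F n in sequentially. real n \<ge> max N1 1"
    using eventually_ge_at_top[of "nat \<lceil>max N1 1\<rceil>"] by eventually_elim linarith
  ultimately have "\<forall>\<^sub>F n in sequentially. norm (real (edit_dist n (S n) (Z n)) / (real n)^2 - 0) < \<epsilon>"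
  proof eventually_elim
    case (elim n)
    have n: "real n \<ge> N1" "real n > 0" using elim(5) by auto
    have n2: "(real n)^2 > 0" using n by simp
    have i: "real (indep_num n (S n)) \<le> \<eta> * real n" "real (indep_num n (Z n)) \<le> \<eta> * real n"
      using elim(1,2) n by (simp_all add: pos_divide_less_eq)
    have c: "real (card (S n)) \<ge> (5/12 - \<kappa>) * (real n)^2" "real (card (Z n)) \<ge> (5/12 - \<kappa>) * (real n)^2"
      using elim(3,4) n2 by (simp_all add: pos_less_divide_eq)
    have m: "(5/12 - \<eta>) * (real n)^2 \<le> (5/12 - \<kappa>) * (real n)^2" "(5/12 - \<theta>) * (real n)^2 \<le> (5/12 - \<kappa>) * (real n)^2"
      by (rule mult_right_mono; use k in simp)+
    obtain f where f: "\<forall>x. f x < (6::nat)" "ecount (\<lambda>x y. {x, y} \<in> S n \<and> f x = f y) {..<n} {..<n} \<le> \<theta> * (real n)^2"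
      using h(2)[OF n(1) g(1) g(3) i(1)] c(1) m(1) by fastforce
    obtain f' where f': "\<forall>x. f' x < (6::nat)" "ecount (\<lambda>x y. {x, y} \<in> Z n \<and> f' x = f' y) {..<n} {..<n} \<le> \<theta> * (real n)^2"
      using h(2)[OF n(1) g(2) g(4) i(2)] c(2) m(1) by fastforce
    have "real (edit_dist n (S n) (Z n)) \<le> (4 * \<theta> + 6 * \<sigma>) * (real n)^2"
      by (rule edit_dist_small[OF g(1) g(2) _ _ f(2) f'(2) _ _ t(2)]) (use f(1) f'(1) c m(2) s in auto)
    also have "\<dots> \<le> (\<epsilon> / 2) * (real n)^2" by (rule mult_right_mono) (use s t in auto)
    finally have "real (edit_dist n (S n) (Z n)) / (real n)^2 \<le> \<epsilon> / 2" using n2 by (simp only: pos_divide_le_eq)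
    moreover have "norm (real (edit_dist n (S n) (Z n)) / (real n)^2 - 0) = real (edit_dist n (S n) (Z n)) / (real n)^2" by simp
    ultimately show ?case using e by linarith
  qed
  then show "\<exists>N. \<forall>n\<ge>N. norm (real (edit_dist n (S n) (Z n)) / (real n)^2 - 0) < \<epsilon>"
    by (simp only: eventually_sequentially)
qed

theorem mainTheorem1:
  shows "(\<forall>\<epsilon>>0. \<exists>\<delta>0>0. \<forall>\<delta>::real. 0 < \<delta> \<and> \<delta> < \<delta>0 \<longrightarrow>
            (\<exists>N. \<forall>n\<ge>N. \<bar>real (RT n 3 6 (\<delta> * real n)) / (real n)^2 - 5/12\<bar> \<le> \<epsilon>))
       \<and> (\<forall>S Z :: nat \<Rightarrow> nat set set.
            (\<forall>n. graph n (S n) \<and> graph n (Z n) \<and> KK_free 3 6 n (S n) \<and> KK_free 3 6 n (Z n))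
          \<and> (\<lambda>n. real (indep_num n (S n)) / real n) \<longlonglongrightarrow> 0
          \<and> (\<lambda>n. real (indep_num n (Z n)) / real n) \<longlonglongrightarrow> 0
          \<and> (\<lambda>n. real (card (S n)) / (real n)^2) \<longlonglongrightarrow> 5/12
          \<and> (\<lambda>n. real (card (Z n)) / (real n)^2) \<longlonglongrightarrow> 5/12
          \<longrightarrow> (\<lambda>n. real (edit_dist n (S n) (Z n)) / (real n)^2) \<longlonglongrightarrow> 0)"
proof (intro conjI allI impI)
  fix \<epsilon> :: real assume "0 < \<epsilon>"
  then show "\<exists>\<delta>0>0. \<forall>\<delta>::real. 0 < \<delta> \<and> \<delta> < \<delta>0 \<longrightarrow>
            (\<exists>N. \<forall>n\<ge>N. \<bar>real (RT n 3 6 (\<delta> * real n)) / (real n)^2 - 5/12\<bar> \<le> \<epsilon>)"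
    by (rule ramsey_turan_density)
next
  fix S Z :: "nat \<Rightarrow> nat set set"
  assume a: "(\<forall>n. graph n (S n) \<and> graph n (Z n) \<and> KK_free 3 6 n (S n) \<and> KK_free 3 6 n (Z n))
          \<and> (\<lambda>n. real (indep_num n (S n)) / real n) \<longlonglongrightarrow> 0
          \<and> (\<lambda>n. real (indep_num n (Z n)) / real n) \<longlonglongrightarrow> 0
          \<and> (\<lambda>n. real (card (S n)) / (real n)^2) \<longlonglongrightarrow> 5/12
          \<and> (\<lambda>n. real (card (Z n)) / (real n)^2) \<longlonglongrightarrow> 5/12"
  then show "(\<lambda>n. real (edit_dist n (S n) (Z n)) / (real n)^2) \<longlonglongrightarrow> 0"
    by (intro weak_stability) blast+
qed

end
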